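(* Let $(\mathsf{Gen},\mathsf{Commit},\mathsf{Ver.Commit},\mathsf{Test},\mathsf{Open},\mathsf{Ver},\mathsf{Out})$ be the succinct multi-qubit classical commitment scheme described in the context. Then the scheme is correct: for every $\ell=\ell(\lambda)=\mathrm{poly}(\lambda)$, every $\ell$-qubit quantum state $\sigma$, every basis $\mathbf b\in\{0,1\}^\ell$ and every subset $J\subseteq[\ell]$, up to total variation distance $\mathrm{negl}(\lambda)$, $$\mathsf{Real}_{c=0}(1^\lambda,\sigma,J,\mathbf b_J)\equiv\sigma(J,\mathbf b_J)\qquad\text{and}\qquad \mathsf{Real}_{c=1}(1^\lambda,\sigma,J,\mathbf b_J)\equiv 1 .$$ Here $\sigma(J,\mathbf b_J)$ is the distribution of the outcome of measuring each qubit $j\in J$ of $\sigma$ in the standard basis if $b_j=0$ and in the Hadamard basis if $b_j=1$. Both experiments begin by generating $(\mathsf{pk},\mathsf{sk})\leftarrow\mathsf{Gen}(1^\lambda)$ and $(\mathsf{rt},\mathbf y,\rho)\leftarrow\mathsf{Commit}(\mathsf{pk},\sigma)$ and running $\mathsf{Ver.Commit}$ between the honest prover with input $(\mathsf{pk},\mathsf{rt},\mathbf y)$ and the verifier with input $(\mathsf{sk},\mathsf{rt})$, outputting $\bot$ if the verifier rejects. Then $\mathsf{Real}_{c=0}$ computes $\mathbf z\leftarrow\mathsf{Open}(\rho,(J,\mathbf b_J))$ and outputs $\bot$ if $\mathsf{Ver}(\mathsf{sk},\mathsf{rt},(J,\mathbf b_J),\mathbf z)=0$, and $\mathsf{Out}(\mathsf{sk},\mathsf{rt},(J,\mathbf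 b_J),\mathbf z)$ otherwise; while $\mathsf{Real}_{c=1}$ runs $\mathsf{Test}$ between the honest prover with input $(\mathsf{pk},\mathsf{rt},\mathbf y,\rho)$ and the verifier with input $(\mathsf{sk},\mathsf{rt})$ and outputs $1$ if the verifier accepts and $\bot$ otherwise.
   Context: Conventions. $\lambda$ is the security parameter; PPT/QPT mean probabilistic/quantum polynomial time; $\mathrm{negl}$ denotes a negligible function. Basis bit $0$ means standard basis, $1$ means Hadamard basis. For bit strings, $\cdot$ is the inner product modulo 2. Noisy trapdoor claw-free function (NTCF) family. A tuple of PPT algorithms $(\mathsf{Gen}_F,\mathsf{Eval}_F,\mathsf{Invert}_F,\mathsf{Check}_F,\mathsf{Good}_F)$: - $\mathsf{Gen}_F(1^\lambda)\to(\mathsf{pk},\mathsf{sk})$; $\mathsf{pk}$ determines a domain $D_{\mathsf{pk}}\subseteq\{0,1\}^{w}$, $w=w(\lambda)=\mathrm{poly}(\lambda)$, which is efficiently verifiable and samplable, and a range $R_{\mathsf{pk}}$. - $\mathsf{Eval}_F(\mathsf{pk},b,x)\to y$, randomized, $b\in\{0,1\}$, $x\in D_{\mathsf{pk}}$, $y\in R_{\mathsf{pk}}$. - $\mathsf{Invert}_F(\mathsf{sk},y)$, deterministic, outputs $((0,x_0),(1,x_1))$ with $x_0,x_1\in D_{\mathsf{pk}}$, or $\bot$. - $\mathsf{Check}_F(\mathsf{pk},b,x,y)\in\{0,1\}$, deterministic. - $\mathsf{Good}_F(x_0,x_1,d)$, deterministic, for $d\in\{0,1\}^{w+1}$; it ignores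 the first bit of $d$. It outputs a bit, in which case $G_{x_0,x_1}=\{d:\mathsf{Good}_F(x_0,x_1,d)=1\}$; or, more generally, a vector in $\{0,1\}^\kappa$ ($\kappa=\mathrm{poly}(\lambda)$) obtained by partitioning $d$ into $\kappa$ blocks $d[1],\dots,d[\kappa]$ and outputting $(\langle a[1],d[1]\rangle,\dots,\langle a[\kappa],d[\kappa]\rangle)$ for nonzero vectors $a[i]$ determined by $x_0,x_1$, in which case $G_{x_0,x_1}=\{d:\mathsf{Good}_F(x_0,x_1,d)\ne 0^\kappa\}$. Required properties. (1) Completeness, for all $(\mathsf{pk},\mathsf{sk})\in\mathrm{Supp}(\mathsf{Gen}_F(1^\lambda))$: (a) for every $b$, $x\in D_{\mathsf{pk}}$ and $y\in\mathrm{Supp}(\mathsf{Eval}_F(\mathsf{pk},b,x))$, $\mathsf{Invert}_F(\mathsf{sk},y)=((0,x_0),(1,x_1))$ with $x_b=x$ and $y\in\mathrm{Supp}(\mathsf{Eval}_F(\mathsf{pk},\beta,x_\beta))$ for both $\beta$; (b) there is a perfect matching $M_{\mathsf{pk}}\subseteq D_{\mathsf{pk}}\times D_{\mathsf{pk}}$ such that $\mathsf{Eval}_F(\mathsf{pk},0,x_0)\equiv\mathsf{Eval}_F(\mathsf{pk},1,x_1)$ iff $(x_0,x_1)\in M_{\mathsf{pk}}$; (c) $\mathsf{Check}_F(\mathsf{pk},b,x,y)=1$ iff $y\in\mathrm{Supp}(\mathsf{Eval}_F(\mathsf{pk},b,x))$; (d) for distinct $x_0,x_1$ the set $G_{x_0,x_1}$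 has density $1-\mathrm{negl}(\lambda)$. (2) Efficient range superposition: for each $b$ one can prepare in QPT a state within negligible distance of $|D_{\mathsf{pk}}|^{-1/2}\sum_{x\in D_{\mathsf{pk}},\,y\in R_{\mathsf{pk}}}\sqrt{p_{\mathsf{pk}}(b,x,y)}\,|x\rangle|y\rangle$, where $p_{\mathsf{pk}}(b,x,\cdot)$ is the density of $\mathsf{Eval}_F(\mathsf{pk},b,x)$. (3) Adaptive hardcore bit: for every QPT $A$, $\Pr[A(\mathsf{pk})=(y,b,x,d,v):\mathsf{Check}_F(\mathsf{pk},b,x,y)=1\wedge d\in G_{x_0,x_1}\wedge d\cdot(1,x_0\oplus x_1)=v]\le\frac12+\mathrm{negl}(\lambda)$, where $((0,x_0),(1,x_1))=\mathsf{Invert}_F(\mathsf{sk},y)$. Weak commitment $W_{\mathsf{pk}}$ of one qubit: applied to a qubit register in state $\sum_s\alpha_s|s\rangle$ (possibly entangled with other registers), it coherently prepares, controlled on $s$, the range superposition for $b=s$ in fresh registers and measures the $y$ register, obtaining a string $y$ and (up to negligible error) the residual state $\sum_s\alpha_s|s\rangle|x_s\rangle$, where $y\in\mathrm{Supp}(\mathsf{Eval}_F(\mathsf{pk},s,x_s))$; it adds a $w$-qubit register. Single-qubit scheme $(\mathsf{Gen}_1,\mathsf{Commit}_1,\mathsf{Open}_1,\mathsf{Ver}_1,\mathsf{Out}_1)$. - $\mathsf{Gen}_1(1^\lambda)$: for $i=0,\dots,w+1$ sample $(\mathsf{pk}_i,\mathsf{sk}_i)\leftarrow\mathsf{Gen}_F(1^\lambda)$;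 output $(\mathsf{pk}_0,\dots,\mathsf{pk}_{w+1})$ and $(\mathsf{sk}_0,\dots,\mathsf{sk}_{w+1})$. - $\mathsf{Commit}_1$ on a qubit: apply $W_{\mathsf{pk}_0}$, obtaining $y_0$ and a residual state on $w+1$ qubits; apply $H^{\otimes(w+1)}$ to these qubits; for $i=1,\dots,w+1$ apply $W_{\mathsf{pk}_i}$ to the $i$-th of these qubits, obtaining $y_i$ and a new $w$-qubit register. Output $y=(y_0,\dots,y_{w+1})$ and the $(w+1)^2$-qubit residual state, ordered so that each of the $w+1$ qubits is followed by its $w$-qubit register. - $\mathsf{Open}_1(\rho,b)$: if $b=1$ measure all qubits of $\rho$ in the standard basis; if $b=0$ measure all qubits in the Hadamard basis; output the outcome $z\in\{0,1\}^{(w+1)^2}$. - $\mathsf{Ver}_1(\mathsf{sk},y,b,z)$: If $b=1$, parse $z=(d_1,x'_1,\dots,d_{w+1},x'_{w+1})$, $d=(d_1,\dots,d_{w+1})$, compute $((0,x_0),(1,x_1))=\mathsf{Invert}_F(\mathsf{sk}_0,y_0)$, and output $1$ iff $\mathsf{Check}_F(\mathsf{pk}_i,d_i,x'_i,y_i)=1$ for all $i\in[w+1]$ and $d\in G_{x_0,x_1}$. If $b=0$, parse $z=(z_1,\dots,z_{w+1})$ with $z_i\in\{0,1\}^{w+1}$, compute $((0,x'_{i,0}),(1,x'_{i,1}))=\mathsf{Invert}_F(\mathsf{sk}_i,y_i)$, output $0$ if some $z_i\notin G_{x'_{i,0},x'_{i,1}}$; otherwise set $m_i=z_i\cdot(1,x'_{i,0}\oplus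 x'_{i,1})$ and output $1$ iff $\mathsf{Check}_F(\mathsf{pk}_0,m_1,(m_2,\dots,m_{w+1}),y_0)=1$. - $\mathsf{Out}_1(\mathsf{sk},y,b,z)$: with the same notation, output $d\cdot(1,x_0\oplus x_1)$ if $b=1$, and $m_1$ if $b=0$. Semi-succinct scheme $(\mathsf{Gen}_{ss},\mathsf{Commit}_{ss},\mathsf{Open}_{ss},\mathsf{Ver}_{ss},\mathsf{Out}_{ss})$: a single key pair $(\mathsf{pk}_*,\mathsf{sk}_* )\leftarrow\mathsf{Gen}_1(1^\lambda)$ is generated, and $\mathsf{Commit}_1,\mathsf{Open}_1,\mathsf{Ver}_1,\mathsf{Out}_1$ are applied qubit by qubit with this same key; $\mathsf{Ver}_{ss}$ accepts iff all positions are accepted. Hash family with local opening $(\mathsf{Gen}_H,\mathsf{Eval}_H,\mathsf{Open}_H,\mathsf{Ver}_H)$: $\mathsf{hk}\leftarrow\mathsf{Gen}_H(1^\lambda)$; $\mathsf{Eval}_H(\mathsf{hk},x)=\mathsf{rt}$ of length $\mathrm{poly}(\lambda,\log|x|)$; $\mathsf{Open}_H(\mathsf{hk},x,i)$ outputs a symbol (bit or block) of $x$ at position $i$ and an opening $o$ of length $\mathrm{poly}(\lambda,\log|x|)$; $\mathsf{Ver}_H(\mathsf{hk},\mathsf{rt},i,\cdot,o)\in\{0,1\}$. Honest openings yield the correct symbol and verify with probability $1-\mathrm{negl}(\lambda)$; no polynomial-size adversary given $\mathsf{hk}$ can, except with negligible probability, produce $\mathsf{rt}$, $i$ and accepting openings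 of position $i$ to two different values. The family is moreover collapsing: no QPT adversary that submits $(\mathsf{rt},j)$ and a quantum state of (value, opening) pairs, which is first projected onto acceptance of $\mathsf{Ver}_H(\mathsf{hk},\mathsf{rt},j,\cdot,\cdot)$, can tell with non-negligible advantage whether the projected state is returned unmeasured or measured in the standard basis. State-preserving succinct argument of knowledge for NP: a publicly verifiable interactive argument $(P,V)$ (with honest prover accepted with probability $1-\mathrm{negl}(\lambda)$) which is succinct (communication $\mathrm{poly}(\lambda,\log T)$ for relations decidable in time $T$; verifier time $\mathrm{poly}(\lambda,\log T)+\tilde O(n)$ for instance size $n$) and $\epsilon$-state-preserving: there is an extractor $\mathcal E$ with oracle access to a prover $P^*$ with state $\rho$ which, on input $(x,1^\lambda,\epsilon)$, runs in time $\mathrm{poly}(|x|,\lambda,1/\epsilon)$ and outputs (transcript $\mathbb T_{Sim}$, string $\mathbf w$, state $\rho_{Sim}$) such that $(\mathbb T_{Sim},\rho_{Sim})$ is $\epsilon$-indistinguishable for QPT distinguishers from the real transcript and residual prover state, and the probability that $\mathbb T_{Sim}$ is accepting but $\mathbf w$ is not a valid witness is at most $\epsilon+\mathrm{negl}(\lambda)$. Succinct scheme. - $\mathsf{Gen}(1^\lambda)$: $(\mathsf{pk}_*,\mathsf{sk}_* )\leftarrow\mathsf{Gen}_1(1^\lambda)$, $\mathsf{hk}\leftarrow\mathsf{Gen}_H(1^\lambda)$; $\mathsf{pk}=(\mathsf{pk}_*,\mathsf{hk})$, $\mathsf{sk}=(\mathsf{sk}_*,\mathsf{hk})$. - $\mathsf{Commit}(\mathsf{pk},\sigma)$: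 $(\mathbf y,\rho)\leftarrow\mathsf{Commit}_{ss}(\mathsf{pk}_*,\sigma)$, $\mathsf{rt}=\mathsf{Eval}_H(\mathsf{hk},\mathbf y)$; output $(\mathsf{rt},\mathbf y,\rho)$. - $\mathsf{Ver.Commit}$: run $(P,V)$ for the NP relation $\{((\mathsf{hk},\mathsf{rt}),\mathbf y):\mathsf{Eval}_H(\mathsf{hk},\mathbf y)=\mathsf{rt}\}$ (language $L^*$) on instance $(\mathsf{hk},\mathsf{rt})$ with witness $\mathbf y$. - $\mathsf{Test}$: the verifier sends a uniform $b\in\{0,1\}$; the prover computes $\mathbf z\leftarrow\mathsf{Open}_{ss}(\rho,b^\ell)$ and sends $\mathsf{rt}'=\mathsf{Eval}_H(\mathsf{hk},\mathbf z)$; they run $(P,V)$ for $L^*$ on instance $(\mathsf{hk},\mathsf{rt}')$ with witness $\mathbf z$; the verifier sends $\mathsf{sk}_*$; they run $(P,V)$ for the relation $\{((\mathsf{sk}_*,\mathsf{hk},\mathsf{rt},\mathsf{rt}',b),(\mathbf y,\mathbf z)):\mathsf{Eval}_H(\mathsf{hk},\mathbf y)=\mathsf{rt},\ \mathsf{Eval}_H(\mathsf{hk},\mathbf z)=\mathsf{rt}',\ \mathsf{Ver}_{ss}(\mathsf{sk}_*,\mathbf y,b^\ell,\mathbf z)=1\}$; the verifier accepts iff both arguments are accepted. - $\mathsf{Open}$ on position $j$, basis $b_j$: compute $(y_j,o_j)=\mathsf{Open}_H(\mathsf{hk},\mathbf y,j)$ (opening of the $j$-th block $y_j$ of $\mathbf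 y$) and $z_j\leftarrow\mathsf{Open}_{ss}(\rho,(j,b_j))$; output $(y_j,o_j,z_j)$. - $\mathsf{Ver}$ on position $j$: accept iff $\mathsf{Ver}_H(\mathsf{hk},\mathsf{rt},j,y_j,o_j)=1$ and $\mathsf{Ver}_1(\mathsf{sk}_*,y_j,b_j,z_j)=1$. $\mathsf{Out}$ on position $j$: $\mathsf{Out}_1(\mathsf{sk}_*,y_j,b_j,z_j)$. For a set $J$, $\mathsf{Open},\mathsf{Ver},\mathsf{Out}$ are applied to every $j\in J$ (and $\mathsf{Ver}$ accepts iff all are accepted).
   Formalization: The pairs (x_0,x_1) in the perfect matching M_pk are required to be distinct (with M_pk the identity and G_{x,x} empty all listed properties hold but Ver always rejects); negligible distance in property (2) is read as Euclidean distance of state vectors. *)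

theory Defs
  imports
    "HOL-Probability.Probability"
    "HOL-Library.Log_Nat"
    "HOL-Library.Monad_Syntax"
begin

section \<open>Bit strings\<close>

type_synonym bits = "bool list"

definition bitstr :: "nat \<Rightarrow> bits set" where
  "bitstr n = {u. length u = n}"

definition dot :: "bits \<Rightarrow> bits \<Rightarrow> bool" where
  "dot a b = odd (length (filter (\<lambda>(p, q). p \<and> q) (zip a b)))"

definition xor_bits :: "bits \<Rightarrow> bits \<Rightarrow> bits" where
  "xor_bits a b = map2 (\<noteq>) a b"

definition slice :: "nat \<Rightarrow> nat \<Rightarrow> 'a list \<Rightarrow> 'a list" where
  "slice k m xs = take m (drop k xs)"

abbreviation zeros :: "nat \<Rightarrow> bits" where
  "zeros n \<equiv> replicate n False"

abbreviation unary :: "nat \<Rightarrow> bits" where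
  "unary n \<equiv> replicate n True"

definition binary :: "nat \<Rightarrow> bits" where
  "binary m = map (bit m) [0..<floorlog 2 m]"

text \<open>A self-delimiting, hence injective, encoding of tuples of bit strings: every payload bit is
  preceded by a one, and every component is closed by a zero.\<close>

definition enc :: "bits list \<Rightarrow> bits" where
  "enc xs = concat (map (\<lambda>x. concat (map (\<lambda>b. [True, b]) x) @ [False]) xs)"

definition dec :: "bits \<Rightarrow> bits list" where
  "dec s = (if s \<in> range enc then inv enc s else [])"

text \<open>Fixed-length messages of registers: \<open>pad m v\<close> is \<open>v\<close> followed by a one and zeros.\<close>

definition pad :: "nat \<Rightarrow> bits \<Rightarrow> bits" where
  "pad m v = take m (v @ True # zeros m)"

definition unpad :: "bits \<Rightarrow> bits" where
  "unpad s = rev (tl (dropWhile Not (rev s)))"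


section \<open>Asymptotics and statistical distance\<close>

definition negl :: "(nat \<Rightarrow> real) \<Rightarrow> bool" where
  "negl \<nu> \<longleftrightarrow> (\<forall>c::nat. eventually (\<lambda>n. \<bar>\<nu> n\<bar> < 1 / real n ^ c) sequentially)"

definition poly_bounded :: "(nat \<Rightarrow> nat) \<Rightarrow> bool" where
  "poly_bounded f \<longleftrightarrow> (\<exists>c. \<forall>n. f n \<le> n ^ c + c)"

definition tv_dist :: "'a pmf \<Rightarrow> 'a pmf \<Rightarrow> real" where
  "tv_dist p q = (SUP A. \<bar>measure_pmf.prob p A - measure_pmf.prob q A\<bar>)"


section \<open>Probabilistic polynomial time\<close>

text \<open>Multi-tape Turing machines over the tape alphabet \<open>{0, 1, blank}\<close> whose transition may depend
  on one fresh coin per step. A tape is the pair of its reversed left part and its right part,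
  the latter starting at the head. The input is on the first tape; the output is read off the last
  tape from the head up to the first blank.\<close>

datatype move = Move_Left | Move_Right | Stay

type_synonym tape = "bool option list \<times> bool option list"
type_synonym config = "nat \<times> tape list"

record tm =
  tapes :: nat
  states :: nat
  delta :: "nat \<Rightarrow> bool \<Rightarrow> bool option list \<Rightarrow> (nat \<times> (bool option \<times> move) list) option"

definition wf_tm :: "tm \<Rightarrow> bool" where
  "wf_tm M \<longleftrightarrow> tapes M \<ge> 1 \<and> states M \<ge> 1 \<and>
     (\<forall>s c rs s' ws. s < states M \<longrightarrow> length rs = tapes M \<longrightarrow> delta M s c rs = Some (s', ws) \<longrightarrow>
        s' < states M \<and> length ws = tapes M)"

fun tape_read :: "tape \<Rightarrow> bool option" where
  "tape_read (l, []) = None"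
| "tape_read (l, z # r) = z"

fun tape_act :: "tape \<Rightarrow> bool option \<times> move \<Rightarrow> tape" where
  "tape_act (l, r) (z, Stay) = (l, z # tl r)"
| "tape_act (l, r) (z, Move_Right) = (z # l, tl r)"
| "tape_act ([], r) (z, Move_Left) = ([], None # z # tl r)"
| "tape_act (a # l, r) (z, Move_Left) = (l, a # z # tl r)"

fun tm_step :: "tm \<Rightarrow> bool \<Rightarrow> config \<Rightarrow> config" where
  "tm_step M c (s, ts) = (case delta M s c (map tape_read ts) of
      None \<Rightarrow> (s, ts)
    | Some (s', ws) \<Rightarrow> (s', map2 tape_act ts ws))"

definition tm_run :: "tm \<Rightarrow> bits \<Rightarrow> bits \<Rightarrow> config" where
  "tm_run M coins x =
     fold (tm_step M) coins (0, ([], map Some x) # replicate (tapes M - 1) ([], []))"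

fun tm_halted :: "tm \<Rightarrow> config \<Rightarrow> bool" where
  "tm_halted M (s, ts) = (\<forall>c. delta M s c (map tape_read ts) = None)"

fun tm_output :: "config \<Rightarrow> bits" where
  "tm_output (s, ts) = map the (takeWhile (\<lambda>z. z \<noteq> None) (snd (last ts)))"

text \<open>\<open>in_time t inp A out\<close>: some machine, given \<open>inp a\<close>, halts within \<open>t a\<close> steps on all coin
  sequences and its output is distributed as the \<open>out\<close>-encoding of a sample of \<open>A a\<close>.\<close>

definition in_time ::
  "('a \<Rightarrow> nat) \<Rightarrow> ('a \<Rightarrow> bits) \<Rightarrow> ('a \<Rightarrow> 'b pmf) \<Rightarrow> ('b \<Rightarrow> bits) \<Rightarrow> bool" where
  "in_time t inp A out \<longleftrightarrow> (\<exists>M. wf_tm M \<and> (\<forall>a.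
     (\<forall>r \<in> bitstr (t a). tm_halted M (tm_run M r (inp a))) \<and>
     map_pmf out (A a) =
       map_pmf (\<lambda>r. tm_output (tm_run M r (inp a))) (pmf_of_set (bitstr (t a)))))"

definition ppt :: "('a \<Rightarrow> bits) \<Rightarrow> ('a \<Rightarrow> 'b pmf) \<Rightarrow> ('b \<Rightarrow> bits) \<Rightarrow> bool" where
  "ppt inp A out \<longleftrightarrow> (\<exists>c. in_time (\<lambda>a. length (inp a) ^ c + c) inp A out)"

definition poly_time :: "('a \<Rightarrow> bits) \<Rightarrow> ('a \<Rightarrow> 'b) \<Rightarrow> ('b \<Rightarrow> bits) \<Rightarrow> bool" where
  "poly_time inp f out \<longleftrightarrow> ppt inp (\<lambda>a. return_pmf (f a)) out"


section \<open>Quantum states, circuits and measurements\<close>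

text \<open>A state is a number of qubits with a density operator, given by its matrix entries in the
  standard basis; basis vectors are bit strings, and qubits are numbered from \<open>0\<close>.\<close>

type_synonym vec = "bits \<Rightarrow> complex"
type_synonym qstate = "nat \<times> (bits \<Rightarrow> bits \<Rightarrow> complex)"

fun is_state :: "nat \<Rightarrow> qstate \<Rightarrow> bool" where
  "is_state n (n', \<rho>) \<longleftrightarrow> n' = n \<and>
     (\<forall>a b. \<rho> a b \<noteq> 0 \<longrightarrow> a \<in> bitstr n \<and> b \<in> bitstr n) \<and>
     (\<forall>a b. \<rho> b a = cnj (\<rho> a b)) \<and>
     (\<forall>v. 0 \<le> Re (\<Sum>a\<in>bitstr n. \<Sum>b\<in>bitstr n. cnj (v a) * \<rho> a b * v b)) \<and>
     (\<Sum>a\<in>bitstr n. \<rho> a a) = 1"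

definition basis_vec :: "bits \<Rightarrow> vec" where
  "basis_vec u = (\<lambda>a. of_bool (a = u))"

fun tensor_basis :: "qstate \<Rightarrow> bits \<Rightarrow> qstate" where
  "tensor_basis (n, \<rho>) u = (n + length u,
     \<lambda>a b. \<rho> (take n a) (take n b) * of_bool (drop n a = u \<and> drop n b = u))"

definition basis_state :: "bits \<Rightarrow> qstate" where
  "basis_state u = (length u, \<lambda>a b. of_bool (a = u \<and> b = u))"

datatype gate = Had nat | Tgate nat | Cnot nat nat

fun gate_op :: "gate \<Rightarrow> vec \<Rightarrow> vec" where
  "gate_op (Had q) \<psi> = (\<lambda>a. (\<psi> (a[q := False]) + (if a ! q then - 1 else 1) * \<psi> (a[q := True]))
      / complex_of_real (sqrt 2))"
| "gate_op (Tgate q) \<psi> = (\<lambda>a. (if a ! q then cis (pi / 4) else 1) * \<psi> a)"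
| "gate_op (Cnot c t) \<psi> = (\<lambda>a. \<psi> (a[t := (a ! t \<noteq> a ! c)]))"

definition circ_op :: "gate list \<Rightarrow> vec \<Rightarrow> vec" where
  "circ_op gs \<psi> = fold gate_op gs \<psi>"

text \<open>\<open>evolve U\<close> maps \<open>\<rho>\<close> to \<open>U \<rho> U\<^sup>*\<close>, for a linear operator \<open>U\<close>: the inner application acts on
  the columns of \<open>\<rho>\<close>, the outer one on the conjugated rows.\<close>

fun evolve :: "(vec \<Rightarrow> vec) \<Rightarrow> qstate \<Rightarrow> qstate" where
  "evolve U (n, \<rho>) = (n, \<lambda>a b. cnj (U (\<lambda>b'. cnj (U (\<lambda>a'. \<rho> a' b') a)) b))"

text \<open>The projective measurement with one projector, onto the span of \<open>{a. f a = v}\<close>, for every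
  value \<open>v\<close>.\<close>

fun measure_with :: "(bits \<Rightarrow> 'v) \<Rightarrow> qstate \<Rightarrow> ('v \<times> qstate) pmf" where
  "measure_with f (n, \<rho>) =
     (let p = (\<lambda>v. \<Sum>a | a \<in> bitstr n \<and> f a = v. Re (\<rho> a a))
      in map_pmf (\<lambda>v. (v, (n, \<lambda>a b. if f a = v \<and> f b = v
                               then \<rho> a b / complex_of_real (p v) else 0)))
           (embed_pmf p))"

definition measure_qubits :: "nat \<Rightarrow> nat \<Rightarrow> qstate \<Rightarrow> (bits \<times> qstate) pmf" where
  "measure_qubits k m st = measure_with (slice k m) st"

text \<open>Partial trace over the qubits \<open>k, \<dots>, k + m - 1\<close>.\<close>

fun discard :: "nat \<Rightarrow> nat \<Rightarrow> qstate \<Rightarrow> qstate" where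
  "discard k m (n, \<rho>) = (n - m,
     \<lambda>a b. \<Sum>t\<in>bitstr m. \<rho> (take k a @ t @ drop k a) (take k b @ t @ drop k b))"

definition hadamards :: "nat \<Rightarrow> nat \<Rightarrow> qstate \<Rightarrow> qstate" where
  "hadamards k m = evolve (circ_op (map Had [k..<k + m]))"


section \<open>Quantum polynomial time\<close>

text \<open>Circuits over the universal gate set \<open>{H, T, CNOT}\<close>. A QPT algorithm with a classical input
  is a map from inputs to circuits whose description is computable in polynomial time.\<close>

type_synonym circuit = "nat \<times> gate list"

fun wf_gate :: "nat \<Rightarrow> gate \<Rightarrow> bool" where
  "wf_gate n (Had q) \<longleftrightarrow> q < n"
| "wf_gate n (Tgate q) \<longleftrightarrow> q < n"
| "wf_gate n (Cnot c t) \<longleftrightarrow> c < n \<and> t < n \<and> c \<noteq> t"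

definition wf_gates :: "nat \<Rightarrow> gate list \<Rightarrow> bool" where
  "wf_gates n gs \<longleftrightarrow> (\<forall>g\<in>set gs. wf_gate n g)"

fun enc_gate :: "gate \<Rightarrow> bits" where
  "enc_gate (Had q) = enc [unary 0, unary q]"
| "enc_gate (Tgate q) = enc [unary 1, unary q]"
| "enc_gate (Cnot c t) = enc [unary 2, unary c, unary t]"

fun enc_circuit :: "circuit \<Rightarrow> bits" where
  "enc_circuit (n, gs) = enc (unary n # map enc_gate gs)"

fun run_circuit :: "circuit \<Rightarrow> bits pmf" where
  "run_circuit (n, gs) =
     map_pmf fst (measure_qubits 0 n (evolve (circ_op gs) (basis_state (zeros n))))"

text \<open>A circuit with an \<open>a\<close>-qubit workspace run on a quantum input; its decision is qubit \<open>0\<close>.\<close>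

fun decide :: "circuit \<Rightarrow> qstate \<Rightarrow> bool pmf" where
  "decide (a, gs) st =
     map_pmf (\<lambda>(o', _). o' = [True])
       (measure_qubits 0 1 (evolve (circ_op gs) (tensor_basis st (zeros a))))"


section \<open>Noisy trapdoor claw-free functions\<close>

text \<open>\<open>prep_F pk b\<close> is the circuit preparing the range superposition; it acts on \<open>width\<close> qubits for
  \<open>x\<close>, then \<open>rlen\<close> qubits for \<open>y\<close>, then \<open>prep_anc pk\<close> workspace qubits.\<close>

record ntcf =
  width :: "nat \<Rightarrow> nat"
  rlen :: "nat \<Rightarrow> nat"
  kappa :: "nat \<Rightarrow> nat"
  Gen_F :: "nat \<Rightarrow> (bits \<times> bits) pmf"
  Dom_F :: "bits \<Rightarrow> bits set"
  Rng_F :: "bits \<Rightarrow> bits set"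
  Eval_F :: "bits \<Rightarrow> bool \<Rightarrow> bits \<Rightarrow> bits pmf"
  Invert_F :: "bits \<Rightarrow> bits \<Rightarrow> (bits \<times> bits) option"
  Check_F :: "bits \<Rightarrow> bool \<Rightarrow> bits \<Rightarrow> bits \<Rightarrow> bool"
  Good_F :: "bits \<Rightarrow> bits \<Rightarrow> bits \<Rightarrow> bits"
  prep_anc :: "bits \<Rightarrow> nat"
  prep_F :: "bits \<Rightarrow> bool \<Rightarrow> gate list"

text \<open>For a one-bit output of \<open>Good_F\<close>, being nonzero means being \<open>1\<close>.\<close>

definition good_set :: "ntcf \<Rightarrow> nat \<Rightarrow> bits \<Rightarrow> bits \<Rightarrow> bits set" where
  "good_set F lam x0 x1 =
     {d \<in> bitstr (width F lam + 1). Good_F F x0 x1 d \<noteq> zeros (kappa F lam)}"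

text \<open>The two sides of the matching are the preimages for \<open>b = 0\<close> and for \<open>b = 1\<close>. A matched pair
  is a claw, so it consists of two distinct preimages.\<close>

definition perfect_matching :: "(bits \<times> bits) set \<Rightarrow> bits set \<Rightarrow> bool" where
  "perfect_matching M D \<longleftrightarrow> M \<subseteq> D \<times> D \<and>
     (\<forall>x0\<in>D. \<exists>!x1. (x0, x1) \<in> M) \<and> (\<forall>x1\<in>D. \<exists>!x0. (x0, x1) \<in> M) \<and>
     (\<forall>(x0, x1)\<in>M. x0 \<noteq> x1)"

definition ntcf_efficient :: "ntcf \<Rightarrow> bool" where
  "ntcf_efficient F \<longleftrightarrow>
     ppt unary (Gen_F F) (\<lambda>(pk, sk). enc [pk, sk]) \<and>
     ppt (\<lambda>(pk, b, x). enc [pk, [b], x]) (\<lambda>(pk, b, x). Eval_F F pk b x) id \<and>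
     poly_time (\<lambda>(sk, y). enc [sk, y]) (\<lambda>(sk, y). Invert_F F sk y)
       (\<lambda>r. case r of None \<Rightarrow> [] | Some (x0, x1) \<Rightarrow> enc [x0, x1]) \<and>
     poly_time (\<lambda>(pk, b, x, y). enc [pk, [b], x, y]) (\<lambda>(pk, b, x, y). Check_F F pk b x y)
       (\<lambda>v. [v]) \<and>
     poly_time (\<lambda>(x0, x1, d). enc [x0, x1, d]) (\<lambda>(x0, x1, d). Good_F F x0 x1 d) id"

definition ntcf_domains :: "ntcf \<Rightarrow> bool" where
  "ntcf_domains F \<longleftrightarrow>
     poly_bounded (width F) \<and> poly_bounded (rlen F) \<and> poly_bounded (kappa F) \<and>
     (\<forall>lam. \<forall>(pk, sk)\<in>set_pmf (Gen_F F lam).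
        Dom_F F pk \<noteq> {} \<and> Dom_F F pk \<subseteq> bitstr (width F lam) \<and>
        Rng_F F pk \<subseteq> bitstr (rlen F lam) \<and>
        (\<forall>b. \<forall>x\<in>Dom_F F pk. set_pmf (Eval_F F pk b x) \<subseteq> Rng_F F pk) \<and>
        (\<forall>y x0 x1. Invert_F F sk y = Some (x0, x1) \<longrightarrow> x0 \<in> Dom_F F pk \<and> x1 \<in> Dom_F F pk)) \<and>
     poly_time (\<lambda>(pk, x). enc [pk, x]) (\<lambda>(pk, x). x \<in> Dom_F F pk) (\<lambda>v. [v]) \<and>
     (\<exists>S \<nu>. ppt id S id \<and> negl \<nu> \<and>
        (\<forall>lam. \<forall>(pk, sk)\<in>set_pmf (Gen_F F lam).
           set_pmf (S pk) \<subseteq> Dom_F F pk \<and> tv_dist (S pk) (pmf_of_set (Dom_F F pk)) \<le> \<nu> lam))"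

definition ntcf_good_form :: "ntcf \<Rightarrow> bool" where
  "ntcf_good_form F \<longleftrightarrow>
     (\<forall>lam. \<forall>(pk, sk)\<in>set_pmf (Gen_F F lam). \<forall>x0\<in>Dom_F F pk. \<forall>x1\<in>Dom_F F pk.
        (\<forall>d\<in>bitstr (width F lam + 1). length (Good_F F x0 x1 d) = kappa F lam) \<and>
        (\<forall>d\<in>bitstr (width F lam). Good_F F x0 x1 (True # d) = Good_F F x0 x1 (False # d))) \<and>
     ((\<forall>lam. kappa F lam = 1) \<or>
      (\<forall>lam. \<exists>ns a. length ns = kappa F lam \<and> sum_list ns = width F lam + 1 \<and>
         (\<forall>(pk, sk)\<in>set_pmf (Gen_F F lam). \<forall>x0\<in>Dom_F F pk. \<forall>x1\<in>Dom_F F pk. x0 \<noteq> x1 \<longrightarrow>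
            (\<forall>i<kappa F lam. a x0 x1 i \<in> bitstr (ns ! i) \<and> a x0 x1 i \<noteq> zeros (ns ! i)) \<and>
            (\<forall>d\<in>bitstr (width F lam + 1). Good_F F x0 x1 d =
               map (\<lambda>i. dot (a x0 x1 i) (slice (sum_list (take i ns)) (ns ! i) d))
                 [0..<kappa F lam]))))"

definition ntcf_complete :: "ntcf \<Rightarrow> bool" where
  "ntcf_complete F \<longleftrightarrow>
     (\<forall>lam. \<forall>(pk, sk)\<in>set_pmf (Gen_F F lam).
        (\<forall>b. \<forall>x\<in>Dom_F F pk. \<forall>y\<in>set_pmf (Eval_F F pk b x).
           \<exists>x0 x1. Invert_F F sk y = Some (x0, x1) \<and> (if b then x1 else x0) = x \<and>
             y \<in> set_pmf (Eval_F F pk False x0) \<and> y \<in> set_pmf (Eval_F F pk True x1)) \<and>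
        (\<exists>M. perfect_matching M (Dom_F F pk) \<and>
           (\<forall>x0\<in>Dom_F F pk. \<forall>x1\<in>Dom_F F pk.
              Eval_F F pk False x0 = Eval_F F pk True x1 \<longleftrightarrow> (x0, x1) \<in> M)) \<and>
        (\<forall>b. \<forall>x\<in>Dom_F F pk. \<forall>y.
           Check_F F pk b x y \<longleftrightarrow> y \<in> set_pmf (Eval_F F pk b x))) \<and>
     (\<exists>\<nu>. negl \<nu> \<and>
        (\<forall>lam. \<forall>(pk, sk)\<in>set_pmf (Gen_F F lam). \<forall>x0\<in>Dom_F F pk. \<forall>x1\<in>Dom_F F pk. x0 \<noteq> x1 \<longrightarrow>
           real (card (good_set F lam x0 x1)) / 2 ^ (width F lam + 1) \<ge> 1 - \<nu> lam))"

definition prep_size :: "ntcf \<Rightarrow> nat \<Rightarrow> bits \<Rightarrow> nat" where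
  "prep_size F lam pk = width F lam + rlen F lam + prep_anc F pk"

definition prep_vec :: "ntcf \<Rightarrow> nat \<Rightarrow> bits \<Rightarrow> bool \<Rightarrow> vec" where
  "prep_vec F lam pk b = circ_op (prep_F F pk b) (basis_vec (zeros (prep_size F lam pk)))"

definition range_superposition :: "ntcf \<Rightarrow> nat \<Rightarrow> bits \<Rightarrow> bool \<Rightarrow> vec" where
  "range_superposition F lam pk b = (\<lambda>a.
     let x = take (width F lam) a; y = slice (width F lam) (rlen F lam) a;
         anc = drop (width F lam + rlen F lam) a
     in if x \<in> Dom_F F pk \<and> y \<in> Rng_F F pk \<and> anc = zeros (prep_anc F pk)
        then complex_of_real (sqrt (pmf (Eval_F F pk b x) y) / sqrt (real (card (Dom_F F pk))))
        else 0)"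

text \<open>The distance is that of vectors, so it also controls the phase between the preparations for
  \<open>b = 0\<close> and \<open>b = 1\<close>, which are used in superposition; the workspace returns to zero.\<close>

definition ntcf_preparable :: "ntcf \<Rightarrow> bool" where
  "ntcf_preparable F \<longleftrightarrow>
     poly_time (\<lambda>(pk, b). enc [pk, [b]]) (\<lambda>(pk, b). (prep_anc F pk, prep_F F pk b)) enc_circuit \<and>
     (\<exists>\<nu>. negl \<nu> \<and>
        (\<forall>lam. \<forall>(pk, sk)\<in>set_pmf (Gen_F F lam). \<forall>b.
           wf_gates (prep_size F lam pk) (prep_F F pk b) \<and>
           L2_set (\<lambda>a. cmod (prep_vec F lam pk b a - range_superposition F lam pk b a))
             (bitstr (prep_size F lam pk)) \<le> \<nu> lam))"

definition adaptive_hardcore :: "ntcf \<Rightarrow> bool" where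
  "adaptive_hardcore F \<longleftrightarrow>
     (\<forall>A :: bits \<Rightarrow> circuit.
        poly_time id A enc_circuit \<longrightarrow> (\<forall>pk. wf_gates (fst (A pk)) (snd (A pk))) \<longrightarrow>
        (\<exists>\<nu>. negl \<nu> \<and> (\<forall>lam.
           measure_pmf.prob
             (do { (pk, sk) \<leftarrow> Gen_F F lam; out \<leftarrow> run_circuit (A pk); return_pmf (pk, sk, out) })
             {(pk, sk, out). \<exists>y b x d v x0 x1 rest.
                out = enc [y, [b], x, d, [v]] @ rest \<and> Check_F F pk b x y \<and>
                Invert_F F sk y = Some (x0, x1) \<and> d \<in> good_set F lam x0 x1 \<and>
                dot d (True # xor_bits x0 x1) = v}
           \<le> 1 / 2 + \<nu> lam)))"

definition is_ntcf :: "ntcf \<Rightarrow> bool" where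
  "is_ntcf F \<longleftrightarrow> ntcf_efficient F \<and> ntcf_domains F \<and> ntcf_good_form F \<and> ntcf_complete F \<and>
     ntcf_preparable F \<and> adaptive_hardcore F"


section \<open>The single-qubit scheme\<close>

text \<open>The weak commitment of qubit \<open>k\<close>. The first step is the isometry
  \<open>|s\<rangle> \<mapsto> |s\<rangle> \<otimes> prep_vec s\<close> on qubit \<open>k\<close>, with the fresh registers inserted right behind it; then the
  \<open>y\<close> register is measured, and it and the workspace are dropped.\<close>

fun controlled_prep :: "ntcf \<Rightarrow> nat \<Rightarrow> bits \<Rightarrow> nat \<Rightarrow> qstate \<Rightarrow> qstate" where
  "controlled_prep F lam pk k (n, \<rho>) =
     (let m = prep_size F lam pk;
          old = (\<lambda>a. take (Suc k) a @ drop (Suc k + m) a);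
          amp = (\<lambda>a. prep_vec F lam pk (a ! k) (slice (Suc k) m a))
      in (n + m, \<lambda>a b. \<rho> (old a) (old b) * amp a * cnj (amp b)))"

definition weak_commit :: "ntcf \<Rightarrow> nat \<Rightarrow> bits \<Rightarrow> nat \<Rightarrow> qstate \<Rightarrow> (bits \<times> qstate) pmf" where
  "weak_commit F lam pk k st =
     (let q = Suc k + width F lam in
      do { (y, st') \<leftarrow> measure_qubits q (rlen F lam) (controlled_prep F lam pk k st);
           return_pmf (y, discard q (rlen F lam + prep_anc F pk) st') })"

fun weak_commits :: "ntcf \<Rightarrow> nat \<Rightarrow> bits list \<Rightarrow> nat \<Rightarrow> qstate \<Rightarrow> (bits list \<times> qstate) pmf" where
  "weak_commits F lam [] k st = return_pmf ([], st)"
| "weak_commits F lam (pk # pks) k st =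
     do { (y, st') \<leftarrow> weak_commit F lam pk k st;
          (ys, st'') \<leftarrow> weak_commits F lam pks (k + (width F lam + 1)) st';
          return_pmf (y # ys, st'') }"

text \<open>A list of \<open>(pk, sk)\<close> pairs; verification uses the public keys as well.\<close>

type_synonym keys = "(bits \<times> bits) list"

definition gen1 :: "ntcf \<Rightarrow> nat \<Rightarrow> keys pmf" where
  "gen1 F lam = replicate_pmf (width F lam + 2) (Gen_F F lam)"

definition blk :: "ntcf \<Rightarrow> nat \<Rightarrow> nat" where
  "blk F lam = (width F lam + 1)\<^sup>2"

definition commit1 :: "ntcf \<Rightarrow> nat \<Rightarrow> bits list \<Rightarrow> nat \<Rightarrow> qstate \<Rightarrow> (bits \<times> qstate) pmf" where
  "commit1 F lam pks k st =
     do { (y0, st1) \<leftarrow> weak_commit F lam (hd pks) k st;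
          (ys, st2) \<leftarrow> weak_commits F lam (tl pks) k (hadamards k (width F lam + 1) st1);
          return_pmf (concat (y0 # ys), st2) }"

text \<open>Opening the block of \<open>blk\<close> qubits starting at \<open>k\<close>. Note the exchange of the bases: a standard
  basis opening (\<open>b\<close> false) measures in the Hadamard basis.\<close>

definition open1 :: "ntcf \<Rightarrow> nat \<Rightarrow> nat \<Rightarrow> bool \<Rightarrow> qstate \<Rightarrow> (bits \<times> qstate) pmf" where
  "open1 F lam k b st =
     measure_qubits k (blk F lam) (if b then st else hadamards k (blk F lam) st)"

definition ypart :: "ntcf \<Rightarrow> nat \<Rightarrow> bits \<Rightarrow> nat \<Rightarrow> bits" where
  "ypart F lam y i = slice (i * rlen F lam) (rlen F lam) y"

definition zpart :: "ntcf \<Rightarrow> nat \<Rightarrow> bits \<Rightarrow> nat \<Rightarrow> bits" where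
  "zpart F lam z i = slice (i * (width F lam + 1)) (width F lam + 1) z"

definition claw :: "ntcf \<Rightarrow> nat \<Rightarrow> keys \<Rightarrow> bits \<Rightarrow> nat \<Rightarrow> (bits \<times> bits) option" where
  "claw F lam ks y i = Invert_F F (snd (ks ! i)) (ypart F lam y i)"

definition dvec :: "ntcf \<Rightarrow> nat \<Rightarrow> bits \<Rightarrow> bits" where
  "dvec F lam z = map (\<lambda>i. hd (zpart F lam z i)) [0..<width F lam + 1]"

definition mvec :: "ntcf \<Rightarrow> nat \<Rightarrow> keys \<Rightarrow> bits \<Rightarrow> bits \<Rightarrow> bits" where
  "mvec F lam ks y z = map (\<lambda>i. case claw F lam ks y (Suc i) of
       None \<Rightarrow> False
     | Some (x0, x1) \<Rightarrow> dot (zpart F lam z i) (True # xor_bits x0 x1)) [0..<width F lam + 1]"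

definition ver1 :: "ntcf \<Rightarrow> nat \<Rightarrow> keys \<Rightarrow> bits \<Rightarrow> bool \<Rightarrow> bits \<Rightarrow> bool" where
  "ver1 F lam ks y b z \<longleftrightarrow>
     length y = (width F lam + 2) * rlen F lam \<and> length z = blk F lam \<and>
     (if b then
        (\<forall>i<width F lam + 1. Check_F F (fst (ks ! Suc i)) (hd (zpart F lam z i))
           (tl (zpart F lam z i)) (ypart F lam y (Suc i))) \<and>
        (\<exists>x0 x1. claw F lam ks y 0 = Some (x0, x1) \<and> dvec F lam z \<in> good_set F lam x0 x1)
      else
        (\<forall>i<width F lam + 1. \<exists>x0 x1. claw F lam ks y (Suc i) = Some (x0, x1) \<and>
           zpart F lam z i \<in> good_set F lam x0 x1) \<and>
        Check_F F (fst (ks ! 0)) (hd (mvec F lam ks y z)) (tl (mvec F lam ks y z))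
          (ypart F lam y 0))"

definition out1 :: "ntcf \<Rightarrow> nat \<Rightarrow> keys \<Rightarrow> bits \<Rightarrow> bool \<Rightarrow> bits \<Rightarrow> bool" where
  "out1 F lam ks y b z =
     (if b then (case claw F lam ks y 0 of
           None \<Rightarrow> False
         | Some (x0, x1) \<Rightarrow> dot (dvec F lam z) (True # xor_bits x0 x1))
      else hd (mvec F lam ks y z))"


section \<open>The semi-succinct scheme\<close>

fun commit_from :: "ntcf \<Rightarrow> nat \<Rightarrow> bits list \<Rightarrow> nat \<Rightarrow> nat \<Rightarrow> qstate \<Rightarrow> (bits list \<times> qstate) pmf" where
  "commit_from F lam pks 0 k st = return_pmf ([], st)"
| "commit_from F lam pks (Suc l) k st =
     do { (y, st') \<leftarrow> commit1 F lam pks k st;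
          (ys, st'') \<leftarrow> commit_from F lam pks l (k + blk F lam) st';
          return_pmf (y # ys, st'') }"

definition commit_ss :: "ntcf \<Rightarrow> nat \<Rightarrow> bits list \<Rightarrow> qstate \<Rightarrow> (bits list \<times> qstate) pmf" where
  "commit_ss F lam pks st = commit_from F lam pks (fst st) 0 st"

fun open_ss :: "ntcf \<Rightarrow> nat \<Rightarrow> (nat \<times> bool) list \<Rightarrow> qstate \<Rightarrow> bits list pmf" where
  "open_ss F lam [] st = return_pmf []"
| "open_ss F lam ((j, b) # jbs) st =
     do { (z, st') \<leftarrow> open1 F lam (j * blk F lam) b st;
          zs \<leftarrow> open_ss F lam jbs st';
          return_pmf (z # zs) }"

definition ver_ss :: "ntcf \<Rightarrow> nat \<Rightarrow> keys \<Rightarrow> bits list \<Rightarrow> bits \<Rightarrow> bits list \<Rightarrow> bool" where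
  "ver_ss F lam ks ys bs zs \<longleftrightarrow> length bs = length ys \<and> length zs = length ys \<and>
     (\<forall>j<length ys. ver1 F lam ks (ys ! j) (bs ! j) (zs ! j))"


section \<open>Hash families with local opening\<close>

text \<open>The hashed message is a list of symbols, all of the same bit length.\<close>

record hash =
  Gen_H :: "nat \<Rightarrow> bits pmf"
  Eval_H :: "bits \<Rightarrow> bits list \<Rightarrow> bits"
  Open_H :: "bits \<Rightarrow> bits list \<Rightarrow> nat \<Rightarrow> bits \<times> bits"
  Ver_H :: "bits \<Rightarrow> bits \<Rightarrow> nat \<Rightarrow> bits \<Rightarrow> bits \<Rightarrow> bool"

definition uniform_blocks :: "bits list \<Rightarrow> bool" where
  "uniform_blocks xs \<longleftrightarrow> (\<exists>n. set xs \<subseteq> bitstr n)"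

definition hash_efficient :: "hash \<Rightarrow> bool" where
  "hash_efficient H \<longleftrightarrow>
     ppt unary (Gen_H H) id \<and>
     poly_time (\<lambda>(hk, xs). enc [hk, enc xs]) (\<lambda>(hk, xs). Eval_H H hk xs) id \<and>
     poly_time (\<lambda>(hk, xs, i). enc [hk, enc xs, unary i]) (\<lambda>(hk, xs, i). Open_H H hk xs i)
       (\<lambda>(v, op). enc [v, op]) \<and>
     poly_time (\<lambda>(hk, rt, i, v, op). enc [hk, rt, unary i, v, op])
       (\<lambda>(hk, rt, i, v, op). Ver_H H hk rt i v op) (\<lambda>v. [v]) \<and>
     (\<exists>c. \<forall>lam. \<forall>hk\<in>set_pmf (Gen_H H lam). \<forall>xs. uniform_blocks xs \<longrightarrow>
        length (Eval_H H hk xs) \<le> (lam + floorlog 2 (length (enc xs))) ^ c + c \<and>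
        (\<forall>i<length xs.
           length (snd (Open_H H hk xs i)) \<le> (lam + floorlog 2 (length (enc xs))) ^ c + c))"

definition hash_opening_correct :: "hash \<Rightarrow> bool" where
  "hash_opening_correct H \<longleftrightarrow>
     (\<forall>p. poly_bounded p \<longrightarrow> (\<exists>\<nu>. negl \<nu> \<and>
        (\<forall>lam xs i. uniform_blocks xs \<longrightarrow> i < length xs \<longrightarrow> length (enc xs) \<le> p lam \<longrightarrow>
           measure_pmf.prob (Gen_H H lam)
             {hk. fst (Open_H H hk xs i) = xs ! i \<and>
                Ver_H H hk (Eval_H H hk xs) i (fst (Open_H H hk xs i)) (snd (Open_H H hk xs i))}
           \<ge> 1 - \<nu> lam)))"

text \<open>Polynomial-size adversaries are polynomial-time ones with polynomially long advice.\<close>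

definition hash_binding :: "hash \<Rightarrow> bool" where
  "hash_binding H \<longleftrightarrow>
     (\<forall>(A :: nat \<times> bits \<times> bits \<Rightarrow> bits pmf) adv.
        ppt (\<lambda>(lam, ad, hk). enc [unary lam, ad, hk]) A id \<longrightarrow>
        poly_bounded (\<lambda>lam. length (adv lam)) \<longrightarrow>
        (\<exists>\<nu>. negl \<nu> \<and> (\<forall>lam.
           measure_pmf.prob
             (do { hk \<leftarrow> Gen_H H lam; out \<leftarrow> A (lam, adv lam, hk); return_pmf (hk, out) })
             {(hk, out). \<exists>rt i v op v' op'. out = enc [rt, unary i, v, op, v', op'] \<and>
                v \<noteq> v' \<and> length v = length v' \<and>
                Ver_H H hk rt i v op \<and> Ver_H H hk rt i v' op'}
           \<le> \<nu> lam)))"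

text \<open>The first stage of a collapsing adversary is a circuit whose first \<open>t\<close> qubits are measured to
  give \<open>(rt, j)\<close> and the symbol length, and whose next \<open>u\<close> qubits hold the superposition of
  (value, opening) pairs; the remaining qubits are its internal state. Padding is fixed, so that
  a pair has only one accepted basis string.\<close>

record collapser =
  c_size :: nat
  c_class :: nat
  c_pair :: nat
  c_gates :: "gate list"

definition wf_collapser :: "collapser \<Rightarrow> bool" where
  "wf_collapser C \<longleftrightarrow> c_class C + c_pair C \<le> c_size C \<and> wf_gates (c_size C) (c_gates C)"

definition enc_collapser :: "collapser \<Rightarrow> bits" where
  "enc_collapser C =
     enc [unary (c_class C), unary (c_pair C), enc_circuit (c_size C, c_gates C)]"

definition accepted_pair ::
  "hash \<Rightarrow> bits \<Rightarrow> bits \<Rightarrow> nat \<Rightarrow> nat \<Rightarrow> nat \<Rightarrow> bits \<Rightarrow> bool" where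
  "accepted_pair H hk rt j bl u s \<longleftrightarrow> (\<exists>v op. length (enc [v, op]) < u \<and>
     s = pad u (enc [v, op]) \<and> length v = bl \<and> Ver_H H hk rt j v op)"

definition collapse_game ::
  "hash \<Rightarrow> (nat \<times> bits \<Rightarrow> collapser) \<Rightarrow> (nat \<times> bits \<times> bits \<Rightarrow> circuit) \<Rightarrow> nat \<Rightarrow> bool \<Rightarrow> bool pmf" where
  "collapse_game H A1 A2 lam measured =
     do { hk \<leftarrow> Gen_H H lam;
          let C = A1 (lam, hk);
          (s, st) \<leftarrow> measure_qubits 0 (c_class C)
                       (evolve (circ_op (c_gates C)) (basis_state (zeros (c_size C))));
          (case dec (unpad s) of
             [rt, j, bl] \<Rightarrow>
               do { (ok, st1) \<leftarrow> measure_with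
                      (\<lambda>a. accepted_pair H hk rt (length j) (length bl) (c_pair C)
                             (slice (c_class C) (c_pair C) a)) st;
                    if \<not> ok then return_pmf False
                    else do { st2 \<leftarrow> (if measured
                                then map_pmf snd (measure_qubits (c_class C) (c_pair C) st1)
                                else return_pmf st1);
                              decide (A2 (lam, hk, s)) st2 } }
           | _ \<Rightarrow> return_pmf False) }"

definition hash_collapsing :: "hash \<Rightarrow> bool" where
  "hash_collapsing H \<longleftrightarrow>
     (\<forall>A1 A2.
        poly_time (\<lambda>(lam, hk). enc [unary lam, hk]) A1 enc_collapser \<longrightarrow>
        poly_time (\<lambda>(lam, hk, s). enc [unary lam, hk, s]) A2 enc_circuit \<longrightarrow>
        (\<forall>lam hk. wf_collapser (A1 (lam, hk))) \<longrightarrow>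
        (\<forall>lam hk s. wf_gates (c_size (A1 (lam, hk)) + fst (A2 (lam, hk, s))) (snd (A2 (lam, hk, s))))
        \<longrightarrow>
        negl (\<lambda>lam. pmf (collapse_game H A1 A2 lam False) True
                        - pmf (collapse_game H A1 A2 lam True) True))"

definition is_hash_family :: "hash \<Rightarrow> bool" where
  "is_hash_family H \<longleftrightarrow> hash_efficient H \<and> hash_opening_correct H \<and> hash_binding H \<and>
     hash_collapsing H"


section \<open>State-preserving succinct arguments of knowledge\<close>

text \<open>The common input is \<open>1\<^sup>\<lambda>\<close>, the instance \<open>x\<close> and a bound \<open>m\<close> on the witness length, which
  fixes the running time of the relation. Each party draws its private coins (and digests
  its inputs) once, and then answers deterministically as a function of the transcript so far; a
  transcript is the list of (verifier message, prover message) rounds. The verdict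
  depends on the common input and the transcript only: public verifiability.\<close>

type_synonym transcript = "(bits \<times> bits) list"
type_synonym relation = "nat \<Rightarrow> bits \<Rightarrow> bits \<Rightarrow> bool"

record argument =
  rounds :: "nat \<Rightarrow> nat \<Rightarrow> bits \<Rightarrow> nat"
  P_init :: "nat \<Rightarrow> nat \<Rightarrow> bits \<Rightarrow> bits \<Rightarrow> bits pmf"
  P_msg :: "bits \<Rightarrow> transcript \<Rightarrow> bits \<Rightarrow> bits"
  V_init :: "nat \<Rightarrow> nat \<Rightarrow> bits \<Rightarrow> bits pmf"
  V_msg :: "bits \<Rightarrow> transcript \<Rightarrow> bits"
  verdict :: "nat \<Rightarrow> nat \<Rightarrow> bits \<Rightarrow> transcript \<Rightarrow> bool"

definition enc_tr :: "transcript \<Rightarrow> bits" where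
  "enc_tr t = enc (concat (map (\<lambda>(v, p). [v, p]) t))"

definition next_round :: "argument \<Rightarrow> bits \<Rightarrow> bits \<Rightarrow> transcript \<Rightarrow> transcript" where
  "next_round \<A> sv sp t = (let v = V_msg \<A> sv t in t @ [(v, P_msg \<A> sp t v)])"

definition honest_transcript :: "argument \<Rightarrow> nat \<Rightarrow> nat \<Rightarrow> bits \<Rightarrow> bits \<Rightarrow> transcript pmf" where
  "honest_transcript \<A> lam m x w =
     do { sv \<leftarrow> V_init \<A> lam m x; sp \<leftarrow> P_init \<A> lam m x w;
          return_pmf ((next_round \<A> sv sp ^^ rounds \<A> lam m x) []) }"

definition arg_efficient :: "argument \<Rightarrow> bool" where
  "arg_efficient \<A> \<longleftrightarrow>
     ppt (\<lambda>(lam, m, x, w). enc [unary lam, unary m, x, w]) (\<lambda>(lam, m, x, w). P_init \<A> lam m x w) id \<and>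
     poly_time (\<lambda>(sp, t, v). enc [sp, enc_tr t, v]) (\<lambda>(sp, t, v). P_msg \<A> sp t v) id \<and>
     poly_time (\<lambda>(sv, t). enc [sv, enc_tr t]) (\<lambda>(sv, t). V_msg \<A> sv t) id"

definition arg_complete :: "argument \<Rightarrow> relation \<Rightarrow> bool" where
  "arg_complete \<A> R \<longleftrightarrow>
     (\<forall>p. poly_bounded p \<longrightarrow> (\<exists>\<nu>. negl \<nu> \<and>
        (\<forall>lam m x w. R lam x w \<longrightarrow> length x \<le> p lam \<longrightarrow> length w \<le> m \<longrightarrow> m \<le> p lam \<longrightarrow>
           measure_pmf.prob (honest_transcript \<A> lam m x w) {t. verdict \<A> lam m x t}
           \<ge> 1 - \<nu> lam)))"

text \<open>\<open>T\<close> bounds the time for deciding the relation in terms of the security parameter, the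
  instance length and the witness length; polynomial dependence on \<open>log T\<close> and
  quasilinear dependence on the instance length are as displayed in the bounds.\<close>

definition decidable_in :: "relation \<Rightarrow> (nat \<Rightarrow> nat \<Rightarrow> nat \<Rightarrow> nat) \<Rightarrow> bool" where
  "decidable_in R T \<longleftrightarrow> (\<forall>lam n. mono (T lam n)) \<and>
     in_time (\<lambda>(lam, x, w). T lam (length x) (length w)) (\<lambda>(lam, x, w). enc [unary lam, x, w])
       (\<lambda>(lam, x, w). return_pmf (R lam x w)) (\<lambda>v. [v])"

definition arg_succinct :: "argument \<Rightarrow> relation \<Rightarrow> bool" where
  "arg_succinct \<A> R \<longleftrightarrow>
     (\<forall>T. decidable_in R T \<longrightarrow> (\<exists>c.
        (\<forall>lam m x w. R lam x w \<longrightarrow> length w \<le> m \<longrightarrow>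
           (\<forall>t\<in>set_pmf (honest_transcript \<A> lam m x w).
              length (enc_tr t) \<le> (lam + floorlog 2 (T lam (length x) m)) ^ c + c)) \<and>
        (\<forall>lam m x. \<forall>sv\<in>set_pmf (V_init \<A> lam m x).
           length sv \<le> (lam + floorlog 2 (T lam (length x) m)) ^ c + c) \<and>
        in_time (\<lambda>(lam, m, x). (lam + floorlog 2 (T lam (length x) m)) ^ c + c
                    + c * length x * floorlog 2 (length x) ^ c)
          (\<lambda>(lam, m, x). enc [unary lam, binary m, x]) (\<lambda>(lam, m, x). V_init \<A> lam m x) id \<and>
        in_time (\<lambda>(lam, m, x, t).
                    (lam + floorlog 2 (T lam (length x) m) + length (enc_tr t)) ^ c + c
                    + c * length x * floorlog 2 (length x) ^ c)
          (\<lambda>(lam, m, x, t). enc [unary lam, binary m, x, enc_tr t])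
          (\<lambda>(lam, m, x, t). return_pmf (verdict \<A> lam m x t)) (\<lambda>v. [v])))"

text \<open>A quantum prover has a \<open>q\<close>-qubit state and a \<open>\<mu>\<close>-qubit message register. In round \<open>i\<close> it
  receives the verifier's message in the message register, applies \<open>U i\<close> to both and returns the
  measured content of the message register.\<close>

fun quantum_rounds ::
  "argument \<Rightarrow> bits \<Rightarrow> nat \<Rightarrow> (nat \<Rightarrow> gate list) \<Rightarrow> nat \<Rightarrow> transcript \<Rightarrow> qstate \<Rightarrow> (transcript \<times> qstate) pmf"
where
  "quantum_rounds \<A> sv \<mu> U 0 t st = return_pmf (t, st)"
| "quantum_rounds \<A> sv \<mu> U (Suc k) t st =
     (let v = V_msg \<A> sv t in
      do { (p, st') \<leftarrow> measure_qubits (fst st) \<mu>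
             (evolve (circ_op (U (length t))) (tensor_basis st (pad \<mu> v)));
           quantum_rounds \<A> sv \<mu> U k (t @ [(v, unpad p)]) (discard (fst st) \<mu> st') })"

definition real_view ::
  "argument \<Rightarrow> nat \<Rightarrow> nat \<Rightarrow> bits \<Rightarrow> nat \<Rightarrow> (nat \<Rightarrow> gate list) \<Rightarrow> qstate \<Rightarrow> (bits \<times> qstate) pmf" where
  "real_view \<A> lam m x \<mu> U \<rho> =
     do { sv \<leftarrow> V_init \<A> lam m x;
          (t, st) \<leftarrow> quantum_rounds \<A> sv \<mu> U (rounds \<A> lam m x) [] \<rho>;
          return_pmf (enc_tr t, st) }"

text \<open>Oracle circuits: \<open>Oracle i inverse c\<close> applies \<open>U i\<close>, or its inverse, to the prover's qubits
  \<open>0, \<dots>, q + \<mu> - 1\<close>, controlled on qubit \<open>c\<close>. The inverse uses that the eighth power of \<open>T\<close>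
  is the identity.\<close>

datatype ogate = Plain gate | Oracle nat bool nat

fun gate_inverse :: "gate \<Rightarrow> gate list" where
  "gate_inverse (Tgate q) = replicate 7 (Tgate q)"
| "gate_inverse g = [g]"

definition circ_inverse :: "gate list \<Rightarrow> gate list" where
  "circ_inverse gs = concat (map gate_inverse (rev gs))"

fun ogate_op :: "(nat \<Rightarrow> gate list) \<Rightarrow> ogate \<Rightarrow> vec \<Rightarrow> vec" where
  "ogate_op U (Plain g) \<psi> = gate_op g \<psi>"
| "ogate_op U (Oracle i inverted c) \<psi> =
     (\<lambda>a. if a ! c then circ_op (if inverted then circ_inverse (U i) else U i) \<psi> a else \<psi> a)"

fun wf_ogate :: "nat \<Rightarrow> nat \<Rightarrow> ogate \<Rightarrow> bool" where
  "wf_ogate d n (Plain g) \<longleftrightarrow> wf_gate n g"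
| "wf_ogate d n (Oracle i inverted c) \<longleftrightarrow> d \<le> c \<and> c < n"

fun enc_ogate :: "ogate \<Rightarrow> bits" where
  "enc_ogate (Plain g) = enc [unary 0, enc_gate g]"
| "enc_ogate (Oracle i inverted c) = enc [unary 1, unary i, [inverted], unary c]"

text \<open>An extractor maps \<open>(\<lambda>, m, x, k, q, \<mu>)\<close>, with \<open>\<epsilon> = 1 / k\<close>, to an oracle circuit with a
  workspace register. In the end the workspace is measured and yields the simulated
  transcript and the witness, while the prover's \<open>q\<close> qubits are the simulated state.\<close>

type_synonym extractor = "nat \<times> nat \<times> bits \<times> nat \<times> nat \<times> nat \<Rightarrow> nat \<times> ogate list"

definition wf_extractor :: "extractor \<Rightarrow> bool" where
  "wf_extractor E \<longleftrightarrow>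
     poly_time (\<lambda>(lam, m, x, k, q, \<mu>). enc [unary lam, unary m, x, unary k, unary q, unary \<mu>]) E
       (\<lambda>(a, ogs). enc (unary a # map enc_ogate ogs)) \<and>
     (\<forall>lam m x k q \<mu>. \<forall>g\<in>set (snd (E (lam, m, x, k, q, \<mu>))).
        wf_ogate (q + \<mu>) (q + \<mu> + fst (E (lam, m, x, k, q, \<mu>))) g)"

definition sim_view ::
  "extractor \<Rightarrow> nat \<Rightarrow> nat \<Rightarrow> bits \<Rightarrow> nat \<Rightarrow> nat \<Rightarrow> (nat \<Rightarrow> gate list) \<Rightarrow> qstate
     \<Rightarrow> (bits \<times> bits \<times> qstate) pmf" where
  "sim_view E lam m x k \<mu> U \<rho> =
     (let q = fst \<rho>; (a, ogs) = E (lam, m, x, k, q, \<mu>) in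
      do { (s, st) \<leftarrow> measure_qubits (q + \<mu>) a
             (evolve (fold (ogate_op U) ogs) (tensor_basis \<rho> (zeros (\<mu> + a))));
           let st' = discard q (\<mu> + a) st;
           return_pmf (case dec (unpad s) of [t, w] \<Rightarrow> (t, w, st') | _ \<Rightarrow> ([], [], st')) })"

definition state_preserving :: "argument \<Rightarrow> relation \<Rightarrow> bool" where
  "state_preserving \<A> R \<longleftrightarrow>
     (\<exists>E. wf_extractor E \<and>
        (\<forall>q \<mu> m k x \<rho> U.
           poly_bounded q \<longrightarrow> poly_bounded \<mu> \<longrightarrow> poly_bounded m \<longrightarrow> poly_bounded k \<longrightarrow>
           poly_bounded (\<lambda>lam. length (x lam)) \<longrightarrow> (\<forall>lam. k lam \<ge> 1) \<longrightarrow>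
           (\<forall>lam. is_state (q lam) (\<rho> lam)) \<longrightarrow>
           poly_time (\<lambda>(lam, x, i). enc [unary lam, x, unary i]) U
             (\<lambda>gs. enc (map enc_gate gs)) \<longrightarrow>
           (\<forall>lam i. wf_gates (q lam + \<mu> lam) (U (lam, x lam, i))) \<longrightarrow>
           (let real = (\<lambda>lam. real_view \<A> lam (m lam) (x lam) (\<mu> lam)
                                (\<lambda>i. U (lam, x lam, i)) (\<rho> lam));
                sim = (\<lambda>lam. sim_view E lam (m lam) (x lam) (k lam) (\<mu> lam)
                                (\<lambda>i. U (lam, x lam, i)) (\<rho> lam))
            in
            (\<forall>D. poly_time (\<lambda>(lam, x, t). enc [unary lam, x, t]) D enc_circuit \<longrightarrow>
               (\<forall>lam x t. wf_gates (q lam + fst (D (lam, x, t))) (snd (D (lam, x, t)))) \<longrightarrow>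
               (\<exists>\<nu>. negl \<nu> \<and> (\<forall>lam.
                  \<bar>pmf (do { (t, st) \<leftarrow> real lam; decide (D (lam, x lam, t)) st }) True
                   - pmf (do { (t, w, st) \<leftarrow> sim lam; decide (D (lam, x lam, t)) st }) True\<bar>
                  \<le> 1 / k lam + \<nu> lam))) \<and>
            (\<exists>\<nu>. negl \<nu> \<and> (\<forall>lam.
               measure_pmf.prob (sim lam)
                 {(s, w, st). (\<exists>t. s = enc_tr t \<and> verdict \<A> lam (m lam) (x lam) t) \<and>
                    \<not> R lam (x lam) w}
               \<le> 1 / k lam + \<nu> lam)))))"

definition is_sp_argument :: "argument \<Rightarrow> relation \<Rightarrow> bool" where
  "is_sp_argument \<A> R \<longleftrightarrow> arg_efficient \<A> \<and> arg_complete \<A> R \<and> arg_succinct \<A> R \<and>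
     state_preserving \<A> R"

definition argue :: "argument \<Rightarrow> nat \<Rightarrow> bits \<Rightarrow> bits \<Rightarrow> bool pmf" where
  "argue \<A> lam x w =
     map_pmf (verdict \<A> lam (length w) x) (honest_transcript \<A> lam (length w) x w)"


section \<open>The succinct scheme\<close>

definition enc_keys :: "keys \<Rightarrow> bits" where
  "enc_keys ks = enc (concat (map (\<lambda>(pk, sk). [pk, sk]) ks))"

definition hash_rel :: "hash \<Rightarrow> relation" where
  "hash_rel H lam x w \<longleftrightarrow>
     (\<exists>hk rt ys. x = enc [hk, rt] \<and> w = enc ys \<and> Eval_H H hk ys = rt)"

definition test_rel :: "ntcf \<Rightarrow> hash \<Rightarrow> relation" where
  "test_rel F H lam x w \<longleftrightarrow>
     (\<exists>ks hk rt rt' b ys zs. x = enc [enc_keys ks, hk, rt, rt', [b]] \<and> w = enc [enc ys, enc zs] \<and>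
        Eval_H H hk ys = rt \<and> Eval_H H hk zs = rt' \<and>
        ver_ss F lam ks ys (replicate (length ys) b) zs)"

definition gen :: "ntcf \<Rightarrow> hash \<Rightarrow> nat \<Rightarrow> ((bits list \<times> bits) \<times> (keys \<times> bits)) pmf" where
  "gen F H lam =
     do { ks \<leftarrow> gen1 F lam; hk \<leftarrow> Gen_H H lam;
          return_pmf ((map fst ks, hk), (ks, hk)) }"

fun commit :: "ntcf \<Rightarrow> hash \<Rightarrow> nat \<Rightarrow> bits list \<times> bits \<Rightarrow> qstate \<Rightarrow> (bits \<times> bits list \<times> qstate) pmf" where
  "commit F H lam (pks, hk) \<sigma> =
     do { (ys, \<rho>) \<leftarrow> commit_ss F lam pks \<sigma>; return_pmf (Eval_H H hk ys, ys, \<rho>) }"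

definition ver_commit :: "argument \<Rightarrow> nat \<Rightarrow> bits \<Rightarrow> bits \<Rightarrow> bits list \<Rightarrow> bool pmf" where
  "ver_commit \<A> lam hk rt ys = argue \<A> lam (enc [hk, rt]) (enc ys)"

definition open_at ::
  "ntcf \<Rightarrow> hash \<Rightarrow> nat \<Rightarrow> bits \<Rightarrow> bits list \<Rightarrow> qstate \<Rightarrow> (nat \<times> bool) list \<Rightarrow> (bits \<times> bits \<times> bits) list pmf"
where
  "open_at F H lam hk ys \<rho> jbs =
     do { zs \<leftarrow> open_ss F lam jbs \<rho>;
          return_pmf (map2 (\<lambda>(j, b) z. (fst (Open_H H hk ys j), snd (Open_H H hk ys j), z)) jbs zs) }"

definition ver_at ::
  "ntcf \<Rightarrow> hash \<Rightarrow> nat \<Rightarrow> keys \<times> bits \<Rightarrow> bits \<Rightarrow> (nat \<times> bool) list \<Rightarrow> (bits \<times> bits \<times> bits) list \<Rightarrow> bool"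
where
  "ver_at F H lam = (\<lambda>(ks, hk) rt jbs ops. list_all2 (\<lambda>(j, b) (y, op, z).
     Ver_H H hk rt j y op \<and> ver1 F lam ks y b z) jbs ops)"

definition out_at :: "ntcf \<Rightarrow> nat \<Rightarrow> keys \<times> bits \<Rightarrow> (nat \<times> bool) list \<Rightarrow> (bits \<times> bits \<times> bits) list \<Rightarrow> bits"
where
  "out_at F lam = (\<lambda>(ks, hk) jbs ops. map2 (\<lambda>(j, b) (y, op, z). out1 F lam ks y b z) jbs ops)"

text \<open>\<open>\<A>1\<close> is the argument for \<open>hash_rel\<close> and \<open>\<A>2\<close> the one for \<open>test_rel\<close>.\<close>

definition test ::
  "ntcf \<Rightarrow> hash \<Rightarrow> argument \<Rightarrow> argument \<Rightarrow> nat \<Rightarrow> keys \<Rightarrow> bits \<Rightarrow> bits \<Rightarrow> bits list \<Rightarrow> qstate \<Rightarrow> bool pmf" where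
  "test F H \<A>1 \<A>2 lam ks hk rt ys \<rho> =
     do { b \<leftarrow> pmf_of_set UNIV;
          zs \<leftarrow> open_ss F lam (map (\<lambda>j. (j, b)) [0..<length ys]) \<rho>;
          let rt' = Eval_H H hk zs;
          acc1 \<leftarrow> argue \<A>1 lam (enc [hk, rt']) (enc zs);
          acc2 \<leftarrow> argue \<A>2 lam (enc [enc_keys ks, hk, rt, rt', [b]]) (enc [enc ys, enc zs]);
          return_pmf (acc1 \<and> acc2) }"

text \<open>The basis choice on \<open>J\<close>, listed in increasing order of the positions.\<close>

definition positions :: "nat set \<Rightarrow> bits \<Rightarrow> (nat \<times> bool) list" where
  "positions J bs = map (\<lambda>j. (j, bs ! j)) (sorted_list_of_set J)"

definition real0 ::
  "ntcf \<Rightarrow> hash \<Rightarrow> argument \<Rightarrow> nat \<Rightarrow> qstate \<Rightarrow> nat set \<Rightarrow> bits \<Rightarrow> bits option pmf" where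
  "real0 F H \<A>1 lam \<sigma> J bs =
     do { (pk, sk) \<leftarrow> gen F H lam;
          (rt, ys, \<rho>) \<leftarrow> commit F H lam pk \<sigma>;
          acc \<leftarrow> ver_commit \<A>1 lam (snd pk) rt ys;
          if \<not> acc then return_pmf None
          else do { ops \<leftarrow> open_at F H lam (snd pk) ys \<rho> (positions J bs);
                    return_pmf (if ver_at F H lam sk rt (positions J bs) ops
                                then Some (out_at F lam sk (positions J bs) ops) else None) } }"

definition real1 ::
  "ntcf \<Rightarrow> hash \<Rightarrow> argument \<Rightarrow> argument \<Rightarrow> nat \<Rightarrow> qstate \<Rightarrow> bool option pmf" where
  "real1 F H \<A>1 \<A>2 lam \<sigma> =
     do { (pk, sk) \<leftarrow> gen F H lam;
          (rt, ys, \<rho>) \<leftarrow> commit F H lam pk \<sigma>;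
          acc \<leftarrow> ver_commit \<A>1 lam (snd pk) rt ys;
          if \<not> acc then return_pmf None
          else do { acc' \<leftarrow> test F H \<A>1 \<A>2 lam (fst sk) (snd pk) rt ys \<rho>;
                    return_pmf (if acc' then Some True else None) } }"

definition ideal :: "qstate \<Rightarrow> nat set \<Rightarrow> bits \<Rightarrow> bits pmf" where
  "ideal \<sigma> J bs =
     (let js = sorted_list_of_set J in
      map_pmf fst (measure_with (\<lambda>a. map ((!) a) js)
        (evolve (circ_op (map Had (filter ((!) bs) js))) \<sigma>)))"

end

theory Submission
  imports Defs
begin

text \<open>For fixed keys, committing to and opening all positions is one measurement: position \<open>j\<close> is
  contracted with a family of row vectors (kernels) depending on its outcome. Replacing the prepared
  superpositions by the exact range superpositions moves each kernel family by a small amount in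
  Euclidean norm, hence the outcome distribution by a small amount in total variation. For the exact
  preparation every residual state is a claw, whose amplitudes on the outcomes with good \<open>d\<close> depend on
  the committed bit only through the claw label; up to the bad mass, the outcome therefore refines a
  measurement of the committed qubit in the basis opened for it, with the verifier's output as the
  label. Hash openings and arguments are then accounted for by union bounds, after bounding the
  lengths of all messages by the running times of the machines that produce them.\<close>

section \<open>Contractions with row vectors\<close>

text \<open>Positions may be entangled and share their keys, so no independence is available. Every
  estimate for one position is therefore an operator bound, valid for all \<open>u\<close> with
  error proportional to \<open>vsq u\<close>; such bounds tensorize and their errors add up.
  Contents of traced-out registers count as further outcomes that nobody reads, and unopened
  positions as read and forgotten; this leaves a product measurement without partial traces. The
  Hadamard layer inside the commitment exchanges the bases: reading the residual qubits directly
  exposes a string \<open>d\<close> whose inner product with the claw is the Hadamard outcome of the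
  committed qubit, while a second layer cancels the first and exposes a preimage behind its
  committed bit. Per position \<open>w + 2\<close> preparations contribute \<open>ep\<close> each,
  doubled when amplitudes become probabilities, and up to \<open>w + 1\<close> goodness tests
  contribute \<open>2 * eg\<close> each, the 2 because a state may be aligned with one label. Hashed
  messages do not depend on the hash key, so correctness of openings for fixed messages
  suffices.\<close>

lemma bitstr_simps [simp]: "a \<in> bitstr n \<longleftrightarrow> length a = n"
  by (simp add: bitstr_def)

lemma bitstr_Suc: "bitstr (Suc n) = (\<lambda>(s, a). s # a) ` (UNIV \<times> bitstr n)"
  by (auto simp: bitstr_def length_Suc_conv image_iff)

lemma finite_bitstr [simp, intro]: "finite (bitstr n)"
  by (induction n) (auto simp: bitstr_Suc, simp add: bitstr_def)

lemma bitstr_0 [simp]: "bitstr 0 = {[]}"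
  by (auto simp: bitstr_def)

lemma sum_bitstr_Suc: "(\<Sum>a\<in>bitstr (Suc n). f a) = (\<Sum>s\<in>UNIV. \<Sum>a\<in>bitstr n. f (s # a))"
  unfolding bitstr_Suc
  by (subst sum.reindex) (auto simp: inj_on_def sum.cartesian_product intro!: sum.cong)

lemma sum_bitstr_append:
  "(\<Sum>a\<in>bitstr (m + n). f a) = (\<Sum>b\<in>bitstr m. \<Sum>a\<in>bitstr n. f (b @ a))"
  by (induction m arbitrary: f) (simp_all add: sum_bitstr_Suc)

lemma listset_eq: "listset As = {xs. list_all2 (\<in>) xs As}"
proof (induction As)
  case (Cons A As)
  then show ?case by (auto simp: set_Cons_def list_all2_Cons2)
qed simp

lemma finite_listset: "(\<And>A. A \<in> set As \<Longrightarrow> finite A) \<Longrightarrow> finite (listset As)"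
proof (induction As)
  case (Cons A As)
  have "listset (A # As) = (\<lambda>(x, xs). x # xs) ` (A \<times> listset As)"
    by (auto simp: set_Cons_def)
  then show ?case using Cons by simp
qed simp

lemma sum_listset_Cons:
  "(\<Sum>xs\<in>listset (A # As). f xs) = (\<Sum>x\<in>A. \<Sum>xs\<in>listset As. f (x # xs))"
proof -
  have "listset (A # As) = (\<lambda>(x, xs). x # xs) ` (A \<times> listset As)"
    by (auto simp: set_Cons_def)
  then show ?thesis
    by (simp add: sum.reindex inj_on_def sum.cartesian_product case_prod_beta)
qed

section \<open>Pairings, product bras and their linearity\<close>

definition sq :: "nat \<Rightarrow> vec \<Rightarrow> real" where
  "sq n \<psi> = (\<Sum>a\<in>bitstr n. (cmod (\<psi> a))\<^sup>2)"

lemma sq_nonneg [simp]: "0 \<le> sq n \<psi>"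
  by (simp add: sq_def sum_nonneg)

text \<open>The pairing is bilinear: \<open>q\<close> is stored as a row, with any conjugation
  already carried out. Hence it is symmetric, which lets rows and vectors exchange roles
  below.\<close>

definition braket :: "(bool \<Rightarrow> complex) \<Rightarrow> (bool \<Rightarrow> complex) \<Rightarrow> complex" where
  "braket q u = (\<Sum>s\<in>UNIV. q s * u s)"

text \<open>The amplitude of the product bra formed by the rows; the head of the list acts on the
  first qubit. All entanglement sits in the vector.\<close>

fun ct :: "(bool \<Rightarrow> complex) list \<Rightarrow> vec \<Rightarrow> complex" where
  "ct [] \<psi> = \<psi> []"
| "ct (q # qs) \<psi> = ct qs (\<lambda>a. braket q (\<lambda>s. \<psi> (s # a)))"

lemma braket_sum: "braket q (\<lambda>s. \<Sum>i\<in>I. c i * \<phi> i s) = (\<Sum>i\<in>I. c i * braket q (\<phi> i))"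
  by (simp add: braket_def sum_distrib_left sum.distrib algebra_simps UNIV_bool)

lemma braket_diff: "braket q (\<lambda>s. u s - v s) = braket q u - braket q v"
  by (simp add: braket_def UNIV_bool algebra_simps)

lemma braket_scale: "braket q (\<lambda>s. c * u s) = c * braket q u"
  by (simp add: braket_def UNIV_bool algebra_simps)

lemma braket_scale_left: "braket (\<lambda>s. c * q s) u = c * braket q u"
  by (simp add: braket_def UNIV_bool algebra_simps)

lemma ct_sum: "ct qs (\<lambda>a. \<Sum>i\<in>I. c i * \<phi> i a) = (\<Sum>i\<in>I. c i * ct qs (\<phi> i))"
  by (induction qs arbitrary: \<phi>) (simp_all add: braket_sum)

lemma ct_diff: "ct qs (\<lambda>a. u a - v a) = ct qs u - ct qs v"
  by (induction qs arbitrary: u v) (simp_all add: braket_diff)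

lemma ct_scale: "ct qs (\<lambda>a. c * u a) = c * ct qs u"
  by (induction qs arbitrary: u) (simp_all add: braket_scale)

text \<open>Contractions of different qubits commute, by linearity of \<open>ct\<close>.\<close>

lemma ct_braket: "ct qs (\<lambda>a. braket q (\<lambda>s. \<phi> s a)) = braket q (\<lambda>s. ct qs (\<phi> s))"
  by (simp add: braket_def ct_sum)

lemma ct_cong: "(\<And>a. length a = length qs \<Longrightarrow> \<phi> a = \<psi> a) \<Longrightarrow> ct qs \<phi> = ct qs \<psi>"
proof (induction qs arbitrary: \<phi> \<psi>)
  case (Cons q qs)
  show ?case unfolding ct.simps by (intro Cons.IH) (simp add: Cons.prems)
qed simp

section \<open>Isometric families of rows and the union bound\<close>

definition vsq :: "(bool \<Rightarrow> complex) \<Rightarrow> real" where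
  "vsq u = (\<Sum>s\<in>UNIV. (cmod (u s))\<^sup>2)"

lemma vsq_nonneg [simp]: "0 \<le> vsq u"
  by (simp add: vsq_def sum_nonneg)

text \<open>The rows, stacked into a matrix, form an isometry; equivalently their rank-one effects
  sum to the identity, so they describe a complete measurement of one qubit.\<close>

definition iso :: "('o \<Rightarrow> bool \<Rightarrow> complex) \<Rightarrow> 'o set \<Rightarrow> bool" where
  "iso k A \<longleftrightarrow> finite A \<and> (\<forall>u. (\<Sum>x\<in>A. (cmod (braket (k x) u))\<^sup>2) = vsq u)"

lemma sq_Suc: "sq (Suc n) \<psi> = (\<Sum>a\<in>bitstr n. vsq (\<lambda>s. \<psi> (s # a)))"
  by (simp add: sq_def vsq_def sum_bitstr_Suc sum.swap[of _ _ UNIV])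

text \<open>The other qubits are spectators: the identity for one qubit is applied at each fixed
  value \<open>a\<close> of them.\<close>

lemma iso_sq:
  assumes "iso k A"
  shows "(\<Sum>x\<in>A. sq n (\<lambda>a. braket (k x) (\<lambda>s. \<psi> (s # a)))) = sq (Suc n) \<psi>"
  using assms unfolding sq_Suc iso_def by (simp add: sq_def sum.swap[of _ _ A])

text \<open>A tensor product of isometries is an isometry. The induction contracts the first qubit
  and leaves a vector on the rest.\<close>

lemma ct_isometry:
  assumes "\<And>i. i \<in> set is \<Longrightarrow> iso (k i) (A i)"
  shows "(\<Sum>xs\<in>listset (map A is). (cmod (ct (map2 k is xs) \<psi>))\<^sup>2) = sq (length is) \<psi>"
  using assms
proof (induction "is" arbitrary: \<psi>)
  case Nil
  then show ?case by (simp add: sq_def)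
next
  case (Cons i "is")
  then show ?case
    by (simp del: listset.simps add: sum_listset_Cons iso_sq)
qed

text \<open>A union bound for possibly entangled positions. A bad first outcome costs at most
  \<open>\<delta>\<close> in total, whatever follows; after a good one the induction hypothesis
  applies to the contracted vector. This is why the bound for one position is required for every
  \<open>u\<close>.\<close>

lemma ct_bad_mass:
  fixes \<delta> :: real
  assumes "\<And>i. i \<in> set is \<Longrightarrow> iso (k i) (A i)"
    and "\<And>i u. i \<in> set is \<Longrightarrow> (\<Sum>x\<in>A i. if bad i x then (cmod (braket (k i x) u))\<^sup>2 else 0) \<le> \<delta> * vsq u"
  shows "(\<Sum>xs\<in>listset (map A is). if list_all2 (\<lambda>i x. \<not> bad i x) is xs then 0
            else (cmod (ct (map2 k is xs) \<psi>))\<^sup>2) \<le> length is * \<delta> * sq (length is) \<psi>"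
  using assms
proof (induction "is" arbitrary: \<psi>)
  case Nil
  then show ?case by simp
next
  case (Cons i "is")
  let ?n = "length is"
  let ?p = "\<lambda>x a. braket (k i x) (\<lambda>s. \<psi> (s # a))"
  let ?S = "\<lambda>x. \<Sum>xs\<in>listset (map A is). (cmod (ct (map2 k is xs) (?p x)))\<^sup>2"
  let ?B = "\<lambda>x. \<Sum>xs\<in>listset (map A is). if list_all2 (\<lambda>i x. \<not> bad i x) is xs then 0
              else (cmod (ct (map2 k is xs) (?p x)))\<^sup>2"
  have S: "?S x = sq ?n (?p x)" for x
    by (rule ct_isometry) (simp add: Cons.prems)
  have B: "?B x \<le> ?n * \<delta> * sq ?n (?p x)" for x
    by (rule Cons.IH) (use Cons.prems in auto)
  have "(\<Sum>xs\<in>listset (map A (i # is)). if list_all2 (\<lambda>i x. \<not> bad i x) (i # is) xs then 0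
            else (cmod (ct (map2 k (i # is) xs) \<psi>))\<^sup>2)
        = (\<Sum>x\<in>A i. if bad i x then ?S x else ?B x)"
    unfolding list.map(2) sum_listset_Cons
    by (intro sum.cong refl) (simp cong: if_cong)
  also have "\<dots> \<le> (\<Sum>x\<in>A i. (if bad i x then sq ?n (?p x) else 0) + ?n * \<delta> * sq ?n (?p x))"
  proof (intro sum_mono)
    fix x
    \<comment> \<open>\<open>\<delta>\<close> carries no sign assumption; the product is nonnegative
      because it bounds a sum of squares.\<close>
    have "0 \<le> ?n * \<delta> * sq ?n (?p x)"
      by (rule order_trans[OF _ B[of x]]) (auto intro!: sum_nonneg)
    then show "(if bad i x then ?S x else ?B x)
        \<le> (if bad i x then sq ?n (?p x) else 0) + ?n * \<delta> * sq ?n (?p x)"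
      using B[of x] S[of x] by simp
  qed
  also have "\<dots> = (\<Sum>x\<in>A i. if bad i x then sq ?n (?p x) else 0) + ?n * \<delta> * (\<Sum>x\<in>A i. sq ?n (?p x))"
    by (simp add: sum.distrib sum_distrib_left)
  also have "(\<Sum>x\<in>A i. sq ?n (?p x)) = sq (Suc ?n) \<psi>"
    by (rule iso_sq) (simp add: Cons.prems)
  also have "(\<Sum>x\<in>A i. if bad i x then sq ?n (?p x) else 0)
      = (\<Sum>a\<in>bitstr ?n. \<Sum>x\<in>A i. if bad i x then (cmod (?p x a))\<^sup>2 else 0)"
    by (subst sum.swap) (auto simp: sq_def intro!: sum.cong)
  also have "\<dots> \<le> (\<Sum>a\<in>bitstr ?n. \<delta> * vsq (\<lambda>s. \<psi> (s # a)))"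
    by (intro sum_mono) (simp add: Cons.prems)
  also have "\<dots> = \<delta> * sq (Suc ?n) \<psi>"
    by (simp add: sq_Suc sum_distrib_left)
  finally show ?case by (simp add: algebra_simps)
qed

text \<open>Every row is a multiple of the basis row named by its label \<open>f x\<close>: the
  measurement refines the one in the basis \<open>n\<close>, and given the label its finer outcome
  says nothing more about the qubit.\<close>

definition resolves ::
  "('o \<Rightarrow> bool \<Rightarrow> complex) \<Rightarrow> 'o set \<Rightarrow> ('o \<Rightarrow> bool) \<Rightarrow> (bool \<Rightarrow> bool \<Rightarrow> complex) \<Rightarrow> bool" where
  "resolves k A f n \<longleftrightarrow> iso k A \<and> (\<forall>x\<in>A. \<exists>c. k x = (\<lambda>s. c * n (f x) s))"

text \<open>As \<open>n v\<close> is a row and \<open>braket\<close> does not conjugate, the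
  conjugate has to be written to obtain the Hermitian product.\<close>

definition orthonormal :: "(bool \<Rightarrow> bool \<Rightarrow> complex) \<Rightarrow> bool" where
  "orthonormal n \<longleftrightarrow> (\<forall>v v'. braket (n v) (\<lambda>s. cnj (n v' s)) = of_bool (v = v'))"

text \<open>Test the isometry on the vector dual to \<open>n v\<close>: rows with another label
  vanish on it, rows with label \<open>v\<close> return exactly their coefficient.\<close>

lemma resolves_mass:
  assumes "resolves k A f n" "orthonormal n"
    and c: "\<And>x. x \<in> A \<Longrightarrow> k x = (\<lambda>s. c x * n (f x) s)"
  shows "(\<Sum>x\<in>A. if f x = v then (cmod (c x))\<^sup>2 else 0) = 1"
proof -
  have "(\<Sum>x\<in>A. (cmod (braket (k x) (\<lambda>s. cnj (n v s))))\<^sup>2) = vsq (\<lambda>s. cnj (n v s))"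
    using assms(1) by (simp add: resolves_def iso_def)
  moreover have "braket (k x) (\<lambda>s. cnj (n v s)) = c x * of_bool (f x = v)" if "x \<in> A" for x
    using c[OF that] assms(2) by (simp add: braket_scale_left orthonormal_def)
  moreover have "vsq (\<lambda>s. cnj (n v s)) = 1"
  proof -
    have "complex_of_real (vsq (\<lambda>s. cnj (n v s))) = braket (n v) (\<lambda>s. cnj (n v s))"
      by (simp add: vsq_def braket_def UNIV_bool complex_norm_square del: of_real_power)
    also have "\<dots> = 1" using assms(2) by (simp add: orthonormal_def)
    finally show ?thesis by (simp only: of_real_eq_1_iff)
  qed
  moreover have "(\<Sum>x\<in>A. if f x = v then (cmod (c x))\<^sup>2 else 0)
      = (\<Sum>x\<in>A. (cmod (c x * of_bool (f x = v)))\<^sup>2)"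
    by (intro sum.cong) auto
  ultimately show ?thesis by simp
qed

text \<open>The scalar is the product of the coefficients of the rows, so it depends on the outcomes
  but not on \<open>\<psi>\<close>.\<close>

lemma ct_resolves:
  assumes "\<And>i. i \<in> set is \<Longrightarrow> resolves (k i) (A i) (f i) (n i)"
    and "xs \<in> listset (map A is)"
  obtains c where "\<And>\<psi>. ct (map2 k is xs) \<psi> = c * ct (map2 n is (map2 f is xs)) \<psi>"
  using assms
proof (induction "is" arbitrary: xs thesis)
  case Nil
  show ?case by (rule Nil.prems(1)[of 1]) (use Nil.prems(3) in simp)
next
  case (Cons i "is")
  from Cons.prems(3) obtain x ys where xs: "xs = x # ys" "x \<in> A i" "ys \<in> listset (map A is)"
    by (auto simp: set_Cons_def)
  obtain d where d: "\<And>\<psi>. ct (map2 k is ys) \<psi> = d * ct (map2 n is (map2 f is ys)) \<psi>"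
    by (rule Cons.IH[OF _ _ xs(3)]) (use Cons.prems in auto)
  obtain c where c: "k i x = (\<lambda>s. c * n i (f i x) s)"
    using Cons.prems(2)[of i] xs(2) by (auto simp: resolves_def)
  show ?case
    by (rule Cons.prems(1)[of "d * c"]) (simp add: xs(1) c d braket_scale_left ct_scale)
qed

text \<open>Summing out the fine outcomes behind fixed labels leaves the product measurement in the
  bases \<open>n i\<close>, because at each position the squared coefficients add up to 1 by
  \<open>resolves_mass\<close>.\<close>

lemma ct_statistics:
  assumes "\<And>i. i \<in> set is \<Longrightarrow> resolves (k i) (A i) (f i) (n i)"
    and "\<And>i. i \<in> set is \<Longrightarrow> orthonormal (n i)" and "length vs = length is"
  shows "(\<Sum>xs\<in>listset (map A is). if map2 f is xs = vs then (cmod (ct (map2 k is xs) \<psi>))\<^sup>2 else 0)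
    = (cmod (ct (map2 n is vs) \<psi>))\<^sup>2"
  using assms
proof (induction "is" arbitrary: vs \<psi>)
  case Nil
  then show ?case by simp
next
  case (Cons i "is")
  then obtain v ws where vs: "vs = v # ws" "length ws = length is"
    by (auto simp: length_Suc_conv)
  have "\<forall>x\<in>A i. \<exists>c. k i x = (\<lambda>s. c * n i (f i x) s)"
    using Cons.prems(1)[of i] by (auto simp: resolves_def)
  then obtain c where c: "\<And>x. x \<in> A i \<Longrightarrow> k i x = (\<lambda>s. c x * n i (f i x) s)"
    by metis
  have IH: "(\<Sum>xs\<in>listset (map A is). if map2 f is xs = ws then (cmod (ct (map2 k is xs) \<phi>))\<^sup>2 else 0)
    = (cmod (ct (map2 n is ws) \<phi>))\<^sup>2" for \<phi>
    by (rule Cons.IH) (use Cons.prems vs in auto)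
  have "(\<Sum>xs\<in>listset (map A (i # is)). if map2 f (i # is) xs = vs
            then (cmod (ct (map2 k (i # is) xs) \<psi>))\<^sup>2 else 0)
      = (\<Sum>x\<in>A i. if f i x = v then (\<Sum>xs\<in>listset (map A is). if map2 f is xs = ws
            then (cmod (ct (map2 k is xs) (\<lambda>a. braket (k i x) (\<lambda>s. \<psi> (s # a)))))\<^sup>2 else 0) else 0)"
    unfolding list.map(2) sum_listset_Cons vs(1)
    by (intro sum.cong refl) (simp cong: if_cong)
  also have "\<dots> = (\<Sum>x\<in>A i. if f i x = v then (cmod (c x))\<^sup>2
        * (cmod (ct (map2 n is ws) (\<lambda>a. braket (n i v) (\<lambda>s. \<psi> (s # a)))))\<^sup>2 else 0)"
    unfolding IH
    by (intro sum.cong refl) (auto simp: c braket_scale_left ct_scale norm_mult power_mult_distrib)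
  also have "\<dots> = (\<Sum>x\<in>A i. if f i x = v then (cmod (c x))\<^sup>2 else 0)
        * (cmod (ct (map2 n is ws) (\<lambda>a. braket (n i v) (\<lambda>s. \<psi> (s # a)))))\<^sup>2"
    by (simp add: sum_distrib_right if_distrib if_distribR cong: if_cong)
  also have "(\<Sum>x\<in>A i. if f i x = v then (cmod (c x))\<^sup>2 else 0) = 1"
    using resolves_mass[OF Cons.prems(1,2) c] by simp
  finally show ?case by (simp add: vs)
qed

text \<open>An operator-norm bound on the difference of the two stacked matrices.\<close>

definition near :: "real \<Rightarrow> ('o \<Rightarrow> bool \<Rightarrow> complex) \<Rightarrow> ('o \<Rightarrow> bool \<Rightarrow> complex) \<Rightarrow> 'o set \<Rightarrow> bool" where
  "near \<epsilon> k k' A \<longleftrightarrow>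
     (\<forall>u. (\<Sum>x\<in>A. (cmod (braket (k x) u - braket (k' x) u))\<^sup>2) \<le> \<epsilon>\<^sup>2 * vsq u)"

lemma L2_set_norm_triangle:
  fixes f g h :: "'a \<Rightarrow> complex"
  assumes "\<And>x. x \<in> A \<Longrightarrow> f x = g x + h x"
  shows "L2_set (\<lambda>x. cmod (f x)) A \<le> L2_set (\<lambda>x. cmod (g x)) A + L2_set (\<lambda>x. cmod (h x)) A"
proof -
  have "L2_set (\<lambda>x. cmod (f x)) A \<le> L2_set (\<lambda>x. cmod (g x) + cmod (h x)) A"
    by (rule L2_set_mono) (simp_all add: assms norm_triangle_ineq)
  also have "\<dots> \<le> L2_set (\<lambda>x. cmod (g x)) A + L2_set (\<lambda>x. cmod (h x)) A"
    by (rule L2_set_triangle_ineq)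
  finally show ?thesis .
qed

text \<open>A hybrid argument: families are exchanged one position at a time, and the isometries at
  the remaining positions do not enlarge the error, so the errors add linearly.\<close>

lemma ct_near:
  fixes \<epsilon> :: real
  assumes "\<And>i. i \<in> set is \<Longrightarrow> iso (k i) (A i)" "\<And>i. i \<in> set is \<Longrightarrow> iso (k' i) (A i)"
    and "\<And>i. i \<in> set is \<Longrightarrow> near \<epsilon> (k i) (k' i) (A i)" and "0 \<le> \<epsilon>"
  shows "L2_set (\<lambda>xs. cmod (ct (map2 k is xs) \<psi> - ct (map2 k' is xs) \<psi>)) (listset (map A is))
    \<le> length is * \<epsilon> * sqrt (sq (length is) \<psi>)"
  using assms(1-3)
proof (induction "is" arbitrary: \<psi>)
  case Nil
  then show ?case by (simp add: L2_set_def)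
next
  case (Cons i "is")
  let ?n = "length is" and ?X = "listset (map A (i # is))"
  let ?p = "\<lambda>k x a. braket (k i x) (\<lambda>s. \<psi> (s # a))"
  \<comment> \<open>The first argument of \<open>?f\<close> is the family on the tail, the second
    the family on the head; the intermediate hybrid is \<open>?f k k'\<close>.\<close>
  let ?f = "\<lambda>k k' xs. ct (map2 k is (tl xs)) (?p k' (hd xs))"
  have "L2_set (\<lambda>xs. cmod (ct (map2 k (i # is) xs) \<psi> - ct (map2 k' (i # is) xs) \<psi>)) ?X
     \<le> L2_set (\<lambda>xs. cmod (?f k k xs - ?f k k' xs)) ?X + L2_set (\<lambda>xs. cmod (?f k k' xs - ?f k' k' xs)) ?X"
    by (rule L2_set_norm_triangle) (auto simp: set_Cons_def)
  moreover have "L2_set (\<lambda>xs. cmod (?f k k xs - ?f k k' xs)) ?X \<le> \<epsilon> * sqrt (sq (Suc ?n) \<psi>)"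
  proof -
    have "(\<Sum>xs\<in>?X. (cmod (?f k k xs - ?f k k' xs))\<^sup>2)
        = (\<Sum>x\<in>A i. \<Sum>xs\<in>listset (map A is). (cmod (ct (map2 k is xs) (\<lambda>a. ?p k x a - ?p k' x a)))\<^sup>2)"
      unfolding list.map(2) sum_listset_Cons by (simp add: ct_diff)
    also have "\<dots> = (\<Sum>x\<in>A i. sq ?n (\<lambda>a. ?p k x a - ?p k' x a))"
      by (intro sum.cong refl ct_isometry) (simp add: Cons.prems)
    also have "\<dots> = (\<Sum>a\<in>bitstr ?n. \<Sum>x\<in>A i. (cmod (?p k x a - ?p k' x a))\<^sup>2)"
      by (simp add: sq_def sum.swap[of _ "A i"])
    also have "\<dots> \<le> (\<Sum>a\<in>bitstr ?n. \<epsilon>\<^sup>2 * vsq (\<lambda>s. \<psi> (s # a)))"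
      using Cons.prems(3)[of i] by (intro sum_mono) (simp add: near_def)
    also have "\<dots> = \<epsilon>\<^sup>2 * sq (Suc ?n) \<psi>"
      by (simp add: sq_Suc sum_distrib_left)
    finally have "L2_set (\<lambda>xs. cmod (?f k k xs - ?f k k' xs)) ?X \<le> sqrt (\<epsilon>\<^sup>2 * sq (Suc ?n) \<psi>)"
      unfolding L2_set_def by (intro real_sqrt_le_mono)
    then show ?thesis using \<open>0 \<le> \<epsilon>\<close> by (simp add: real_sqrt_mult)
  qed
  moreover have "L2_set (\<lambda>xs. cmod (?f k k' xs - ?f k' k' xs)) ?X \<le> ?n * \<epsilon> * sqrt (sq (Suc ?n) \<psi>)"
  proof -
    have IH: "(\<Sum>xs\<in>listset (map A is). (cmod (ct (map2 k is xs) \<phi> - ct (map2 k' is xs) \<phi>))\<^sup>2)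
        \<le> (?n * \<epsilon>)\<^sup>2 * sq ?n \<phi>" for \<phi>
    proof -
      have "L2_set (\<lambda>xs. cmod (ct (map2 k is xs) \<phi> - ct (map2 k' is xs) \<phi>)) (listset (map A is))
          \<le> ?n * \<epsilon> * sqrt (sq ?n \<phi>)"
        by (rule Cons.IH) (use Cons.prems in auto)
      then have "(L2_set (\<lambda>xs. cmod (ct (map2 k is xs) \<phi> - ct (map2 k' is xs) \<phi>)) (listset (map A is)))\<^sup>2
          \<le> (?n * \<epsilon> * sqrt (sq ?n \<phi>))\<^sup>2"
        by (intro power_mono) (simp_all add: L2_set_nonneg)
      then show ?thesis by (simp add: L2_set_def sum_nonneg power_mult_distrib)
    qed
    have "(\<Sum>xs\<in>?X. (cmod (?f k k' xs - ?f k' k' xs))\<^sup>2)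
        = (\<Sum>x\<in>A i. \<Sum>xs\<in>listset (map A is).
              (cmod (ct (map2 k is xs) (?p k' x) - ct (map2 k' is xs) (?p k' x)))\<^sup>2)"
      unfolding list.map(2) sum_listset_Cons by simp
    also have "\<dots> \<le> (\<Sum>x\<in>A i. (?n * \<epsilon>)\<^sup>2 * sq ?n (?p k' x))"
      by (intro sum_mono IH)
    also have "\<dots> = (?n * \<epsilon>)\<^sup>2 * sq (Suc ?n) \<psi>"
      using iso_sq[OF Cons.prems(2)[of i]] by (simp add: sum_distrib_left[symmetric])
    finally have "L2_set (\<lambda>xs. cmod (?f k k' xs - ?f k' k' xs)) ?X \<le> sqrt ((?n * \<epsilon>)\<^sup>2 * sq (Suc ?n) \<psi>)"
      unfolding L2_set_def by (intro real_sqrt_le_mono)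
    then show ?thesis using \<open>0 \<le> \<epsilon>\<close> by (simp add: real_sqrt_mult)
  qed
  ultimately show ?case by (simp add: algebra_simps)
qed

section \<open>Operators on registers\<close>

text \<open>A family of rows read as an operator: qubit \<open>k\<close> is replaced in place by
  \<open>m\<close> qubits, and the string they hold selects the row.\<close>

definition lap :: "nat \<Rightarrow> nat \<Rightarrow> (bits \<Rightarrow> bool \<Rightarrow> complex) \<Rightarrow> vec \<Rightarrow> vec" where
  "lap k m K \<psi> = (\<lambda>a. braket (K (slice k m a)) (\<lambda>s. \<psi> (take k a @ s # drop (k + m) a)))"

text \<open>Each application expands its qubit to \<open>m\<close> qubits, so the next original
  qubit sits \<open>m\<close> places further on.\<close>

fun sap :: "nat \<Rightarrow> nat \<Rightarrow> (bits \<Rightarrow> bool \<Rightarrow> complex) list \<Rightarrow> vec \<Rightarrow> vec" where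
  "sap k m [] \<psi> = \<psi>"
| "sap k m (K # Ks) \<psi> = sap (k + m) m Ks (lap k m K \<psi>)"

text \<open>Vectors are functions on all bit strings; the support condition turns agreement on
  strings of length \<open>n\<close> into equality of functions.\<close>

definition supp :: "nat \<Rightarrow> vec \<Rightarrow> bool" where
  "supp n \<psi> \<longleftrightarrow> (\<forall>a. length a \<noteq> n \<longrightarrow> \<psi> a = 0)"

definition kern :: "nat \<Rightarrow> (bits \<Rightarrow> bool \<Rightarrow> complex) \<Rightarrow> bool" where
  "kern m K \<longleftrightarrow> (\<forall>b s. length b \<noteq> m \<longrightarrow> K b s = 0)"

lemma suppD: "supp n \<psi> \<Longrightarrow> length a \<noteq> n \<Longrightarrow> \<psi> a = 0"
  by (simp add: supp_def)

lemma supp_eqI: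
  assumes "supp n \<psi>" "supp n \<phi>" "\<And>a. length a = n \<Longrightarrow> \<psi> a = \<phi> a"
  shows "\<psi> = \<phi>"
proof
  fix a show "\<psi> a = \<phi> a"
    using assms by (cases "length a = n") (auto simp: supp_def)
qed

lemma braket_0 [simp]: "braket q (\<lambda>s. 0) = 0" "braket (\<lambda>s. 0) u = 0"
  by (simp_all add: braket_def)

lemma lap_append:
  assumes "length a = k" "length b = m"
  shows "lap k m K \<psi> (a @ b @ c) = braket (K b) (\<lambda>s. \<psi> (a @ s # c))"
  using assms by (simp add: lap_def slice_def)

lemma supp_lap:
  assumes "supp n \<psi>" "kern m K" "k < n"
  shows "supp (n - 1 + m) (lap k m K \<psi>)"
  unfolding supp_def
proof (intro allI impI)
  fix a :: bits assume a: "length a \<noteq> n - 1 + m"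
  show "lap k m K \<psi> a = 0"
  proof (cases "k + m \<le> length a")
    case True
    then have "length (take k a @ s # drop (k + m) a) \<noteq> n" for s
      using a assms(3) by simp
    then show ?thesis using assms(1) by (simp add: lap_def suppD)
  next
    case False
    \<comment> \<open>For \<open>m = 0\<close> the empty slice has the right length, so there the
      zero has to come from the support of \<open>\<psi>\<close>.\<close>
    then have "K (slice k m a) = (\<lambda>s. 0) \<or> m = 0"
      using assms(2) by (auto simp: kern_def slice_def)
    moreover have "\<psi> (take k a @ s # drop (k + m) a) = 0" if "m = 0" for s
      using False that a assms(1,3) by (intro suppD[OF assms(1)]) auto
    ultimately show ?thesis by (auto simp: lap_def)
  qed
qed

lemma supp_sap:
  assumes "supp n \<psi>" "\<And>K. K \<in> set Ks \<Longrightarrow> kern m K" "k + length Ks \<le> n" "0 < m"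
  shows "supp (n - length Ks + length Ks * m) (sap k m Ks \<psi>)"
  using assms
proof (induction Ks arbitrary: k n \<psi>)
  case (Cons K Ks)
  have 1: "supp (n - 1 + m) (lap k m K \<psi>)"
    by (rule supp_lap) (use Cons.prems in auto)
  have "supp (n - 1 + m - length Ks + length Ks * m) (sap (k + m) m Ks (lap k m K \<psi>))"
    by (rule Cons.IH[OF 1]) (use Cons.prems in auto)
  moreover have "n - 1 + m - length Ks + length Ks * m
      = n - length (K # Ks) + length (K # Ks) * m"
    using Cons.prems(3) by simp
  ultimately show ?case by (simp only: sap.simps)
qed simp

text \<open>The bridge between operators and contractions: the treated qubits are consecutive, so
  evaluation on concatenated blocks contracts them with one row per block.\<close>

lemma sap_ct:
  assumes "length a = k" "length bs = length Ks" "\<And>b. b \<in> set bs \<Longrightarrow> length b = m"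
  shows "sap k m Ks \<psi> (a @ concat bs @ c) = ct (map2 (\<lambda>K b. K b) Ks bs) (\<lambda>b. \<psi> (a @ b @ c))"
  using assms
proof (induction Ks arbitrary: k a bs \<psi>)
  case (Cons K Ks)
  then obtain b bs' where bs: "bs = b # bs'" by (cases bs) auto
  have "sap k m (K # Ks) \<psi> (a @ concat bs @ c)
      = sap (k + m) m Ks (lap k m K \<psi>) ((a @ b) @ concat bs' @ c)"
    by (simp add: bs)
  also have "\<dots> = ct (map2 (\<lambda>K b. K b) Ks bs') (\<lambda>d. lap k m K \<psi> ((a @ b) @ d @ c))"
    by (rule Cons.IH) (use Cons.prems bs in auto)
  also have "(\<lambda>d. lap k m K \<psi> ((a @ b) @ d @ c)) = (\<lambda>d. braket (K b) (\<lambda>s. \<psi> (a @ (s # d) @ c)))"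
    using Cons.prems bs by (simp add: lap_append)
  finally show ?case by (simp add: bs)
qed simp

lemma sum_sq_append:
  "sq (k + m + r) \<psi> = (\<Sum>a\<in>bitstr k. \<Sum>c\<in>bitstr r. \<Sum>b\<in>bitstr m. (cmod (\<psi> (a @ b @ c)))\<^sup>2)"
proof -
  have "sq (k + m + r) \<psi> = (\<Sum>a\<in>bitstr k. \<Sum>b\<in>bitstr m. \<Sum>c\<in>bitstr r. (cmod (\<psi> (a @ b @ c)))\<^sup>2)"
    unfolding sq_def add.assoc sum_bitstr_append by simp
  then show ?thesis by (simp add: sum.swap[of _ "bitstr m"])
qed

lemma sq_lap:
  assumes "iso K (bitstr m)" "k < n"
  shows "sq (n - 1 + m) (lap k m K \<psi>) = sq n \<psi>"
proof -
  obtain r where n: "n = k + 1 + r" using assms(2) by (metis add.assoc less_iff_Suc_add plus_1_eq_Suc add_Suc_right)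
  have "sq (k + m + r) (lap k m K \<psi>) = (\<Sum>a\<in>bitstr k. \<Sum>c\<in>bitstr r. vsq (\<lambda>s. \<psi> (a @ s # c)))"
    using assms(1) by (simp add: sum_sq_append lap_append iso_def)
  also have "\<dots> = sq (k + 1 + r) \<psi>"
    unfolding sum_sq_append One_nat_def by (simp add: sum_bitstr_Suc vsq_def)
  finally show ?thesis by (simp add: n add.commute add.left_commute)
qed

subsection \<open>Gates\<close>

definition had1 :: "bool \<Rightarrow> bool \<Rightarrow> complex" where
  "had1 v s = (if v \<and> s then - 1 else 1) / complex_of_real (sqrt 2)"

definition had_kern :: "bits \<Rightarrow> bool \<Rightarrow> complex" where
  "had_kern b s = (if length b = 1 then had1 (hd b) s else 0)"

definition id1 :: "bool \<Rightarrow> bool \<Rightarrow> complex" where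
  "id1 v s = of_bool (v = s)"

definition id_kern :: "bits \<Rightarrow> bool \<Rightarrow> complex" where
  "id_kern b s = (if length b = 1 then id1 (hd b) s else 0)"

lemma kern_had [simp]: "kern 1 had_kern" "kern (Suc 0) had_kern" "kern 1 id_kern" "kern (Suc 0) id_kern"
  by (simp_all add: kern_def had_kern_def id_kern_def)

lemma sum_squares_cmod:
  "(cmod (x + y))\<^sup>2 + (cmod (x - y))\<^sup>2 = 2 * ((cmod x)\<^sup>2 + (cmod y)\<^sup>2)"
  by (simp only: cmod_power2) (simp add: power2_eq_square algebra_simps)

lemma braket_had1:
  "braket (had1 False) u = (u False + u True) / complex_of_real (sqrt 2)"
  "braket (had1 True) u = (u False - u True) / complex_of_real (sqrt 2)"
  by (simp_all add: braket_def had1_def UNIV_bool add_divide_distrib diff_divide_distrib)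

lemma vsq_had1: "vsq (\<lambda>v. braket (had1 v) u) = vsq u"
  using sum_squares_cmod[of "u False" "u True"]
  by (simp add: vsq_def braket_had1 UNIV_bool norm_divide power_divide field_simps)

lemma iso_had1: "iso had1 UNIV"
  using vsq_had1 by (simp add: iso_def vsq_def)

lemma iso_id1: "iso id1 UNIV"
  by (auto simp: iso_def vsq_def braket_def id1_def UNIV_bool)

lemma iso_bits1:
  assumes "iso n UNIV" "\<And>v. K [v] = n v"
  shows "iso K (bitstr 1)"
  using assms(1) by (simp add: iso_def One_nat_def sum_bitstr_Suc assms(2))

lemma iso_had_kern: "iso had_kern (bitstr 1)"
  by (rule iso_bits1[OF iso_had1]) (simp add: had_kern_def fun_eq_iff)

lemma orthonormal_had1: "orthonormal had1"
  by (auto simp: orthonormal_def braket_def had1_def UNIV_bool simp flip: of_real_mult of_real_divide)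

lemma orthonormal_id1: "orthonormal id1"
  by (auto simp: orthonormal_def braket_def id1_def UNIV_bool)

lemma gate_op_Had:
  assumes "supp n \<psi>" "q < n"
  shows "gate_op (Had q) \<psi> = lap q 1 had_kern \<psi>"
proof
  fix a :: bits
  show "gate_op (Had q) \<psi> a = lap q 1 had_kern \<psi> a"
  proof (cases "q < length a")
    case True
    then have "slice q 1 a = [a ! q]"
      by (simp add: slice_def take_Suc_conv_app_nth Cons_nth_drop_Suc[symmetric])
    moreover have "take q a @ s # drop (q + 1) a = a[q := s]" for s
      using True by (simp add: upd_conv_take_nth_drop)
    ultimately show ?thesis
      by (simp add: lap_def had_kern_def braket_def had1_def UNIV_bool add_divide_distrib)
  next
    case False
    then show ?thesis
      using assms by (simp add: lap_def had_kern_def slice_def suppD braket_def)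
  qed
qed

lemma circ_op_hadamards:
  assumes "supp n \<psi>" "k + r \<le> n"
  shows "circ_op (map Had [k..<k + r]) \<psi> = sap k 1 (replicate r had_kern) \<psi>"
  using assms
proof (induction r arbitrary: k \<psi>)
  case 0
  then show ?case by (simp add: circ_op_def)
next
  case (Suc r)
  have eq: "[k..<k + Suc r] = k # [Suc k..<Suc k + r]"
    by (simp add: upt_rec)
  have 1: "supp n (lap k 1 had_kern \<psi>)"
    using supp_lap[OF Suc.prems(1) kern_had(1), of k] Suc.prems(2) by simp
  have "circ_op (map Had [k..<k + Suc r]) \<psi> = circ_op (map Had [Suc k..<Suc k + r]) (gate_op (Had k) \<psi>)"
    unfolding eq by (simp add: circ_op_def)
  also have "gate_op (Had k) \<psi> = lap k 1 had_kern \<psi>"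
    by (rule gate_op_Had) (use Suc.prems in auto)
  also have "circ_op (map Had [Suc k..<Suc k + r]) (lap k 1 had_kern \<psi>)
      = sap (Suc k) 1 (replicate r had_kern) (lap k 1 had_kern \<psi>)"
    by (rule Suc.IH[OF 1]) (use Suc.prems in auto)
  finally show ?case by simp
qed

lemma lap_id_kern:
  assumes "supp n \<psi>" "q < n"
  shows "lap q 1 id_kern \<psi> = \<psi>"
proof (rule supp_eqI[OF _ assms(1)])
  show "supp n (lap q 1 id_kern \<psi>)"
    using supp_lap[OF assms(1) kern_had(3) assms(2)] assms(2) by simp
next
  fix a :: bits assume "length a = n"
  then have "slice q 1 a = [a ! q]" "take q a @ (a ! q) # drop (q + 1) a = a"
    using assms(2) by (simp_all add: slice_def take_Suc_conv_app_nth Cons_nth_drop_Suc[symmetric])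
      (metis Cons_nth_drop_Suc append_take_drop_id)
  then show "lap q 1 id_kern \<psi> a = \<psi> a"
    by (cases "a ! q") (simp_all add: lap_def id_kern_def braket_def id1_def UNIV_bool)
qed

text \<open>Positions without a gate receive the identity kernel, so that a selection of Hadamard
  gates becomes a product with one row at every position.\<close>

lemma circ_op_some_hadamards:
  assumes "supp n \<psi>" "k + r \<le> n"
  shows "circ_op (map Had (filter P [k..<k + r])) \<psi>
    = sap k 1 (map (\<lambda>j. if P j then had_kern else id_kern) [k..<k + r]) \<psi>"
  using assms
proof (induction r arbitrary: k \<psi>)
  case 0
  then show ?case by (simp add: circ_op_def)
next
  case (Suc r)
  have eq: "[k..<k + Suc r] = k # [Suc k..<Suc k + r]"
    by (simp add: upt_rec)
  have lt: "k < n" using Suc.prems by simp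
  let ?K = "if P k then had_kern else id_kern"
  have 1: "supp n (lap k 1 ?K \<psi>)"
    using supp_lap[OF Suc.prems(1) _ lt, of 1 ?K] lt by simp
  have "circ_op (map Had (filter P [k..<k + Suc r])) \<psi>
      = circ_op (map Had (filter P [Suc k..<Suc k + r])) (lap k 1 ?K \<psi>)"
    unfolding eq using gate_op_Had[OF Suc.prems(1) lt] lap_id_kern[OF Suc.prems(1) lt]
    by (simp add: circ_op_def)
  also have "\<dots> = sap (Suc k) 1 (map (\<lambda>j. if P j then had_kern else id_kern) [Suc k..<Suc k + r]) (lap k 1 ?K \<psi>)"
    by (rule Suc.IH[OF 1]) (use Suc.prems in auto)
  finally show ?case unfolding eq by simp
qed

section \<open>Linearity and norm preservation of circuits\<close>

definition linear_op :: "(vec \<Rightarrow> vec) \<Rightarrow> bool" where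
  "linear_op U \<longleftrightarrow> (\<forall>\<phi> \<psi>. U (\<lambda>a. \<phi> a + \<psi> a) = (\<lambda>a. U \<phi> a + U \<psi> a)) \<and>
     (\<forall>c \<phi>. U (\<lambda>a. c * \<phi> a) = (\<lambda>a. c * U \<phi> a))"

lemma linear_op_gate: "linear_op (gate_op g)"
  by (cases g) (auto simp: linear_op_def fun_eq_iff algebra_simps add_divide_distrib)

lemma linear_op_circ: "linear_op (circ_op gs)"
proof (induction gs)
  case Nil
  then show ?case by (simp add: circ_op_def linear_op_def)
next
  case (Cons g gs)
  have "circ_op (g # gs) = (\<lambda>\<psi>. circ_op gs (gate_op g \<psi>))"
    by (simp add: circ_op_def fun_eq_iff)
  then show ?case using Cons linear_op_gate[of g] by (simp add: linear_op_def)
qed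

lemma linear_op_add: "linear_op U \<Longrightarrow> U (\<lambda>a. \<phi> a + \<psi> a) = (\<lambda>a. U \<phi> a + U \<psi> a)"
  by (simp add: linear_op_def)

lemma linear_op_scale: "linear_op U \<Longrightarrow> U (\<lambda>a. c * \<phi> a) = (\<lambda>a. c * U \<phi> a)"
  by (simp add: linear_op_def)

lemma linear_op_0: "linear_op U \<Longrightarrow> U (\<lambda>a. 0) = (\<lambda>a. 0)"
  using linear_op_scale[of U 0 "\<lambda>a. 0"] by simp

lemma linear_op_sum_list:
  assumes "linear_op U"
  shows "U (\<lambda>a. \<Sum>\<psi>\<leftarrow>\<Psi>. c \<psi> * f \<psi> a) = (\<lambda>a. \<Sum>\<psi>\<leftarrow>\<Psi>. c \<psi> * U (f \<psi>) a)"
proof (induction \<Psi>)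
  case Nil
  then show ?case by (simp add: linear_op_0[OF assms])
next
  case (Cons \<psi> \<Psi>)
  show ?case
    by (simp add: linear_op_add[OF assms] linear_op_scale[OF assms] Cons.IH)
qed

lemma gate_op_norm:
  assumes "wf_gate n g" "supp n \<psi>"
  shows "supp n (gate_op g \<psi>) \<and> sq n (gate_op g \<psi>) = sq n \<psi>"
proof (cases g)
  case (Had q)
  then have q: "q < n" using assms(1) by simp
  show ?thesis
    unfolding Had gate_op_Had[OF assms(2) q]
    using supp_lap[OF assms(2) kern_had(1) q] sq_lap[OF iso_had_kern q, of \<psi>] q by simp
next
  case (Tgate q)
  have "cmod (gate_op (Tgate q) \<psi> a) = cmod (\<psi> a)" for a
    by (simp add: norm_mult)
  then show ?thesis using assms(2) Tgate by (simp add: supp_def sq_def)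
next
  case (Cnot c t)
  \<comment> \<open>A CNOT permutes the basis strings by an involution, because control and target
    differ; its effect on the norm is a reindexed sum.\<close>
  let ?h = "\<lambda>a :: bits. a[t := (a ! t \<noteq> a ! c)]"
  have inv: "?h (?h a) = a" if "a \<in> bitstr n" for a
    using that assms(1) Cnot by (auto simp: nth_list_update list_eq_iff_nth_eq)
  have "bij_betw ?h (bitstr n) (bitstr n)"
    by (rule bij_betw_byWitness[where f' = ?h]) (use inv in auto)
  then have "sq n (gate_op g \<psi>) = sq n \<psi>"
    unfolding sq_def Cnot gate_op.simps by (rule sum.reindex_bij_betw)
  then show ?thesis using assms(2) Cnot by (simp add: supp_def)
qed

lemma circ_op_norm:
  assumes "wf_gates n gs" "supp n \<psi>"
  shows "supp n (circ_op gs \<psi>) \<and> sq n (circ_op gs \<psi>) = sq n \<psi>"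
  using assms
proof (induction gs arbitrary: \<psi>)
  case (Cons g gs)
  have "supp n (gate_op g \<psi>) \<and> sq n (gate_op g \<psi>) = sq n \<psi>"
    by (rule gate_op_norm) (use Cons.prems in \<open>auto simp: wf_gates_def\<close>)
  moreover have "supp n (circ_op gs (gate_op g \<psi>)) \<and> sq n (circ_op gs (gate_op g \<psi>)) = sq n (gate_op g \<psi>)"
    by (rule Cons.IH) (use Cons.prems calculation in \<open>auto simp: wf_gates_def\<close>)
  ultimately show ?case by (simp add: circ_op_def)
qed (simp add: circ_op_def)

section \<open>Mixtures and instruments\<close>

text \<open>Mixed states are kept as lists of unnormalised vectors, so that a measurement only restricts
  the vectors and a partial trace only lengthens the list.\<close>

definition wt :: "nat \<Rightarrow> vec list \<Rightarrow> real" where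
  "wt n \<Psi> = (\<Sum>\<psi>\<leftarrow>\<Psi>. sq n \<psi>)"

text \<open>Dividing by the total weight makes the renormalisation after a measurement
  automatic.\<close>

definition mk :: "nat \<Rightarrow> vec list \<Rightarrow> qstate" where
  "mk n \<Psi> = (n, \<lambda>a b. (\<Sum>\<psi>\<leftarrow>\<Psi>. \<psi> a * cnj (\<psi> b)) / complex_of_real (wt n \<Psi>))"

text \<open>Positive weight excludes division by zero in \<open>mk\<close>; outcomes of probability
  zero have to be treated apart for this reason.\<close>

definition valid :: "nat \<Rightarrow> vec list \<Rightarrow> bool" where
  "valid n \<Psi> \<longleftrightarrow> (\<forall>\<psi>\<in>set \<Psi>. supp n \<psi>) \<and> 0 < wt n \<Psi>"

lemma wt_nonneg [simp]: "0 \<le> wt n \<Psi>"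
  by (auto simp: wt_def intro!: sum_list_nonneg)

lemma wt_concat_map: "wt n (concat (map f \<Psi>)) = (\<Sum>\<psi>\<leftarrow>\<Psi>. wt n (f \<psi>))"
  by (induction \<Psi>) (simp_all add: wt_def)

lemma sum_list_concat_map:
  "(\<Sum>x\<leftarrow>concat (map f xs). g x) = (\<Sum>x\<leftarrow>xs. \<Sum>y\<leftarrow>f x. g y)"
  by (induction xs) simp_all

lemma wt_eq_0:
  assumes "wt n \<Psi> = 0" "\<psi> \<in> set \<Psi>" "supp n \<psi>"
  shows "\<psi> = (\<lambda>a. 0)"
proof
  fix a
  have "sq n \<psi> = 0"
    using assms(1,2) unfolding wt_def by (subst (asm) sum_list_nonneg_eq_0_iff) auto
  then show "\<psi> a = 0"
    using assms(3) by (cases "length a = n") (auto simp: sq_def sum_nonneg_eq_0_iff suppD)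
qed

lemma sum_list_zero: "(\<And>x. x \<in> set xs \<Longrightarrow> f x = 0) \<Longrightarrow> (\<Sum>x\<leftarrow>xs. f x) = (0 :: 'b :: monoid_add)"
  by (induction xs) simp_all

lemma cnj_sum_list: "cnj (\<Sum>x\<leftarrow>xs. f x) = (\<Sum>x\<leftarrow>xs. cnj (f x))"
  by (induction xs) simp_all

lemma sum_list_swap: "(\<Sum>x\<leftarrow>xs. \<Sum>y\<in>A. f x y) = (\<Sum>y\<in>A. \<Sum>x\<leftarrow>xs. (f x y :: 'b :: comm_monoid_add))"
  by (induction xs) (simp_all add: sum.distrib)

lemma sum_list_divide: "(\<Sum>x\<leftarrow>xs. f x) / c = (\<Sum>x\<leftarrow>xs. f x / (c :: 'b :: field))"
  by (induction xs) (simp_all add: add_divide_distrib)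

lemma evolve_mk:
  assumes "linear_op U" and "\<And>\<psi>. \<psi> \<in> set \<Psi> \<Longrightarrow> sq n (U \<psi>) = sq n \<psi>"
  shows "evolve U (mk n \<Psi>) = mk n (map U \<Psi>)"
proof -
  let ?N = "complex_of_real (wt n \<Psi>)"
  have wt: "wt n (map U \<Psi>) = wt n \<Psi>"
    using assms(2) by (simp add: wt_def o_def cong: map_cong)
  \<comment> \<open>\<open>evolve\<close> acts first on the columns and then on the conjugated rows;
    each time the other index is a constant coefficient of a linear combination.\<close>
  have 1: "U (\<lambda>a'. (\<Sum>\<psi>\<leftarrow>\<Psi>. \<psi> a' * cnj (\<psi> b')) / ?N) a = (\<Sum>\<psi>\<leftarrow>\<Psi>. (cnj (\<psi> b') / ?N) * U \<psi> a)" for a b'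
    using fun_cong[OF linear_op_sum_list[OF assms(1), of "\<lambda>\<psi>. cnj (\<psi> b') / ?N" "\<lambda>\<psi>. \<psi>" \<Psi>]]
    by (simp add: sum_list_divide mult.commute)
  have 2: "U (\<lambda>b'. cnj (\<Sum>\<psi>\<leftarrow>\<Psi>. (cnj (\<psi> b') / ?N) * U \<psi> a)) b
     = (\<Sum>\<psi>\<leftarrow>\<Psi>. (cnj (U \<psi> a) / ?N) * U \<psi> b)" for a b
    using fun_cong[OF linear_op_sum_list[OF assms(1), of "\<lambda>\<psi>. cnj (U \<psi> a) / ?N" "\<lambda>\<psi>. \<psi>" \<Psi>]]
    by (simp add: cnj_sum_list mult.commute)
  show ?thesis
    unfolding mk_def evolve.simps 1 2 wt
    by (simp add: cnj_sum_list sum_list_divide o_def)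
qed

definition keep :: "(bits \<Rightarrow> 'v) \<Rightarrow> 'v \<Rightarrow> vec \<Rightarrow> vec" where
  "keep f v \<psi> = (\<lambda>a. if f a = v then \<psi> a else 0)"

lemma supp_keep: "supp n \<psi> \<Longrightarrow> supp n (keep f v \<psi>)"
  by (simp add: supp_def keep_def)

lemma sq_keep: "sq n (keep f v \<psi>) = (\<Sum>a | a \<in> bitstr n \<and> f a = v. (cmod (\<psi> a))\<^sup>2)"
proof -
  have "sq n (keep f v \<psi>) = (\<Sum>a\<in>bitstr n. if f a = v then (cmod (\<psi> a))\<^sup>2 else 0)"
    by (auto simp: sq_def keep_def intro!: sum.cong)
  also have "\<dots> = (\<Sum>a\<in>bitstr n \<inter> {a. f a = v}. (cmod (\<psi> a))\<^sup>2)"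
    by (simp add: sum.inter_restrict)
  also have "bitstr n \<inter> {a. f a = v} = {a. a \<in> bitstr n \<and> f a = v}" by auto
  finally show ?thesis .
qed

lemma Re_sum_list: "Re (\<Sum>x\<leftarrow>xs. f x) = (\<Sum>x\<leftarrow>xs. Re (f x))"
  by (induction xs) simp_all

lemma mk_prob:
  "(\<Sum>a | a \<in> bitstr n \<and> f a = v. Re (snd (mk n \<Psi>) a a)) = wt n (map (keep f v) \<Psi>) / wt n \<Psi>"
proof -
  have "Re (z * cnj z) = (cmod z)\<^sup>2" for z
    by (simp add: cmod_power2) (simp add: power2_eq_square)
  then have "Re (snd (mk n \<Psi>) a a) = (\<Sum>\<psi>\<leftarrow>\<Psi>. (cmod (\<psi> a))\<^sup>2) / wt n \<Psi>" for a
    unfolding mk_def snd_conv Re_divide_of_real Re_sum_list by simp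
  then show ?thesis
    by (simp add: wt_def o_def sq_keep sum_list_swap sum_divide_distrib)
qed

text \<open>Restricting the vectors scales the weight by the probability of the outcome, which is
  exactly the divisor of the post-measurement state.\<close>

lemma measure_with_mk:
  assumes "valid n \<Psi>"
  shows "\<exists>Q. measure_with f (mk n \<Psi>) = map_pmf (\<lambda>v. (v, mk n (map (keep f v) \<Psi>))) Q \<and>
    (\<forall>v. pmf Q v = wt n (map (keep f v) \<Psi>) / wt n \<Psi>)"
proof -
  let ?p = "\<lambda>v. wt n (map (keep f v) \<Psi>) / wt n \<Psi>"
  have pos: "0 < wt n \<Psi>" using assms by (simp add: valid_def)
  \<comment> \<open>The value type may be infinite; only values attained on the finitely many basis
    strings carry mass.\<close>
  have zero: "?p v = 0" if "v \<notin> f ` bitstr n" for v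
  proof -
    have "{a. a \<in> bitstr n \<and> f a = v} = {}" using that by auto
    then have "sq n (keep f v \<psi>) = 0" for \<psi> by (simp only: sq_keep sum.empty)
    then show ?thesis by (simp add: wt_def o_def)
  qed
  have "(\<Sum>v\<in>f ` bitstr n. wt n (map (keep f v) \<Psi>)) = wt n \<Psi>"
  proof -
    have "(\<Sum>v\<in>f ` bitstr n. sq n (keep f v \<psi>)) = sq n \<psi>" for \<psi>
      unfolding sq_keep unfolding sq_def by (rule sum.image_gen[symmetric]) simp
    then show ?thesis by (simp add: wt_def o_def flip: sum_list_swap)
  qed
  then have sum1: "(\<Sum>v\<in>f ` bitstr n. ?p v) = 1"
    using pos by (simp flip: sum_divide_distrib)
  have "(\<integral>\<^sup>+ v. ennreal (?p v) \<partial>count_space UNIV) = (\<Sum>v\<in>f ` bitstr n. ennreal (?p v))"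
    by (rule nn_integral_count_space') (use zero in auto)
  also have "\<dots> = 1"
    using sum1 pos by (subst sum_ennreal) simp_all
  finally have int: "(\<integral>\<^sup>+ v. ennreal (?p v) \<partial>count_space UNIV) = 1" .
  have state: "(n, \<lambda>a b. if f a = v \<and> f b = v then snd (mk n \<Psi>) a b / complex_of_real (?p v) else 0)
      = mk n (map (keep f v) \<Psi>)" for v
    using pos
    by (auto simp: mk_def fun_eq_iff keep_def o_def divide_simps)
  have "measure_with f (mk n \<Psi>) = map_pmf (\<lambda>v. (v, mk n (map (keep f v) \<Psi>))) (embed_pmf ?p)"
    unfolding state[symmetric] mk_prob[symmetric, where f = f]
    by (simp add: mk_def Let_def cong: if_cong)
  moreover have "pmf (embed_pmf ?p) v = ?p v" for v
    using pos by (intro pmf_embed_pmf int) simp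
  ultimately show ?thesis by blast
qed

section \<open>Partial traces of mixtures\<close>

definition insert_bits :: "nat \<Rightarrow> bits \<Rightarrow> vec \<Rightarrow> vec" where
  "insert_bits k t \<psi> = (\<lambda>a. \<psi> (take k a @ t @ drop k a))"

abbreviation strs :: "nat \<Rightarrow> bits list" where
  "strs m \<equiv> List.n_lists m [False, True]"

lemma set_strs [simp]: "set (strs m) = bitstr m"
  by (auto simp: set_n_lists bitstr_def UNIV_bool[symmetric])

lemma sum_list_strs: "(\<Sum>t\<leftarrow>strs m. f t) = (\<Sum>t\<in>bitstr m. f t)"
proof -
  have "distinct (strs m)" by (simp add: distinct_n_lists)
  then show ?thesis by (simp add: sum_list_distinct_conv_sum_set)
qed

lemma sq_insert_bits:
  assumes "k + m \<le> n"
  shows "(\<Sum>t\<in>bitstr m. sq (n - m) (insert_bits k t \<psi>)) = sq n \<psi>"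
proof -
  obtain r where n: "n = k + m + r" using assms le_Suc_ex by blast
  have e: "n - m = k + r" by (simp add: n)
  show ?thesis
    unfolding e n sum_sq_append
    by (simp add: sq_def sum_bitstr_append insert_bits_def sum.swap[of _ _ "bitstr m"])
qed

text \<open>A partial trace is a mixture over the contents of the traced qubits: each vector splits
  into one vector per content, and the total weight stays the same.\<close>

lemma discard_mk:
  assumes "k + m \<le> n"
  shows "discard k m (mk n \<Psi>) = mk (n - m) (concat (map (\<lambda>\<psi>. map (\<lambda>t. insert_bits k t \<psi>) (strs m)) \<Psi>))"
proof -
  have "wt (n - m) (concat (map (\<lambda>\<psi>. map (\<lambda>t. insert_bits k t \<psi>) (strs m)) \<Psi>)) = wt n \<Psi>"
    by (simp add: wt_concat_map) (simp add: wt_def o_def sum_list_strs sq_insert_bits[OF assms])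
  then show ?thesis
    by (simp add: mk_def fun_eq_iff sum_list_concat_map o_def sum_list_strs sum_list_swap insert_bits_def
        flip: sum_divide_distrib)
qed

text \<open>A quantum instrument in Kraus form: \<open>B x\<close> lists the Kraus operators of the
  outcome \<open>x\<close>, and \<open>h x\<close> is what is reported of it, so outcomes may be
  finer than reports. The clause on the zero vector keeps compositions consistent after outcomes of
  probability zero.\<close>

definition implements ::
  "nat \<Rightarrow> nat \<Rightarrow> (qstate \<Rightarrow> ('v \<times> qstate) pmf) \<Rightarrow> ('x \<Rightarrow> 'v) \<Rightarrow> ('x \<Rightarrow> vec \<Rightarrow> vec list) \<Rightarrow> bool" where
  "implements n n' P h B \<longleftrightarrow>
     (\<forall>x \<psi>. supp n \<psi> \<longrightarrow> (\<forall>\<phi>\<in>set (B x \<psi>). supp n' \<phi>)) \<and>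
     (\<forall>x. \<forall>\<phi>\<in>set (B x (\<lambda>a. 0)). \<phi> = (\<lambda>a. 0)) \<and>
     (\<forall>\<Psi>. valid n \<Psi> \<longrightarrow> (\<exists>Q. P (mk n \<Psi>) = map_pmf (\<lambda>x. (h x, mk n' (concat (map (B x) \<Psi>)))) Q \<and>
        (\<forall>x. pmf Q x = wt n' (concat (map (B x) \<Psi>)) / wt n \<Psi>)))"

lemma pmf_dependent_pair:
  "pmf (bind_pmf p (\<lambda>x. map_pmf (Pair x) (q x))) (x, y) = pmf p x * pmf (q x) y"
proof -
  have "pmf (map_pmf (Pair z) (q z)) (x, y) = indicator {x} z * pmf (q x) y" for z
  proof (cases "z = x")
    case True
    then show ?thesis by (simp add: pmf_map_inj' inj_on_def)
  next
    case False
    then have "(x, y) \<notin> set_pmf (map_pmf (Pair z) (q z))" by auto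
    then show ?thesis using False by (simp add: set_pmf_iff del: set_map_pmf)
  qed
  then have "pmf (bind_pmf p (\<lambda>x. map_pmf (Pair x) (q x))) (x, y)
      = measure_pmf.expectation p (\<lambda>z. indicator {x} z * pmf (q x) y)"
    by (simp add: pmf_bind)
  also have "\<dots> = pmf p x * pmf (q x) y"
    by (simp add: measure_pmf_single)
  finally show ?thesis .
qed

text \<open>Kraus operators of the two stages are composed, and Born's rule telescopes: the
  intermediate weight cancels between the two quotients.\<close>

lemma implements_bind:
  assumes P: "implements n n' P h B" and P': "\<And>x. implements n' n'' (P' (h x)) (h' x) (B' x)"
  shows "implements n n'' (\<lambda>st. P st \<bind> (\<lambda>(v, st'). P' v st' \<bind> (\<lambda>(v', st''). return_pmf (g v v', st''))))
    (\<lambda>(x, x'). g (h x) (h' x x')) (\<lambda>(x, x') \<psi>. concat (map (B' x x') (B x \<psi>)))"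
  unfolding implements_def
proof (intro conjI allI impI ballI)
  fix \<Psi> assume v: "valid n \<Psi>"
  obtain Q where Q: "P (mk n \<Psi>) = map_pmf (\<lambda>x. (h x, mk n' (concat (map (B x) \<Psi>)))) Q"
      "\<And>x. pmf Q x = wt n' (concat (map (B x) \<Psi>)) / wt n \<Psi>"
    using P v unfolding implements_def by blast
  let ?\<Phi> = "\<lambda>x. concat (map (B x) \<Psi>)"
  let ?R = "\<lambda>x Q'. P' (h x) (mk n' (?\<Phi> x)) = map_pmf (\<lambda>x'. (h' x x', mk n'' (concat (map (B' x x') (?\<Phi> x))))) Q' \<and>
      (\<forall>x'. pmf Q' x' = wt n'' (concat (map (B' x x') (?\<Phi> x))) / wt n' (?\<Phi> x))"
  have supp: "supp n' \<phi>" if "\<phi> \<in> set (?\<Phi> x)" for \<phi> x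
    using that v P unfolding implements_def valid_def by auto
  have ex: "\<exists>Q'. ?R x Q'" if "x \<in> set_pmf Q" for x
  proof -
    have "0 < wt n' (?\<Phi> x) / wt n \<Psi>" using that Q(2)[of x] by (metis pmf_positive)
    then have "0 < wt n' (?\<Phi> x)" using v by (simp add: valid_def zero_less_divide_iff)
    then have "valid n' (?\<Phi> x)" using supp by (simp add: valid_def)
    then show ?thesis using P'[of x] unfolding implements_def by blast
  qed
  \<comment> \<open>A second-stage distribution is guaranteed only after outcomes of positive
    probability, where the intermediate mixture is valid; elsewhere \<open>SOME\<close> may return
    anything.\<close>
  define Q' where "Q' x = (SOME Q'. ?R x Q')" for x
  have Q': "?R x (Q' x)" if "x \<in> set_pmf Q" for x
    unfolding Q'_def by (rule someI_ex[OF ex[OF that]])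
  let ?C = "\<lambda>(x, x') \<psi>. concat (map (B' x x') (B x \<psi>))"
  have cc: "concat (map (\<lambda>\<psi>. concat (map (B' x x') (B x \<psi>))) \<Psi>) = concat (map (B' x x') (?\<Phi> x))" for x x'
    by (induction \<Psi>) simp_all
  let ?QQ = "bind_pmf Q (\<lambda>x. map_pmf (Pair x) (Q' x))"
  have "P (mk n \<Psi>) \<bind> (\<lambda>(v, st'). P' v st' \<bind> (\<lambda>(v', st''). return_pmf (g v v', st'')))
      = Q \<bind> (\<lambda>x. P' (h x) (mk n' (?\<Phi> x)) \<bind> (\<lambda>(v', st''). return_pmf (g (h x) v', st'')))"
    unfolding Q(1) by (simp add: bind_map_pmf)
  also have "\<dots> = Q \<bind> (\<lambda>x. Q' x \<bind> (\<lambda>x'. return_pmf (g (h x) (h' x x'), mk n'' (concat (map (B' x x') (?\<Phi> x))))))"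
    by (intro bind_pmf_cong refl) (simp add: Q' bind_map_pmf)
  also have "\<dots> = map_pmf (\<lambda>z. (case z of (x, x') \<Rightarrow> g (h x) (h' x x'), mk n'' (concat (map (?C z) \<Psi>)))) ?QQ"
    unfolding map_bind_pmf map_pmf_comp by (simp add: map_pmf_def bind_assoc_pmf bind_return_pmf cc)
  finally have "P (mk n \<Psi>) \<bind> (\<lambda>(v, st'). P' v st' \<bind> (\<lambda>(v', st''). return_pmf (g v v', st'')))
     = map_pmf (\<lambda>z. (case z of (x, x') \<Rightarrow> g (h x) (h' x x'), mk n'' (concat (map (?C z) \<Psi>)))) ?QQ" .
  moreover have "pmf ?QQ (x, x') = wt n'' (concat (map (?C (x, x')) \<Psi>)) / wt n \<Psi>" for x x'
  proof (cases "x \<in> set_pmf Q")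
    case True
    then have "wt n' (?\<Phi> x) \<noteq> 0" using Q(2)[of x] by (auto simp: set_pmf_iff)
    then show ?thesis using Q'[OF True] Q(2)[of x] by (simp add: pmf_dependent_pair cc)
  next
    case False
    then have z: "wt n' (?\<Phi> x) = 0"
      using Q(2)[of x] v by (simp add: set_pmf_iff valid_def)
    \<comment> \<open>Weight zero forces the intermediate vectors to vanish, and zero vectors only
      have zero branches, so both sides of Born's rule are 0.\<close>
    have "wt n'' (B' x x' \<phi>) = 0" if "\<phi> \<in> set (?\<Phi> x)" for \<phi>
    proof -
      have "\<phi> = (\<lambda>a. 0)" by (rule wt_eq_0[OF z that supp[OF that]])
      then have "\<forall>\<omega>\<in>set (B' x x' \<phi>). \<omega> = (\<lambda>a. 0)" using P' unfolding implements_def by blast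
      then show ?thesis unfolding wt_def by (intro sum_list_zero) (auto simp: sq_def)
    qed
    then have "wt n'' (concat (map (B' x x') (?\<Phi> x))) = 0"
      unfolding wt_concat_map by (intro sum_list_zero)
    then show ?thesis using False by (simp add: pmf_dependent_pair cc pmf_eq_0_set_pmf)
  qed
  ultimately show "\<exists>Q. P (mk n \<Psi>) \<bind> (\<lambda>(v, st'). P' v st' \<bind> (\<lambda>(v', st''). return_pmf (g v v', st'')))
      = map_pmf (\<lambda>x. (case x of (x, x') \<Rightarrow> g (h x) (h' x x'), mk n'' (concat (map (?C x) \<Psi>)))) Q \<and>
      (\<forall>x. pmf Q x = wt n'' (concat (map (?C x) \<Psi>)) / wt n \<Psi>)"
    by (intro exI[of _ ?QQ]) auto
next
  fix x :: "'b \<times> 'd" and \<psi> \<phi>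
  assume "supp n \<psi>" "\<phi> \<in> set ((case x of (x, x') \<Rightarrow> \<lambda>\<psi>. concat (map (B' x x') (B x \<psi>))) \<psi>)"
  then show "supp n'' \<phi>" using P P' unfolding implements_def by (cases x) fastforce
next
  fix x :: "'b \<times> 'd" and \<phi>
  assume "\<phi> \<in> set ((case x of (x, x') \<Rightarrow> \<lambda>\<psi>. concat (map (B' x x') (B x \<psi>))) (\<lambda>a. 0))"
  then show "\<phi> = (\<lambda>a. 0)" using P P' unfolding implements_def by (cases x) fastforce
qed

text \<open>New indices outside the range of \<open>e\<close> get no branch, hence weight and
  probability 0.\<close>

lemma implements_reindex:
  assumes "implements n n' P h B" "inj e" "\<And>x. h' (e x) = h x" "\<And>x. B' (e x) = B x"
    and "\<And>z \<psi>. z \<notin> range e \<Longrightarrow> B' z \<psi> = []"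
  shows "implements n n' P h' B'"
  unfolding implements_def
proof (intro conjI allI impI ballI)
  fix x \<psi> \<phi> assume "supp n \<psi>" "\<phi> \<in> set (B' x \<psi>)"
  then show "supp n' \<phi>" using assms unfolding implements_def
    by (cases "x \<in> range e") (auto simp: assms)
next
  fix x \<phi> assume "\<phi> \<in> set (B' x (\<lambda>a. 0))"
  then show "\<phi> = (\<lambda>a. 0)" using assms unfolding implements_def
    by (cases "x \<in> range e") (auto simp: assms)
next
  fix \<Psi> assume "valid n \<Psi>"
  then obtain Q where Q: "P (mk n \<Psi>) = map_pmf (\<lambda>x. (h x, mk n' (concat (map (B x) \<Psi>)))) Q"
      "\<And>x. pmf Q x = wt n' (concat (map (B x) \<Psi>)) / wt n \<Psi>"
    using assms(1) unfolding implements_def by blast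
  have "pmf (map_pmf e Q) z = wt n' (concat (map (B' z) \<Psi>)) / wt n \<Psi>" for z
  proof (cases "z \<in> range e")
    case True
    then show ?thesis using Q(2) assms by (auto simp: pmf_map_inj')
  next
    case False
    then have "wt n' (concat (map (B' z) \<Psi>)) = 0"
      unfolding wt_concat_map by (intro sum_list_zero) (simp add: assms(5) wt_def)
    moreover have "z \<notin> set_pmf (map_pmf e Q)" using False by auto
    ultimately show ?thesis by (simp add: pmf_eq_0_set_pmf del: set_map_pmf)
  qed
  then show "\<exists>Q. P (mk n \<Psi>) = map_pmf (\<lambda>x. (h' x, mk n' (concat (map (B' x) \<Psi>)))) Q \<and>
      (\<forall>x. pmf Q x = wt n' (concat (map (B' x) \<Psi>)) / wt n \<Psi>)"
    by (intro exI[of _ "map_pmf e Q"]) (simp add: Q(1) map_pmf_comp assms)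
qed

section \<open>Repeating an instrument along a register\<close>

fun sequence :: "('i \<Rightarrow> nat \<Rightarrow> qstate \<Rightarrow> ('v \<times> qstate) pmf) \<Rightarrow> nat \<Rightarrow> 'i list \<Rightarrow> nat \<Rightarrow> qstate
    \<Rightarrow> ('v list \<times> qstate) pmf" where
  "sequence P m [] k st = return_pmf ([], st)"
| "sequence P m (i # is) k st = P i k st \<bind> (\<lambda>(y, st'). sequence P m is (k + m) st' \<bind>
     (\<lambda>(ys, st''). return_pmf (y # ys, st'')))"

text \<open>One branch for every combination \<open>ts\<close> of hidden contents. Outcome lists of
  a wrong length get no branch, so plain lists can serve as indices.\<close>

definition seq_branch ::
  "nat \<Rightarrow> ('i \<Rightarrow> 'x \<Rightarrow> 't \<Rightarrow> bits \<Rightarrow> bool \<Rightarrow> complex) \<Rightarrow> ('i \<Rightarrow> 'x \<Rightarrow> 't list) \<Rightarrow> 'i list \<Rightarrow> nat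
     \<Rightarrow> 'x list \<Rightarrow> vec \<Rightarrow> vec list" where
  "seq_branch m K T is k xs \<psi> = (if length xs = length is
     then map (\<lambda>ts. sap k m (map (\<lambda>(i, x, t). K i x t) (zip is (zip xs ts))) \<psi>) (product_lists (map2 T is xs))
     else [])"

lemma supp_0 [simp]: "supp n (\<lambda>a. 0)"
  by (simp add: supp_def)

lemma implements_sequence:
  assumes "\<And>i n k. i \<in> set is \<Longrightarrow> k < n \<Longrightarrow>
      implements n (n - 1 + m) (P i k) h (\<lambda>x \<psi>. map (\<lambda>t. lap k m (K i x t) \<psi>) (T i x))"
    and "k + length is \<le> n" "0 < m"
  shows "implements n (n - length is + length is * m) (sequence P m is k) (map h) (seq_branch m K T is k)"
  using assms
proof (induction "is" arbitrary: n k)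
  case Nil
  show ?case
    unfolding implements_def
  proof (intro conjI allI impI ballI)
    fix \<Psi> assume "valid n \<Psi>"
    then have "wt n \<Psi> \<noteq> 0" by (simp add: valid_def)
    have e: "concat (map (seq_branch m K T [] k []) \<Psi>) = \<Psi>"
      by (induction \<Psi>) (simp_all add: seq_branch_def)
    have "pmf (return_pmf []) x = wt n (concat (map (seq_branch m K T [] k x) \<Psi>)) / wt n \<Psi>" for x
    proof (cases x)
      case Nil
      then show ?thesis using \<open>wt n \<Psi> \<noteq> 0\<close> by (simp add: e)
    next
      case (Cons y ys)
      then have "wt n (concat (map (seq_branch m K T [] k x) \<Psi>)) = 0"
        unfolding wt_concat_map by (intro sum_list_zero) (simp add: seq_branch_def wt_def)
      then show ?thesis using Cons by simp
    qed
    then show "\<exists>Q. sequence P m [] k (mk n \<Psi>) = map_pmf (\<lambda>x. (map h x,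
          mk (n - length [] + length [] * m) (concat (map (seq_branch m K T [] k x) \<Psi>)))) Q \<and>
        (\<forall>x. pmf Q x = wt (n - length [] + length [] * m) (concat (map (seq_branch m K T [] k x) \<Psi>)) / wt n \<Psi>)"
      by (intro exI[of _ "return_pmf []"]) (simp add: e)
  qed (auto simp: seq_branch_def split: if_splits)
next
  case (Cons i "is")
  let ?B = "\<lambda>x \<psi>. map (\<lambda>t. lap k m (K i x t) \<psi>) (T i x)"
  let ?n = "n - 1 + m"
  have 1: "implements n ?n (P i k) h ?B"
    by (rule Cons.prems) (use Cons.prems in auto)
  have 2: "implements ?n (?n - length is + length is * m) (sequence P m is (k + m)) (map h)
      (seq_branch m K T is (k + m))"
    by (rule Cons.IH) (use Cons.prems in auto)
  have n: "?n - length is + length is * m = n - length (i # is) + length (i # is) * m"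
    using Cons.prems(2) by simp
  have seq: "sequence P m (i # is) k = (\<lambda>st. P i k st \<bind> (\<lambda>(y, st'). sequence P m is (k + m) st' \<bind>
     (\<lambda>(ys, st''). return_pmf (y # ys, st''))))"
    by (simp add: fun_eq_iff)
  have 3: "implements n (n - length (i # is) + length (i # is) * m) (sequence P m (i # is) k)
      (\<lambda>(x, xs). h x # map h xs)
      (\<lambda>(x, xs) \<psi>. concat (map (seq_branch m K T is (k + m) xs) (?B x \<psi>)))"
    using implements_bind[OF 1, where P' = "\<lambda>_. sequence P m is (k + m)" and h' = "\<lambda>_. map h"
        and B' = "\<lambda>_. seq_branch m K T is (k + m)" and g = "(#)", OF 2]
    unfolding n by (simp add: seq case_prod_unfold)
  show ?case
  proof (rule implements_reindex[OF 3, where e = "\<lambda>(x, xs). x # xs"])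
    show "inj (\<lambda>(x, xs). x # xs)" by (auto simp: inj_on_def)
  next
    fix x :: "'c \<times> 'c list"
    show "seq_branch m K T (i # is) k (case x of (x, xs) \<Rightarrow> x # xs)
        = (case x of (x, xs) \<Rightarrow> \<lambda>\<psi>. concat (map (seq_branch m K T is (k + m) xs) (?B x \<psi>)))"
      by (cases x) (auto simp: seq_branch_def fun_eq_iff map_concat o_def)
  next
    fix z :: "'c list" and \<psi> assume "z \<notin> range (\<lambda>(x, xs). x # xs)"
    then have "z = []" by (cases z) auto
    then show "seq_branch m K T (i # is) k z \<psi> = []" by (simp add: seq_branch_def)
  qed auto
qed

lemma sequence_weak_commits:
  "weak_commits F lam pks k st = sequence (weak_commit F lam) (width F lam + 1) pks k st"
  by (induction pks arbitrary: k st) simp_all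

lemma sequence_commit_from:
  "commit_from F lam pks l k st = sequence (\<lambda>_. commit1 F lam pks) (blk F lam) (replicate l ()) k st"
  by (induction l arbitrary: k st) simp_all

subsection \<open>The weak commitment\<close>

definition unit_prep :: "ntcf \<Rightarrow> nat \<Rightarrow> bits \<Rightarrow> bool" where
  "unit_prep F lam pk \<longleftrightarrow> (\<forall>s. supp (prep_size F lam pk) (prep_vec F lam pk s) \<and>
     sq (prep_size F lam pk) (prep_vec F lam pk s) = 1)"

lemma unit_prepI:
  assumes "\<And>s. wf_gates (prep_size F lam pk) (prep_F F pk s)"
  shows "unit_prep F lam pk"
proof -
  let ?n = "prep_size F lam pk"
  have b: "supp ?n (basis_vec (zeros ?n))" by (auto simp: supp_def basis_vec_def)
  have "sq ?n (basis_vec (zeros ?n)) = (\<Sum>a\<in>bitstr ?n. if a = zeros ?n then 1 else 0)"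
    unfolding sq_def basis_vec_def by (intro sum.cong) auto
  then have "sq ?n (basis_vec (zeros ?n)) = 1" by simp
  then show ?thesis
    using circ_op_norm[OF assms b] by (simp add: unit_prep_def prep_vec_def)
qed

text \<open>The controlled preparation as a kernel for one qubit: the leading output bit repeats the
  control, which makes it an isometry.\<close>

definition prep_kern :: "ntcf \<Rightarrow> nat \<Rightarrow> bits \<Rightarrow> bits \<Rightarrow> bool \<Rightarrow> complex" where
  "prep_kern F lam pk b s =
     (if length b = Suc (prep_size F lam pk) \<and> hd b = s then prep_vec F lam pk s (tl b) else 0)"

lemma braket_prep_kern:
  assumes "length b = Suc (prep_size F lam pk)"
  shows "braket (prep_kern F lam pk b) u = prep_vec F lam pk (hd b) (tl b) * u (hd b)"
  using assms by (cases "hd b") (simp_all add: braket_def prep_kern_def UNIV_bool)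

lemma iso_prep_kern:
  assumes "unit_prep F lam pk"
  shows "iso (prep_kern F lam pk) (bitstr (Suc (prep_size F lam pk)))"
  unfolding iso_def
proof (intro conjI allI)
  fix u
  have "(\<Sum>x\<in>bitstr (Suc (prep_size F lam pk)). (cmod (braket (prep_kern F lam pk x) u))\<^sup>2)
      = (\<Sum>s\<in>UNIV. \<Sum>a\<in>bitstr (prep_size F lam pk). (cmod (prep_vec F lam pk s a))\<^sup>2 * (cmod (u s))\<^sup>2)"
    unfolding sum_bitstr_Suc
    by (intro sum.cong refl) (simp add: braket_prep_kern norm_mult power_mult_distrib)
  also have "\<dots> = vsq u"
    using assms by (simp add: vsq_def unit_prep_def sq_def flip: sum_distrib_right)
  finally show "(\<Sum>x\<in>bitstr (Suc (prep_size F lam pk)). (cmod (braket (prep_kern F lam pk x) u))\<^sup>2) = vsq u" .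
qed simp

lemma kern_prep: "kern (Suc (prep_size F lam pk)) (prep_kern F lam pk)"
  by (simp add: kern_def prep_kern_def)

lemma lap_prep_kern:
  assumes "unit_prep F lam pk" "supp n \<psi>" "k < n"
  shows "lap k (Suc (prep_size F lam pk)) (prep_kern F lam pk) \<psi> a
    = \<psi> (take (Suc k) a @ drop (Suc k + prep_size F lam pk) a)
        * prep_vec F lam pk (a ! k) (slice (Suc k) (prep_size F lam pk) a)"
proof -
  let ?m = "prep_size F lam pk"
  show ?thesis
  proof (cases "Suc k + ?m \<le> length a")
    case True
    then have "slice k (Suc ?m) a = a ! k # slice (Suc k) ?m a"
      by (simp add: slice_def Cons_nth_drop_Suc[symmetric])
    moreover have "take (Suc k) a = take k a @ [a ! k]"
      using True by (simp add: take_Suc_conv_app_nth)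
    ultimately show ?thesis
      using True by (simp add: lap_def braket_prep_kern slice_def mult.commute)
  next
    \<comment> \<open>The string is too short to hold the register: the kernel vanishes by its
      length test, the product formula by the support of one of its factors.\<close>
    case False
    then have "prep_kern F lam pk (slice k (Suc ?m) a) = (\<lambda>s. 0)"
      by (auto simp: prep_kern_def slice_def fun_eq_iff)
    moreover have "\<psi> (take (Suc k) a @ drop (Suc k + ?m) a) = 0
        \<or> prep_vec F lam pk (a ! k) (slice (Suc k) ?m a) = 0"
    proof (cases "k < length a")
      case True
      then have "length (slice (Suc k) ?m a) \<noteq> ?m" using False by (simp add: slice_def)
      moreover have "supp ?m (prep_vec F lam pk (a ! k))"
        using assms(1) by (simp add: unit_prep_def)
      ultimately show ?thesis using suppD by blast
    next
      case False
      then show ?thesis using assms(2,3) by (simp add: suppD)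
    qed
    ultimately show ?thesis by (auto simp: lap_def)
  qed
qed

lemma controlled_prep_mk:
  assumes "unit_prep F lam pk" "valid n \<Psi>" "k < n"
  shows "controlled_prep F lam pk k (mk n \<Psi>)
    = mk (n + prep_size F lam pk) (map (lap k (Suc (prep_size F lam pk)) (prep_kern F lam pk)) \<Psi>)"
proof -
  let ?m = "prep_size F lam pk"
  let ?f = "lap k (Suc ?m) (prep_kern F lam pk)"
  have e: "n - 1 + Suc ?m = n + ?m" using assms(3) by simp
  have wt: "wt (n + ?m) (map ?f \<Psi>) = wt n \<Psi>"
    using sq_lap[OF iso_prep_kern[OF assms(1)] assms(3)] unfolding e by (simp add: wt_def o_def)
  have f: "?f \<psi> a = \<psi> (take (Suc k) a @ drop (Suc k + ?m) a)
        * prep_vec F lam pk (a ! k) (slice (Suc k) ?m a)" if "\<psi> \<in> set \<Psi>" for \<psi> a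
    by (rule lap_prep_kern[OF assms(1) _ assms(3)]) (use assms(2) that in \<open>auto simp: valid_def\<close>)
  have "map (\<lambda>\<psi>. ?f \<psi> a * cnj (?f \<psi> b)) \<Psi>
      = map (\<lambda>\<psi>. \<psi> (take (Suc k) a @ drop (Suc k + ?m) a) * cnj (\<psi> (take (Suc k) b @ drop (Suc k + ?m) b))
          * (prep_vec F lam pk (a ! k) (slice (Suc k) ?m a)
          * cnj (prep_vec F lam pk (b ! k) (slice (Suc k) ?m b)))) \<Psi>" for a b
    by (intro map_cong refl) (simp add: f)
  then show ?thesis
    by (simp add: mk_def wt o_def Let_def fun_eq_iff sum_list_mult_const del: map_eq_conv)
qed

definition weak_kern :: "ntcf \<Rightarrow> nat \<Rightarrow> bits \<Rightarrow> bits \<Rightarrow> bits \<Rightarrow> bits \<Rightarrow> bool \<Rightarrow> complex" where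
  "weak_kern F lam pk y t b s =
     (if length b = Suc (width F lam) \<and> hd b = s \<and> take (rlen F lam) t = y
      then prep_vec F lam pk s (tl b @ t) else 0)"

definition hidden :: "ntcf \<Rightarrow> nat \<Rightarrow> bits \<Rightarrow> nat" where
  "hidden F lam pk = rlen F lam + prep_anc F pk"

lemma kern_weak: "kern (Suc (width F lam)) (weak_kern F lam pk y t)"
  by (simp add: kern_def weak_kern_def)

lemma lap_0: "lap k m K (\<lambda>a. 0) = (\<lambda>a. 0)"
  by (simp add: lap_def fun_eq_iff)

text \<open>Measuring \<open>y\<close> and tracing out registers merely selects rows of the
  controlled preparation, one selection for each discarded content \<open>t\<close>.\<close>

lemma implements_weak_commit:
  assumes "unit_prep F lam pk" "k < n"
  shows "implements n (n - 1 + (width F lam + 1)) (weak_commit F lam pk k) id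
    (\<lambda>y \<psi>. map (\<lambda>t. lap k (width F lam + 1) (weak_kern F lam pk y t) \<psi>) (strs (hidden F lam pk)))"
  unfolding implements_def
proof (intro conjI allI impI ballI)
  let ?w = "width F lam" and ?r = "rlen F lam" and ?m = "prep_size F lam pk" and ?h = "hidden F lam pk"
  let ?q = "Suc k + ?w"
  let ?P = "lap k (Suc ?m) (prep_kern F lam pk)"
  let ?f = "slice ?q ?r"
  let ?B = "\<lambda>y \<psi>. map (\<lambda>t. lap k (?w + 1) (weak_kern F lam pk y t) \<psi>) (strs ?h)"
  fix \<Psi> assume v: "valid n \<Psi>"
  have m: "?m = ?w + ?h" by (simp add: prep_size_def hidden_def)
  have e: "n - 1 + Suc ?m = n + ?m" using assms(2) by simp
  have wt: "wt (n + ?m) (map ?P \<Psi>) = wt n \<Psi>"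
    using sq_lap[OF iso_prep_kern[OF assms(1)] assms(2)] unfolding e by (simp add: wt_def o_def)
  have supp: "supp (n + ?m) (?P \<psi>)" if "\<psi> \<in> set \<Psi>" for \<psi>
  proof -
    have "supp (n - 1 + Suc ?m) (?P \<psi>)"
      by (rule supp_lap[OF _ kern_prep assms(2)]) (use v that in \<open>auto simp: valid_def\<close>)
    then show ?thesis by (simp only: e)
  qed
  have v': "valid (n + ?m) (map ?P \<Psi>)"
    using v supp by (simp add: valid_def wt)
  obtain Q where Q: "measure_with ?f (mk (n + ?m) (map ?P \<Psi>))
       = map_pmf (\<lambda>y. (y, mk (n + ?m) (map (keep ?f y) (map ?P \<Psi>)))) Q"
     "\<And>y. pmf Q y = wt (n + ?m) (map (keep ?f y) (map ?P \<Psi>)) / wt (n + ?m) (map ?P \<Psi>)"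
    using measure_with_mk[OF v'] by blast
  have n': "n + ?m - ?h = n - 1 + (?w + 1)" using m assms(2) by simp
  \<comment> \<open>Fixing \<open>t\<close> at its place right behind the \<open>w + 1\<close> kept
    bits turns the kernel of the preparation into \<open>weak_kern\<close>.\<close>
  have cut: "insert_bits ?q t (keep ?f y (?P \<psi>)) = lap k (?w + 1) (weak_kern F lam pk y t) \<psi>"
    if "\<psi> \<in> set \<Psi>" "t \<in> bitstr ?h" for \<psi> t y
  proof (rule supp_eqI)
    show "supp (n - 1 + (?w + 1)) (lap k (?w + 1) (weak_kern F lam pk y t) \<psi>)"
      using supp_lap[OF _ kern_weak assms(2), of \<psi>] v that by (simp add: valid_def)
    show "supp (n - 1 + (?w + 1)) (insert_bits ?q t (keep ?f y (?P \<psi>)))"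
      unfolding supp_def insert_bits_def
    proof (intro allI impI)
      fix a :: bits assume a: "length a \<noteq> n - 1 + (?w + 1)"
      have "length (take ?q a) + length (drop ?q a) = length a"
        by (metis append_take_drop_id length_append)
      then have "length (take ?q a @ t @ drop ?q a) = length a + ?h"
        using that(2) by (simp only: length_append bitstr_simps)
      then have "length (take ?q a @ t @ drop ?q a) \<noteq> n + ?m"
        using a m assms(2) by linarith
      then show "keep ?f y (?P \<psi>) (take ?q a @ t @ drop ?q a) = 0"
        by (rule suppD[OF supp_keep[OF supp[OF that(1)]]])
    qed
    fix a :: bits assume a: "length a = n - 1 + (?w + 1)"
    define a1 a2 a3 where "a1 = take k a" "a2 = slice k (?w + 1) a" "a3 = drop ?q a"
    have a': "a = a1 @ a2 @ a3" "length a1 = k" "length a2 = Suc ?w"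
      using a assms(2) by (auto simp: a1_a2_a3_def slice_def min_def)
        (metis append_take_drop_id add.commute drop_drop add_Suc_right plus_1_eq_Suc)
    have l: "take ?q a @ t @ drop ?q a = a1 @ (a2 @ t) @ a3"
      using a' by simp
    have lt: "length t = ?h" using that(2) by simp
    have f: "?f (a1 @ (a2 @ t) @ a3) = take ?r t"
      using a' lt by (simp add: slice_def hidden_def)
    have "?P \<psi> (a1 @ (a2 @ t) @ a3) = braket (prep_kern F lam pk (a2 @ t)) (\<lambda>s. \<psi> (a1 @ s # a3))"
      by (rule lap_append) (use a' lt m in auto)
    moreover have "lap k (?w + 1) (weak_kern F lam pk y t) \<psi> (a1 @ a2 @ a3)
        = braket (weak_kern F lam pk y t a2) (\<lambda>s. \<psi> (a1 @ s # a3))"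
      by (rule lap_append) (use a' in auto)
    moreover have "a2 \<noteq> []" using a' by auto
    then have "weak_kern F lam pk y t a2 = (if take ?r t = y then prep_kern F lam pk (a2 @ t) else (\<lambda>s. 0))"
      using a' lt m by (auto simp: weak_kern_def prep_kern_def fun_eq_iff)
    ultimately show "insert_bits ?q t (keep ?f y (?P \<psi>)) a = lap k (?w + 1) (weak_kern F lam pk y t) \<psi> a"
      unfolding insert_bits_def l keep_def f by (simp add: a'(1))
  qed
  let ?\<Phi> = "\<lambda>y. concat (map (\<lambda>\<psi>. map (\<lambda>t. insert_bits ?q t \<psi>) (strs ?h)) (map (keep ?f y) (map ?P \<Psi>)))"
  have \<Phi>: "?\<Phi> y = concat (map (?B y) \<Psi>)" for y
    by (simp add: o_def del: map_eq_conv) (intro arg_cong[of _ _ concat] map_cong refl; use cut in simp)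
  have le: "?q + ?h \<le> n + ?m" using m assms(2) by simp
  have wt': "wt (n - 1 + (?w + 1)) (concat (map (?B y) \<Psi>)) = wt (n + ?m) (map (keep ?f y) (map ?P \<Psi>))" for y
    unfolding \<Phi>[symmetric] n'[symmetric]
    by (simp add: wt_concat_map) (simp add: wt_def o_def sum_list_strs; use sq_insert_bits[OF le] in simp)
  have "weak_commit F lam pk k (mk n \<Psi>) = map_pmf (\<lambda>y. (id y, mk (n - 1 + (?w + 1)) (concat (map (?B y) \<Psi>)))) Q"
    unfolding weak_commit_def Let_def controlled_prep_mk[OF assms(1) v assms(2)] measure_qubits_def
      \<Phi>[symmetric] n'[symmetric]
    by (simp only: Q(1) hidden_def[symmetric])
       (simp only: discard_mk[OF le] bind_map_pmf map_pmf_def[symmetric] case_prod_conv id_apply)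
  then show "\<exists>Q. weak_commit F lam pk k (mk n \<Psi>)
        = map_pmf (\<lambda>y. (id y, mk (n - 1 + (?w + 1)) (concat (map (?B y) \<Psi>)))) Q \<and>
      (\<forall>y. pmf Q y = wt (n - 1 + (?w + 1)) (concat (map (?B y) \<Psi>)) / wt n \<Psi>)"
    unfolding wt' using Q(2) wt by (intro exI[of _ Q]) simp
next
  fix y \<psi> \<phi>
  assume "supp n \<psi>" "\<phi> \<in> set (map (\<lambda>t. lap k (width F lam + 1) (weak_kern F lam pk y t) \<psi>) (strs (hidden F lam pk)))"
  then show "supp (n - 1 + (width F lam + 1)) \<phi>"
    using supp_lap[OF _ kern_weak assms(2)] by auto
qed (auto simp: lap_0)

subsection \<open>Commitment and opening of one qubit\<close>

definition chunks :: "nat \<Rightarrow> nat \<Rightarrow> 'a list \<Rightarrow> 'a list list" where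
  "chunks m r b = map (\<lambda>i. slice (i * m) m b) [0..<r]"

lemma concat_chunks:
  assumes "length b = r * m"
  shows "concat (chunks m r b) = b" "length (chunks m r b) = r"
    "\<And>c. c \<in> set (chunks m r b) \<Longrightarrow> length c = m"
proof -
  have "concat (chunks m r b) = take (r * m) b" if "r * m \<le> length b" for r
    using that
  proof (induction r)
    case (Suc r)
    then show ?case
      by (simp add: chunks_def slice_def take_add add.commute[of m])
  qed (simp add: chunks_def)
  then show "concat (chunks m r b) = b" using assms by simp
  show "length (chunks m r b) = r" by (simp add: chunks_def)
  fix c assume "c \<in> set (chunks m r b)"
  then obtain i where i: "i < r" "c = slice (i * m) m b" by (auto simp: chunks_def)
  have "i * m + m \<le> r * m" using i(1) by (metis Suc_leI add.commute mult_Suc mult_le_mono1)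
  then show "length c = m" using assms i(2) by (simp add: slice_def)
qed

lemma chunks_concat:
  assumes "length bs = r" "\<And>c. c \<in> set bs \<Longrightarrow> length c = m"
  shows "chunks m r (concat bs) = bs"
proof -
  have len: "length (concat bs) = r * m"
    using assms by (induction bs arbitrary: r) auto
  have "xs = bs" if "concat xs = concat bs" "length xs = length bs"
    "\<And>c. c \<in> set xs \<Longrightarrow> length c = m" for xs
    using that assms(2)
  proof (induction xs arbitrary: bs)
    case (Cons x xs)
    then obtain b bs' where "bs = b # bs'" by (cases bs) auto
    with Cons show ?case by auto
  qed simp
  from this[of "chunks m r (concat bs)"] show ?thesis
    using concat_chunks[OF len] assms(1) by simp
qed

lemma concat_split_nth:
  assumes "j < length bs" "\<And>c. c \<in> set bs \<Longrightarrow> length c = m"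
  shows "concat bs = concat (take j bs) @ bs ! j @ concat (drop (Suc j) bs)"
    "length (concat (take j bs)) = j * m"
proof -
  show "concat bs = concat (take j bs) @ bs ! j @ concat (drop (Suc j) bs)"
    using assms(1) by (metis concat.simps(2) concat_append id_take_nth_drop)
  have "\<forall>c\<in>set (take j bs). length c = m" using assms(2) by (meson in_set_takeD)
  moreover have "length (take j bs) = j" using assms(1) by simp
  moreover have "length (concat cs) = length cs * m" if "\<forall>c\<in>set cs. length c = m" for cs :: "'a list list"
    using that by (induction cs) auto
  ultimately show "length (concat (take j bs)) = j * m" by metis
qed

lemma slice_concat:
  assumes "j < length bs" "\<And>c. c \<in> set bs \<Longrightarrow> length c = m"
  shows "slice (j * m) m (concat bs) = bs ! j"
proof -
  have "length (bs ! j) = m" using assms by simp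
  then show ?thesis
    using concat_split_nth[OF assms] by (simp add: slice_def)
qed

lemma braket_commute: "braket q u = braket u q"
  by (simp add: braket_def mult.commute)

lemma map2_replicate_left: "length xs = r \<Longrightarrow> map2 f (replicate r c) xs = map (f c) xs"
  by (induction xs arbitrary: r) auto

lemma sap_hadamards:
  assumes "length a = k" "length b = r"
  shows "sap k 1 (replicate r had_kern) \<psi> (a @ b @ c) = ct (map had1 b) (\<lambda>d. \<psi> (a @ d @ c))"
proof -
  have "sap k 1 (replicate r had_kern) \<psi> (a @ concat (map (\<lambda>v. [v]) b) @ c)
      = ct (map2 (\<lambda>K b. K b) (replicate r had_kern) (map (\<lambda>v. [v]) b)) (\<lambda>d. \<psi> (a @ d @ c))"
    by (rule sap_ct) (use assms in auto)
  moreover have "concat (map (\<lambda>v. [v]) b) = b" by (induction b) auto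
  moreover have "map2 (\<lambda>K b. K b) (replicate r had_kern) (map (\<lambda>v. [v]) b) = map had1 b"
    using assms(2) by (simp add: map2_replicate_left o_def had_kern_def fun_eq_iff)
  ultimately show ?thesis by simp
qed

lemma supp_hadamards:
  assumes "supp n \<psi>" "k + r \<le> n"
  shows "supp n (sap k 1 (replicate r had_kern) \<psi>)"
proof -
  let ?Ks = "replicate r had_kern"
  have "supp (n - length ?Ks + length ?Ks * 1) (sap k 1 ?Ks \<psi>)"
    by (rule supp_sap[OF assms(1)]) (use assms(2) in auto)
  then show ?thesis using assms(2) by simp
qed

text \<open>The kernel followed by Hadamard gates on all of its output qubits: the new row
  \<open>b\<close> is a signed superposition of the old rows.\<close>

definition hadamard_kern :: "(bits \<Rightarrow> bool \<Rightarrow> complex) \<Rightarrow> bits \<Rightarrow> bool \<Rightarrow> complex" where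
  "hadamard_kern K b s = ct (map had1 b) (\<lambda>d. K d s)"

lemma ct_0 [simp]: "ct qs (\<lambda>a. 0) = 0"
  by (induction qs) simp_all

text \<open>The outer contraction runs over the \<open>w + 1\<close> qubits left by the first weak
  commitment after their Hadamard gates: output qubits of the first kernel are input qubits of the
  others. The length test supports the family on full blocks.\<close>

definition commit_kern ::
  "ntcf \<Rightarrow> nat \<Rightarrow> bits list \<Rightarrow> bits \<times> bits list \<Rightarrow> bits \<times> bits list \<Rightarrow> bits \<Rightarrow> bool \<Rightarrow> complex" where
  "commit_kern F lam pks x t b s =
     (if length b = blk F lam
      then ct (map (\<lambda>(pk, y, t, c). weak_kern F lam pk y t c)
             (zip (tl pks) (zip (snd x) (zip (snd t) (chunks (width F lam + 1) (width F lam + 1) b)))))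
           (\<lambda>d. hadamard_kern (weak_kern F lam (hd pks) (fst x) (fst t)) d s)
      else 0)"

lemma kern_commit: "kern (blk F lam) (commit_kern F lam pks x t)"
  by (simp add: kern_def commit_kern_def)

definition hidden_list :: "ntcf \<Rightarrow> nat \<Rightarrow> bits list \<Rightarrow> (bits \<times> bits list) list" where
  "hidden_list F lam pks = List.product (strs (hidden F lam (hd pks)))
     (product_lists (map (\<lambda>pk. strs (hidden F lam pk)) (tl pks)))"

lemma blk_eq: "blk F lam = (width F lam + 1) * (width F lam + 1)"
  by (simp add: blk_def power2_eq_square)

text \<open>Three layers of operators collapse into one kernel on the committed qubit, because all
  of them act on qubits descending from it.\<close>

lemma commit_lap:
  assumes len: "length pks = width F lam + 2" "length ys = width F lam + 1" "length ts = width F lam + 1"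
    and \<psi>: "supp n \<psi>" "k < n"
  shows "sap k (width F lam + 1) (map (\<lambda>(pk, y, t). weak_kern F lam pk y t) (zip (tl pks) (zip ys ts)))
        (sap k 1 (replicate (width F lam + 1) had_kern)
           (lap k (width F lam + 1) (weak_kern F lam (hd pks) y0 t0) \<psi>))
    = lap k (blk F lam) (commit_kern F lam pks (y0, ys) (t0, ts)) \<psi>" (is "?L = ?R")
proof -
  let ?m = "width F lam + 1"
  let ?W = "weak_kern F lam (hd pks) y0 t0"
  let ?Ks = "map (\<lambda>(pk, y, t). weak_kern F lam pk y t) (zip (tl pks) (zip ys ts))"
  let ?H = "sap k 1 (replicate ?m had_kern) (lap k ?m ?W \<psi>)"
  have lKs: "length ?Ks = ?m" using len by simp
  have s1: "supp (n - 1 + ?m) (lap k ?m ?W \<psi>)"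
    using supp_lap[OF \<psi>(1) kern_weak \<psi>(2)] by simp
  have s2: "supp (n - 1 + ?m) ?H"
    by (rule supp_hadamards[OF s1]) (use \<psi>(2) in simp)
  have s3: "supp (n - 1 + ?m - length ?Ks + length ?Ks * ?m) (sap k ?m ?Ks ?H)"
  proof (rule supp_sap[OF s2])
    fix K assume "K \<in> set ?Ks"
    then obtain p where "K = (case p of (pk, y, t) \<Rightarrow> weak_kern F lam pk y t)" by (auto simp only: set_map)
    then show "kern ?m K" using kern_weak by (cases p) simp
  qed (use lKs \<psi>(2) in simp_all)
  show ?thesis
  proof (rule supp_eqI)
    show "supp (n - 1 + blk F lam) ?R"
      by (rule supp_lap[OF \<psi>(1) kern_commit \<psi>(2)])
    show "supp (n - 1 + blk F lam) ?L"
      using s3 by (simp only: lKs blk_eq add_diff_cancel_right')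
    fix a :: bits assume a: "length a = n - 1 + blk F lam"
    define a1 b a3 where "a1 = take k a" "b = slice k (blk F lam) a" "a3 = drop (k + blk F lam) a"
    have a': "a = a1 @ b @ a3" "length a1 = k" "length b = ?m * ?m"
    proof -
      show "length a1 = k" using a \<psi>(2) by (simp add: a1_b_a3_def)
      show "length b = ?m * ?m" using a \<psi>(2) unfolding blk_eq[symmetric] by (simp add: a1_b_a3_def slice_def)
      have "drop (k + blk F lam) a = drop (blk F lam) (drop k a)" by (simp add: add.commute)
      then show "a = a1 @ b @ a3" by (simp only: a1_b_a3_def slice_def append_take_drop_id)
    qed
    define bs where "bs = chunks ?m ?m b"
    have bs: "concat bs = b" "length bs = ?m" "\<And>c. c \<in> set bs \<Longrightarrow> length c = ?m"
      unfolding bs_def using concat_chunks[OF a'(3)] by auto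
    let ?Q = "map (\<lambda>(pk, y, t, c). weak_kern F lam pk y t c) (zip (tl pks) (zip ys (zip ts bs)))"
    have Q: "map2 (\<lambda>K b. K b) ?Ks bs = ?Q"
      using len bs(2) by (intro nth_equalityI) auto
    have "?L a = ct ?Q (\<lambda>d. ?H (a1 @ d @ a3))"
      unfolding a'(1) bs(1)[symmetric] Q[symmetric]
      by (rule sap_ct) (use a' bs lKs in auto)
    \<comment> \<open>The committed bit \<open>s\<close> is pulled out through the Hadamard layer,
      which leaves a kernel evaluated at the intermediate string \<open>d\<close>.\<close>
    also have "\<dots> = ct ?Q (\<lambda>d. braket (hadamard_kern ?W d) (\<lambda>s. \<psi> (a1 @ s # a3)))"
    proof (rule ct_cong)
      fix d :: bits assume "length d = length ?Q"
      then have d: "length d = ?m" using len bs(2) by simp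
      have "?H (a1 @ d @ a3) = ct (map had1 d) (\<lambda>e. lap k ?m ?W \<psi> (a1 @ e @ a3))"
        by (rule sap_hadamards) (use a' d in auto)
      also have "\<dots> = ct (map had1 d) (\<lambda>e. braket (?W e) (\<lambda>s. \<psi> (a1 @ s # a3)))"
        by (rule ct_cong) (use a' d in \<open>simp add: lap_append\<close>)
      also have "\<dots> = braket (hadamard_kern ?W d) (\<lambda>s. \<psi> (a1 @ s # a3))"
        unfolding braket_commute[of _ "\<lambda>s. \<psi> (a1 @ s # a3)"] ct_braket hadamard_kern_def ..
      finally show "?H (a1 @ d @ a3) = braket (hadamard_kern ?W d) (\<lambda>s. \<psi> (a1 @ s # a3))" .
    qed
    also have "\<dots> = braket (commit_kern F lam pks (y0, ys) (t0, ts) b) (\<lambda>s. \<psi> (a1 @ s # a3))"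
      unfolding braket_commute[of _ "\<lambda>s. \<psi> (a1 @ s # a3)"] ct_braket
      using a'(3) by (simp add: commit_kern_def[abs_def] blk_eq bs_def)
    also have "\<dots> = ?R a"
      unfolding a'(1) by (rule lap_append[symmetric]) (use a' in \<open>auto simp: blk_eq\<close>)
    finally show "?L a = ?R a" .
  qed
qed

lemma hadamards_mk:
  assumes "valid n \<Psi>" "k + r \<le> n"
  shows "hadamards k r (mk n \<Psi>) = mk n (map (sap k 1 (replicate r had_kern)) \<Psi>)"
    and "wt n (map (sap k 1 (replicate r had_kern)) \<Psi>) = wt n \<Psi>"
proof -
  let ?U = "circ_op (map Had [k..<k + r])"
  have wf: "wf_gates n (map Had [k..<k + r])" using assms by (auto simp: wf_gates_def)
  have sq: "sq n (?U \<psi>) = sq n \<psi>" if "\<psi> \<in> set \<Psi>" for \<psi>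
    using circ_op_norm[OF wf, of \<psi>] assms(1) that by (auto simp: valid_def)
  have "?U \<psi> = sap k 1 (replicate r had_kern) \<psi>" if "\<psi> \<in> set \<Psi>" for \<psi>
    by (rule circ_op_hadamards[OF _ assms(2)]) (use assms(1) that in \<open>auto simp: valid_def\<close>)
  then have U: "map (sap k 1 (replicate r had_kern)) \<Psi> = map ?U \<Psi>"
    by simp
  show "hadamards k r (mk n \<Psi>) = mk n (map (sap k 1 (replicate r had_kern)) \<Psi>)"
    unfolding hadamards_def U by (rule evolve_mk[OF linear_op_circ sq])
  show "wt n (map (sap k 1 (replicate r had_kern)) \<Psi>) = wt n \<Psi>"
    unfolding U using sq by (simp add: wt_def o_def cong: map_cong)
qed

lemma sap_0: "sap k m Ks (\<lambda>a. 0) = (\<lambda>a. 0)"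
  by (induction Ks arbitrary: k) (simp_all add: lap_0)

text \<open>Gates become an instrument with the trivial outcome \<open>()\<close>, so that
  \<open>implements_bind\<close> can insert them between measurements.\<close>

lemma implements_hadamards:
  assumes "k + r \<le> n"
  shows "implements n n (\<lambda>st. return_pmf ((), hadamards k r st)) id
    (\<lambda>_ \<psi>. [sap k 1 (replicate r had_kern) \<psi>])"
  unfolding implements_def
proof (intro conjI allI impI ballI)
  fix \<Psi> assume v: "valid n \<Psi>"
  have c: "concat (map (\<lambda>\<psi>. [sap k 1 (replicate r had_kern) \<psi>]) \<Psi>) = map (sap k 1 (replicate r had_kern)) \<Psi>"
    by (induction \<Psi>) auto
  have "pmf (return_pmf ()) x = 1" for x by simp
  then show "\<exists>Q. return_pmf ((), hadamards k r (mk n \<Psi>))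
       = map_pmf (\<lambda>x. (id x, mk n (concat (map (\<lambda>\<psi>. [sap k 1 (replicate r had_kern) \<psi>]) \<Psi>)))) Q \<and>
      (\<forall>x. pmf Q x = wt n (concat (map (\<lambda>\<psi>. [sap k 1 (replicate r had_kern) \<psi>]) \<Psi>)) / wt n \<Psi>)"
    unfolding c hadamards_mk[OF v assms] using v
    by (intro exI[of _ "return_pmf ()"]) (simp add: valid_def)
next
  fix \<psi> \<phi> assume "supp n \<psi>" "\<phi> \<in> set [sap k 1 (replicate r had_kern) \<psi>]"
  then show "supp n \<phi>"
    using supp_hadamards[OF _ assms] by simp
qed (simp add: sap_0)

lemma implements_cong:
  assumes "implements n n' P h B" "\<And>x \<psi>. supp n \<psi> \<Longrightarrow> B' x \<psi> = B x \<psi>"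
  shows "implements n n' P h B'"
proof -
  have "concat (map (B' x) \<Psi>) = concat (map (B x) \<Psi>)" if "valid n \<Psi>" for x \<Psi>
    using that assms(2) by (intro arg_cong[of _ _ concat] map_cong) (auto simp: valid_def)
  then show ?thesis using assms unfolding implements_def by simp
qed

text \<open>No hashing takes place here: the result is the string that later serves as one symbol of
  the hashed message.\<close>

definition commit_hash :: "bits \<times> bits list \<Rightarrow> bits" where
  "commit_hash x = concat (fst x # snd x)"

text \<open>The instrument is first composed from a weak commitment, the Hadamard layer and the
  remaining weak commitments; \<open>commit_lap\<close> then merges each branch into a single
  kernel.\<close>

lemma implements_commit1:
  assumes "\<And>pk. pk \<in> set pks \<Longrightarrow> unit_prep F lam pk" "length pks = width F lam + 2" "k < n"
  shows "implements n (n - 1 + blk F lam) (commit1 F lam pks k) commit_hash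
    (\<lambda>x \<psi>. if length (snd x) = width F lam + 1
       then map (\<lambda>t. lap k (blk F lam) (commit_kern F lam pks x t) \<psi>) (hidden_list F lam pks) else [])"
proof -
  let ?m = "width F lam + 1"
  let ?n = "n - 1 + ?m"
  let ?B1 = "\<lambda>y \<psi>. map (\<lambda>t. lap k ?m (weak_kern F lam (hd pks) y t) \<psi>) (strs (hidden F lam (hd pks)))"
  let ?B2 = "\<lambda>(_ :: unit) \<psi>. [sap k 1 (replicate ?m had_kern) \<psi>]"
  let ?B3 = "seq_branch ?m (weak_kern F lam) (\<lambda>pk _. strs (hidden F lam pk)) (tl pks) k"
  have lt: "length (tl pks) = ?m" using assms(2) by simp
  obtain pk pks' where pks: "pks = pk # pks'" using assms(2) by (cases pks) auto
  have 1: "implements n ?n (weak_commit F lam (hd pks) k) id ?B1"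
    by (rule implements_weak_commit) (use assms pks in auto)
  have 2: "implements ?n ?n (\<lambda>st. return_pmf ((), hadamards k ?m st)) id ?B2"
    by (rule implements_hadamards) (use assms(3) in simp)
  have "implements ?n (?n - length (tl pks) + length (tl pks) * ?m)
      (sequence (weak_commit F lam) ?m (tl pks) k) (map id) ?B3"
  proof (rule implements_sequence)
    fix i n' k' assume i: "i \<in> set (tl pks)" "k' < (n' :: nat)"
    show "implements n' (n' - 1 + ?m) (weak_commit F lam i k') id
        (\<lambda>x \<psi>. map (\<lambda>t. lap k' ?m (weak_kern F lam i x t) \<psi>) (strs (hidden F lam i)))"
      by (rule implements_weak_commit) (use assms(1) i pks in auto)
  qed (use assms(3) lt in auto)
  moreover have "?n - length (tl pks) + length (tl pks) * ?m = n - 1 + blk F lam"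
    using lt by (simp add: blk_eq)
  moreover have "sequence (weak_commit F lam) ?m (tl pks) k = weak_commits F lam (tl pks) k"
    by (simp add: sequence_weak_commits fun_eq_iff)
  ultimately have 3: "implements ?n (n - 1 + blk F lam) (weak_commits F lam (tl pks) k) id ?B3"
    by (simp only: list.map_id0)
  have 23: "implements ?n (n - 1 + blk F lam)
      (\<lambda>st. return_pmf ((), hadamards k ?m st) \<bind> (\<lambda>(v, st'). weak_commits F lam (tl pks) k st' \<bind>
          (\<lambda>(v', st''). return_pmf (v', st''))))
      (\<lambda>(x :: unit, x'). id x') (\<lambda>(x, x') \<psi>. concat (map (?B3 x') (?B2 x \<psi>)))"
    by (rule implements_bind[OF 2, where g = "\<lambda>v v'. v'" and h' = "\<lambda>_. id" and
          P' = "\<lambda>_. weak_commits F lam (tl pks) k" and B' = "\<lambda>_. ?B3", OF 3])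
  have 123: "implements n (n - 1 + blk F lam)
      (\<lambda>st. weak_commit F lam (hd pks) k st \<bind> (\<lambda>(y0, st1).
         return_pmf ((), hadamards k ?m st1) \<bind> (\<lambda>(v, st'). weak_commits F lam (tl pks) k st' \<bind>
          (\<lambda>(v', st''). return_pmf (v', st''))) \<bind> (\<lambda>(ys, st2). return_pmf (concat (y0 # ys), st2))))
      (\<lambda>(x, x'). concat (id x # (case x' of (x :: unit, x') \<Rightarrow> id x')))
      (\<lambda>(x, x') \<psi>. concat (map ((\<lambda>(x, x') \<psi>. concat (map (?B3 x') (?B2 x \<psi>))) x') (?B1 x \<psi>)))"
    by (rule implements_bind[OF 1, where g = "\<lambda>y0 ys. concat (y0 # ys)" and h' = "\<lambda>_ (x :: unit, x'). id x'" and
          P' = "\<lambda>_. \<lambda>st. return_pmf ((), hadamards k ?m st) \<bind> (\<lambda>(v, st'). weak_commits F lam (tl pks) k st' \<bind>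
          (\<lambda>(v', st''). return_pmf (v', st'')))" and
          B' = "\<lambda>_. (\<lambda>(x, x') \<psi>. concat (map (?B3 x') (?B2 x \<psi>)))", OF 23])
  have P: "(\<lambda>st. weak_commit F lam (hd pks) k st \<bind> (\<lambda>(y0, st1).
         return_pmf ((), hadamards k ?m st1) \<bind> (\<lambda>(v, st'). weak_commits F lam (tl pks) k st' \<bind>
          (\<lambda>(v', st''). return_pmf (v', st''))) \<bind> (\<lambda>(ys, st2). return_pmf (concat (y0 # ys), st2))))
      = commit1 F lam pks k"
    by (simp add: commit1_def fun_eq_iff bind_return_pmf bind_assoc_pmf case_prod_unfold)
  have 4: "implements n (n - 1 + blk F lam) (commit1 F lam pks k) commit_hash
     (\<lambda>(x, x') \<psi>. concat (map ((\<lambda>(x, x') \<psi>. concat (map (?B3 x') (?B2 x \<psi>))) ((), x')) (?B1 x \<psi>)))"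
  \<comment> \<open>The reindexing removes the trivial outcome of the Hadamard layer.\<close>
  proof (rule implements_reindex[OF 123[unfolded P], where e = "\<lambda>(x, (u, x')). (x, x')"])
    fix z :: "bits \<times> bits list"
    have "z = (\<lambda>(x, (u :: unit, x')). (x, x')) (fst z, ((), snd z))" by simp
    then have "z \<in> range (\<lambda>(x, (u :: unit, x')). (x, x'))" by (rule range_eqI)
    moreover assume "z \<notin> range (\<lambda>(x, (u :: unit, x')). (x, x'))"
    ultimately show "(\<lambda>(x, x') \<psi>. concat (map ((\<lambda>(x, x') \<psi>. concat (map (?B3 x') (?B2 x \<psi>))) ((), x')) (?B1 x \<psi>))) z \<psi> = []" for \<psi>
      by contradiction
  qed (simp_all add: inj_on_def commit_hash_def split_paired_all)
  show ?thesis
  proof (rule implements_cong[OF 4])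
    fix x :: "bits \<times> bits list" and \<psi> assume \<psi>: "supp n \<psi>"
    obtain y0 ys where x: "x = (y0, ys)" by (cases x)
    have ts: "length ts = ?m" if "ts \<in> set (product_lists (map (\<lambda>pk. strs (hidden F lam pk)) (tl pks)))" for ts
      using in_set_product_lists_length[OF that] lt by simp
    show "(if length (snd x) = width F lam + 1
        then map (\<lambda>t. lap k (blk F lam) (commit_kern F lam pks x t) \<psi>) (hidden_list F lam pks) else [])
      = (case x of (x, x') \<Rightarrow> \<lambda>\<psi>. concat (map ((\<lambda>(x, x') \<psi>. concat (map (?B3 x') (?B2 x \<psi>))) ((), x')) (?B1 x \<psi>))) \<psi>"
    proof (cases "length ys = ?m")
      case True
      let ?S = "strs (hidden F lam (hd pks))"
      let ?PL = "product_lists (map (\<lambda>pk. strs (hidden F lam pk)) (tl pks))"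
      have "map f (List.product ?S ?PL) = concat (map (\<lambda>t0. map (\<lambda>ts. f (t0, ts)) ?PL) ?S)" for f :: "_ \<Rightarrow> vec"
        by (simp add: product_concat_map map_concat o_def)
      then have "map (\<lambda>t. lap k (blk F lam) (commit_kern F lam pks x t) \<psi>) (hidden_list F lam pks)
          = concat (map (\<lambda>t0. map (\<lambda>ts. lap k (blk F lam) (commit_kern F lam pks (y0, ys) (t0, ts)) \<psi>) ?PL) ?S)"
        by (simp only: hidden_list_def x)
      also have "\<dots> = concat (map (\<lambda>t0. map (\<lambda>ts.
            sap k ?m (map (\<lambda>(pk, y, t). weak_kern F lam pk y t) (zip (tl pks) (zip ys ts)))
             (sap k 1 (replicate ?m had_kern) (lap k ?m (weak_kern F lam (hd pks) y0 t0) \<psi>))) ?PL) ?S)"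
        by (intro arg_cong[of _ _ concat] map_cong refl commit_lap[symmetric])
          (use assms(2,3) True ts \<psi> in auto)
      also have "map (\<lambda>pk. strs (hidden F lam pk)) (tl pks) = map2 (\<lambda>pk _. strs (hidden F lam pk)) (tl pks) ys"
        using True lt by (intro nth_equalityI) simp_all
      also have "concat (map (\<lambda>t0. map (\<lambda>ts.
            sap k ?m (map (\<lambda>(pk, y, t). weak_kern F lam pk y t) (zip (tl pks) (zip ys ts)))
             (sap k 1 (replicate ?m had_kern) (lap k ?m (weak_kern F lam (hd pks) y0 t0) \<psi>)))
               (product_lists (map2 (\<lambda>pk _. strs (hidden F lam pk)) (tl pks) ys))) ?S)
          = concat (map (\<lambda>\<phi>. concat (map (?B3 ys) (?B2 () \<phi>))) (?B1 y0 \<psi>))"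
        using True lt by (simp only: seq_branch_def if_True map_map o_def list.map concat.simps append_Nil2 simp_thms)
      finally show ?thesis using True by (simp only: x snd_conv if_True case_prod_conv simp_thms)
    next
      case False
      then show ?thesis using lt by (simp add: x seq_branch_def o_def)
    qed
  qed
qed

subsection \<open>Joint distribution of commitments and openings\<close>

text \<open>A wrong number of \<open>y\<close> strings is given an empty list and so probability
  0.\<close>

definition hidden1 :: "ntcf \<Rightarrow> nat \<Rightarrow> bits list \<Rightarrow> bits \<times> bits list \<Rightarrow> (bits \<times> bits list) list" where
  "hidden1 F lam pks x = (if length (snd x) = width F lam + 1 then hidden_list F lam pks else [])"

abbreviation commit_branch ::
  "ntcf \<Rightarrow> nat \<Rightarrow> bits list \<Rightarrow> nat \<Rightarrow> (bits \<times> bits list) list \<Rightarrow> vec \<Rightarrow> vec list" where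
  "commit_branch F lam pks l \<equiv> seq_branch (blk F lam) (\<lambda>_. commit_kern F lam pks) (\<lambda>_. hidden1 F lam pks)
     (replicate l ()) 0"

lemma blk_pos: "0 < blk F lam"
  by (simp add: blk_def)

lemma implements_commit_from:
  assumes "\<And>pk. pk \<in> set pks \<Longrightarrow> unit_prep F lam pk" "length pks = width F lam + 2"
  shows "implements l (l * blk F lam) (commit_from F lam pks l 0) (map commit_hash) (commit_branch F lam pks l)"
proof -
  have "implements l (l - length (replicate l ()) + length (replicate l ()) * blk F lam)
      (sequence (\<lambda>_. commit1 F lam pks) (blk F lam) (replicate l ()) 0) (map commit_hash) (commit_branch F lam pks l)"
  proof (rule implements_sequence)
    fix i :: unit and n k :: nat assume "k < n"
    have "(if length (snd x) = width F lam + 1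
        then map (\<lambda>t. lap k (blk F lam) (commit_kern F lam pks x t) \<psi>) (hidden_list F lam pks) else [])
      = map (\<lambda>t. lap k (blk F lam) (commit_kern F lam pks x t) \<psi>) (hidden1 F lam pks x)" for x \<psi>
      by (simp add: hidden1_def)
    with implements_commit1[OF assms \<open>k < n\<close>]
    show "implements n (n - 1 + blk F lam) (commit1 F lam pks k) commit_hash
        (\<lambda>x \<psi>. map (\<lambda>t. lap k (blk F lam) (commit_kern F lam pks x t) \<psi>) (hidden1 F lam pks x))"
      by simp
  qed (simp_all add: blk_pos)
  moreover have "sequence (\<lambda>_. commit1 F lam pks) (blk F lam) (replicate l ()) 0 = commit_from F lam pks l 0"
    by (simp add: sequence_commit_from fun_eq_iff)
  ultimately show ?thesis by simp
qed

section \<open>Openings as updates of single kernels\<close>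

fun open_branch :: "nat \<Rightarrow> (nat \<times> bool) list \<Rightarrow> bits list \<Rightarrow> vec \<Rightarrow> vec" where
  "open_branch m [] zs \<psi> = \<psi>"
| "open_branch m ((j, b) # jbs) zs \<psi> = open_branch m jbs (tl zs) (keep (slice (j * m) m) (hd zs)
     (if b then \<psi> else sap (j * m) 1 (replicate m had_kern) \<psi>))"

lemma open_branch_0: "open_branch m jbs zs (\<lambda>a. 0) = (\<lambda>a. 0)"
proof (induction jbs arbitrary: zs)
  case (Cons jb jbs)
  have "keep f v (\<lambda>a. 0) = (\<lambda>a. 0)" for f :: "bits \<Rightarrow> bits" and v by (simp add: keep_def)
  then show ?case using Cons by (cases jb) (simp add: sap_0)
qed simp

lemma pmf_bind_Cons:
  "pmf (bind_pmf p (\<lambda>x. bind_pmf (q x) (\<lambda>xs. return_pmf (x # xs)))) zs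
    = (case zs of [] \<Rightarrow> 0 | z # zs' \<Rightarrow> pmf p z * pmf (q z) zs')"
proof -
  let ?D = "bind_pmf p (\<lambda>x. map_pmf (Pair x) (q x))"
  let ?c = "\<lambda>(x, xs). x # xs"
  have e: "bind_pmf p (\<lambda>x. bind_pmf (q x) (\<lambda>xs. return_pmf (x # xs))) = map_pmf ?c ?D"
    by (simp add: map_bind_pmf map_pmf_comp) (simp add: map_pmf_def)
  show ?thesis
  proof (cases zs)
    case Nil
    have "[] \<notin> set_pmf (map_pmf ?c ?D)" by auto
    then show ?thesis unfolding e using Nil by (simp add: pmf_eq_0_set_pmf del: set_map_pmf)
  next
    case (Cons z zs')
    have inj: "inj ?c" by (auto simp: inj_on_def)
    have "pmf (map_pmf ?c ?D) (?c (z, zs')) = pmf ?D (z, zs')" by (rule pmf_map_inj'[OF inj])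
    then show ?thesis unfolding e using Cons by (simp add: pmf_dependent_pair)
  qed
qed

text \<open>A projective measurement has one Kraus operator per outcome, so the list of vectors
  keeps its length and successive probabilities telescope to one quotient of weights.\<close>

lemma open_ss_pmf:
  assumes "valid n \<Psi>" "\<And>j b. (j, b) \<in> set jbs \<Longrightarrow> j * blk F lam + blk F lam \<le> n"
  shows "pmf (open_ss F lam jbs (mk n \<Psi>)) zs = (if length zs = length jbs
     then wt n (map (open_branch (blk F lam) jbs zs) \<Psi>) / wt n \<Psi> else 0)"
  using assms
proof (induction jbs arbitrary: zs \<Psi>)
  case Nil
  then have "wt n \<Psi> \<noteq> 0" by (simp add: valid_def)
  then show ?case by (simp add: o_def)
next
  case (Cons jb jbs)
  obtain j b where jb: "jb = (j, b)" by (cases jb)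
  let ?m = "blk F lam"
  let ?f = "slice (j * ?m) ?m"
  let ?h = "\<lambda>\<psi>. if b then \<psi> else sap (j * ?m) 1 (replicate ?m had_kern) \<psi>"
  let ?\<Psi> = "map ?h \<Psi>"
  have le: "j * ?m + ?m \<le> n" using Cons.prems(2)[of j b] jb by simp
  have wt: "wt n ?\<Psi> = wt n \<Psi>"
    using hadamards_mk(2)[OF Cons.prems(1) le] by (cases b) (simp_all add: o_def)
  have st: "(if b then mk n \<Psi> else hadamards (j * ?m) ?m (mk n \<Psi>)) = mk n ?\<Psi>"
    using hadamards_mk(1)[OF Cons.prems(1) le] by (cases b) simp_all
  have s: "\<forall>\<psi>\<in>set ?\<Psi>. supp n \<psi>"
    using Cons.prems(1) supp_hadamards[OF _ le] by (auto simp: valid_def)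
  then have v: "valid n ?\<Psi>"
    using Cons.prems(1) wt by (simp add: valid_def)
  let ?\<Phi> = "\<lambda>z. map (keep ?f z) ?\<Psi>"
  obtain Q where Q: "measure_with ?f (mk n ?\<Psi>) = map_pmf (\<lambda>z. (z, mk n (?\<Phi> z))) Q"
     "\<And>z. pmf Q z = wt n (?\<Phi> z) / wt n ?\<Psi>"
    using measure_with_mk[OF v] by blast
  have s': "supp n \<phi>" if "\<phi> \<in> set (?\<Phi> z)" for \<phi> z
    using that s by (auto intro: supp_keep)
  have "open_ss F lam ((j, b) # jbs) (mk n \<Psi>)
      = bind_pmf Q (\<lambda>z. bind_pmf (open_ss F lam jbs (mk n (?\<Phi> z))) (\<lambda>zs. return_pmf (z # zs)))"
    by (simp only: open_ss.simps open1_def st measure_qubits_def Q(1) bind_map_pmf case_prod_conv)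
  then have *: "pmf (open_ss F lam (jb # jbs) (mk n \<Psi>)) zs
      = (case zs of [] \<Rightarrow> 0 | z # zs' \<Rightarrow> pmf Q z * pmf (open_ss F lam jbs (mk n (?\<Phi> z))) zs')"
    by (simp only: jb pmf_bind_Cons)
  show ?case
  proof (cases zs)
    case Nil
    then show ?thesis using * by simp
  next
    case (Cons z zs')
    have ob: "map (open_branch ?m jbs zs') (?\<Phi> z) = map (open_branch ?m (jb # jbs) zs) \<Psi>"
      by (simp add: jb Cons)
    show ?thesis
    proof (cases "wt n (?\<Phi> z) = 0")
      \<comment> \<open>A first outcome of probability zero: the state after it is not valid, but
        every later branch vanishes too.\<close>
      case True
      have "wt n (map (open_branch ?m jbs zs') (?\<Phi> z)) = 0"
        unfolding wt_def
      proof (rule sum_list_zero)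
        fix \<omega> assume "\<omega> \<in> set (map (open_branch ?m jbs zs') (?\<Phi> z))"
        then obtain \<phi> where \<phi>: "\<phi> \<in> set (?\<Phi> z)" "\<omega> = open_branch ?m jbs zs' \<phi>"
          unfolding set_map by blast
        have "\<phi> = (\<lambda>a. 0)" by (rule wt_eq_0[OF True \<phi>(1) s'[OF \<phi>(1)]])
        then show "sq n \<omega> = 0" by (simp add: \<phi>(2) open_branch_0 sq_def)
      qed
      then have z: "wt n (map (open_branch ?m (jb # jbs) zs) \<Psi>) = 0" by (simp only: ob)
      have "pmf Q z = 0" by (simp only: Q(2) True div_0)
      then have "pmf (open_ss F lam (jb # jbs) (mk n \<Psi>)) zs = 0" unfolding * by (simp add: Cons)
      then show ?thesis by (simp only: z div_0 if_cancel)
    next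
      case False
      then have "valid n (?\<Phi> z)"
        using s' wt_nonneg[of n "?\<Phi> z"] by (simp add: valid_def less_le)
      then have "pmf (open_ss F lam jbs (mk n (?\<Phi> z))) zs' = (if length zs' = length jbs
          then wt n (map (open_branch ?m jbs zs') (?\<Phi> z)) / wt n (?\<Phi> z) else 0)"
        by (rule Cons.IH) (use Cons.prems(2) in auto)
      then have "pmf Q z * pmf (open_ss F lam jbs (mk n (?\<Phi> z))) zs' = (if length zs' = length jbs
          then wt n (map (open_branch ?m (jb # jbs) zs) \<Psi>) / wt n \<Psi> else 0)"
        unfolding Q(2) ob wt using False by simp
      then show ?thesis unfolding * by (simp add: Cons)
    qed
  qed
qed

definition hadamard_if :: "bool \<Rightarrow> (bits \<Rightarrow> bool \<Rightarrow> complex) \<Rightarrow> bits \<Rightarrow> bool \<Rightarrow> complex" where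
  "hadamard_if \<beta> K = (if \<beta> then hadamard_kern K else K)"

lemma ct_commute: "ct qs (\<lambda>a. ct r (\<lambda>d. f d a)) = ct r (\<lambda>d. ct qs (f d))"
proof (induction qs arbitrary: f)
  case (Cons q qs)
  have "braket q (\<lambda>s. ct r (\<lambda>d. f d (s # a))) = ct r (\<lambda>d. braket q (\<lambda>s. f d (s # a)))" for a
    by (rule ct_braket[symmetric])
  then show ?case by (simp add: Cons)
qed simp

text \<open>Multilinearity in the rows: a superposition in one row is a superposition of
  contractions.\<close>

lemma ct_update:
  assumes "j < length qs"
  shows "ct (qs[j := \<lambda>s. ct r (\<lambda>d. q d s)]) \<psi> = ct r (\<lambda>d. ct (qs[j := q d]) \<psi>)"
  using assms
proof (induction qs arbitrary: j \<psi>)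
  case (Cons p qs)
  show ?case
  proof (cases j)
    case 0
    have "braket (\<lambda>s. ct r (\<lambda>d. q d s)) u = ct r (\<lambda>d. braket (q d) u)" for u
      by (simp only: braket_commute[of _ u] ct_braket)
    then show ?thesis using 0 by (simp add: ct_commute[of qs r])
  next
    case (Suc j')
    then show ?thesis using Cons by simp
  qed
qed simp

lemma ct_update_0:
  assumes "j < length qs"
  shows "ct (qs[j := \<lambda>s. 0]) \<psi> = 0"
  using assms by (induction qs arbitrary: j \<psi>) (auto split: nat.split)

lemma map2_update:
  assumes "length xs = length ys" "j < length xs"
  shows "map2 f (xs[j := x]) ys = (map2 f xs ys)[j := f x (ys ! j)]"
    "map2 f xs (ys[j := y]) = (map2 f xs ys)[j := f (xs ! j) y]"
  using assms by (auto intro!: nth_equalityI simp: nth_list_update)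

text \<open>The invariant of successive openings: on block strings the current vector is still a
  product contraction of the vector \<open>\<psi>\<close> before the commitment, and each opening
  changes a single entry of \<open>Cs\<close>.\<close>

definition agrees :: "nat \<Rightarrow> (bits \<Rightarrow> bool \<Rightarrow> complex) list \<Rightarrow> vec \<Rightarrow> vec \<Rightarrow> bool" where
  "agrees m Cs \<psi> \<phi> \<longleftrightarrow> (\<forall>bs. length bs = length Cs \<longrightarrow> (\<forall>b\<in>set bs. length b = m) \<longrightarrow>
     \<phi> (concat bs) = ct (map2 (\<lambda>K b. K b) Cs bs) \<psi>)"

lemma agrees_hadamards:
  assumes "agrees m Cs \<psi> \<phi>" "j < length Cs"
  shows "agrees m (Cs[j := hadamard_kern (Cs ! j)]) \<psi> (sap (j * m) 1 (replicate m had_kern) \<phi>)"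
  unfolding agrees_def
proof (intro allI impI)
  fix bs :: "bits list"
  assume bs: "length bs = length (Cs[j := hadamard_kern (Cs ! j)])" "\<forall>b\<in>set bs. length b = m"
  then have len: "length bs = length Cs" and m: "\<And>b. b \<in> set bs \<Longrightarrow> length b = m" by auto
  have j: "j < length bs" using len assms(2) by simp
  note split = concat_split_nth[OF j m]
  have "sap (j * m) 1 (replicate m had_kern) \<phi> (concat bs)
      = ct (map had1 (bs ! j)) (\<lambda>d. \<phi> (concat (take j bs) @ d @ concat (drop (Suc j) bs)))"
    using sap_hadamards[of "concat (take j bs)" "j * m" "bs ! j" m \<phi> "concat (drop (Suc j) bs)"]
      split(2) m j by (simp only: split(1)[symmetric] nth_mem)
  also have "\<dots> = ct (map had1 (bs ! j)) (\<lambda>d. ct ((map2 (\<lambda>K b. K b) Cs bs)[j := (Cs ! j) d]) \<psi>)"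
  proof (rule ct_cong)
    fix d :: bits assume "length d = length (map had1 (bs ! j))"
    then have "length d = m" using m j by simp
    then have "\<forall>b\<in>set (bs[j := d]). length b = m"
      using m by (auto dest: set_update_subset_insert[THEN subsetD])
    then have "\<phi> (concat (bs[j := d])) = ct (map2 (\<lambda>K b. K b) Cs (bs[j := d])) \<psi>"
      using assms(1) len unfolding agrees_def by simp
    then show "\<phi> (concat (take j bs) @ d @ concat (drop (Suc j) bs))
        = ct ((map2 (\<lambda>K b. K b) Cs bs)[j := (Cs ! j) d]) \<psi>"
      using map2_update(2)[of Cs bs j "\<lambda>K b. K b" d] len assms(2) j by (simp add: upd_conv_take_nth_drop)
  qed
  also have "\<dots> = ct ((map2 (\<lambda>K b. K b) Cs bs)[j := \<lambda>s. ct (map had1 (bs ! j)) (\<lambda>d. (Cs ! j) d s)]) \<psi>"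
    by (rule ct_update[symmetric]) (use len j in simp)
  also have "\<dots> = ct (map2 (\<lambda>K b. K b) (Cs[j := hadamard_kern (Cs ! j)]) bs) \<psi>"
    using map2_update(1)[of Cs bs j "\<lambda>K b. K b" "hadamard_kern (Cs ! j)"] len assms(2)
    by (simp add: hadamard_kern_def[abs_def])
  finally show "sap (j * m) 1 (replicate m had_kern) \<phi> (concat bs)
      = ct (map2 (\<lambda>K b. K b) (Cs[j := hadamard_kern (Cs ! j)]) bs) \<psi>" .
qed

text \<open>Projecting onto an outcome zeroes the rows of that position at all other
  strings.\<close>

lemma agrees_keep:
  assumes "agrees m Cs \<psi> \<phi>" "j < length Cs"
  shows "agrees m (Cs[j := \<lambda>b s. if b = z then (Cs ! j) b s else 0]) \<psi> (keep (slice (j * m) m) z \<phi>)"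
  unfolding agrees_def
proof (intro allI impI)
  let ?C = "\<lambda>b s. if b = z then (Cs ! j) b s else 0"
  fix bs :: "bits list"
  assume bs: "length bs = length (Cs[j := ?C])" "\<forall>b\<in>set bs. length b = m"
  then have len: "length bs = length Cs" and m: "\<And>b. b \<in> set bs \<Longrightarrow> length b = m" by auto
  have j: "j < length bs" using len assms(2) by simp
  have \<phi>: "\<phi> (concat bs) = ct (map2 (\<lambda>K b. K b) Cs bs) \<psi>"
    using assms(1) len m unfolding agrees_def by simp
  have u: "map2 (\<lambda>K b. K b) (Cs[j := ?C]) bs = (map2 (\<lambda>K b. K b) Cs bs)[j := ?C (bs ! j)]"
    by (rule map2_update(1)) (use len assms(2) in simp_all)
  show "keep (slice (j * m) m) z \<phi> (concat bs) = ct (map2 (\<lambda>K b. K b) (Cs[j := ?C]) bs) \<psi>"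
  proof (cases "bs ! j = z")
    case True
    have "(Cs ! j) (bs ! j) = map2 (\<lambda>K b. K b) Cs bs ! j" using j len by simp
    then have "(map2 (\<lambda>K b. K b) Cs bs)[j := (Cs ! j) (bs ! j)] = map2 (\<lambda>K b. K b) Cs bs"
      by (simp only: list_update_id)
    moreover have "?C (bs ! j) = (Cs ! j) (bs ! j)" using True by (simp add: fun_eq_iff)
    ultimately show ?thesis
      unfolding u using True by (simp add: keep_def slice_concat[OF j m] \<phi>)
  next
    case False
    have "?C (bs ! j) = (\<lambda>s. 0)" using False by (simp add: fun_eq_iff)
    then show ?thesis
      unfolding u using False j len by (simp add: keep_def slice_concat[OF j m] ct_update_0)
  qed
qed

text \<open>Openings at distinct positions touch distinct kernels, so what remains of them is which
  positions received Hadamard gates and whether the contents match \<open>zs\<close>. A position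
  opened twice would meet an already modified kernel.\<close>

lemma open_branch_ct:
  assumes "agrees m Cs \<psi> \<phi>" "length bs = length Cs" "\<And>b. b \<in> set bs \<Longrightarrow> length b = m"
    and "distinct (map fst jbs)" "\<And>j b. (j, b) \<in> set jbs \<Longrightarrow> j < length Cs" "length zs = length jbs"
  shows "open_branch m jbs zs \<phi> (concat bs) = (if map (\<lambda>(j, b). bs ! j) jbs = zs
    then ct (map (\<lambda>j. hadamard_if ((j, False) \<in> set jbs) (Cs ! j) (bs ! j)) [0..<length Cs]) \<psi> else 0)"
  using assms
proof (induction jbs arbitrary: Cs zs \<phi>)
  case Nil
  have "map2 (\<lambda>K b. K b) Cs bs = map (\<lambda>j. (Cs ! j) (bs ! j)) [0..<length Cs]"
    using Nil.prems(2) by (intro nth_equalityI) simp_all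
  then show ?case
    using Nil.prems unfolding agrees_def by (simp add: hadamard_if_def)
next
  case (Cons jb jbs)
  obtain j b where jb: "jb = (j, b)" by (cases jb)
  obtain z zs' where zs: "zs = z # zs'" using Cons.prems(6) by (cases zs) auto
  have j: "j < length Cs" using Cons.prems(5) jb by auto
  let ?Cs1 = "Cs[j := hadamard_if (\<not> b) (Cs ! j)]"
  let ?\<phi>1 = "if b then \<phi> else sap (j * m) 1 (replicate m had_kern) \<phi>"
  let ?C = "\<lambda>b' s. if b' = z then hadamard_if (\<not> b) (Cs ! j) b' s else 0"
  have "agrees m ?Cs1 \<psi> ?\<phi>1"
    using agrees_hadamards[OF Cons.prems(1) j] Cons.prems(1) by (simp add: hadamard_if_def)
  from agrees_keep[OF this, of j z]
  have ag: "agrees m (Cs[j := ?C]) \<psi> (keep (slice (j * m) m) z ?\<phi>1)"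
    by (simp only: nth_list_update_eq[OF j] list_update_overwrite length_list_update j)
  have "open_branch m (jb # jbs) zs \<phi> (concat bs)
      = open_branch m jbs zs' (keep (slice (j * m) m) z ?\<phi>1) (concat bs)"
    by (simp add: jb zs)
  also have "\<dots> = (if map (\<lambda>(j, b). bs ! j) jbs = zs' then ct (map (\<lambda>i. hadamard_if ((i, False) \<in> set jbs)
      (Cs[j := ?C] ! i) (bs ! i)) [0..<length (Cs[j := ?C])]) \<psi> else 0)"
    by (rule Cons.IH[OF ag]) (use Cons.prems zs in auto)
  also have "map (\<lambda>i. hadamard_if ((i, False) \<in> set jbs) (Cs[j := ?C] ! i) (bs ! i)) [0..<length (Cs[j := ?C])]
      = (map (\<lambda>i. hadamard_if ((i, False) \<in> set (jb # jbs)) (Cs ! i) (bs ! i)) [0..<length Cs])[j := ?C (bs ! j)]"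
    (is "?l = ?r")
  proof (rule nth_equalityI)
    fix i assume "i < length ?l"
    then have i: "i < length Cs" by simp
    have "(j, False) \<notin> set jbs" using Cons.prems(4) jb by force
    then show "?l ! i = ?r ! i"
      using i j by (cases "i = j") (simp_all add: jb hadamard_if_def)
  qed simp
  finally have *: "open_branch m (jb # jbs) zs \<phi> (concat bs)
      = (if map (\<lambda>(j, b). bs ! j) jbs = zs' then ct ?r \<psi> else 0)" .
  show ?case
  proof (cases "bs ! j = z")
    case True
    let ?R = "map (\<lambda>i. hadamard_if ((i, False) \<in> set (jb # jbs)) (Cs ! i) (bs ! i)) [0..<length Cs]"
    have "(j, False) \<notin> set jbs" using Cons.prems(4) jb by force
    then have "?C (bs ! j) = ?R ! j"
      using True j by (auto simp: fun_eq_iff jb hadamard_if_def)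
    then have "?r = ?R" by (simp only: list_update_id)
    then show ?thesis unfolding * using True by (simp add: jb zs)
  next
    case False
    then have "?C (bs ! j) = (\<lambda>s. 0)" by (simp add: fun_eq_iff)
    then have "ct ?r \<psi> = 0" using j by (simp only: ct_update_0 length_map length_upt diff_zero)
    then show ?thesis unfolding * using False by (simp add: jb zs)
  qed
qed

lemma agrees_sap: "agrees m Cs \<psi> (sap 0 m Cs \<psi>)"
  unfolding agrees_def
proof (intro allI impI)
  fix bs :: "bits list" assume "length bs = length Cs" "\<forall>b\<in>set bs. length b = m"
  then show "sap 0 m Cs \<psi> (concat bs) = ct (map2 (\<lambda>K b. K b) Cs bs) \<psi>"
    using sap_ct[of "[]" 0 bs Cs m \<psi> "[]"] by simp
qed

section \<open>Sums over blocks and finitely supported distributions\<close>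

lemma sum_concat_blocks:
  "(\<Sum>b\<in>bitstr (r * m). f b) = (\<Sum>bs\<in>listset (replicate r (bitstr m)). f (concat bs))"
proof (induction r arbitrary: f)
  case (Suc r)
  have "(\<Sum>b\<in>bitstr (Suc r * m). f b) = (\<Sum>b\<in>bitstr m. \<Sum>a\<in>bitstr (r * m). f (b @ a))"
    unfolding mult_Suc by (rule sum_bitstr_append)
  also have "\<dots> = (\<Sum>bs\<in>listset (replicate (Suc r) (bitstr m)). f (concat bs))"
    unfolding replicate_Suc sum_listset_Cons Suc by simp
  finally show ?case .
qed simp

lemma sum_product_lists:
  assumes "\<And>xs. xs \<in> set xss \<Longrightarrow> distinct xs"
  shows "(\<Sum>ts\<leftarrow>product_lists xss. f ts) = (\<Sum>ts\<in>listset (map set xss). f ts)"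
  using assms
proof (induction xss arbitrary: f)
  case (Cons xs xss)
  have "(\<Sum>ts\<leftarrow>product_lists (xs # xss). f ts) = (\<Sum>x\<leftarrow>xs. \<Sum>ts\<leftarrow>product_lists xss. f (x # ts))"
    by (simp add: sum_list_concat_map o_def)
  also have "\<dots> = (\<Sum>x\<leftarrow>xs. \<Sum>ts\<in>listset (map set xss). f (x # ts))"
    using Cons by simp
  also have "\<dots> = (\<Sum>x\<in>set xs. \<Sum>ts\<in>listset (map set xss). f (x # ts))"
    using Cons.prems by (simp add: sum_list_distinct_conv_sum_set)
  finally show ?case unfolding list.map(2) sum_listset_Cons .
qed simp

lemma sum_triple:
  "(\<Sum>x\<in>A \<times> (B \<times> C). g x) = (\<Sum>a\<in>A. \<Sum>b\<in>B. \<Sum>c\<in>C. g (a, b, c))"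
  by (simp add: sum.cartesian_product split_def)

lemma sum_listset_zip3:
  fixes f :: "('a \<times> 'b \<times> 'c) list \<Rightarrow> 'd :: comm_monoid_add"
  shows "(\<Sum>os\<in>listset (map (\<lambda>i. Y i \<times> (T i \<times> B i)) is). f os)
    = (\<Sum>ys\<in>listset (map Y is). \<Sum>ts\<in>listset (map T is). \<Sum>bs\<in>listset (map B is). f (zip ys (zip ts bs)))"
proof (induction "is" arbitrary: f)
  case (Cons i "is")
  let ?Y = "listset (map Y is)" and ?T = "listset (map T is)" and ?B = "listset (map B is)"
  have "(\<Sum>os\<in>listset (map (\<lambda>i. Y i \<times> (T i \<times> B i)) (i # is)). f os)
     = (\<Sum>y\<in>Y i. \<Sum>t\<in>T i. \<Sum>b\<in>B i. \<Sum>ys\<in>?Y. \<Sum>ts\<in>?T. \<Sum>bs\<in>?B. f ((y, t, b) # zip ys (zip ts bs)))"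
    unfolding list.map(2) sum_listset_Cons Cons by (simp only: sum_triple)
  also have "\<dots> = (\<Sum>y\<in>Y i. \<Sum>ys\<in>?Y. \<Sum>t\<in>T i. \<Sum>ts\<in>?T. \<Sum>b\<in>B i. \<Sum>bs\<in>?B. f ((y, t, b) # zip ys (zip ts bs)))"
  proof (rule sum.cong[OF refl])
    fix y
    have "(\<Sum>t\<in>T i. \<Sum>b\<in>B i. \<Sum>ys\<in>?Y. \<Sum>ts\<in>?T. \<Sum>bs\<in>?B. f ((y, t, b) # zip ys (zip ts bs)))
       = (\<Sum>t\<in>T i. \<Sum>ys\<in>?Y. \<Sum>b\<in>B i. \<Sum>ts\<in>?T. \<Sum>bs\<in>?B. f ((y, t, b) # zip ys (zip ts bs)))"
      by (intro sum.cong refl sum.swap)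
    also have "\<dots> = (\<Sum>ys\<in>?Y. \<Sum>t\<in>T i. \<Sum>b\<in>B i. \<Sum>ts\<in>?T. \<Sum>bs\<in>?B. f ((y, t, b) # zip ys (zip ts bs)))"
      by (rule sum.swap)
    also have "\<dots> = (\<Sum>ys\<in>?Y. \<Sum>t\<in>T i. \<Sum>ts\<in>?T. \<Sum>b\<in>B i. \<Sum>bs\<in>?B. f ((y, t, b) # zip ys (zip ts bs)))"
      by (intro sum.cong refl sum.swap)
    finally show "(\<Sum>t\<in>T i. \<Sum>b\<in>B i. \<Sum>ys\<in>?Y. \<Sum>ts\<in>?T. \<Sum>bs\<in>?B. f ((y, t, b) # zip ys (zip ts bs)))
       = (\<Sum>ys\<in>?Y. \<Sum>t\<in>T i. \<Sum>ts\<in>?T. \<Sum>b\<in>B i. \<Sum>bs\<in>?B. f ((y, t, b) # zip ys (zip ts bs)))" .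
  qed
  finally show ?case unfolding list.map(2) sum_listset_Cons by simp
qed simp

text \<open>Both have total mass 1, so no inequality can be strict. Distributions can thus be
  compared by a one-sided computation.\<close>

lemma pmf_le_imp_eq:
  assumes "\<And>x. pmf p x \<le> pmf q x"
  shows "p = q"
proof (rule pmf_eqI)
  fix x
  have "emeasure p (- {x}) \<le> emeasure q (- {x})"
    unfolding nn_integral_pmf[symmetric] by (intro nn_integral_mono ennreal_leI assms)
  then have "measure_pmf.prob p (- {x}) \<le> measure_pmf.prob q (- {x})"
    by (simp add: measure_pmf.emeasure_eq_measure)
  then have "1 - pmf p x \<le> 1 - pmf q x"
    by (simp add: measure_pmf_single measure_pmf.prob_compl[of "{x}", simplified] Compl_eq_Diff_UNIV)
  then show "pmf p x = pmf q x" using assms[of x] by simp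
qed

lemma prob_finite_support:
  assumes "finite A" "\<And>x. x \<notin> A \<Longrightarrow> pmf p x = 0"
  shows "measure_pmf.prob p S = (\<Sum>x\<in>A. if x \<in> S then pmf p x else 0)"
proof -
  have "set_pmf p \<subseteq> A" using assms(2) by (metis set_pmf_iff subsetI)
  then have "measure_pmf.prob p S = measure_pmf.prob p (A \<inter> S)"
    by (intro measure_prob_cong_0) (auto simp: set_pmf_iff)
  also have "\<dots> = (\<Sum>x\<in>A \<inter> S. pmf p x)"
    using assms(1) by (simp add: measure_measure_pmf_finite)
  finally show ?thesis using assms(1) by (simp add: sum.inter_restrict)
qed

lemma finite_pmf_exists:
  assumes "finite A" "\<And>x. x \<in> A \<Longrightarrow> 0 \<le> f x" "(\<Sum>x\<in>A. f x) = 1"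
  obtains D where "\<And>x. pmf D x = (if x \<in> A then f x else (0 :: real))"
proof
  let ?f = "\<lambda>x. if x \<in> A then f x else 0"
  have "(\<integral>\<^sup>+ x. ennreal (?f x) \<partial>count_space UNIV) = (\<Sum>x\<in>A. ennreal (?f x))"
    by (rule nn_integral_count_space') (use assms in auto)
  also have "\<dots> = ennreal (\<Sum>x\<in>A. ?f x)" using assms(2) by (intro sum_ennreal) simp
  also have "\<dots> = 1" using assms(3) by simp
  finally show "pmf (embed_pmf ?f) x = ?f x" for x
    by (intro pmf_embed_pmf) (use assms(2) in auto)
qed

lemma wt_open_branch_0:
  assumes "wt n \<Phi> = 0" "\<And>\<phi>. \<phi> \<in> set \<Phi> \<Longrightarrow> supp n \<phi>"
  shows "wt n (map (open_branch m jbs zs) \<Phi>) = 0"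
  unfolding wt_def
proof (rule sum_list_zero)
  fix \<omega> assume "\<omega> \<in> set (map (open_branch m jbs zs) \<Phi>)"
  then obtain \<phi> where \<phi>: "\<phi> \<in> set \<Phi>" "\<omega> = open_branch m jbs zs \<phi>"
    unfolding set_map by blast
  have "\<phi> = (\<lambda>a. 0)" by (rule wt_eq_0[OF assms(1) \<phi>(1) assms(2)[OF \<phi>(1)]])
  then show "sq n \<omega> = 0" by (simp add: \<phi>(2) open_branch_0 sq_def)
qed

section \<open>The joint game as a single product measurement\<close>

definition ss_game ::
  "ntcf \<Rightarrow> nat \<Rightarrow> bits list \<Rightarrow> (nat \<times> bool) list \<Rightarrow> qstate \<Rightarrow> (bits list \<times> bits list) pmf" where
  "ss_game F lam pks jbs st =
     commit_ss F lam pks st \<bind> (\<lambda>(ys, \<rho>). map_pmf (Pair ys) (open_ss F lam jbs \<rho>))"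

lemma ss_game_mk:
  assumes "\<And>pk. pk \<in> set pks \<Longrightarrow> unit_prep F lam pk" "length pks = width F lam + 2"
    and v: "valid l \<Psi>" and jbs: "\<And>j b. (j, b) \<in> set jbs \<Longrightarrow> j < l"
  obtains R where "ss_game F lam pks jbs (mk l \<Psi>) = map_pmf (\<lambda>(xs, zs). (map commit_hash xs, zs)) R"
    "\<And>xs zs. pmf R (xs, zs) = (if length zs = length jbs
       then wt (l * blk F lam) (map (open_branch (blk F lam) jbs zs) (concat (map (commit_branch F lam pks l xs) \<Psi>)))
         / wt l \<Psi> else 0)"
proof -
  let ?N = "l * blk F lam"
  let ?\<Phi> = "\<lambda>xs. concat (map (commit_branch F lam pks l xs) \<Psi>)"
  have imp: "implements l ?N (commit_from F lam pks l 0) (map commit_hash) (commit_branch F lam pks l)"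
    by (rule implements_commit_from[OF assms(1,2)])
  obtain Q where Q: "commit_from F lam pks l 0 (mk l \<Psi>) = map_pmf (\<lambda>xs. (map commit_hash xs, mk ?N (?\<Phi> xs))) Q"
    "\<And>xs. pmf Q xs = wt ?N (?\<Phi> xs) / wt l \<Psi>"
    using imp v unfolding implements_def by blast
  have s: "supp ?N \<phi>" if "\<phi> \<in> set (?\<Phi> xs)" for \<phi> xs
    using that imp v unfolding implements_def valid_def set_concat set_map by blast
  have le: "j * blk F lam + blk F lam \<le> ?N" if "(j, b) \<in> set jbs" for j b
    using jbs[OF that] by (metis Suc_leI add.commute mult_Suc mult_le_mono1)
  let ?R = "bind_pmf Q (\<lambda>xs. map_pmf (Pair xs) (open_ss F lam jbs (mk ?N (?\<Phi> xs))))"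
  show ?thesis
  proof (rule that)
    show "ss_game F lam pks jbs (mk l \<Psi>) = map_pmf (\<lambda>(xs, zs). (map commit_hash xs, zs)) ?R"
      unfolding ss_game_def commit_ss_def
      by (simp add: mk_def[of l] Q(1)[unfolded mk_def[of l]] bind_map_pmf map_bind_pmf map_pmf_comp)
  next
    fix xs zs
    show "pmf ?R (xs, zs) = (if length zs = length jbs
       then wt ?N (map (open_branch (blk F lam) jbs zs) (?\<Phi> xs)) / wt l \<Psi> else 0)"
    proof (cases "wt ?N (?\<Phi> xs) = 0")
      case True
      then show ?thesis
        using wt_open_branch_0[OF True s] by (simp add: pmf_dependent_pair Q(2))
    next
      case False
      then have "valid ?N (?\<Phi> xs)"
        unfolding valid_def using wt_nonneg[of ?N "?\<Phi> xs"] s by (metis order_le_imp_less_or_eq)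
      from open_ss_pmf[OF this le]
      show ?thesis using False by (simp add: pmf_dependent_pair Q(2))
    qed
  qed
qed

type_synonym outcome = "(bits \<times> bits list) \<times> (bits \<times> bits list) \<times> bits"

text \<open>\<open>\<beta>\<close> says that the residual qubits get Hadamard gates before they are
  read, as in an opening for the standard basis. An unopened position has \<open>\<beta>\<close>
  false: it is treated as read without gates, and the result is ignored.\<close>

definition game_kern :: "ntcf \<Rightarrow> nat \<Rightarrow> bits list \<Rightarrow> bool \<Rightarrow> outcome \<Rightarrow> bool \<Rightarrow> complex" where
  "game_kern F lam pks \<beta> = (\<lambda>(x, t, b). hadamard_if \<beta> (commit_kern F lam pks x t) b)"

definition commitments :: "ntcf \<Rightarrow> nat \<Rightarrow> (bits \<times> bits list) set" where
  "commitments F lam = bitstr (rlen F lam) \<times> listset (replicate (width F lam + 1) (bitstr (rlen F lam)))"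

lemma finite_commitments: "finite (commitments F lam)"
  unfolding commitments_def by (intro finite_cartesian_product finite_bitstr finite_listset) auto

definition hidden_set :: "ntcf \<Rightarrow> nat \<Rightarrow> bits list \<Rightarrow> (bits \<times> bits list) set" where
  "hidden_set F lam pks = bitstr (hidden F lam (hd pks))
     \<times> listset (map (\<lambda>pk. bitstr (hidden F lam pk)) (tl pks))"

definition outcomes :: "ntcf \<Rightarrow> nat \<Rightarrow> bits list \<Rightarrow> outcome set" where
  "outcomes F lam pks = commitments F lam \<times> (hidden_set F lam pks \<times> bitstr (blk F lam))"

lemma distinct_strs: "distinct (strs n)"
  by (simp add: distinct_n_lists)

lemma product_lists_listset: "set (product_lists xss) = listset (map set xss)"
  by (induction xss) (auto simp: set_Cons_def)

lemma distinct_hidden_list: "distinct (hidden_list F lam pks)"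
  unfolding hidden_list_def
  by (intro distinct_product distinct_strs distinct_product_lists) (auto simp: distinct_strs)

lemma set_hidden_list: "set (hidden_list F lam pks) = hidden_set F lam pks"
  by (simp add: hidden_list_def hidden_set_def product_lists_listset o_def)

lemma hadamarded_positions:
  assumes "length xs = l" "length ts = l" "length bs = l"
  shows "map2 (game_kern F lam pks) (map (\<lambda>j. (j, False) \<in> set jbs) [0..<l]) (zip xs (zip ts bs))
    = map (\<lambda>j. hadamard_if ((j, False) \<in> set jbs)
        (map2 (commit_kern F lam pks) xs ts ! j) (bs ! j)) [0..<l]"
  using assms by (intro nth_equalityI) (simp_all add: game_kern_def)

text \<open>The squared norm of a branch sums over the contents of all blocks, so unopened blocks
  are in effect measured and forgotten.\<close>

lemma wt_game:
  assumes xs: "length xs = l" "\<And>x. x \<in> set xs \<Longrightarrow> length (snd x) = width F lam + 1"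
    and jbs: "distinct (map fst jbs)" "\<And>j b. (j, b) \<in> set jbs \<Longrightarrow> j < l" "length zs = length jbs"
  shows "wt (l * blk F lam) (map (open_branch (blk F lam) jbs zs) (commit_branch F lam pks l xs \<psi>))
    = (\<Sum>ts\<in>listset (replicate l (hidden_set F lam pks)). \<Sum>bs\<in>listset (replicate l (bitstr (blk F lam))).
        if map (\<lambda>(j, b). bs ! j) jbs = zs then
          (cmod (ct (map2 (game_kern F lam pks) (map (\<lambda>j. (j, False) \<in> set jbs) [0..<l]) (zip xs (zip ts bs))) \<psi>))\<^sup>2
        else 0)"
proof -
  let ?m = "blk F lam"
  let ?Cs = "\<lambda>ts. map2 (commit_kern F lam pks) xs ts"
  have h: "map2 (\<lambda>_. hidden1 F lam pks) (replicate l ()) xs = replicate l (hidden_list F lam pks)"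
    using xs by (intro nth_equalityI) (simp_all add: hidden1_def)
  have c: "map (\<lambda>(i, x, t). commit_kern F lam pks x t) (zip (replicate l ()) (zip xs ts)) = ?Cs ts"
    if "length ts = l" for ts
    using xs(1) that by (intro nth_equalityI) simp_all
  have PL: "(\<Sum>ts\<leftarrow>product_lists (replicate l (hidden_list F lam pks)). f ts)
      = (\<Sum>ts\<in>listset (replicate l (hidden_set F lam pks)). f ts)" for f :: "_ \<Rightarrow> real"
    using sum_product_lists[of "replicate l (hidden_list F lam pks)" f] distinct_hidden_list
    by (simp add: set_hidden_list)
  have "wt (l * ?m) (map (open_branch ?m jbs zs) (commit_branch F lam pks l xs \<psi>))
      = (\<Sum>ts\<leftarrow>product_lists (replicate l (hidden_list F lam pks)). sq (l * ?m) (open_branch ?m jbs zs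
          (sap 0 ?m (map (\<lambda>(i, x, t). commit_kern F lam pks x t) (zip (replicate l ()) (zip xs ts))) \<psi>)))"
    unfolding seq_branch_def h using xs(1) by (simp add: wt_def o_def)
  also have "\<dots> = (\<Sum>ts\<in>listset (replicate l (hidden_set F lam pks)). sq (l * ?m) (open_branch ?m jbs zs
          (sap 0 ?m (map (\<lambda>(i, x, t). commit_kern F lam pks x t) (zip (replicate l ()) (zip xs ts))) \<psi>)))"
    by (rule PL)
  also have "\<dots> = (\<Sum>ts\<in>listset (replicate l (hidden_set F lam pks)). \<Sum>bs\<in>listset (replicate l (bitstr ?m)).
        if map (\<lambda>(j, b). bs ! j) jbs = zs then
          (cmod (ct (map2 (game_kern F lam pks) (map (\<lambda>j. (j, False) \<in> set jbs) [0..<l]) (zip xs (zip ts bs))) \<psi>))\<^sup>2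
        else 0)"
    unfolding sq_def sum_concat_blocks
  proof (intro sum.cong refl)
    fix ts bs
    assume "ts \<in> listset (replicate l (hidden_set F lam pks))" "bs \<in> listset (replicate l (bitstr ?m))"
    then have ts: "length ts = l" and bs: "length bs = l" "\<And>b. b \<in> set bs \<Longrightarrow> length b = ?m"
      by (auto simp: listset_eq list_all2_conv_all_nth in_set_conv_nth)
    have lC: "length (?Cs ts) = l" using xs(1) ts by simp
    have "open_branch ?m jbs zs (sap 0 ?m (?Cs ts) \<psi>) (concat bs) = (if map (\<lambda>(j, b). bs ! j) jbs = zs
        then ct (map (\<lambda>j. hadamard_if ((j, False) \<in> set jbs) (?Cs ts ! j) (bs ! j)) [0..<length (?Cs ts)]) \<psi> else 0)"
      by (rule open_branch_ct[OF agrees_sap]) (use lC bs jbs in auto)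
    then show "(cmod (open_branch ?m jbs zs (sap 0 ?m (map (\<lambda>(i, x, t). commit_kern F lam pks x t)
          (zip (replicate l ()) (zip xs ts))) \<psi>) (concat bs)))\<^sup>2
        = (if map (\<lambda>(j, b). bs ! j) jbs = zs then
          (cmod (ct (map2 (game_kern F lam pks) (map (\<lambda>j. (j, False) \<in> set jbs) [0..<l]) (zip xs (zip ts bs))) \<psi>))\<^sup>2
          else 0)"
      unfolding c[OF ts] lC hadamarded_positions[OF xs(1) ts bs(1)] by simp
  qed
  finally show ?thesis .
qed

definition visible :: "(nat \<times> bool) list \<Rightarrow> outcome list \<Rightarrow> bits list \<times> bits list" where
  "visible jbs os = (map (commit_hash \<circ> fst) os, map (\<lambda>(j, b). snd (snd (os ! j))) jbs)"

text \<open>\<open>D\<close> draws complete outcomes, hidden contents included, by Born's rule for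
  the product kernel; isometry makes this a distribution. The actual game is its visible
  part.\<close>

lemma game_distribution:
  assumes pks: "\<And>pk. pk \<in> set pks \<Longrightarrow> unit_prep F lam pk" "length pks = width F lam + 2"
    and v: "valid l \<Psi>"
    and jbs: "distinct (map fst jbs)" "\<And>j b. (j, b) \<in> set jbs \<Longrightarrow> j < l"
    and iso: "\<And>\<beta>. iso (game_kern F lam pks \<beta>) (outcomes F lam pks)"
    and is_def: "is = map (\<lambda>j. (j, False) \<in> set jbs) [0..<l]"
  obtains D where "ss_game F lam pks jbs (mk l \<Psi>) = map_pmf (visible jbs) D"
    "\<And>os. pmf D os = (if os \<in> listset (map (\<lambda>_. outcomes F lam pks) is)
       then (\<Sum>\<psi>\<leftarrow>\<Psi>. (cmod (ct (map2 (game_kern F lam pks) is os) \<psi>))\<^sup>2) / wt l \<Psi> else 0)"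
proof -
  let ?A = "outcomes F lam pks" and ?k = "game_kern F lam pks"
  let ?O = "listset (map (\<lambda>_. ?A) is)"
  let ?w = "\<lambda>os. (\<Sum>\<psi>\<leftarrow>\<Psi>. (cmod (ct (map2 ?k is os) \<psi>))\<^sup>2) / wt l \<Psi>"
  have pos: "0 < wt l \<Psi>" using v by (simp add: valid_def)
  have len: "length is = l" by (simp add: is_def)
  have finO: "finite ?O" using iso by (intro finite_listset) (auto simp: iso_def)
  have "(\<Sum>os\<in>?O. (\<Sum>\<psi>\<leftarrow>\<Psi>. (cmod (ct (map2 ?k is os) \<psi>))\<^sup>2)) = wt l \<Psi>"
    using ct_isometry[of "is" ?k "\<lambda>_. ?A"] iso by (simp add: wt_def len flip: sum_list_swap)
  then have sum1: "(\<Sum>os\<in>?O. ?w os) = 1" using pos by (simp flip: sum_divide_distrib)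
  have nn: "0 \<le> ?w os" for os
    using pos by (intro divide_nonneg_nonneg sum_list_nonneg) auto
  obtain D where D: "\<And>os. pmf D os = (if os \<in> ?O then ?w os else 0)"
    using finite_pmf_exists[OF finO nn sum1] by blast
  obtain R where R: "ss_game F lam pks jbs (mk l \<Psi>) = map_pmf (\<lambda>(xs, zs). (map commit_hash xs, zs)) R"
    "\<And>xs zs. pmf R (xs, zs) = (if length zs = length jbs
       then wt (l * blk F lam) (map (open_branch (blk F lam) jbs zs) (concat (map (commit_branch F lam pks l xs) \<Psi>)))
         / wt l \<Psi> else 0)"
    by (rule ss_game_mk[OF pks v, where jbs = jbs]) (use jbs(2) that in \<open>(assumption | blast)+\<close>)
  let ?z = "\<lambda>os. map (\<lambda>(j, b). snd (snd (os ! j))) jbs"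
  let ?g = "\<lambda>os. (map fst os, ?z os)"
  have "map_pmf ?g D = R"
  \<comment> \<open>Only one inequality is proved, so for lists \<open>xs\<close> outside
    \<open>?X\<close>, where the left side is 0, the right side need not be computed.\<close>
  proof (rule pmf_le_imp_eq)
    fix p :: "(bits \<times> bits list) list \<times> bits list"
    obtain xs zs where p: "p = (xs, zs)" by (cases p)
    let ?X = "listset (map (\<lambda>_. commitments F lam) is)"
    let ?T = "listset (replicate l (hidden_set F lam pks))"
    let ?B = "listset (replicate l (bitstr (blk F lam)))"
    let ?G = "\<lambda>xs. \<Sum>ts\<in>?T. \<Sum>bs\<in>?B. if map (\<lambda>(j, b). bs ! j) jbs = zs then ?w (zip xs (zip ts bs)) else 0"
    have rep: "map (\<lambda>_. c) is = replicate l c" for c :: 'z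
      using len by (simp add: map_replicate_const)
    have "pmf (map_pmf ?g D) p = measure_pmf.prob D (?g -` {p})"
      by (simp add: pmf_map)
    also have "\<dots> = (\<Sum>os\<in>?O. if os \<in> ?g -` {p} then pmf D os else 0)"
      by (rule prob_finite_support[OF finO]) (simp add: D)
    also have "\<dots> = (\<Sum>os\<in>?O. if ?g os = p then ?w os else 0)"
      by (intro sum.cong refl) (simp add: D)
    also have "\<dots> = (\<Sum>xs'\<in>?X. \<Sum>ts\<in>?T. \<Sum>bs\<in>?B.
        if ?g (zip xs' (zip ts bs)) = p then ?w (zip xs' (zip ts bs)) else 0)"
      unfolding outcomes_def rep[symmetric] by (rule sum_listset_zip3)
    also have "\<dots> = (\<Sum>xs'\<in>?X. if xs' = xs then ?G xs else 0)"
    proof (rule sum.cong[OF refl])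
      fix xs' assume x: "xs' \<in> ?X"
      have "(if ?g (zip xs' (zip ts bs)) = p then ?w (zip xs' (zip ts bs)) else 0)
          = (if xs' = xs then (if map (\<lambda>(j, b). bs ! j) jbs = zs then ?w (zip xs (zip ts bs)) else 0) else 0)"
        if "ts \<in> ?T" "bs \<in> ?B" for ts bs
      proof -
        have l: "length xs' = l" "length ts = l" "length bs = l"
          using x that len by (auto simp: listset_eq list_all2_conv_all_nth)
        have "?z (zip xs' (zip ts bs)) = map (\<lambda>(j, b). bs ! j) jbs"
          by (intro map_cong refl) (use jbs(2) l in auto)
        moreover have "map fst (zip xs' (zip ts bs)) = xs'" using l by simp
        ultimately show ?thesis
          by (cases "xs' = xs") (simp_all only: p prod.inject simp_thms if_False if_True)
      qed
      then have "(\<Sum>ts\<in>?T. \<Sum>bs\<in>?B. if ?g (zip xs' (zip ts bs)) = p then ?w (zip xs' (zip ts bs)) else 0)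
        = (\<Sum>ts\<in>?T. \<Sum>bs\<in>?B. if xs' = xs then
            (if map (\<lambda>(j, b). bs ! j) jbs = zs then ?w (zip xs (zip ts bs)) else 0) else 0)"
        by (intro sum.cong refl)
      then show "(\<Sum>ts\<in>?T. \<Sum>bs\<in>?B. if ?g (zip xs' (zip ts bs)) = p then ?w (zip xs' (zip ts bs)) else 0)
        = (if xs' = xs then ?G xs else 0)"
        by (cases "xs' = xs") simp_all
    qed
    also have "\<dots> = (if xs \<in> ?X then ?G xs else 0)"
    proof -
      have "finite ?X"
        by (intro finite_listset) (auto simp: finite_commitments)
      then show ?thesis by (rule sum.delta)
    qed
    also have "\<dots> \<le> pmf R (xs, zs)"
    proof (cases "xs \<in> ?X")
      case True
      show ?thesis
      proof (cases "length zs = length jbs")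
        case lz: True
        have x: "length xs = l" "\<And>x. x \<in> set xs \<Longrightarrow> length (snd x) = width F lam + 1"
          using True len by (auto simp: listset_eq list_all2_conv_all_nth in_set_conv_nth commitments_def)
        have g: "wt (l * blk F lam) (map (open_branch (blk F lam) jbs zs) (commit_branch F lam pks l xs \<psi>))
            = (\<Sum>ts\<in>?T. \<Sum>bs\<in>?B. if map (\<lambda>(j, b). bs ! j) jbs = zs
                then (cmod (ct (map2 ?k is (zip xs (zip ts bs))) \<psi>))\<^sup>2 else 0)" for \<psi>
          unfolding is_def by (rule wt_game[OF x jbs lz])
        have "wt (l * blk F lam) (map (open_branch (blk F lam) jbs zs) (concat (map (commit_branch F lam pks l xs) \<Psi>)))
            = (\<Sum>\<psi>\<leftarrow>\<Psi>. wt (l * blk F lam) (map (open_branch (blk F lam) jbs zs) (commit_branch F lam pks l xs \<psi>)))"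
          unfolding map_concat map_map wt_concat_map by (simp add: o_def)
        also have "\<dots> = (\<Sum>ts\<in>?T. \<Sum>bs\<in>?B. if map (\<lambda>(j, b). bs ! j) jbs = zs
            then (\<Sum>\<psi>\<leftarrow>\<Psi>. (cmod (ct (map2 ?k is (zip xs (zip ts bs))) \<psi>))\<^sup>2) else 0)"
          unfolding g sum_list_swap by (intro sum.cong refl) (simp add: sum_list_zero)
        finally have "pmf R (xs, zs) = ?G xs"
          unfolding R(2) using lz by (simp add: sum_divide_distrib if_distrib[of "\<lambda>x. x / _"] cong: if_cong)
        then show ?thesis using True by simp
      next
        case False
        then have "\<And>bs. map (\<lambda>(j, b). bs ! j) jbs \<noteq> zs" by auto
        then show ?thesis using True by simp
      qed
    qed simp
    finally show "pmf (map_pmf ?g D) p \<le> pmf R p" by (simp add: p)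
  qed
  then have "ss_game F lam pks jbs (mk l \<Psi>) = map_pmf (visible jbs) D"
    unfolding R(1) by (auto simp: map_pmf_comp visible_def[abs_def] o_def)
  then show ?thesis using that D by blast
qed

section \<open>Nested kernels\<close>

text \<open>\<open>v\<close> sends the qubit to a register of \<open>length is\<close> qubits with
  side outcome \<open>c\<close>, and each register qubit is then measured with its own family. A
  commitment followed by its opening has this shape.\<close>

definition nest ::
  "('c \<Rightarrow> bits \<Rightarrow> bool \<Rightarrow> complex) \<Rightarrow> ('i \<Rightarrow> 'o \<Rightarrow> bool \<Rightarrow> complex) \<Rightarrow> 'i list \<Rightarrow> 'c \<times> 'o list
     \<Rightarrow> bool \<Rightarrow> complex" where
  "nest v k is = (\<lambda>(c, os) s. ct (map2 k is os) (\<lambda>d. v c d s))"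

lemma braket_nest: "braket (nest v k is (c, os)) u = ct (map2 k is os) (\<lambda>d. braket (v c d) u)"
  unfolding nest_def case_prod_conv braket_commute[of _ u] ct_braket ..

lemma braket_nest_case:
  "braket (nest v k is x) u = (case x of (c, os) \<Rightarrow> ct (map2 k is os) (\<lambda>d. braket (v c d) u))"
  by (cases x) (simp add: braket_nest)

lemma iso_nest:
  assumes "iso (\<lambda>(c, d). v c d) (C \<times> bitstr (length is))" "\<And>i. i \<in> set is \<Longrightarrow> iso (k i) (A i)" "finite C"
  shows "iso (nest v k is) (C \<times> listset (map A is))"
  unfolding iso_def
proof (intro conjI allI)
  show "finite (C \<times> listset (map A is))"
    using assms(2,3) by (intro finite_cartesian_product finite_listset) (auto simp: iso_def)
  fix u
  have "(\<Sum>x\<in>C \<times> listset (map A is). (cmod (braket (nest v k is x) u))\<^sup>2)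
      = (\<Sum>c\<in>C. \<Sum>os\<in>listset (map A is). (cmod (ct (map2 k is os) (\<lambda>d. braket (v c d) u)))\<^sup>2)"
    by (simp only: sum.cartesian_product split_def braket_nest[of v k "is" "fst x" "snd x" for x, simplified])
  also have "\<dots> = (\<Sum>c\<in>C. sq (length is) (\<lambda>d. braket (v c d) u))"
    by (intro sum.cong refl ct_isometry assms(2))
  also have "\<dots> = vsq u"
    using assms(1) by (simp add: iso_def sq_def sum.cartesian_product split_def)
  finally show "(\<Sum>x\<in>C \<times> listset (map A is). (cmod (braket (nest v k is x) u))\<^sup>2) = vsq u" .
qed

text \<open>A second hybrid argument: the outer family is exchanged in front of the inner
  isometries, then \<open>ct_near\<close> exchanges the inner ones behind the isometry
  \<open>v'\<close>.\<close>

lemma near_nest: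
  fixes \<epsilon> \<epsilon>0 :: real
  assumes v: "iso (\<lambda>(c, d). v' c d) (C \<times> bitstr (length is))"
    "near \<epsilon>0 (\<lambda>(c, d). v c d) (\<lambda>(c, d). v' c d) (C \<times> bitstr (length is))"
    and k: "\<And>i. i \<in> set is \<Longrightarrow> iso (k i) (A i)" "\<And>i. i \<in> set is \<Longrightarrow> iso (k' i) (A i)"
    "\<And>i. i \<in> set is \<Longrightarrow> near \<epsilon> (k i) (k' i) (A i)"
    and "0 \<le> \<epsilon>0" "0 \<le> \<epsilon>"
  shows "near (\<epsilon>0 + length is * \<epsilon>) (nest v k is) (nest v' k' is) (C \<times> listset (map A is))"
  unfolding near_def
proof
  fix u
  let ?n = "length is" and ?L = "listset (map A is)"
  let ?X = "C \<times> ?L"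
  let ?f = "\<lambda>k v (c, os). ct (map2 k is os) (\<lambda>d. braket (v c d) u)"
  have "L2_set (\<lambda>x. cmod (?f k v x - ?f k' v' x)) ?X
      \<le> L2_set (\<lambda>x. cmod (?f k v x - ?f k v' x)) ?X + L2_set (\<lambda>x. cmod (?f k v' x - ?f k' v' x)) ?X"
    by (rule L2_set_norm_triangle) auto
  moreover have "L2_set (\<lambda>x. cmod (?f k v x - ?f k v' x)) ?X \<le> \<epsilon>0 * sqrt (vsq u)"
  proof -
    have "(\<Sum>x\<in>?X. (cmod (?f k v x - ?f k v' x))\<^sup>2)
        = (\<Sum>c\<in>C. \<Sum>os\<in>?L. (cmod (ct (map2 k is os) (\<lambda>d. braket (v c d) u - braket (v' c d) u)))\<^sup>2)"
      by (simp add: sum.cartesian_product split_def ct_diff)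
    also have "\<dots> = (\<Sum>c\<in>C. sq ?n (\<lambda>d. braket (v c d) u - braket (v' c d) u))"
      by (intro sum.cong refl ct_isometry k)
    also have "\<dots> \<le> \<epsilon>0\<^sup>2 * vsq u"
      using v(2) by (simp add: near_def sq_def sum.cartesian_product split_def)
    finally have "L2_set (\<lambda>x. cmod (?f k v x - ?f k v' x)) ?X \<le> sqrt (\<epsilon>0\<^sup>2 * vsq u)"
      unfolding L2_set_def by (intro real_sqrt_le_mono)
    then show ?thesis using \<open>0 \<le> \<epsilon>0\<close> by (simp add: real_sqrt_mult)
  qed
  moreover have "L2_set (\<lambda>x. cmod (?f k v' x - ?f k' v' x)) ?X \<le> ?n * \<epsilon> * sqrt (vsq u)"
  proof -
    have ct: "(\<Sum>os\<in>?L. (cmod (ct (map2 k is os) \<phi> - ct (map2 k' is os) \<phi>))\<^sup>2) \<le> (?n * \<epsilon>)\<^sup>2 * sq ?n \<phi>" for \<phi>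
    proof -
      have "(L2_set (\<lambda>os. cmod (ct (map2 k is os) \<phi> - ct (map2 k' is os) \<phi>)) ?L)\<^sup>2
          \<le> (?n * \<epsilon> * sqrt (sq ?n \<phi>))\<^sup>2"
        by (rule power_mono[OF ct_near[OF k \<open>0 \<le> \<epsilon>\<close>] L2_set_nonneg])
      then show ?thesis by (simp add: L2_set_def sum_nonneg power_mult_distrib)
    qed
    have "(\<Sum>x\<in>?X. (cmod (?f k v' x - ?f k' v' x))\<^sup>2)
        = (\<Sum>c\<in>C. \<Sum>os\<in>?L. (cmod (ct (map2 k is os) (\<lambda>d. braket (v' c d) u) - ct (map2 k' is os) (\<lambda>d. braket (v' c d) u)))\<^sup>2)"
      by (simp add: sum.cartesian_product split_def)
    also have "\<dots> \<le> (\<Sum>c\<in>C. (?n * \<epsilon>)\<^sup>2 * sq ?n (\<lambda>d. braket (v' c d) u))"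
      by (intro sum_mono ct)
    also have "\<dots> = (?n * \<epsilon>)\<^sup>2 * vsq u"
      using v(1) by (simp add: iso_def sq_def sum.cartesian_product split_def flip: sum_distrib_left)
    finally have "L2_set (\<lambda>x. cmod (?f k v' x - ?f k' v' x)) ?X \<le> sqrt ((?n * \<epsilon>)\<^sup>2 * vsq u)"
      unfolding L2_set_def by (intro real_sqrt_le_mono)
    then show ?thesis using \<open>0 \<le> \<epsilon>\<close> by (simp add: real_sqrt_mult)
  qed
  ultimately have "L2_set (\<lambda>x. cmod (?f k v x - ?f k' v' x)) ?X \<le> (\<epsilon>0 + ?n * \<epsilon>) * sqrt (vsq u)"
    by (simp add: algebra_simps)
  then have "(L2_set (\<lambda>x. cmod (?f k v x - ?f k' v' x)) ?X)\<^sup>2 \<le> ((\<epsilon>0 + ?n * \<epsilon>) * sqrt (vsq u))\<^sup>2"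
    by (intro power_mono L2_set_nonneg)
  then have "(\<Sum>x\<in>?X. (cmod (?f k v x - ?f k' v' x))\<^sup>2) \<le> (\<epsilon>0 + ?n * \<epsilon>)\<^sup>2 * vsq u"
    by (simp add: L2_set_def sum_nonneg power_mult_distrib)
  then show "(\<Sum>x\<in>?X. (cmod (braket (nest v k is x) u - braket (nest v' k' is x) u))\<^sup>2)
      \<le> (\<epsilon>0 + ?n * \<epsilon>)\<^sup>2 * vsq u"
    by (simp only: braket_nest_case)
qed

lemma nest_bad_inner:
  fixes \<delta> :: real
  assumes "iso (\<lambda>(c, d). v c d) (C \<times> bitstr (length is))" "\<And>i. i \<in> set is \<Longrightarrow> iso (k i) (A i)"
    and "\<And>i u. i \<in> set is \<Longrightarrow> (\<Sum>x\<in>A i. if bad i x then (cmod (braket (k i x) u))\<^sup>2 else 0) \<le> \<delta> * vsq u"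
  shows "(\<Sum>x\<in>C \<times> listset (map A is). if list_all2 (\<lambda>i x. \<not> bad i x) is (snd x) then 0
            else (cmod (braket (nest v k is x) u))\<^sup>2) \<le> length is * \<delta> * vsq u"
proof -
  have "(\<Sum>x\<in>C \<times> listset (map A is). if list_all2 (\<lambda>i x. \<not> bad i x) is (snd x) then 0
            else (cmod (braket (nest v k is x) u))\<^sup>2)
    = (\<Sum>c\<in>C. \<Sum>os\<in>listset (map A is). if list_all2 (\<lambda>i x. \<not> bad i x) is os then 0
            else (cmod (ct (map2 k is os) (\<lambda>d. braket (v c d) u)))\<^sup>2)"
    unfolding sum.cartesian_product by (intro sum.cong refl) (auto simp: braket_nest)
  also have "\<dots> \<le> (\<Sum>c\<in>C. length is * \<delta> * sq (length is) (\<lambda>d. braket (v c d) u))"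
    by (intro sum_mono ct_bad_mass assms(2,3))
  also have "\<dots> = length is * \<delta> * vsq u"
    using assms(1) by (simp add: iso_def sq_def sum.cartesian_product split_def flip: sum_distrib_left)
  finally show ?thesis .
qed

lemma ct_id: "ct (map id1 d) \<phi> = \<phi> d"
proof (induction d arbitrary: \<phi>)
  case (Cons s d)
  have "braket (id1 s) (\<lambda>s. \<phi> (s # a)) = \<phi> (s # a)" for a
    by (cases s) (simp_all add: braket_def id1_def UNIV_bool)
  then show ?case using Cons.IH by simp
qed simp

lemma map2_const: "length is = length vs \<Longrightarrow> map2 (\<lambda>_. f) is vs = map f vs"
  by (intro nth_equalityI) simp_all

text \<open>Inner families that resolve the standard basis reveal exactly the intermediate string,
  so an event about that string has the mass it would have if the register were read
  directly.\<close>

lemma nest_bad_outer: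
  assumes "\<And>i. i \<in> set is \<Longrightarrow> resolves (k i) (A i) (f i) id1" "finite C"
  shows "(\<Sum>x\<in>C \<times> listset (map A is). if bad (fst x) (map2 f is (snd x))
            then (cmod (braket (nest v k is x) u))\<^sup>2 else 0)
      = (\<Sum>x\<in>C \<times> bitstr (length is). if bad (fst x) (snd x) then (cmod (braket (v (fst x) (snd x)) u))\<^sup>2 else 0)"
proof -
  let ?L = "listset (map A is)"
  have fin: "finite ?L" using assms(1) by (intro finite_listset) (auto simp: resolves_def iso_def)
  have *: "(\<Sum>os\<in>?L. if P (map2 f is os) then (cmod (ct (map2 k is os) \<phi>))\<^sup>2 else 0)
     = (\<Sum>d\<in>bitstr (length is). if P d then (cmod (\<phi> d))\<^sup>2 else 0)" for P \<phi>
  proof -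
    have "(\<Sum>d\<in>bitstr (length is). if P d then (cmod (\<phi> d))\<^sup>2 else 0)
        = (\<Sum>d\<in>bitstr (length is). if P d then
            (\<Sum>os\<in>?L. if map2 f is os = d then (cmod (ct (map2 k is os) \<phi>))\<^sup>2 else 0) else 0)"
    proof (intro sum.cong refl)
      fix d assume "d \<in> bitstr (length is)"
      then have d: "length d = length is" by simp
      have "(\<Sum>os\<in>?L. if map2 f is os = d then (cmod (ct (map2 k is os) \<phi>))\<^sup>2 else 0)
          = (cmod (ct (map2 (\<lambda>_. id1) is d) \<phi>))\<^sup>2"
        by (rule ct_statistics) (use assms d orthonormal_id1 in auto)
      also have "\<dots> = (cmod (\<phi> d))\<^sup>2" by (simp add: map2_const d ct_id)
      finally show "(if P d then (cmod (\<phi> d))\<^sup>2 else 0) = (if P d then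
            (\<Sum>os\<in>?L. if map2 f is os = d then (cmod (ct (map2 k is os) \<phi>))\<^sup>2 else 0) else 0)"
        by simp
    qed
    also have "\<dots> = (\<Sum>d\<in>bitstr (length is). \<Sum>os\<in>?L. if map2 f is os = d then
        (if P d then (cmod (ct (map2 k is os) \<phi>))\<^sup>2 else 0) else 0)"
      by (intro sum.cong refl) (simp cong: if_cong)
    also have "\<dots> = (\<Sum>os\<in>?L. \<Sum>d\<in>bitstr (length is). if map2 f is os = d then
        (if P d then (cmod (ct (map2 k is os) \<phi>))\<^sup>2 else 0) else 0)"
      by (rule sum.swap)
    also have "\<dots> = (\<Sum>os\<in>?L. if P (map2 f is os) then (cmod (ct (map2 k is os) \<phi>))\<^sup>2 else 0)"
    proof (intro sum.cong refl)
      fix os assume "os \<in> ?L"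
      then have "map2 f is os \<in> bitstr (length is)"
        by (auto simp: listset_eq list_all2_conv_all_nth)
      then show "(\<Sum>d\<in>bitstr (length is). if map2 f is os = d then
        (if P d then (cmod (ct (map2 k is os) \<phi>))\<^sup>2 else 0) else 0)
        = (if P (map2 f is os) then (cmod (ct (map2 k is os) \<phi>))\<^sup>2 else 0)"
        by (subst sum.delta'[OF finite_bitstr]) (simp only: if_True)
    qed
    finally show ?thesis by (rule sym)
  qed
  have "(\<Sum>x\<in>C \<times> ?L. if bad (fst x) (map2 f is (snd x)) then (cmod (braket (nest v k is x) u))\<^sup>2 else 0)
     = (\<Sum>c\<in>C. \<Sum>os\<in>?L. if bad c (map2 f is os) then (cmod (ct (map2 k is os) (\<lambda>d. braket (v c d) u)))\<^sup>2 else 0)"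
    unfolding sum.cartesian_product by (intro sum.cong refl) (auto simp: braket_nest)
  also have "\<dots> = (\<Sum>x\<in>C \<times> bitstr (length is). if bad (fst x) (snd x) then (cmod (braket (v (fst x) (snd x)) u))\<^sup>2 else 0)"
    unfolding * by (simp add: sum.cartesian_product split_def)
  finally show ?thesis .
qed

text \<open>The Hadamard matrix squares to the identity, qubit by qubit.\<close>

lemma ct_had_had: "ct (map had1 m) (\<lambda>d. ct (map had1 d) \<phi>) = \<phi> m"
proof (induction m arbitrary: \<phi>)
  case (Cons s m)
  have hh: "braket (had1 s) (\<lambda>v. braket (had1 v) u) = u s" for u
    by (cases s) (simp_all add: braket_def had1_def UNIV_bool add_divide_distrib[symmetric]
        diff_divide_distrib[symmetric] flip: of_real_mult)
  have "ct (map had1 (s # m)) (\<lambda>d. ct (map had1 d) \<phi>)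
      = ct (map had1 m) (\<lambda>d. ct (map had1 d) (\<lambda>a. braket (had1 s) (\<lambda>v. braket (had1 v) (\<lambda>s. \<phi> (s # a)))))"
    by (simp add: ct_braket)
  also have "\<dots> = \<phi> (s # m)"
    by (simp add: Cons hh)
  finally show ?case .
qed simp

text \<open>Reading the register in the standard basis selects one outer row up to a scalar, so the
  label of the outer kernel is inherited.\<close>

lemma resolves_nest_id:
  assumes k: "\<And>i. i \<in> set is \<Longrightarrow> resolves (k i) (A i) (f i) id1"
    and v: "resolves (\<lambda>(c, d). v c d) (C \<times> bitstr (length is)) (\<lambda>(c, d). g c d) n" and "finite C"
  shows "resolves (nest v k is) (C \<times> listset (map A is)) (\<lambda>(c, os). g c (map2 f is os)) n"
  unfolding resolves_def
proof (intro conjI ballI)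
  show "iso (nest v k is) (C \<times> listset (map A is))"
    using assms by (intro iso_nest) (auto simp: resolves_def)
  fix x assume "x \<in> C \<times> listset (map A is)"
  then obtain c os where x: "x = (c, os)" "c \<in> C" "os \<in> listset (map A is)" by auto
  let ?d = "map2 f is os"
  have d: "length ?d = length is" using x(3) by (auto simp: listset_eq list_all2_conv_all_nth)
  obtain e where e: "\<And>\<phi>. ct (map2 k is os) \<phi> = e * ct (map2 (\<lambda>_. id1) is ?d) \<phi>"
    by (rule ct_resolves[where n = "\<lambda>_. id1", OF _ x(3)], erule k, rule that)
  have "\<exists>e'. v c ?d = (\<lambda>s. e' * n (g c ?d) s)"
    using v x(2) d unfolding resolves_def by fastforce
  then obtain e' where e': "v c ?d = (\<lambda>s. e' * n (g c ?d) s)" by blast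
  have "nest v k is x = (\<lambda>s. (e * e') * n (g c ?d) s)"
    unfolding x(1) nest_def case_prod_conv e map2_const[OF d[symmetric]] ct_id e'
    by (simp add: fun_eq_iff mult.assoc)
  then show "\<exists>e. nest v k is x = (\<lambda>s. e * n ((\<lambda>(c, os). g c (map2 f is os)) x) s)"
    by (auto simp: x(1))
qed

text \<open>Inner measurements in the Hadamard basis cancel the Hadamard layer of the outer kernel
  and leave the raw row of \<open>w\<close> at the string of labels.\<close>

lemma nest_hadamard_kern:
  assumes "\<And>i. i \<in> set is \<Longrightarrow> resolves (k i) (A i) (f i) had1" "os \<in> listset (map A is)"
  obtains e where "nest (\<lambda>c. hadamard_kern (w c)) k is (c, os) = (\<lambda>s. e * w c (map2 f is os) s)"
proof -
  let ?d = "map2 f is os"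
  have d: "length ?d = length is" using assms(2) by (auto simp: listset_eq list_all2_conv_all_nth)
  obtain e where e: "\<And>\<phi>. ct (map2 k is os) \<phi> = e * ct (map2 (\<lambda>_. had1) is ?d) \<phi>"
    by (rule ct_resolves[where n = "\<lambda>_. had1", OF _ assms(2)], erule assms(1), rule that)
  show ?thesis
    by (rule that[of e]) (simp only: nest_def case_prod_conv e map2_const[OF d[symmetric]]
        hadamard_kern_def ct_had_had)
qed

lemma resolves_nest_had:
  assumes k: "\<And>i. i \<in> set is \<Longrightarrow> resolves (k i) (A i) (f i) had1"
    and iso: "iso (\<lambda>(c, d). hadamard_kern (w c) d) (C \<times> bitstr (length is))" and "finite C"
    and w: "\<And>c m. c \<in> C \<Longrightarrow> length m = length is \<Longrightarrow> \<exists>e. w c m = (\<lambda>s. e * n (g c m) s)"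
  shows "resolves (nest (\<lambda>c. hadamard_kern (w c)) k is) (C \<times> listset (map A is)) (\<lambda>(c, os). g c (map2 f is os)) n"
  unfolding resolves_def
proof (intro conjI ballI)
  let ?v = "\<lambda>c. hadamard_kern (w c)"
  show "iso (nest ?v k is) (C \<times> listset (map A is))"
    using assms by (intro iso_nest) (auto simp: resolves_def)
  fix x assume "x \<in> C \<times> listset (map A is)"
  then obtain c os where x: "x = (c, os)" "c \<in> C" "os \<in> listset (map A is)" by auto
  let ?d = "map2 f is os"
  have d: "length ?d = length is" using x(3) by (auto simp: listset_eq list_all2_conv_all_nth)
  obtain e where e: "nest ?v k is (c, os) = (\<lambda>s. e * w c ?d s)"
    by (rule nest_hadamard_kern[OF _ x(3)], erule k, rule that)
  obtain e' where e': "w c ?d = (\<lambda>s. e' * n (g c ?d) s)" using w[OF x(2) d] by blast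
  have "nest ?v k is x = (\<lambda>s. (e * e') * n (g c ?d) s)"
    unfolding x(1) e e' by (simp add: fun_eq_iff mult.assoc)
  then show "\<exists>e. nest ?v k is x = (\<lambda>s. e * n ((\<lambda>(c, os). g c (map2 f is os)) x) s)"
    by (auto simp: x(1))
qed

lemma iso_bij:
  assumes "bij_betw e B A" "iso k A"
  shows "iso (\<lambda>x. k (e x)) B"
  unfolding iso_def
proof (intro conjI allI)
  show "finite B" using assms by (simp add: iso_def bij_betw_finite)
  show "(\<Sum>x\<in>B. (cmod (braket (k (e x)) u))\<^sup>2) = vsq u" for u
    using sum.reindex_bij_betw[OF assms(1), of "\<lambda>x. (cmod (braket (k x) u))\<^sup>2"] assms(2)
    by (simp add: iso_def)
qed

lemma near_bij:
  assumes "bij_betw e B A" "near \<epsilon> k k' A"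
  shows "near \<epsilon> (\<lambda>x. k (e x)) (\<lambda>x. k' (e x)) B"
  unfolding near_def
proof
  show "(\<Sum>x\<in>B. (cmod (braket (k (e x)) u - braket (k' (e x)) u))\<^sup>2) \<le> \<epsilon>\<^sup>2 * vsq u" for u
    using sum.reindex_bij_betw[OF assms(1), of "\<lambda>x. (cmod (braket (k x) u - braket (k' x) u))\<^sup>2"] assms(2)
    by (simp add: near_def)
qed

lemma resolves_bij:
  assumes "bij_betw e B A" "resolves k A f n"
  shows "resolves (\<lambda>x. k (e x)) B (\<lambda>x. f (e x)) n"
  unfolding resolves_def
proof (intro conjI ballI)
  show "iso (\<lambda>x. k (e x)) B"
    by (rule iso_bij[OF assms(1)]) (use assms(2) in \<open>simp add: resolves_def\<close>)
  fix x assume "x \<in> B"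
  then have "e x \<in> A" using assms(1) by (auto simp: bij_betw_def)
  then show "\<exists>c. k (e x) = (\<lambda>s. c * n (f (e x)) s)" using assms(2) by (simp add: resolves_def)
qed

section \<open>Kernels of the weak commitment\<close>

text \<open>\<open>weak_kern\<close> with the prepared vectors \<open>p\<close> as a parameter, so
  that the circuit and the exact range superposition are instances of one family.\<close>

definition wk :: "nat \<Rightarrow> nat \<Rightarrow> (bool \<Rightarrow> vec) \<Rightarrow> bits \<times> bits \<Rightarrow> bits \<Rightarrow> bool \<Rightarrow> complex" where
  "wk w r p = (\<lambda>(y, t) b s. if length b = Suc w \<and> hd b = s \<and> take r t = y then p s (tl b @ t) else 0)"

definition slots :: "nat \<Rightarrow> nat \<Rightarrow> (bits \<times> bits) set" where
  "slots r h = bitstr r \<times> bitstr h"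

lemma finite_slots [simp]: "finite (slots r h)"
  by (simp add: slots_def)

lemma braket_wk:
  "length b = Suc w \<Longrightarrow> braket (wk w r p (y, t) b) u = (if take r t = y then p (hd b) (tl b @ t) * u (hd b) else 0)"
  by (cases "hd b") (simp_all add: braket_def wk_def UNIV_bool)

text \<open>The announced \<open>y\<close> is a prefix of \<open>t\<close>, so the sum over
  \<open>y\<close> collapses; \<open>r \<le> h\<close> makes this prefix a full string of length
  \<open>r\<close>.\<close>

lemma sum_wk:
  assumes "r \<le> h"
  shows "(\<Sum>(c, b)\<in>slots r h \<times> bitstr (Suc w). (cmod (braket (wk w r p c b) u))\<^sup>2)
    = (\<Sum>s\<in>UNIV. (cmod (u s))\<^sup>2 * sq (w + h) (p s))"
proof -
  let ?F = "\<lambda>s x t. (cmod (p s (x @ t)))\<^sup>2 * (cmod (u s))\<^sup>2"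
  have "(\<Sum>(c, b)\<in>slots r h \<times> bitstr (Suc w). (cmod (braket (wk w r p c b) u))\<^sup>2)
      = (\<Sum>y\<in>bitstr r. \<Sum>t\<in>bitstr h. \<Sum>b\<in>bitstr (Suc w). (cmod (braket (wk w r p (y, t) b) u))\<^sup>2)"
    by (simp only: slots_def sum.cartesian_product' case_prod_conv)
  also have "\<dots> = (\<Sum>y\<in>bitstr r. \<Sum>t\<in>bitstr h. if take r t = y then (\<Sum>s\<in>UNIV. \<Sum>x\<in>bitstr w. ?F s x t) else 0)"
    unfolding sum_bitstr_Suc
    by (intro sum.cong refl) (simp add: braket_wk norm_mult power_mult_distrib)
  also have "\<dots> = (\<Sum>t\<in>bitstr h. \<Sum>y\<in>bitstr r. if take r t = y then (\<Sum>s\<in>UNIV. \<Sum>x\<in>bitstr w. ?F s x t) else 0)"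
    by (rule sum.swap)
  also have "\<dots> = (\<Sum>t\<in>bitstr h. \<Sum>s\<in>UNIV. \<Sum>x\<in>bitstr w. ?F s x t)"
    using assms by (intro sum.cong refl) simp
  also have "\<dots> = (\<Sum>s\<in>UNIV. \<Sum>t\<in>bitstr h. \<Sum>x\<in>bitstr w. ?F s x t)"
    by (rule sum.swap)
  also have "\<dots> = (\<Sum>s\<in>UNIV. \<Sum>x\<in>bitstr w. \<Sum>t\<in>bitstr h. ?F s x t)"
    by (intro sum.cong refl sum.swap)
  also have "\<dots> = (\<Sum>s\<in>UNIV. (cmod (u s))\<^sup>2 * sq (w + h) (p s))"
    unfolding sq_def sum_bitstr_append by (simp add: sum_distrib_left mult.commute)
  finally show ?thesis .
qed

lemma had_isometry: "(\<Sum>b\<in>bitstr n. (cmod (ct (map had1 b) \<phi>))\<^sup>2) = sq n \<phi>"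
proof (induction n arbitrary: \<phi>)
  case (Suc n)
  have "(\<Sum>b\<in>bitstr (Suc n). (cmod (ct (map had1 b) \<phi>))\<^sup>2)
     = (\<Sum>s\<in>UNIV. sq n (\<lambda>a. braket (had1 s) (\<lambda>s. \<phi> (s # a))))"
    by (simp add: sum_bitstr_Suc Suc)
  then show ?case by (simp only: iso_sq[OF iso_had1])
qed (simp add: sq_def)

lemma braket_hadamard_kern: "braket (hadamard_kern K b) u = ct (map had1 b) (\<lambda>d. braket (K d) u)"
  by (simp only: hadamard_kern_def[abs_def] braket_commute[of _ u] ct_braket)

lemma sum_hadamard_kern:
  "(\<Sum>(c, b)\<in>C \<times> bitstr n. (cmod (braket (hadamard_kern (K c) b) u))\<^sup>2)
    = (\<Sum>(c, b)\<in>C \<times> bitstr n. (cmod (braket (K c b) u))\<^sup>2)"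
  by (simp add: braket_hadamard_kern had_isometry sq_def flip: sum.cartesian_product)

definition vk :: "nat \<Rightarrow> nat \<Rightarrow> (bool \<Rightarrow> vec) \<Rightarrow> bits \<times> bits \<Rightarrow> bits \<Rightarrow> bool \<Rightarrow> complex" where
  "vk w r p c = hadamard_kern (wk w r p c)"

lemma iso_wk:
  assumes "\<And>s. sq (w + h) (p s) = 1" "r \<le> h"
  shows "iso (\<lambda>(c, b). wk w r p c b) (slots r h \<times> bitstr (Suc w))"
    "iso (\<lambda>(c, b). vk w r p c b) (slots r h \<times> bitstr (Suc w))"
proof -
  have "(\<Sum>(c, b)\<in>slots r h \<times> bitstr (Suc w). (cmod (braket (wk w r p c b) u))\<^sup>2) = vsq u" for u
    unfolding sum_wk[OF assms(2)] assms(1) vsq_def by simp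
  then show "iso (\<lambda>(c, b). wk w r p c b) (slots r h \<times> bitstr (Suc w))"
    "iso (\<lambda>(c, b). vk w r p c b) (slots r h \<times> bitstr (Suc w))"
    using sum_hadamard_kern[where C = "slots r h" and K = "wk w r p"]
    by (simp_all add: iso_def split_def vk_def)
qed

text \<open>The kernel is linear in the prepared vectors, so the difference of two families is the
  family of the difference, whose norm \<open>sum_wk\<close> computes.\<close>

lemma near_wk:
  assumes "\<And>s. sq (w + h) (\<lambda>a. p s a - p' s a) \<le> \<epsilon>\<^sup>2" "r \<le> h"
  shows "near \<epsilon> (\<lambda>(c, b). wk w r p c b) (\<lambda>(c, b). wk w r p' c b) (slots r h \<times> bitstr (Suc w))"
    "near \<epsilon> (\<lambda>(c, b). vk w r p c b) (\<lambda>(c, b). vk w r p' c b) (slots r h \<times> bitstr (Suc w))"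
proof -
  let ?p = "\<lambda>s a. p s a - p' s a"
  have w: "braket (wk w r p c b) u - braket (wk w r p' c b) u = braket (wk w r ?p c b) u" for c b u
    by (cases c) (auto simp: wk_def braket_def UNIV_bool algebra_simps)
  have v: "braket (vk w r p c b) u - braket (vk w r p' c b) u = braket (vk w r ?p c b) u" for c b u
    unfolding vk_def braket_hadamard_kern ct_diff[symmetric] w ..
  have "(\<Sum>(c, b)\<in>slots r h \<times> bitstr (Suc w). (cmod (braket (wk w r ?p c b) u))\<^sup>2) \<le> \<epsilon>\<^sup>2 * vsq u" for u
  proof -
    have "(\<Sum>(c, b)\<in>slots r h \<times> bitstr (Suc w). (cmod (braket (wk w r ?p c b) u))\<^sup>2)
        \<le> (\<Sum>s\<in>UNIV. (cmod (u s))\<^sup>2 * \<epsilon>\<^sup>2)"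
      unfolding sum_wk[OF assms(2)] by (intro sum_mono mult_left_mono assms(1)) simp
    then show ?thesis by (simp add: vsq_def sum_distrib_left mult.commute)
  qed
  then show "near \<epsilon> (\<lambda>(c, b). wk w r p c b) (\<lambda>(c, b). wk w r p' c b) (slots r h \<times> bitstr (Suc w))"
    "near \<epsilon> (\<lambda>(c, b). vk w r p c b) (\<lambda>(c, b). vk w r p' c b) (slots r h \<times> bitstr (Suc w))"
    using sum_hadamard_kern[where C = "slots r h" and K = "wk w r ?p"]
    by (simp_all add: near_def split_def v w) (simp_all add: vk_def)
qed

text \<open>The leading bit of the residual string is a copy of the committed bit.\<close>

lemma resolves_wk:
  assumes "\<And>s. sq (w + h) (p s) = 1" "r \<le> h"
  shows "resolves (\<lambda>(c, b). wk w r p c b) (slots r h \<times> bitstr (Suc w)) (\<lambda>(c, b). hd b) id1"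
  unfolding resolves_def
proof (intro conjI ballI)
  fix x assume "x \<in> slots r h \<times> bitstr (Suc w)"
  then obtain y t b where x: "x = ((y, t), b)" by (cases x) auto
  show "\<exists>c. (\<lambda>(c, b). wk w r p c b) x = (\<lambda>s. c * id1 ((\<lambda>(c, b). hd b) x) s)"
    by (rule exI[of _ "wk w r p (y, t) b (hd b)"]) (auto simp: x wk_def id1_def)
qed (rule iso_wk(1)[OF assms])

section \<open>The ideal preparation of a claw\<close>

lemma dot_Cons: "dot (a # d) (b # e) = ((a \<and> b) \<noteq> dot d e)"
  by (auto simp: dot_def)

lemma dot_xor:
  assumes "length a = length d" "length b = length d"
  shows "dot d (xor_bits a b) = (dot d a \<noteq> dot d b)"
  using assms
proof (induction d arbitrary: a b)
  case Nil
  then show ?case by (simp add: dot_def)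
next
  case (Cons x d)
  then obtain p a' q b' where ab: "a = p # a'" "b = q # b'" by (metis length_Suc_conv)
  then show ?case using Cons by (auto simp: xor_bits_def dot_Cons)
qed

text \<open>The Hadamard transform of a point mass is a character of constant modulus.\<close>

lemma ct_had_delta:
  assumes "length d = length e"
  shows "ct (map had1 d) (\<lambda>b. if b = e then \<gamma> else 0)
    = \<gamma> * (if dot d e then - 1 else 1) / complex_of_real (sqrt 2) ^ length d"
  using assms
proof (induction d arbitrary: e)
  case Nil
  then show ?case by (simp add: dot_def)
next
  case (Cons x d)
  then obtain y e' where e: "e = y # e'" by (cases e) auto
  have "braket (had1 x) (\<lambda>s. if s # a = e then \<gamma> else 0) = had1 x y * (if a = e' then \<gamma> else 0)" for a
    by (cases y) (simp_all add: e braket_def UNIV_bool)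
  then have "ct (map had1 (x # d)) (\<lambda>b. if b = e then \<gamma> else 0)
      = had1 x y * ct (map had1 d) (\<lambda>b. if b = e' then \<gamma> else 0)"
    by (simp add: ct_scale)
  also have "ct (map had1 d) (\<lambda>b. if b = e' then \<gamma> else 0)
      = \<gamma> * (if dot d e' then - 1 else 1) / complex_of_real (sqrt 2) ^ length d"
    by (rule Cons.IH) (use Cons.prems e in simp)
  also have "had1 x y * \<dots> = \<gamma> * (if dot (x # d) e then - 1 else 1) / complex_of_real (sqrt 2) ^ length (x # d)"
    by (cases x; cases y; cases "dot d e'") (simp_all add: e dot_Cons had1_def)
  finally show ?case .
qed

lemma card_bitstr: "card (bitstr n) = 2 ^ n"
  using card_lists_length_eq[of "UNIV :: bool set" n] by (simp add: bitstr_def)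

lemma cmod_sqrt2_power: "(cmod (complex_of_real (sqrt 2) ^ n))\<^sup>2 = 2 ^ n"
  by (simp add: norm_power power_mult[symmetric] mult.commute[of _ 2]) (simp add: power_mult)

lemma braket_had1_le: "(cmod (braket (had1 v) u))\<^sup>2 \<le> vsq u"
  unfolding vsq_had1[symmetric, of u] by (cases v) (simp_all add: vsq_def UNIV_bool)

text \<open>The keys are fixed together with two numbers valid for every key in the support:
  \<open>ep\<close> bounds the error of the preparation, \<open>eg\<close> the fraction of strings
  that are not good. All estimates below are uniform in the keys, so averaging over key generation
  can come last.\<close>

locale claw_keys =
  fixes F :: ntcf and lam :: nat and ks :: keys and ep eg :: real
  assumes domains: "ntcf_domains F" and complete: "ntcf_complete F"
    and keys: "set ks \<subseteq> set_pmf (Gen_F F lam)" and length_keys: "length ks = width F lam + 2"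
    and prep_wf: "\<And>pk sk s. (pk, sk) \<in> set_pmf (Gen_F F lam) \<Longrightarrow> wf_gates (prep_size F lam pk) (prep_F F pk s)"
    and prep_near: "\<And>pk sk s. (pk, sk) \<in> set_pmf (Gen_F F lam) \<Longrightarrow>
       L2_set (\<lambda>a. cmod (prep_vec F lam pk s a - range_superposition F lam pk s a)) (bitstr (prep_size F lam pk)) \<le> ep"
    and good_dense: "\<And>pk sk x0 x1. (pk, sk) \<in> set_pmf (Gen_F F lam) \<Longrightarrow> x0 \<in> Dom_F F pk \<Longrightarrow>
       x1 \<in> Dom_F F pk \<Longrightarrow> x0 \<noteq> x1 \<Longrightarrow>
       real (card (good_set F lam x0 x1)) / 2 ^ (width F lam + 1) \<ge> 1 - eg"
begin

abbreviation "w \<equiv> width F lam"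
abbreviation "r \<equiv> rlen F lam"
abbreviation "h pk \<equiv> hidden F lam pk"
abbreviation "ideal_prep pk \<equiv> range_superposition F lam pk"

lemma r_le_h: "r \<le> h pk"
  by (simp add: hidden_def)

lemma prep_size_h: "prep_size F lam pk = w + h pk"
  by (simp add: prep_size_def hidden_def)

lemma ep_nonneg: "0 \<le> ep"
proof -
  obtain pk sk where "(pk, sk) \<in> set_pmf (Gen_F F lam)"
    using set_pmf_not_empty[of "Gen_F F lam"] by auto
  from prep_near[OF this] show ?thesis using L2_set_nonneg order_trans by blast
qed

text \<open>On outcomes of nonzero ideal amplitude the inversion succeeds by
  \<open>ideal_claw\<close>; the default value only makes the function total.\<close>

definition label :: "bits \<Rightarrow> bits \<Rightarrow> bits \<Rightarrow> bool" where
  "label sk y d = (case Invert_F F sk y of None \<Rightarrow> False | Some (x0, x1) \<Rightarrow> dot d (True # xor_bits x0 x1))"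

definition accepted :: "bits \<Rightarrow> bits \<Rightarrow> bits \<Rightarrow> bool" where
  "accepted sk y d \<longleftrightarrow> (\<exists>x0 x1. Invert_F F sk y = Some (x0, x1) \<and> d \<in> good_set F lam x0 x1)"

context
  fixes pk sk assumes key: "(pk, sk) \<in> set_pmf (Gen_F F lam)"
begin

lemma key_domain:
  "Dom_F F pk \<noteq> {}" "Dom_F F pk \<subseteq> bitstr w" "Rng_F F pk \<subseteq> bitstr r"
  "x \<in> Dom_F F pk \<Longrightarrow> set_pmf (Eval_F F pk s x) \<subseteq> Rng_F F pk"
  "Invert_F F sk y = Some (x0, x1) \<Longrightarrow> x0 \<in> Dom_F F pk \<and> x1 \<in> Dom_F F pk"
proof -
  have "\<forall>lam. \<forall>(pk, sk)\<in>set_pmf (Gen_F F lam).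
        Dom_F F pk \<noteq> {} \<and> Dom_F F pk \<subseteq> bitstr (width F lam) \<and>
        Rng_F F pk \<subseteq> bitstr (rlen F lam) \<and>
        (\<forall>b. \<forall>x\<in>Dom_F F pk. set_pmf (Eval_F F pk b x) \<subseteq> Rng_F F pk) \<and>
        (\<forall>y x0 x1. Invert_F F sk y = Some (x0, x1) \<longrightarrow> x0 \<in> Dom_F F pk \<and> x1 \<in> Dom_F F pk)"
    using domains unfolding ntcf_domains_def by (elim conjE)
  note c = bspec[OF spec[OF this, of lam] key, unfolded case_prod_conv]
  show "Dom_F F pk \<noteq> {}" "Dom_F F pk \<subseteq> bitstr w" "Rng_F F pk \<subseteq> bitstr r"
    "x \<in> Dom_F F pk \<Longrightarrow> set_pmf (Eval_F F pk s x) \<subseteq> Rng_F F pk"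
    "Invert_F F sk y = Some (x0, x1) \<Longrightarrow> x0 \<in> Dom_F F pk \<and> x1 \<in> Dom_F F pk"
    using c by simp_all
qed

lemma key_complete:
  "x \<in> Dom_F F pk \<Longrightarrow> y \<in> set_pmf (Eval_F F pk b x) \<Longrightarrow>
     \<exists>x0 x1. Invert_F F sk y = Some (x0, x1) \<and> (if b then x1 else x0) = x \<and>
             y \<in> set_pmf (Eval_F F pk False x0) \<and> y \<in> set_pmf (Eval_F F pk True x1)"
  "\<exists>M. perfect_matching M (Dom_F F pk) \<and>
           (\<forall>x0\<in>Dom_F F pk. \<forall>x1\<in>Dom_F F pk. Eval_F F pk False x0 = Eval_F F pk True x1 \<longleftrightarrow> (x0, x1) \<in> M)"
  "x \<in> Dom_F F pk \<Longrightarrow> Check_F F pk b x y \<longleftrightarrow> y \<in> set_pmf (Eval_F F pk b x)"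
proof -
  note c = bspec[OF spec[OF conjunct1[OF complete[unfolded ntcf_complete_def]], of lam] key, unfolded case_prod_conv]
  show "x \<in> Dom_F F pk \<Longrightarrow> y \<in> set_pmf (Eval_F F pk b x) \<Longrightarrow>
     \<exists>x0 x1. Invert_F F sk y = Some (x0, x1) \<and> (if b then x1 else x0) = x \<and>
             y \<in> set_pmf (Eval_F F pk False x0) \<and> y \<in> set_pmf (Eval_F F pk True x1)"
    using conjunct1[OF c] by blast
  show "\<exists>M. perfect_matching M (Dom_F F pk) \<and>
           (\<forall>x0\<in>Dom_F F pk. \<forall>x1\<in>Dom_F F pk. Eval_F F pk False x0 = Eval_F F pk True x1 \<longleftrightarrow> (x0, x1) \<in> M)"
    by (rule conjunct1[OF conjunct2[OF c]])
  show "x \<in> Dom_F F pk \<Longrightarrow> Check_F F pk b x y \<longleftrightarrow> y \<in> set_pmf (Eval_F F pk b x)"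
    using conjunct2[OF conjunct2[OF c]] by blast
qed

lemma ideal_prep_eq:
  assumes "length x = w" "length t = h pk"
  shows "ideal_prep pk s (x @ t) = (if x \<in> Dom_F F pk \<and> take r t \<in> Rng_F F pk \<and> drop r t = zeros (prep_anc F pk)
    then complex_of_real (sqrt (pmf (Eval_F F pk s x) (take r t)) / sqrt (real (card (Dom_F F pk)))) else 0)"
  using assms by (simp add: range_superposition_def slice_def Let_def)

lemma ideal_prep_unit: "sq (w + h pk) (ideal_prep pk s) = 1"
proof -
  let ?D = "Dom_F F pk" and ?R = "Rng_F F pk"
  have finD: "finite ?D" using key_domain(2) finite_subset by blast
  have cardD: "0 < card ?D" using finD key_domain(1) by (simp add: card_gt_0_iff)
  have "sq (w + h pk) (ideal_prep pk s)
      = (\<Sum>x\<in>bitstr w. \<Sum>y\<in>bitstr r. \<Sum>c\<in>bitstr (prep_anc F pk). (cmod (ideal_prep pk s (x @ y @ c)))\<^sup>2)"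
    by (simp add: sq_def hidden_def sum_bitstr_append)
  also have "\<dots> = (\<Sum>x\<in>bitstr w. \<Sum>y\<in>bitstr r. \<Sum>c\<in>bitstr (prep_anc F pk). if c = zeros (prep_anc F pk) then
      (if x \<in> ?D \<and> y \<in> ?R then pmf (Eval_F F pk s x) y / card ?D else 0) else 0)"
  proof (intro sum.cong refl)
    fix x y c assume l: "x \<in> bitstr w" "y \<in> bitstr r" "c \<in> bitstr (prep_anc F pk)"
    have "ideal_prep pk s (x @ y @ c) = (if x \<in> ?D \<and> y \<in> ?R \<and> c = zeros (prep_anc F pk)
      then complex_of_real (sqrt (pmf (Eval_F F pk s x) y) / sqrt (real (card ?D))) else 0)"
      using ideal_prep_eq[of x "y @ c" s] l by (simp add: hidden_def)
    then show "(cmod (ideal_prep pk s (x @ y @ c)))\<^sup>2 = (if c = zeros (prep_anc F pk) then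
      (if x \<in> ?D \<and> y \<in> ?R then pmf (Eval_F F pk s x) y / card ?D else 0) else 0)"
      by (simp add: norm_divide power_divide)
  qed
  also have "\<dots> = (\<Sum>x\<in>bitstr w. \<Sum>y\<in>bitstr r. if x \<in> ?D \<and> y \<in> ?R then pmf (Eval_F F pk s x) y / card ?D else 0)"
    by (intro sum.cong refl) simp
  also have "\<dots> = (\<Sum>x\<in>bitstr w. if x \<in> ?D then 1 / card ?D else 0)"
  proof (intro sum.cong refl)
    fix x
    show "(\<Sum>y\<in>bitstr r. if x \<in> ?D \<and> y \<in> ?R then pmf (Eval_F F pk s x) y / card ?D else 0)
        = (if x \<in> ?D then 1 / card ?D else 0)"
    proof (cases "x \<in> ?D")
      case True
      have "(\<Sum>y\<in>bitstr r. if y \<in> ?R then pmf (Eval_F F pk s x) y else 0) = (\<Sum>y\<in>bitstr r. pmf (Eval_F F pk s x) y)"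
        using key_domain(4)[OF True, of s] by (intro sum.cong refl) (auto simp: set_pmf_iff)
      also have "\<dots> = 1"
        using key_domain(3) key_domain(4)[OF True, of s] by (intro sum_pmf_eq_1) auto
      finally have "(\<Sum>y\<in>bitstr r. (if y \<in> ?R then pmf (Eval_F F pk s x) y else 0) / card ?D) = 1 / card ?D"
        by (simp flip: sum_divide_distrib)
      then show ?thesis using True by (simp add: if_distrib[of "\<lambda>z. z / _"] cong: if_cong)
    qed simp
  qed
  also have "\<dots> = (\<Sum>x\<in>?D. 1 / card ?D)"
    using key_domain(2) by (simp add: sum.inter_restrict[symmetric] inf_absorb2)
  also have "\<dots> = 1" using cardD by simp
  finally show ?thesis .
qed

text \<open>Inversion leaves one preimage of \<open>y\<close> for each bit, and the matching gives
  both the same density, hence the same amplitude \<open>\<gamma>\<close>. This equality is what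
  keeps the committed superposition intact.\<close>

lemma ideal_claw:
  fixes y t :: bits
  assumes "length t = h pk"
  shows "(\<forall>b s. wk w r (ideal_prep pk) (y, t) b s = 0) \<or>
    (\<exists>x0 x1 \<gamma>. Invert_F F sk y = Some (x0, x1) \<and> x0 \<in> Dom_F F pk \<and> x1 \<in> Dom_F F pk \<and> x0 \<noteq> x1 \<and>
       y \<in> set_pmf (Eval_F F pk False x0) \<and> y \<in> set_pmf (Eval_F F pk True x1) \<and>
       (\<forall>b s. wk w r (ideal_prep pk) (y, t) b s = (if b = s # (if s then x1 else x0) then \<gamma> else 0)))"
proof (cases "\<exists>b s. wk w r (ideal_prep pk) (y, t) b s \<noteq> 0")
  case True
  let ?D = "Dom_F F pk"
  have val: "wk w r (ideal_prep pk) (y, t) (s # x) s = (if length x = w \<and> take r t = y \<and> x \<in> ?D \<and> y \<in> Rng_F F pk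
       \<and> drop r t = zeros (prep_anc F pk)
      then complex_of_real (sqrt (pmf (Eval_F F pk s x) y) / sqrt (real (card ?D))) else 0)" for s x
    using ideal_prep_eq[of x t s] assms by (auto simp: wk_def)
  have hd: "\<exists>x. b = s # x" if "wk w r (ideal_prep pk) (y, t) b s \<noteq> 0" for b s
    using that by (cases b) (auto simp: wk_def split: if_splits)
  obtain b s where bs: "wk w r (ideal_prep pk) (y, t) b s \<noteq> 0" using True by blast
  then obtain x where x: "b = s # x" using hd by blast
  have c: "length x = w" "take r t = y" "x \<in> ?D" "y \<in> Rng_F F pk" "drop r t = zeros (prep_anc F pk)"
    "y \<in> set_pmf (Eval_F F pk s x)"
    using bs unfolding x val by (auto simp: set_pmf_iff split: if_splits)
  obtain x0 x1 where inv: "Invert_F F sk y = Some (x0, x1)"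
    "y \<in> set_pmf (Eval_F F pk False x0)" "y \<in> set_pmf (Eval_F F pk True x1)"
    using key_complete(1)[OF c(3,6)] by blast
  have D: "x0 \<in> ?D" "x1 \<in> ?D" using key_domain(5)[OF inv(1)] by auto
  obtain M where M: "perfect_matching M ?D"
    "\<And>x0 x1. x0 \<in> ?D \<Longrightarrow> x1 \<in> ?D \<Longrightarrow> Eval_F F pk False x0 = Eval_F F pk True x1 \<longleftrightarrow> (x0, x1) \<in> M"
    using key_complete(2) by blast
  \<comment> \<open>Inversion yields an \<open>x1\<close> with \<open>y\<close> in its support, but
    not yet equal densities; the partner of \<open>x0\<close> in the matching has the same density,
    and inversion of \<open>y\<close> forces it to be \<open>x1\<close>.\<close>
  obtain x1' where x1': "(x0, x1') \<in> M" "x1' \<in> ?D"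
    using M(1) D(1) unfolding perfect_matching_def by blast
  have e: "Eval_F F pk False x0 = Eval_F F pk True x1'" using M(2)[OF D(1) x1'(2)] x1'(1) by simp
  then have "x1' = x1" using key_complete(1)[OF x1'(2), of y True] inv by auto
  then have eq: "Eval_F F pk False x0 = Eval_F F pk True x1" and ne: "x0 \<noteq> x1"
    using e x1'(1) M(1) unfolding perfect_matching_def by auto
  let ?g = "complex_of_real (sqrt (pmf (Eval_F F pk False x0) y) / sqrt (real (card ?D)))"
  have "wk w r (ideal_prep pk) (y, t) b s = (if b = s # (if s then x1 else x0) then ?g else 0)" for b s
  proof (cases "b = s # (if s then x1 else x0)")
    case True
    have "(if s then x1 else x0) \<in> ?D" "length (if s then x1 else x0) = w"
      using D key_domain(2) by auto
    moreover have "Eval_F F pk s (if s then x1 else x0) = Eval_F F pk False x0" using eq by simp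
    ultimately show ?thesis unfolding True val using c by simp
  next
    case False
    have "wk w r (ideal_prep pk) (y, t) b s = 0"
    proof (rule ccontr)
      assume nz: "wk w r (ideal_prep pk) (y, t) b s \<noteq> 0"
      then obtain x where x: "b = s # x" using hd by blast
      have "x \<in> ?D" "y \<in> set_pmf (Eval_F F pk s x)"
        using nz unfolding x val by (auto simp: set_pmf_iff split: if_splits)
      from key_complete(1)[OF this] have "x = (if s then x1 else x0)" using inv(1) by auto
      then show False using False x by simp
    qed
    then show ?thesis using False by simp
  qed
  then show ?thesis using inv D ne by blast
qed blast

text \<open>Nonzero ideal amplitude puts \<open>y\<close> into the support of the evaluation, which
  is what the check decides.\<close>

lemma check_wk:
  assumes "length t = h pk" "wk w r (ideal_prep pk) (y, t) b s \<noteq> 0"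
  shows "Check_F F pk (hd b) (tl b) y"
proof -
  obtain x0 x1 \<gamma> where x: "x0 \<in> Dom_F F pk" "x1 \<in> Dom_F F pk"
    "y \<in> set_pmf (Eval_F F pk False x0)" "y \<in> set_pmf (Eval_F F pk True x1)"
    and wk: "\<And>b s. wk w r (ideal_prep pk) (y, t) b s = (if b = s # (if s then x1 else x0) then \<gamma> else 0)"
    using ideal_claw[OF assms(1), of y] assms(2) by blast
  have "b = s # (if s then x1 else x0)" using assms(2) unfolding wk by (rule contrapos_np) simp
  moreover have "Check_F F pk False x0 y" "Check_F F pk True x1 y"
    using x by (simp_all only: key_complete(3))
  ultimately show ?thesis by (cases s) simp_all
qed

text \<open>The two claw strings acquire the signs of \<open>d\<close> paired with \<open>x0\<close>
  behind a 0 and \<open>x1\<close> behind a 1. The ratio of the signs is given by the label, so up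
  to a factor the row is the Hadamard row of the label.\<close>

lemma vk_ideal:
  assumes "length t = h pk" "length d = Suc w"
    and "Invert_F F sk y = Some (x0, x1)" "x0 \<in> Dom_F F pk" "x1 \<in> Dom_F F pk"
    and "\<And>b s. wk w r (ideal_prep pk) (y, t) b s = (if b = s # (if s then x1 else x0) then \<gamma> else 0)"
  obtains e where "vk w r (ideal_prep pk) (y, t) d = (\<lambda>s. e * had1 (label sk y d) s)"
    "(cmod e)\<^sup>2 = 2 * (cmod \<gamma>)\<^sup>2 / 2 ^ Suc w"
proof -
  obtain d0 d' where d: "d = d0 # d'" "length d' = w" using assms(2) by (cases d) auto
  have l: "length x0 = w" "length x1 = w" using assms(4,5) key_domain(2) by auto
  let ?N = "complex_of_real (sqrt 2) ^ Suc w"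
  \<comment> \<open>The sign belonging to the committed bit 0 is factored out, and
    \<open>sqrt 2\<close> compensates the normalisation inside \<open>had1\<close>.\<close>
  let ?e = "\<gamma> * (if dot d' x0 then - 1 else 1) * complex_of_real (sqrt 2) / ?N"
  have lab: "label sk y d = (d0 \<noteq> (dot d' x0 \<noteq> dot d' x1))"
    using assms(3) l d by (simp add: label_def dot_Cons dot_xor)
  have s2: "complex_of_real (sqrt 2) \<noteq> 0" by simp
  have "vk w r (ideal_prep pk) (y, t) d s = ?e * had1 (label sk y d) s" for s
  proof -
    have "vk w r (ideal_prep pk) (y, t) d s = ct (map had1 d) (\<lambda>b. if b = s # (if s then x1 else x0) then \<gamma> else 0)"
      by (simp add: vk_def hadamard_kern_def assms(6))
    also have "\<dots> = \<gamma> * (if dot d (s # (if s then x1 else x0)) then - 1 else 1) / ?N"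
      using ct_had_delta[of d "s # (if s then x1 else x0)" \<gamma>] l assms(2) by simp
    also have "\<dots> = ?e * had1 (label sk y d) s"
      unfolding lab using s2 by (cases s; cases d0; cases "dot d' x0"; cases "dot d' x1")
        (simp_all add: d(1) dot_Cons had1_def)
    finally show ?thesis .
  qed
  moreover have "(cmod ?e)\<^sup>2 = 2 * (cmod \<gamma>)\<^sup>2 / 2 ^ Suc w"
    unfolding norm_divide power_divide cmod_sqrt2_power
    by (simp add: norm_mult power_mult_distrib)
  ultimately show ?thesis by (intro that[of ?e]) (auto simp: fun_eq_iff)
qed

lemma resolves_vk:
  "resolves (\<lambda>(c, d). vk w r (ideal_prep pk) c d) (slots r (h pk) \<times> bitstr (Suc w)) (\<lambda>(c, d). label sk (fst c) d) had1"
  unfolding resolves_def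
proof (intro conjI ballI)
  show "iso (\<lambda>(c, d). vk w r (ideal_prep pk) c d) (slots r (h pk) \<times> bitstr (Suc w))"
    by (rule iso_wk(2)[OF ideal_prep_unit r_le_h])
  fix x assume "x \<in> slots r (h pk) \<times> bitstr (Suc w)"
  then obtain y t d where x: "x = ((y, t), d)" "length t = h pk" "length d = Suc w"
    by (auto simp: slots_def)
  have "\<exists>e. vk w r (ideal_prep pk) (y, t) d = (\<lambda>s. e * had1 (label sk y d) s)"
  proof (cases "\<forall>b s. wk w r (ideal_prep pk) (y, t) b s = 0")
    case True
    then show ?thesis by (intro exI[of _ 0]) (simp add: vk_def hadamard_kern_def fun_eq_iff)
  next
    case False
    then show ?thesis using ideal_claw[OF x(2), of y] vk_ideal[OF x(2,3)] by metis
  qed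
  then show "\<exists>e. (\<lambda>(c, d). vk w r (ideal_prep pk) c d) x = (\<lambda>s. e * had1 ((\<lambda>(c, d). label sk (fst c) d) x) s)"
    by (simp add: x(1))
qed

text \<open>Within one claw all rows have equal norm, so the bad mass is governed by the fraction of
  bad strings. The factor 2 pays for arbitrary \<open>u\<close>: a vector may be aligned with the
  rows of one label, so each squared overlap is bounded by \<open>vsq u\<close> rather than by its
  average.\<close>

lemma vk_bad:
  "(\<Sum>x\<in>slots r (h pk) \<times> bitstr (Suc w). if \<not> accepted sk (fst (fst x)) (snd x)
      then (cmod (braket (vk w r (ideal_prep pk) (fst x) (snd x)) u))\<^sup>2 else 0) \<le> 2 * eg * vsq u"
proof -
  let ?v = "vk w r (ideal_prep pk)" and ?B = "bitstr (Suc w)"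
  \<comment> \<open>The squared amplitudes of all claws are summed by committing to the bit 0, where
    isometry gives 1.\<close>
  let ?e0 = "\<lambda>s. of_bool (s = False) :: complex"
  have v0: "braket q ?e0 = q False" for q by (simp add: braket_def UNIV_bool)
  have 1: "(\<Sum>d\<in>?B. if \<not> accepted sk (fst c) d then (cmod (braket (?v c d) u))\<^sup>2 else 0)
      \<le> 2 * eg * vsq u * (\<Sum>d\<in>?B. (cmod (?v c d False))\<^sup>2)" if c: "c \<in> slots r (h pk)" for c
  proof -
    obtain y t where yt: "c = (y, t)" "length t = h pk" using c by (auto simp: slots_def)
    show ?thesis
    proof (cases "\<forall>b s. wk w r (ideal_prep pk) (y, t) b s = 0")
      case True
      then have "?v c d = (\<lambda>s. 0)" for d by (simp add: yt vk_def hadamard_kern_def fun_eq_iff)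
      then show ?thesis by (simp cong: if_cong)
    next
      case False
      then obtain x0 x1 \<gamma> where inv: "Invert_F F sk y = Some (x0, x1)" "x0 \<in> Dom_F F pk" "x1 \<in> Dom_F F pk"
        "x0 \<noteq> x1" and wk: "\<And>b s. wk w r (ideal_prep pk) (y, t) b s = (if b = s # (if s then x1 else x0) then \<gamma> else 0)"
        using ideal_claw[OF yt(2), of y] by blast
      have b: "(cmod (braket (?v c d) u))\<^sup>2 \<le> 2 * (cmod \<gamma>)\<^sup>2 / 2 ^ Suc w * vsq u"
        "(cmod (?v c d False))\<^sup>2 = (cmod \<gamma>)\<^sup>2 / 2 ^ Suc w" if len: "length d = Suc w" for d
      proof -
        obtain e where e: "?v (y, t) d = (\<lambda>s. e * had1 (label sk y d) s)" "(cmod e)\<^sup>2 = 2 * (cmod \<gamma>)\<^sup>2 / 2 ^ Suc w"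
          by (rule vk_ideal[OF yt(2) len inv(1-3) wk], rule that)
        have "(cmod (braket (?v c d) u))\<^sup>2 = (cmod e)\<^sup>2 * (cmod (braket (had1 (label sk y d)) u))\<^sup>2"
          by (simp add: yt(1) e(1) braket_scale_left norm_mult power_mult_distrib)
        also have "\<dots> \<le> (cmod e)\<^sup>2 * vsq u" by (intro mult_left_mono braket_had1_le) simp
        finally show "(cmod (braket (?v c d) u))\<^sup>2 \<le> 2 * (cmod \<gamma>)\<^sup>2 / 2 ^ Suc w * vsq u" by (simp only: e(2))
        have "(cmod (?v c d False))\<^sup>2 = (cmod e)\<^sup>2 / 2"
          by (simp add: yt(1) e(1) had1_def norm_mult norm_divide power_mult_distrib power_divide)
        then show "(cmod (?v c d False))\<^sup>2 = (cmod \<gamma>)\<^sup>2 / 2 ^ Suc w" by (simp add: e(2))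
      qed
      let ?G = "good_set F lam x0 x1"
      have G: "?G \<subseteq> ?B" by (auto simp: good_set_def)
      have cardB: "card ?B = 2 ^ Suc w" by (rule card_bitstr)
      have acc: "accepted sk y d \<longleftrightarrow> d \<in> ?G" for d using inv(1) by (simp add: accepted_def)
      have "(\<Sum>d\<in>?B. if \<not> accepted sk (fst c) d then (cmod (braket (?v c d) u))\<^sup>2 else 0)
          \<le> (\<Sum>d\<in>?B. if d \<in> ?B - ?G then 2 * (cmod \<gamma>)\<^sup>2 / 2 ^ Suc w * vsq u else 0)"
        by (intro sum_mono) (use b(1) in \<open>auto simp: yt acc\<close>)
      also have "\<dots> = (\<Sum>d\<in>?B - ?G. 2 * (cmod \<gamma>)\<^sup>2 / 2 ^ Suc w * vsq u)"
        by (rule sum.mono_neutral_cong_right) auto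
      also have "\<dots> = (real (card (?B - ?G)) / 2 ^ Suc w) * (2 * (cmod \<gamma>)\<^sup>2 * vsq u)" by simp
      also have "real (card (?B - ?G)) = 2 ^ Suc w - real (card ?G)"
        using card_Diff_subset[OF finite_subset[OF G finite_bitstr] G] card_mono[OF finite_bitstr G] cardB
        by (simp add: of_nat_diff)
      also have "(2 ^ Suc w - real (card ?G)) / 2 ^ Suc w * (2 * (cmod \<gamma>)\<^sup>2 * vsq u) \<le> eg * (2 * (cmod \<gamma>)\<^sup>2 * vsq u)"
        using good_dense[OF key inv(2-4)] by (intro mult_right_mono) (simp_all add: diff_divide_distrib)
      also have "\<dots> = 2 * eg * vsq u * (\<Sum>d\<in>?B. (cmod \<gamma>)\<^sup>2 / 2 ^ Suc w)"
        using cardB by simp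
      also have "(\<Sum>d\<in>?B. (cmod \<gamma>)\<^sup>2 / 2 ^ Suc w) = (\<Sum>d\<in>?B. (cmod (?v c d False))\<^sup>2)"
        by (intro sum.cong refl) (simp add: b(2))
      finally show ?thesis .
    qed
  qed
  have "(\<Sum>x\<in>slots r (h pk) \<times> ?B. if \<not> accepted sk (fst (fst x)) (snd x)
      then (cmod (braket (?v (fst x) (snd x)) u))\<^sup>2 else 0)
     = (\<Sum>c\<in>slots r (h pk). \<Sum>d\<in>?B. if \<not> accepted sk (fst c) d then (cmod (braket (?v c d) u))\<^sup>2 else 0)"
    by (simp only: sum.cartesian_product' fst_conv snd_conv)
  also have "\<dots> \<le> (\<Sum>c\<in>slots r (h pk). 2 * eg * vsq u * (\<Sum>d\<in>?B. (cmod (?v c d False))\<^sup>2))"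
    by (intro sum_mono 1)
  also have "\<dots> = 2 * eg * vsq u * (\<Sum>c\<in>slots r (h pk). \<Sum>d\<in>?B. (cmod (?v c d False))\<^sup>2)"
    by (simp add: sum_distrib_left)
  also have "(\<Sum>c\<in>slots r (h pk). \<Sum>d\<in>?B. (cmod (?v c d False))\<^sup>2) = 1"
  proof -
    have "(\<Sum>x\<in>slots r (h pk) \<times> ?B. (cmod (braket ((\<lambda>(c, d). ?v c d) x) ?e0))\<^sup>2) = vsq ?e0"
      using iso_wk(2)[where p = "ideal_prep pk", OF ideal_prep_unit r_le_h] unfolding iso_def by blast
    moreover have "vsq ?e0 = 1" by (simp add: vsq_def UNIV_bool)
    ultimately show ?thesis by (simp only: sum.cartesian_product' case_prod_conv v0)
  qed
  finally show ?thesis by simp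
qed

end

end

section \<open>Kernels of the game\<close>

lemma ct_append: "ct (qs @ rs) \<phi> = ct rs (\<lambda>e. ct qs (\<lambda>d. \<phi> (d @ e)))"
  by (induction qs arbitrary: \<phi>) (simp_all add: ct_braket)

lemma chunks_append:
  assumes "length d = m"
  shows "chunks m (Suc n) (d @ e) = d # chunks m n e"
  using assms unfolding chunks_def
  by (simp add: upt_conv_Cons map_Suc_upt[symmetric] slice_def o_def del: upt_Suc)

text \<open>Hadamard gates on a concatenation act block by block, so the gates of an opening can be
  absorbed into the inner kernels.\<close>

lemma hadamard_blocks:
  assumes "length bs = length Ks" "\<And>b. b \<in> set bs \<Longrightarrow> length b = m"
  shows "ct (map had1 (concat bs)) (\<lambda>d. ct (map2 (\<lambda>K c. K c) Ks (chunks m (length Ks) d)) \<psi>)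
    = ct (map2 hadamard_kern Ks bs) \<psi>"
  using assms
proof (induction Ks arbitrary: bs \<psi>)
  case (Cons K Ks)
  then obtain b bs' where bs: "bs = b # bs'" by (cases bs) auto
  have lb: "length b = m" using Cons.prems(2) bs by simp
  have "ct (map had1 (concat bs)) (\<lambda>d. ct (map2 (\<lambda>K c. K c) (K # Ks) (chunks m (length (K # Ks)) d)) \<psi>)
      = ct (map had1 (concat bs')) (\<lambda>e. ct (map had1 b)
          (\<lambda>d. ct (map2 (\<lambda>K c. K c) (K # Ks) (chunks m (length (K # Ks)) (d @ e))) \<psi>))"
    by (simp add: bs ct_append)
  also have "\<dots> = ct (map had1 (concat bs')) (\<lambda>e. ct (map had1 b)
          (\<lambda>d. ct (map2 (\<lambda>K c. K c) Ks (chunks m (length Ks) e)) (\<lambda>a. braket (K d) (\<lambda>s. \<psi> (s # a)))))"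
    by (intro ct_cong) (simp add: chunks_append lb)
  also have "\<dots> = ct (map had1 (concat bs')) (\<lambda>e. ct (map2 (\<lambda>K c. K c) Ks (chunks m (length Ks) e))
          (\<lambda>a. braket (hadamard_kern K b) (\<lambda>s. \<psi> (s # a))))"
    unfolding braket_hadamard_kern by (subst ct_commute) (rule refl)
  also have "\<dots> = ct (map2 hadamard_kern Ks bs') (\<lambda>a. braket (hadamard_kern K b) (\<lambda>s. \<psi> (s # a)))"
    by (rule Cons.IH) (use Cons.prems bs in auto)
  finally show ?case by (simp add: bs)
qed simp

lemma ct_zero_row: "(\<lambda>s. 0) \<in> set qs \<Longrightarrow> ct qs \<psi> = 0"
  by (induction qs arbitrary: \<psi>) auto

section \<open>Splitting one position into its weak commitments\<close>

type_synonym slot_outcome = "(bits \<times> bits) \<times> bits"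

context claw_keys
begin

abbreviation "pks \<equiv> map fst ks"
abbreviation "key0 \<equiv> hd ks"
abbreviation "keys1 \<equiv> tl ks"

lemma key0_in: "(fst key0, snd key0) \<in> set_pmf (Gen_F F lam)"
  using keys length_keys by (cases ks) auto

lemma keys1_in: "i \<in> set keys1 \<Longrightarrow> (fst i, snd i) \<in> set_pmf (Gen_F F lam)"
  using keys by (cases ks) auto

lemma length_keys1: "length keys1 = Suc w"
  using length_keys by simp

abbreviation slots1 :: "bits \<times> bits \<Rightarrow> slot_outcome set" where
  "slots1 i \<equiv> slots r (h (fst i)) \<times> bitstr (Suc w)"

abbreviation block_kern :: "(bits \<Rightarrow> bool \<Rightarrow> vec) \<Rightarrow> bool \<Rightarrow> bits \<times> bits \<Rightarrow> slot_outcome \<Rightarrow> bool \<Rightarrow> complex" where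
  "block_kern p \<beta> i \<equiv> (\<lambda>(c, b). (if \<beta> then vk else wk) w r (p (fst i)) c b)"

text \<open>The outer family is always \<open>vk\<close>, on account of the Hadamard layer inside
  the commitment; the gates of an opening affect the inner families.\<close>

abbreviation nested_kern :: "(bits \<Rightarrow> bool \<Rightarrow> vec) \<Rightarrow> bool \<Rightarrow> (bits \<times> bits) \<times> slot_outcome list \<Rightarrow> bool \<Rightarrow> complex" where
  "nested_kern p \<beta> \<equiv> nest (vk w r (p (fst key0))) (block_kern p \<beta>) keys1"

abbreviation "nested_outcomes \<equiv> slots r (h (fst key0)) \<times> listset (map slots1 keys1)"

text \<open>Sorts the data by weak commitment: \<open>(y, t)\<close> of the first one, and for each
  later one its \<open>(y, t)\<close> with its own \<open>w + 1\<close> residual bits.\<close>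

definition regroup :: "outcome \<Rightarrow> (bits \<times> bits) \<times> slot_outcome list" where
  "regroup = (\<lambda>(x, t, b). ((fst x, fst t), zip (zip (snd x) (snd t)) (chunks (Suc w) (Suc w) b)))"

definition ungroup :: "(bits \<times> bits) \<times> slot_outcome list \<Rightarrow> outcome" where
  "ungroup = (\<lambda>(c, os). ((fst c, map (fst \<circ> fst) os), (snd c, map (snd \<circ> fst) os), concat (map snd os)))"

lemma outcomesD:
  assumes "(x, t, b) \<in> outcomes F lam pks"
  shows "length (fst x) = r" "length (snd x) = Suc w" "\<And>y. y \<in> set (snd x) \<Longrightarrow> length y = r"
    "length (fst t) = h (fst key0)" "length (snd t) = Suc w"
    "\<And>j. j < Suc w \<Longrightarrow> length (snd t ! j) = h (fst (keys1 ! j))" "length b = Suc w * Suc w"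
proof -
  have k: "hd pks = fst key0" "tl pks = map fst keys1" using length_keys by (cases ks; simp)+
  have "fst x \<in> bitstr r" "snd x \<in> listset (replicate (Suc w) (bitstr r))"
    "fst t \<in> bitstr (h (fst key0))" "snd t \<in> listset (map (\<lambda>pk. bitstr (h pk)) (map fst keys1))"
    "b \<in> bitstr (blk F lam)"
    using assms by (auto simp: outcomes_def commitments_def hidden_set_def k)
  then show "length (fst x) = r" "length (snd x) = Suc w" "\<And>y. y \<in> set (snd x) \<Longrightarrow> length y = r"
    "length (fst t) = h (fst key0)" "length (snd t) = Suc w"
    "\<And>j. j < Suc w \<Longrightarrow> length (snd t ! j) = h (fst (keys1 ! j))" "length b = Suc w * Suc w"
    using length_keys1
    by (auto simp: listset_eq list_all2_conv_all_nth in_set_conv_nth blk_eq simp del: listset.simps replicate_Suc)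
qed

lemma bij_regroup: "bij_betw regroup (outcomes F lam pks) nested_outcomes"
proof (rule bij_betw_byWitness[where f' = ungroup])
  show "\<forall>o1\<in>outcomes F lam pks. ungroup (regroup o1) = o1"
  proof
    fix o1 assume "o1 \<in> outcomes F lam pks"
    then obtain x t b where o1: "o1 = (x, t, b)" "(x, t, b) \<in> outcomes F lam pks" by (cases o1) auto
    note D = outcomesD[OF o1(2)]
    have c: "length (chunks (Suc w) (Suc w) b) = Suc w" "concat (chunks (Suc w) (Suc w) b) = b"
      using concat_chunks[OF D(7)] by auto
    then show "ungroup (regroup o1) = o1"
      using D by (simp add: o1(1) regroup_def ungroup_def map_zip_map flip: map_map)
  qed
  show "\<forall>n\<in>nested_outcomes. regroup (ungroup n) = n"
  proof
    fix n assume "n \<in> nested_outcomes"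
    then obtain c os where n: "n = (c, os)" "os \<in> listset (map slots1 keys1)" by auto
    have l: "length os = Suc w" "\<And>d. d \<in> set (map snd os) \<Longrightarrow> length d = Suc w"
    proof -
      show "length os = Suc w" using n(2) length_keys1 by (simp add: listset_eq list_all2_lengthD)
      fix d assume "d \<in> set (map snd os)"
      then obtain j where j: "j < length os" "d = snd (os ! j)" by (auto simp: in_set_conv_nth)
      have "os ! j \<in> slots1 (keys1 ! j)"
        using n(2) j(1) by (auto simp: listset_eq list_all2_conv_all_nth)
      then show "length d = Suc w" unfolding j(2) mem_Times_iff by simp
    qed
    have "chunks (Suc w) (Suc w) (concat (map snd os)) = map snd os"
      by (rule chunks_concat) (use l in auto)
    moreover have "zip (zip (map (fst \<circ> fst) os) (map (snd \<circ> fst) os)) (map snd os) = os"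
      by (rule nth_equalityI) simp_all
    ultimately show "regroup (ungroup n) = n" by (simp add: n(1) regroup_def ungroup_def)
  qed
  show "regroup ` outcomes F lam pks \<subseteq> nested_outcomes"
  proof
    fix n assume "n \<in> regroup ` outcomes F lam pks"
    then obtain x t b where n: "n = regroup (x, t, b)" "(x, t, b) \<in> outcomes F lam pks" by auto
    note D = outcomesD[OF n(2)]
    note c = concat_chunks[OF D(7)]
    show "n \<in> nested_outcomes"
      using D c(2) c(3)[OF nth_mem] length_keys1
      by (auto simp: n(1) regroup_def slots_def listset_eq list_all2_conv_all_nth)
  qed
  show "ungroup ` nested_outcomes \<subseteq> outcomes F lam pks"
  proof
    fix o1 assume "o1 \<in> ungroup ` nested_outcomes"
    then obtain c os where o1: "o1 = ungroup (c, os)" "c \<in> slots r (h (fst key0))" "os \<in> listset (map slots1 keys1)"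
      by auto
    have k: "hd pks = fst key0" "tl pks = map fst keys1" using length_keys by (cases ks; simp)+
    have l: "length os = Suc w" "\<And>j. j < Suc w \<Longrightarrow> os ! j \<in> slots1 (keys1 ! j)"
      using o1(3) length_keys1 by (auto simp: listset_eq list_all2_conv_all_nth)
    have l3: "length (snd (os ! j)) = Suc w" if "j < Suc w" for j
      using l(2)[OF that] unfolding mem_Times_iff by simp
    have "length (concat (map snd os)) = length os * Suc w" if "\<forall>j<length os. length (snd (os ! j)) = Suc w" for os :: "slot_outcome list"
      using that by (induction os) (auto simp: All_less_Suc2)
    then have "length (concat (map snd os)) = Suc w * Suc w" using l(1) l3 by simp
    then show "o1 \<in> outcomes F lam pks"
      using o1(2) l length_keys1
      by (auto simp: o1(1) ungroup_def outcomes_def commitments_def hidden_set_def k slots_def blk_eq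
          listset_eq list_all2_conv_all_nth mem_Times_iff simp del: listset.simps replicate_Suc)
  qed
qed

abbreviation "real_prep pk \<equiv> prep_vec F lam pk"

lemma weak_kern_wk: "weak_kern F lam pk y t = wk w r (real_prep pk) (y, t)"
  by (simp add: weak_kern_def wk_def fun_eq_iff)

text \<open>Without gates the contraction already has nested form; with gates
  \<open>hadamard_blocks\<close> first distributes them over the blocks.\<close>

lemma game_kern_regroup:
  assumes "x \<in> outcomes F lam pks"
  shows "game_kern F lam pks \<beta> x = nested_kern real_prep \<beta> (regroup x)"
proof -
  obtain c t b where x: "x = (c, t, b)" by (cases x)
  note D = outcomesD[OF assms[unfolded x]]
  have k: "hd pks = fst key0" "tl pks = map fst keys1" using length_keys by (cases ks; simp)+
  let ?m = "Suc w"
  let ?Ks = "map (\<lambda>(i, y, t). wk w r (real_prep (fst i)) (y, t)) (zip keys1 (zip (snd c) (snd t)))"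
  let ?V = "vk w r (real_prep (fst key0)) (fst c, fst t)"
  have lK: "length ?Ks = ?m" using D length_keys1 by simp
  have C: "commit_kern F lam pks c t d s = ct (map2 (\<lambda>K c. K c) ?Ks (chunks ?m (length ?Ks) d)) (\<lambda>e. ?V e s)"
    if "length d = ?m * ?m" for d s
  proof -
    have "map (\<lambda>(pk, y, t, c). weak_kern F lam pk y t c) (zip (tl pks) (zip (snd c) (zip (snd t) (chunks ?m ?m d))))
        = map2 (\<lambda>K c. K c) ?Ks (chunks ?m (length ?Ks) d)"
      unfolding lK using D length_keys1 k concat_chunks(2)[OF that]
      by (intro nth_equalityI) (simp_all add: weak_kern_wk)
    then show ?thesis
      using that by (simp only: commit_kern_def blk_eq vk_def weak_kern_wk k Suc_eq_plus1 refl if_True)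
  qed
  have cb: "length (chunks ?m ?m b) = ?m" "concat (chunks ?m ?m b) = b" "\<And>d. d \<in> set (chunks ?m ?m b) \<Longrightarrow> length d = ?m"
    using concat_chunks[OF D(7)] by auto
  show ?thesis
  proof (cases \<beta>)
    case False
    have "map2 (block_kern real_prep False) keys1 (snd (regroup x)) = map2 (\<lambda>K c. K c) ?Ks (chunks ?m (length ?Ks) b)"
      unfolding lK using D length_keys1 cb(1)
      by (intro nth_equalityI) (simp_all add: x regroup_def)
    then show ?thesis
      using False C[OF D(7)]
      by (simp add: x game_kern_def hadamard_if_def nest_def regroup_def fun_eq_iff)
  next
    case True
    have "map2 (block_kern real_prep True) keys1 (snd (regroup x)) = map2 hadamard_kern ?Ks (chunks ?m ?m b)"
      using D length_keys1 cb(1)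
      by (intro nth_equalityI) (simp_all add: x regroup_def vk_def)
    moreover have "hadamard_kern (commit_kern F lam pks c t) b s = ct (map2 hadamard_kern ?Ks (chunks ?m ?m b)) (\<lambda>e. ?V e s)" for s
    proof -
      have "hadamard_kern (commit_kern F lam pks c t) b s = ct (map had1 b) (\<lambda>d. commit_kern F lam pks c t d s)"
        by (simp add: hadamard_kern_def)
      also have "\<dots> = ct (map had1 b) (\<lambda>d. ct (map2 (\<lambda>K c. K c) ?Ks (chunks ?m (length ?Ks) d)) (\<lambda>e. ?V e s))"
        by (rule ct_cong) (simp add: C D(7))
      also have "\<dots> = ct (map had1 (concat (chunks ?m ?m b))) (\<lambda>d. ct (map2 (\<lambda>K c. K c) ?Ks (chunks ?m (length ?Ks) d)) (\<lambda>e. ?V e s))"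
        by (simp only: cb(2))
      also have "\<dots> = ct (map2 hadamard_kern ?Ks (chunks ?m ?m b)) (\<lambda>e. ?V e s)"
        by (rule hadamard_blocks) (use cb lK in auto)
      finally show ?thesis .
    qed
    ultimately show ?thesis
      using True by (simp add: x game_kern_def hadamard_if_def nest_def regroup_def fun_eq_iff)
  qed
qed

lemma unit_prep_key: "(pk, sk) \<in> set_pmf (Gen_F F lam) \<Longrightarrow> unit_prep F lam pk"
  by (rule unit_prepI) (rule prep_wf)

lemma real_prep_unit: "(pk, sk) \<in> set_pmf (Gen_F F lam) \<Longrightarrow> sq (w + h pk) (real_prep pk s) = 1"
  using unit_prep_key[of pk sk] by (simp add: unit_prep_def prep_size_h)

lemma prep_distance:
  assumes "(pk, sk) \<in> set_pmf (Gen_F F lam)"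
  shows "sq (w + h pk) (\<lambda>a. real_prep pk s a - ideal_prep pk s a) \<le> ep\<^sup>2"
proof -
  have "(L2_set (\<lambda>a. cmod (real_prep pk s a - ideal_prep pk s a)) (bitstr (w + h pk)))\<^sup>2 \<le> ep\<^sup>2"
    using prep_near[OF assms, of s] by (intro power_mono) (simp_all add: prep_size_h L2_set_nonneg)
  then show ?thesis by (simp add: L2_set_def sq_def sum_nonneg)
qed

lemma iso_block:
  assumes "\<And>s. sq (w + h (fst i)) (p (fst i) s) = 1"
  shows "iso (block_kern p \<beta> i) (slots1 i)"
  using iso_wk[where p = "p (fst i)", OF assms r_le_h] by (cases \<beta>) simp_all

lemma iso_nested:
  assumes "\<And>pk sk s. (pk, sk) \<in> set_pmf (Gen_F F lam) \<Longrightarrow> sq (w + h pk) (p pk s) = 1"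
  shows "iso (nested_kern p \<beta>) nested_outcomes"
proof (rule iso_nest)
  show "iso (\<lambda>(c, d). vk w r (p (fst key0)) c d) (slots r (h (fst key0)) \<times> bitstr (length keys1))"
    unfolding length_keys1 by (rule iso_wk(2)[OF assms[OF key0_in] r_le_h])
  show "iso (block_kern p \<beta> i) (slots1 i)" if "i \<in> set keys1" for i
    by (rule iso_block[where p = p, OF assms[OF keys1_in[OF that]]])
qed simp

text \<open>One outer and \<open>w + 1\<close> inner preparations contribute \<open>ep\<close>
  each.\<close>

lemma near_nested:
  "near ((w + 2) * ep) (nested_kern real_prep \<beta>) (nested_kern ideal_prep \<beta>) nested_outcomes"
proof -
  have b: "near ep (block_kern real_prep \<beta> i) (block_kern ideal_prep \<beta> i) (slots1 i)" if "i \<in> set keys1" for i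
    using near_wk[where p = "real_prep (fst i)" and p' = "ideal_prep (fst i)", OF prep_distance[OF keys1_in[OF that]] r_le_h] by (cases \<beta>) simp_all
  have "near (ep + length keys1 * ep) (nested_kern real_prep \<beta>) (nested_kern ideal_prep \<beta>) nested_outcomes"
  proof (rule near_nest)
    show "iso (\<lambda>(c, d). vk w r (ideal_prep (fst key0)) c d) (slots r (h (fst key0)) \<times> bitstr (length keys1))"
      unfolding length_keys1 by (rule iso_wk(2)[OF ideal_prep_unit[OF key0_in] r_le_h])
    show "near ep (\<lambda>(c, d). vk w r (real_prep (fst key0)) c d) (\<lambda>(c, d). vk w r (ideal_prep (fst key0)) c d)
        (slots r (h (fst key0)) \<times> bitstr (length keys1))"
      unfolding length_keys1 by (rule near_wk(2)[OF prep_distance[OF key0_in] r_le_h])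
    show "iso (block_kern real_prep \<beta> i) (slots1 i)" if "i \<in> set keys1" for i
      by (rule iso_block[where p = real_prep, OF real_prep_unit[OF keys1_in[OF that]]])
    show "iso (block_kern ideal_prep \<beta> i) (slots1 i)" if "i \<in> set keys1" for i
      by (rule iso_block[where p = ideal_prep, OF ideal_prep_unit[OF keys1_in[OF that]]])
  qed (use b ep_nonneg in auto)
  moreover have "ep + length keys1 * ep = (w + 2) * ep"
    unfolding length_keys1 by (simp add: algebra_simps)
  ultimately show ?thesis by simp
qed

definition basis_kern :: "bool \<Rightarrow> bool \<Rightarrow> bool \<Rightarrow> complex" where
  "basis_kern \<beta> = (if \<beta> then id1 else had1)"

definition nested_label :: "bool \<Rightarrow> (bits \<times> bits) \<times> slot_outcome list \<Rightarrow> bool" where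
  "nested_label \<beta> = (\<lambda>(c, os). if \<beta> then hd (map2 (\<lambda>i (c, b). label (snd i) (fst c) b) keys1 os)
     else label (snd key0) (fst c) (map2 (\<lambda>i (c, b). hd b) keys1 os))"

lemma resolves_vk1:
  "i \<in> set keys1 \<Longrightarrow> resolves (block_kern ideal_prep True i) (slots1 i) (\<lambda>(c, b). label (snd i) (fst c) b) had1"
  using resolves_vk[OF keys1_in] by simp

lemma resolves_wk1:
  "i \<in> set keys1 \<Longrightarrow> resolves (block_kern ideal_prep False i) (slots1 i) (\<lambda>(c, b). hd b) id1"
  using resolves_wk[where p = "ideal_prep (fst i)", OF ideal_prep_unit[OF keys1_in] r_le_h] by simp

text \<open>Without gates the inner families expose a standard basis string \<open>d\<close>, and
  the outer \<open>vk\<close> resolves the Hadamard basis. With gates the inner families resolve the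
  Hadamard basis and cancel the layer of the commitment; the raw outer row at the recovered string
  then resolves the standard basis by its leading bit.\<close>

lemma resolves_nested:
  "resolves (nested_kern ideal_prep \<beta>) nested_outcomes (nested_label \<beta>) (basis_kern \<beta>)"
proof (cases \<beta>)
  case False
  have "resolves (nested_kern ideal_prep False) nested_outcomes
      (\<lambda>(c, os). label (snd key0) (fst c) (map2 (\<lambda>i (c, b). hd b) keys1 os)) had1"
  proof (rule resolves_nest_id)
    show "resolves (\<lambda>(c, d). vk w r (ideal_prep (fst key0)) c d) (slots r (h (fst key0)) \<times> bitstr (length keys1))
        (\<lambda>(c, d). label (snd key0) (fst c) d) had1"
      unfolding length_keys1 by (rule resolves_vk[OF key0_in])
  qed (rule resolves_wk1, simp_all)
  then show ?thesis using False by (simp add: nested_label_def basis_kern_def)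
next
  case True
  have "resolves (nest (\<lambda>c. hadamard_kern (wk w r (ideal_prep (fst key0)) c)) (block_kern ideal_prep True) keys1)
      nested_outcomes (\<lambda>(c, os). hd (map2 (\<lambda>i (c, b). label (snd i) (fst c) b) keys1 os)) id1"
  proof (rule resolves_nest_had)
    show "iso (\<lambda>(c, d). hadamard_kern (wk w r (ideal_prep (fst key0)) c) d)
        (slots r (h (fst key0)) \<times> bitstr (length keys1))"
      using iso_wk(2)[where p = "ideal_prep (fst key0)", OF ideal_prep_unit[OF key0_in] r_le_h] unfolding length_keys1 vk_def .
    show "\<exists>e. wk w r (ideal_prep (fst key0)) c m = (\<lambda>s. e * id1 (hd m) s)" for c m
      by (rule exI[of _ "wk w r (ideal_prep (fst key0)) c m (hd m)"])
        (cases c, auto simp: wk_def id1_def)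
  qed (rule resolves_vk1, simp_all)
  then show ?thesis using True by (simp add: nested_label_def basis_kern_def vk_def[abs_def])
qed

end

section \<open>Verification and output on the ideal kernels\<close>

context claw_keys
begin

definition ideal_kern :: "bool \<Rightarrow> outcome \<Rightarrow> bool \<Rightarrow> complex" where
  "ideal_kern \<beta> x = nested_kern ideal_prep \<beta> (regroup x)"

lemma iso_game: "iso (game_kern F lam pks \<beta>) (outcomes F lam pks)"
proof -
  have "iso (\<lambda>x. nested_kern real_prep \<beta> (regroup x)) (outcomes F lam pks)"
    by (rule iso_bij[OF bij_regroup iso_nested[where p = real_prep]]) (rule real_prep_unit)
  then show ?thesis by (simp add: iso_def game_kern_regroup)
qed

lemma iso_ideal: "iso (ideal_kern \<beta>) (outcomes F lam pks)"
  using iso_bij[OF bij_regroup iso_nested[where p = ideal_prep, OF ideal_prep_unit]]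
  by (simp add: ideal_kern_def[abs_def])

lemma near_game: "near ((w + 2) * ep) (game_kern F lam pks \<beta>) (ideal_kern \<beta>) (outcomes F lam pks)"
  using near_bij[OF bij_regroup near_nested, of \<beta>]
  by (simp add: near_def game_kern_regroup ideal_kern_def)

text \<open>The negation translates conventions: \<open>\<beta>\<close> stands for gates on the
  residual qubits, which is an opening with basis bit 0.\<close>

definition result :: "bool \<Rightarrow> outcome \<Rightarrow> bool" where
  "result \<beta> = (\<lambda>(x, t, b). out1 F lam ks (commit_hash x) (\<not> \<beta>) b)"

definition verified :: "bool \<Rightarrow> outcome \<Rightarrow> bool" where
  "verified \<beta> = (\<lambda>(x, t, b). ver1 F lam ks (commit_hash x) (\<not> \<beta>) b)"

context
  fixes x t b assumes o: "(x, t, b) \<in> outcomes F lam pks"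
begin

lemmas outcome_lengths = outcomesD[OF o]

abbreviation "zs \<equiv> chunks (Suc w) (Suc w) b"

lemma zs: "length zs = Suc w" "concat zs = b" "z \<in> set zs \<Longrightarrow> length z = Suc w"
  using concat_chunks[OF outcome_lengths(7)] by auto

lemma zpart_zs: "i < Suc w \<Longrightarrow> zpart F lam b i = zs ! i"
  by (simp add: zpart_def chunks_def del: upt_Suc)

lemma ypart_commit: "i < Suc (Suc w) \<Longrightarrow> ypart F lam (commit_hash x) i = (fst x # snd x) ! i"
  unfolding ypart_def commit_hash_def by (rule slice_concat) (use outcome_lengths in auto)

lemma claw_commit:
  "claw F lam ks (commit_hash x) 0 = Invert_F F (snd key0) (fst x)"
  "i < Suc w \<Longrightarrow> claw F lam ks (commit_hash x) (Suc i) = Invert_F F (snd (keys1 ! i)) (snd x ! i)"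
  using length_keys by (cases ks; simp add: claw_def ypart_commit)+

lemma dvec_zs: "dvec F lam b = map2 (\<lambda>i (c, z). hd z) keys1 (snd (regroup (x, t, b)))"
  using outcome_lengths zs length_keys1
  by (intro nth_equalityI) (simp_all add: dvec_def zpart_zs regroup_def del: upt_Suc)

lemma mvec_zs: "mvec F lam ks (commit_hash x) b
    = map2 (\<lambda>i (c, z). label (snd i) (fst c) z) keys1 (snd (regroup (x, t, b)))"
  using outcome_lengths zs length_keys1
  by (intro nth_equalityI) (simp_all add: mvec_def zpart_zs claw_commit label_def regroup_def del: upt_Suc split: option.split)

lemma result_label: "result \<beta> (x, t, b) = nested_label \<beta> (regroup (x, t, b))"
proof (cases \<beta>)
  case True
  then show ?thesis
    by (simp add: result_def out1_def nested_label_def mvec_zs split_def)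
next
  case False
  have "nested_label False (regroup (x, t, b)) = label (snd key0) (fst (fst (regroup (x, t, b)))) (dvec F lam b)"
    unfolding dvec_zs by (cases "regroup (x, t, b)") (simp only: nested_label_def case_prod_conv if_False fst_conv snd_conv)
  moreover have "fst (fst (regroup (x, t, b))) = fst x" by (simp add: regroup_def)
  moreover have "result False (x, t, b) = label (snd key0) (fst x) (dvec F lam b)"
    by (simp add: result_def out1_def claw_commit(1) label_def)
  ultimately show ?thesis using False by simp
qed

lemma commit_length: "length (commit_hash x) = (w + 2) * r"
proof -
  have "length (concat ys) = length ys * r" if "\<forall>y\<in>set ys. length y = r" for ys :: "bits list"
    using that by (induction ys) auto
  from this[of "fst x # snd x"] show ?thesis using outcome_lengths by (simp add: commit_hash_def)
qed

lemma hidden_block: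
  assumes "i < Suc w"
  shows "snd (regroup (x, t, b)) ! i = ((snd x ! i, snd t ! i), zs ! i)" "length (snd t ! i) = h (fst (keys1 ! i))"
  using outcome_lengths zs assms by (simp_all add: regroup_def)

text \<open>The checks of the inner commitments hold wherever the ideal amplitude is nonzero, so
  there only the goodness of \<open>d\<close> can fail.\<close>

lemma rejected_std:
  assumes "\<not> verified False (x, t, b)" "ideal_kern False (x, t, b) \<noteq> (\<lambda>s. 0)"
  shows "\<not> accepted (snd key0) (fst x) (dvec F lam b)"
proof
  assume acc: "accepted (snd key0) (fst x) (dvec F lam b)"
  have "Check_F F (fst (keys1 ! i)) (hd (zs ! i)) (tl (zs ! i)) (snd x ! i)" if i: "i < Suc w" for i
  proof (rule ccontr)
    assume nc: "\<not> Check_F F (fst (keys1 ! i)) (hd (zs ! i)) (tl (zs ! i)) (snd x ! i)"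
    have k: "keys1 ! i \<in> set keys1" using i length_keys1 by (metis nth_mem)
    have "wk w r (ideal_prep (fst (keys1 ! i))) (snd x ! i, snd t ! i) (zs ! i) = (\<lambda>s. 0)"
      using check_wk[OF keys1_in[OF k] hidden_block(2)[OF i]] nc by blast
    then have "map2 (block_kern ideal_prep False) keys1 (snd (regroup (x, t, b))) ! i = (\<lambda>s. 0)"
      using i length_keys1 outcome_lengths zs hidden_block(1)[OF i] by (simp add: regroup_def)
    moreover have "i < length (map2 (block_kern ideal_prep False) keys1 (snd (regroup (x, t, b))))"
      using i length_keys1 outcome_lengths zs by (simp add: regroup_def)
    ultimately have "(\<lambda>s. 0) \<in> set (map2 (block_kern ideal_prep False) keys1 (snd (regroup (x, t, b))))"
      by (metis nth_mem)
    from ct_zero_row[OF this] have "ideal_kern False (x, t, b) = (\<lambda>s. 0)"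
      by (simp add: ideal_kern_def nest_def split_def fun_eq_iff)
    then show False using assms(2) by simp
  qed
  then have "ver1 F lam ks (commit_hash x) True b"
    using acc outcome_lengths(7) length_keys
    by (auto simp: ver1_def commit_length blk_eq zpart_zs ypart_commit claw_commit accepted_def nth_tl)
  then show False using assms(1) by (simp add: verified_def)
qed

text \<open>The row is a multiple of the outer \<open>wk\<close> at the recovered string. Where it
  is nonzero the check of the first commitment succeeds, so only the goodness tests can
  fail.\<close>

lemma rejected_had:
  assumes "\<not> verified True (x, t, b)" "ideal_kern True (x, t, b) \<noteq> (\<lambda>s. 0)"
  shows "\<not> list_all2 (\<lambda>i (c, z). accepted (snd i) (fst c) z) keys1 (snd (regroup (x, t, b)))"
proof
  assume acc: "list_all2 (\<lambda>i (c, z). accepted (snd i) (fst c) z) keys1 (snd (regroup (x, t, b)))"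
  let ?m = "mvec F lam ks (commit_hash x) b"
  have in_nested: "snd (regroup (x, t, b)) \<in> listset (map slots1 keys1)"
  proof -
    have "regroup (x, t, b) \<in> nested_outcomes" using bij_betwE[OF bij_regroup] o by blast
    then show ?thesis by (simp only: mem_Times_iff)
  qed
  have reg: "regroup (x, t, b) = ((fst x, fst t), snd (regroup (x, t, b)))"
    by (simp add: regroup_def)
  obtain e where "nest (\<lambda>c. hadamard_kern (wk w r (ideal_prep (fst key0)) c)) (block_kern ideal_prep True) keys1
      ((fst x, fst t), snd (regroup (x, t, b)))
      = (\<lambda>s. e * wk w r (ideal_prep (fst key0)) (fst x, fst t)
          (map2 (\<lambda>i (c, z). label (snd i) (fst c) z) keys1 (snd (regroup (x, t, b)))) s)"
    by (rule nest_hadamard_kern[OF _ in_nested], erule resolves_vk1, rule that)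
  then have e: "ideal_kern True (x, t, b) = (\<lambda>s. e * wk w r (ideal_prep (fst key0)) (fst x, fst t) ?m s)"
    unfolding ideal_kern_def mvec_zs reg[symmetric] by (simp add: vk_def[abs_def])
  then obtain s where "wk w r (ideal_prep (fst key0)) (fst x, fst t) ?m s \<noteq> 0"
    using assms(2) by (auto simp: fun_eq_iff)
  from check_wk[OF key0_in outcome_lengths(4) this]
  have chk: "Check_F F (fst key0) (hd ?m) (tl ?m) (fst x)" .
  have "\<exists>x0 x1. claw F lam ks (commit_hash x) (Suc i) = Some (x0, x1) \<and> zpart F lam b i \<in> good_set F lam x0 x1"
    if i: "i < Suc w" for i
    using acc i length_keys1 hidden_block(1)[OF i]
    by (auto simp: list_all2_conv_all_nth claw_commit zpart_zs accepted_def)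
  moreover have "ks ! 0 = key0" using length_keys by (cases ks) simp_all
  ultimately have "ver1 F lam ks (commit_hash x) False b"
    using chk outcome_lengths(7)
    by (simp add: ver1_def commit_length blk_eq ypart_commit)
  then show False using assms(1) by (simp add: verified_def)
qed

end

lemma resolves_ideal: "resolves (ideal_kern \<beta>) (outcomes F lam pks) (result \<beta>) (basis_kern \<beta>)"
proof -
  have "resolves (\<lambda>x. nested_kern ideal_prep \<beta> (regroup x)) (outcomes F lam pks)
      (\<lambda>x. nested_label \<beta> (regroup x)) (basis_kern \<beta>)"
    by (rule resolves_bij[OF bij_regroup resolves_nested])
  moreover have "result \<beta> x = nested_label \<beta> (regroup x)" if "x \<in> outcomes F lam pks" for x
    using that by (cases x) (simp add: result_label)
  ultimately show ?thesis by (simp add: resolves_def ideal_kern_def[abs_def])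
qed

text \<open>A density cannot exceed 1. The two distinct domain elements to which the density
  condition is applied are a matched pair.\<close>

lemma eg_nonneg: "0 \<le> eg"
proof -
  note k = key0_in
  have "Dom_F F (fst key0) \<noteq> {}" by (rule key_domain(1)[OF k])
  then obtain x where x: "x \<in> Dom_F F (fst key0)" by blast
  obtain M where "perfect_matching M (Dom_F F (fst key0))" using key_complete(2)[OF k] by blast
  then obtain x' where x': "x' \<in> Dom_F F (fst key0)" "x \<noteq> x'"
    using x unfolding perfect_matching_def by blast
  have "card (good_set F lam x x') \<le> card (bitstr (Suc w))"
    by (rule card_mono) (auto simp: good_set_def)
  then have "real (card (good_set F lam x x')) / 2 ^ (w + 1) \<le> 1"
    by (simp add: card_bitstr) (metis of_nat_le_iff of_nat_mult of_nat_numeral of_nat_power)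
  then show ?thesis using good_dense[OF k x x'(1) x'(2)] by linarith
qed

text \<open>Without gates one string \<open>d\<close> must be good, with gates \<open>w + 1\<close>
  strings must; the larger bound serves both cases.\<close>

lemma ideal_bad:
  "(\<Sum>x\<in>outcomes F lam pks. if \<not> verified \<beta> x then (cmod (braket (ideal_kern \<beta> x) u))\<^sup>2 else 0)
    \<le> (w + 1) * (2 * eg) * vsq u"
proof (cases \<beta>)
  case False
  let ?bad = "\<lambda>c d. \<not> accepted (snd key0) (fst c) d"
  let ?f = "\<lambda>i (c, z). hd z"
  have "(\<Sum>x\<in>outcomes F lam pks. if \<not> verified \<beta> x then (cmod (braket (ideal_kern \<beta> x) u))\<^sup>2 else 0)
     \<le> (\<Sum>x\<in>outcomes F lam pks. if ?bad (fst (regroup x)) (map2 ?f keys1 (snd (regroup x)))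
          then (cmod (braket (nested_kern ideal_prep False (regroup x)) u))\<^sup>2 else 0)"
  proof (rule sum_mono)
    fix y assume "y \<in> outcomes F lam pks"
    then obtain x t b where y: "y = (x, t, b)" "(x, t, b) \<in> outcomes F lam pks" by (cases y) auto
    have "braket (ideal_kern False y) u = 0" if "\<not> verified False y"
      "\<not> ?bad (fst (regroup y)) (map2 ?f keys1 (snd (regroup y)))"
    proof -
      have "ideal_kern False y = (\<lambda>s. 0)"
      proof (rule ccontr)
        assume "ideal_kern False y \<noteq> (\<lambda>s. 0)"
        then have "\<not> accepted (snd key0) (fst x) (dvec F lam b)"
          using rejected_std[OF y(2)] that(1) unfolding y(1) by blast
        then show False using that(2) unfolding y(1) dvec_zs[OF y(2)] by (simp add: regroup_def)
      qed
      then show ?thesis by simp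
    qed
    then show "(if \<not> verified \<beta> y then (cmod (braket (ideal_kern \<beta> y) u))\<^sup>2 else 0)
      \<le> (if ?bad (fst (regroup y)) (map2 ?f keys1 (snd (regroup y)))
          then (cmod (braket (nested_kern ideal_prep False (regroup y)) u))\<^sup>2 else 0)"
      using False by (auto simp: ideal_kern_def)
  qed
  also have "\<dots> = (\<Sum>n\<in>nested_outcomes. if ?bad (fst n) (map2 ?f keys1 (snd n))
          then (cmod (braket (nested_kern ideal_prep False n) u))\<^sup>2 else 0)"
    by (rule sum.reindex_bij_betw[OF bij_regroup])
  also have "\<dots> = (\<Sum>x\<in>slots r (h (fst key0)) \<times> bitstr (length keys1). if ?bad (fst x) (snd x)
       then (cmod (braket (vk w r (ideal_prep (fst key0)) (fst x) (snd x)) u))\<^sup>2 else 0)"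
    by (rule nest_bad_outer) (rule resolves_wk1, simp_all)
  also have "\<dots> \<le> 2 * eg * vsq u"
    unfolding length_keys1 by (rule vk_bad[OF key0_in])
  also have "\<dots> \<le> (w + 1) * (2 * eg) * vsq u"
    using eg_nonneg by (intro mult_right_mono) (simp_all add: mult_le_cancel_right1)
  finally show ?thesis .
next
  case True
  let ?bad = "\<lambda>i x. \<not> accepted (snd i) (fst (fst x)) (snd x)"
  have "(\<Sum>x\<in>outcomes F lam pks. if \<not> verified \<beta> x then (cmod (braket (ideal_kern \<beta> x) u))\<^sup>2 else 0)
     \<le> (\<Sum>x\<in>outcomes F lam pks. if list_all2 (\<lambda>i x. \<not> ?bad i x) keys1 (snd (regroup x)) then 0
          else (cmod (braket (nested_kern ideal_prep True (regroup x)) u))\<^sup>2)"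
  proof (rule sum_mono)
    fix y assume "y \<in> outcomes F lam pks"
    then obtain x t b where y: "y = (x, t, b)" "(x, t, b) \<in> outcomes F lam pks" by (cases y) auto
    have "braket (ideal_kern True y) u = 0" if "\<not> verified True y"
      "list_all2 (\<lambda>i x. \<not> ?bad i x) keys1 (snd (regroup y))"
    proof -
      have "ideal_kern True y = (\<lambda>s. 0)"
      proof (rule ccontr)
        assume "ideal_kern True y \<noteq> (\<lambda>s. 0)"
        then have "\<not> list_all2 (\<lambda>i (c, z). accepted (snd i) (fst c) z) keys1 (snd (regroup (x, t, b)))"
          using rejected_had[OF y(2)] that(1) unfolding y(1) by blast
        then show False using that(2) unfolding y(1) by (simp add: split_def)
      qed
      then show ?thesis by simp
    qed
    then show "(if \<not> verified \<beta> y then (cmod (braket (ideal_kern \<beta> y) u))\<^sup>2 else 0)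
      \<le> (if list_all2 (\<lambda>i x. \<not> ?bad i x) keys1 (snd (regroup y)) then 0
          else (cmod (braket (nested_kern ideal_prep True (regroup y)) u))\<^sup>2)"
      using True by (auto simp: ideal_kern_def)
  qed
  also have "\<dots> = (\<Sum>n\<in>nested_outcomes. if list_all2 (\<lambda>i x. \<not> ?bad i x) keys1 (snd n) then 0
          else (cmod (braket (nested_kern ideal_prep True n) u))\<^sup>2)"
    by (rule sum.reindex_bij_betw[OF bij_regroup])
  also have "\<dots> \<le> length keys1 * (2 * eg) * vsq u"
  proof (rule nest_bad_inner)
    show "iso (\<lambda>(c, d). vk w r (ideal_prep (fst key0)) c d) (slots r (h (fst key0)) \<times> bitstr (length keys1))"
      unfolding length_keys1 by (rule iso_wk(2)[OF ideal_prep_unit[OF key0_in] r_le_h])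
    show "iso (block_kern ideal_prep True i) (slots1 i)" if "i \<in> set keys1" for i
      by (rule iso_block[where p = ideal_prep, OF ideal_prep_unit[OF keys1_in[OF that]]])
    show "(\<Sum>x\<in>slots1 i. if ?bad i x then (cmod (braket (block_kern ideal_prep True i x) u))\<^sup>2 else 0) \<le> 2 * eg * vsq u"
      if "i \<in> set keys1" for i u
      using vk_bad[OF keys1_in[OF that], of u] by (simp add: split_def cong: if_cong)
  qed
  also have "\<dots> = (w + 1) * (2 * eg) * vsq u" unfolding length_keys1 by simp
  finally show ?thesis .
qed

end

section \<open>Density operators as mixtures\<close>

definition qform :: "'a set \<Rightarrow> ('a \<Rightarrow> 'a \<Rightarrow> complex) \<Rightarrow> ('a \<Rightarrow> complex) \<Rightarrow> complex" where
  "qform S \<rho> v = (\<Sum>a\<in>S. \<Sum>b\<in>S. cnj (v a) * \<rho> a b * v b)"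

lemma qform_insert:
  assumes "finite S" "x \<notin> S" "\<And>a b. \<rho> b a = cnj (\<rho> a b)"
  shows "qform (insert x S) \<rho> v = qform S \<rho> v + cnj (v x) * (\<Sum>b\<in>S. \<rho> x b * v b)
    + cnj (\<Sum>b\<in>S. \<rho> x b * v b) * v x + cnj (v x) * \<rho> x x * v x"
proof -
  have "(\<Sum>a\<in>S. cnj (v a) * \<rho> a x * v x) = cnj (\<Sum>b\<in>S. \<rho> x b * v b) * v x"
    unfolding cnj_sum sum_distrib_right
  proof (intro sum.cong refl)
    fix a show "cnj (v a) * \<rho> a x * v x = cnj (\<rho> x a * v a) * v x"
      unfolding assms(3)[of a x] by simp
  qed
  moreover have "(\<Sum>b\<in>S. cnj (v x) * \<rho> x b * v b) = cnj (v x) * (\<Sum>b\<in>S. \<rho> x b * v b)"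
    by (simp add: sum_distrib_left mult.assoc)
  ultimately show ?thesis
    using assms(1,2) by (simp add: qform_def sum.distrib algebra_simps)
qed

text \<open>One step of the Cholesky decomposition: the pivot \<open>\<rho> x x\<close> is split off as a rank-one operator.\<close>

lemma gram_vectors:
  fixes \<rho> :: "'a \<Rightarrow> 'a \<Rightarrow> complex"
  assumes "finite S" "\<And>a b. \<rho> b a = cnj (\<rho> a b)" "\<And>v. 0 \<le> Re (qform S \<rho> v)"
    and "\<And>a b. \<rho> a b \<noteq> 0 \<Longrightarrow> a \<in> S \<and> b \<in> S"
  shows "\<exists>\<Psi>. (\<forall>\<psi>\<in>set \<Psi>. \<forall>a. a \<notin> S \<longrightarrow> \<psi> a = 0) \<and> (\<forall>a b. \<rho> a b = (\<Sum>\<psi>\<leftarrow>\<Psi>. \<psi> a * cnj (\<psi> b)))"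
  using assms
proof (induction S arbitrary: \<rho> rule: finite_induct)
  case empty
  have "\<rho> a b = 0" for a b using empty.prems(3) by blast
  then show ?case by (intro exI[of _ "[]"]) simp
next
  case (insert x S)
  note herm = insert.prems(1)
  note Q = qform_insert[OF insert.hyps, of \<rho>, OF herm]
  have "cnj (\<rho> x x) = \<rho> x x" by (rule herm[symmetric])
  then have real: "Im (\<rho> x x) = 0" by (simp add: complex_eq_iff)
  have Rex: "\<rho> x x = complex_of_real (Re (\<rho> x x))" using real by (simp add: complex_eq_iff)
  have upd: "qform S \<rho> (v(x := c)) = qform S \<rho> v" "(\<Sum>b\<in>S. \<rho> x b * (v(x := c)) b) = (\<Sum>b\<in>S. \<rho> x b * v b)" for v c
    using insert.hyps(2) by (auto simp: qform_def intro!: sum.cong)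
  have d0: "0 \<le> Re (\<rho> x x)"
    using insert.prems(2)[of "(\<lambda>_. 0)(x := 1)"] unfolding Q upd by (simp add: qform_def)
  show ?case
  proof (cases "Re (\<rho> x x) = 0")
    case True
    then have xx: "\<rho> x x = 0" using Rex by simp
    have row: "\<rho> x b = 0" if b: "b \<in> S" for b
    proof (rule ccontr)
      assume nz: "\<rho> x b \<noteq> 0"
      \<comment> \<open>Chosen so that the form at \<open>?v\<close> equals -1: with a zero pivot
        only the cross term involves the coordinate \<open>x\<close>, and it can be made as negative
        as desired.\<close>
      let ?t = "(Re (\<rho> b b) + 1) / (2 * (cmod (\<rho> x b))\<^sup>2)"
      let ?v = "(\<lambda>a. of_bool (a = b))(x := - complex_of_real ?t * \<rho> x b)"
      have s: "(\<Sum>b'\<in>S. \<rho> x b' * of_bool (b' = b)) = \<rho> x b"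
        using insert.hyps(1) b by (simp add: of_bool_def if_distrib cong: if_cong)
      have q: "qform S \<rho> (\<lambda>a. of_bool (a = b)) = \<rho> b b"
      proof -
        have "(\<Sum>b'\<in>S. cnj (of_bool (a = b)) * \<rho> a b' * of_bool (b' = b)) = (if a = b then \<rho> a b else 0)" for a
        proof -
          have "(\<Sum>b'\<in>S. cnj (of_bool (a = b)) * \<rho> a b' * of_bool (b' = b))
              = (\<Sum>b'\<in>S. if b' = b then (if a = b then \<rho> a b else 0) else 0)"
            by (intro sum.cong) auto
          then show ?thesis using insert.hyps(1) b by simp
        qed
        then show ?thesis using insert.hyps(1) b by (simp add: qform_def)
      qed
      have "0 \<le> Re (qform (insert x S) \<rho> ?v)" by (rule insert.prems(2))
      also have "Re (qform (insert x S) \<rho> ?v) = Re (\<rho> b b) - 2 * ?t * (cmod (\<rho> x b))\<^sup>2"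
        unfolding Q upd q s xx by (simp add: cmod_power2) (simp add: power2_eq_square algebra_simps)
      also have "\<dots> = - 1" using nz by (simp add: field_simps)
      finally show False by simp
    qed
    have zero: "\<rho> x b = 0" "\<rho> b x = 0" for b
    proof -
      show "\<rho> x b = 0" using row[of b] xx insert.prems(3)[of x b] by auto
      then show "\<rho> b x = 0" by (subst herm) simp
    qed
    have "\<exists>\<Psi>. (\<forall>\<psi>\<in>set \<Psi>. \<forall>a. a \<notin> S \<longrightarrow> \<psi> a = 0) \<and> (\<forall>a b. \<rho> a b = (\<Sum>\<psi>\<leftarrow>\<Psi>. \<psi> a * cnj (\<psi> b)))"
    proof (rule insert.IH[OF herm])
      show "0 \<le> Re (qform S \<rho> v)" for v
        using insert.prems(2)[of "v(x := 0)"] unfolding Q upd by simp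
      show "a \<in> S \<and> b \<in> S" if "\<rho> a b \<noteq> 0" for a b
        using insert.prems(3)[OF that] zero that by auto
    qed
    then show ?thesis by blast
  next
    case False
    define d where "d = Re (\<rho> x x)"
    have d: "0 < d" using False d0 by (simp add: d_def)
    have xx: "\<rho> x x = complex_of_real d" using Rex by (simp add: d_def)
    \<comment> \<open>The pivot column scaled by \<open>1 / sqrt d\<close>; subtracting its rank-one
      operator clears row and column \<open>x\<close> and leaves the Schur complement.\<close>
    let ?\<psi> = "\<lambda>a. \<rho> a x / complex_of_real (sqrt d)"
    let ?\<rho> = "\<lambda>a b. \<rho> a b - ?\<psi> a * cnj (?\<psi> b)"
    have prod: "?\<psi> a * cnj (?\<psi> b) = \<rho> a x * \<rho> x b / complex_of_real d" for a b
    proof -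
      have "cnj (\<rho> b x) = \<rho> x b" by (rule herm[symmetric])
      then show ?thesis using d by (simp flip: of_real_mult)
    qed
    have "\<exists>\<Psi>. (\<forall>\<psi>\<in>set \<Psi>. \<forall>a. a \<notin> S \<longrightarrow> \<psi> a = 0) \<and> (\<forall>a b. ?\<rho> a b = (\<Sum>\<psi>\<leftarrow>\<Psi>. \<psi> a * cnj (\<psi> b)))"
    proof (rule insert.IH)
      show "?\<rho> b a = cnj (?\<rho> a b)" for a b
      proof -
        have "cnj (\<rho> a b) = \<rho> b a" by (rule herm[symmetric])
        then show ?thesis by (simp add: mult.commute)
      qed
      show "a \<in> S \<and> b \<in> S" if "?\<rho> a b \<noteq> 0" for a b
      proof -
        have "a \<noteq> x" "b \<noteq> x" using that d unfolding prod xx by (auto simp: xx)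
        moreover have "\<rho> a b \<noteq> 0 \<or> \<rho> a x \<noteq> 0 \<and> \<rho> x b \<noteq> 0" using that unfolding prod by auto
        ultimately show ?thesis using insert.prems(3) by blast
      qed
      show "0 \<le> Re (qform S ?\<rho> v)" for v
      proof -
        let ?c = "\<Sum>b\<in>S. \<rho> x b * v b"
        have "qform S ?\<rho> v = qform S \<rho> v - (\<Sum>a\<in>S. \<Sum>b\<in>S. cnj (v a) * (\<rho> a x * \<rho> x b / complex_of_real d) * v b)"
          unfolding prod qform_def by (simp add: algebra_simps sum_subtractf)
        also have "(\<Sum>a\<in>S. \<Sum>b\<in>S. cnj (v a) * (\<rho> a x * \<rho> x b / complex_of_real d) * v b)
            = (\<Sum>a\<in>S. cnj (v a) * \<rho> a x) * ?c / complex_of_real d"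
          unfolding sum_product sum_divide_distrib by (intro sum.cong refl) (simp add: algebra_simps)
        also have "(\<Sum>a\<in>S. cnj (v a) * \<rho> a x) = cnj ?c"
          unfolding cnj_sum
        proof (intro sum.cong refl)
          fix a show "cnj (v a) * \<rho> a x = cnj (\<rho> x a * v a)"
            unfolding herm[of a x] by simp
        qed
        finally have e: "qform S ?\<rho> v = qform S \<rho> v - cnj ?c * ?c / complex_of_real d" .
        \<comment> \<open>Completing the square: this entry at \<open>x\<close> minimises the form
          over the pivot coordinate, so positivity of the complement is positivity of
          \<open>\<rho>\<close> at one vector.\<close>
        have eq: "qform (insert x S) \<rho> (v(x := - ?c / complex_of_real d)) = qform S ?\<rho> v"
          unfolding Q upd e xx using d by (simp add: field_simps)
        show ?thesis using insert.prems(2)[of "v(x := - ?c / complex_of_real d)"] by (simp only: eq)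
      qed
    qed
    then obtain \<Psi> where \<Psi>: "\<forall>\<psi>\<in>set \<Psi>. \<forall>a. a \<notin> S \<longrightarrow> \<psi> a = 0"
      "\<And>a b. ?\<rho> a b = (\<Sum>\<psi>\<leftarrow>\<Psi>. \<psi> a * cnj (\<psi> b))" by blast
    have 1: "\<rho> a b = (\<Sum>\<psi>\<leftarrow>?\<psi> # \<Psi>. \<psi> a * cnj (\<psi> b))" for a b
      using \<Psi>(2)[of a b] by (simp add: algebra_simps)
    have 2: "?\<psi> a = 0" if "a \<notin> insert x S" for a
      using insert.prems(3)[of a x] that by auto
    show ?thesis
    proof (intro exI[of _ "?\<psi> # \<Psi>"] conjI ballI allI impI)
      fix \<phi> a assume "\<phi> \<in> set (?\<psi> # \<Psi>)" and a: "a \<notin> insert x S"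
      then have "\<phi> = ?\<psi> \<or> \<phi> \<in> set \<Psi>" by (simp only: list.set insert_iff)
      then show "\<phi> a = 0"
      proof
        assume "\<phi> = ?\<psi>"
        then show ?thesis using 2[OF a] by (simp only:)
      next
        assume "\<phi> \<in> set \<Psi>"
        then show ?thesis using \<Psi>(1) a by blast
      qed
    qed (rule 1)
  qed
qed

text \<open>The trace of the operator is the total weight of its Gram vectors, so unit trace gives
  weight 1.\<close>

lemma is_state_mk:
  assumes "is_state l \<sigma>"
  obtains \<Psi> where "\<sigma> = mk l \<Psi>" "valid l \<Psi>" "wt l \<Psi> = 1"
proof -
  obtain \<rho> where \<sigma>: "\<sigma> = (l, \<rho>)" using assms by (cases \<sigma>) auto
  have st: "\<And>a b. \<rho> a b \<noteq> 0 \<Longrightarrow> a \<in> bitstr l \<and> b \<in> bitstr l" "\<And>a b. \<rho> b a = cnj (\<rho> a b)"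
    "\<And>v. 0 \<le> Re (qform (bitstr l) \<rho> v)" "(\<Sum>a\<in>bitstr l. \<rho> a a) = 1"
    using assms unfolding \<sigma> is_state.simps qform_def by blast+
  obtain \<Psi> where \<Psi>: "\<forall>\<psi>\<in>set \<Psi>. \<forall>a. a \<notin> bitstr l \<longrightarrow> \<psi> a = 0"
    "\<And>a b. \<rho> a b = (\<Sum>\<psi>\<leftarrow>\<Psi>. \<psi> a * cnj (\<psi> b))"
    using gram_vectors[OF finite_bitstr st(2,3,1)] by blast
  have "complex_of_real (wt l \<Psi>) = (\<Sum>a\<in>bitstr l. \<rho> a a)"
  proof -
    have "complex_of_real (\<Sum>\<psi>\<leftarrow>\<Psi>. (cmod (\<psi> a))\<^sup>2) = \<rho> a a" for a
      unfolding \<Psi>(2) by (induction \<Psi>) (simp_all add: complex_norm_square del: of_real_power)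
    then show ?thesis unfolding wt_def sq_def sum_list_swap by simp
  qed
  then have wt: "wt l \<Psi> = 1" using st(4) by (simp only: of_real_eq_1_iff)
  have "\<sigma> = mk l \<Psi>" unfolding \<sigma> mk_def wt by (simp add: \<Psi>(2) fun_eq_iff)
  moreover have "valid l \<Psi>" using \<Psi>(1) wt by (simp add: valid_def supp_def)
  ultimately show ?thesis using wt that by blast
qed

section \<open>Comparison of measurement statistics\<close>

text \<open>Factor the difference of squares and apply Cauchy-Schwarz: closeness of amplitudes
  becomes closeness of probabilities, uniformly over events \<open>P\<close>.\<close>

lemma L2_square_diff:
  fixes f g :: "'a \<Rightarrow> complex"
  assumes "finite A"
  shows "\<bar>(\<Sum>x\<in>A. if P x then (cmod (f x))\<^sup>2 else 0) - (\<Sum>x\<in>A. if P x then (cmod (g x))\<^sup>2 else 0)\<bar>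
    \<le> L2_set (\<lambda>x. cmod (f x - g x)) A * (L2_set (\<lambda>x. cmod (f x)) A + L2_set (\<lambda>x. cmod (g x)) A)"
proof -
  have "\<bar>(\<Sum>x\<in>A. if P x then (cmod (f x))\<^sup>2 else 0) - (\<Sum>x\<in>A. if P x then (cmod (g x))\<^sup>2 else 0)\<bar>
      \<le> (\<Sum>x\<in>A. \<bar>(if P x then (cmod (f x))\<^sup>2 else 0) - (if P x then (cmod (g x))\<^sup>2 else 0)\<bar>)"
    unfolding sum_subtractf[symmetric] by (rule sum_abs)
  also have "\<dots> \<le> (\<Sum>x\<in>A. \<bar>cmod (f x - g x) * (cmod (f x) + cmod (g x))\<bar>)"
  proof (rule sum_mono)
    fix x
    have "(cmod (f x))\<^sup>2 - (cmod (g x))\<^sup>2 = (cmod (f x) - cmod (g x)) * (cmod (f x) + cmod (g x))"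
      by (simp add: power2_eq_square algebra_simps)
    then have "\<bar>(cmod (f x))\<^sup>2 - (cmod (g x))\<^sup>2\<bar> = \<bar>cmod (f x) - cmod (g x)\<bar> * (cmod (f x) + cmod (g x))"
      by (simp add: abs_mult)
    also have "\<dots> \<le> cmod (f x - g x) * (cmod (f x) + cmod (g x))"
      by (intro mult_right_mono norm_triangle_ineq3) simp
    finally show "\<bar>(if P x then (cmod (f x))\<^sup>2 else 0) - (if P x then (cmod (g x))\<^sup>2 else 0)\<bar>
        \<le> \<bar>cmod (f x - g x) * (cmod (f x) + cmod (g x))\<bar>"
      by (auto simp: abs_mult)
  qed
  also have "\<dots> \<le> L2_set (\<lambda>x. cmod (f x - g x)) A * L2_set (\<lambda>x. cmod (f x) + cmod (g x)) A"
    unfolding abs_mult by (rule L2_set_mult_ineq)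
  also have "\<dots> \<le> L2_set (\<lambda>x. cmod (f x - g x)) A * (L2_set (\<lambda>x. cmod (f x)) A + L2_set (\<lambda>x. cmod (g x)) A)"
    by (intro mult_left_mono L2_set_triangle_ineq L2_set_nonneg)
  finally show ?thesis .
qed

definition mass ::
  "('i \<Rightarrow> 'o \<Rightarrow> bool \<Rightarrow> complex) \<Rightarrow> ('i \<Rightarrow> 'o set) \<Rightarrow> 'i list \<Rightarrow> vec list \<Rightarrow> ('o list \<Rightarrow> bool) \<Rightarrow> real" where
  "mass k A is \<Psi> P = (\<Sum>\<psi>\<leftarrow>\<Psi>. \<Sum>os\<in>listset (map A is). if P os then (cmod (ct (map2 k is os) \<psi>))\<^sup>2 else 0)"

lemma sum_list_abs_le:
  fixes f g b :: "'a \<Rightarrow> real"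
  assumes "\<And>x. x \<in> set xs \<Longrightarrow> \<bar>f x - g x\<bar> \<le> b x"
  shows "\<bar>(\<Sum>x\<leftarrow>xs. f x) - (\<Sum>x\<leftarrow>xs. g x)\<bar> \<le> (\<Sum>x\<leftarrow>xs. b x)"
  using assms
proof (induction xs)
  case (Cons x xs)
  then have "\<bar>f x - g x\<bar> \<le> b x" "\<bar>(\<Sum>x\<leftarrow>xs. f x) - (\<Sum>x\<leftarrow>xs. g x)\<bar> \<le> (\<Sum>x\<leftarrow>xs. b x)" by auto
  then show ?case by simp
qed simp

text \<open>The factor 2 is the sum of the norms of the two amplitude vectors, each of which is the
  norm of \<open>\<psi>\<close>.\<close>

lemma mass_near:
  fixes \<epsilon> :: real
  assumes k: "\<And>i. iso (k i) (A i)" "\<And>i. iso (k' i) (A i)" "\<And>i. near \<epsilon> (k i) (k' i) (A i)" and "0 \<le> \<epsilon>"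
  shows "\<bar>mass k A is \<Psi> P - mass k' A is \<Psi> P\<bar> \<le> 2 * length is * \<epsilon> * wt (length is) \<Psi>"
proof -
  let ?O = "listset (map A is)" and ?n = "length is"
  have fin: "finite ?O" using k(1) by (intro finite_listset) (auto simp: iso_def)
  have n: "L2_set (\<lambda>os. cmod (ct (map2 k is os) \<psi>)) ?O = sqrt (sq ?n \<psi>)"
    if "\<And>i. iso (k i) (A i)" for k \<psi>
    unfolding L2_set_def using ct_isometry[of "is" k A \<psi>] that by simp
  have "\<bar>mass k A is \<Psi> P - mass k' A is \<Psi> P\<bar> \<le> (\<Sum>\<psi>\<leftarrow>\<Psi>. 2 * ?n * \<epsilon> * sq ?n \<psi>)"
    unfolding mass_def
  proof (rule sum_list_abs_le)
    fix \<psi>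
    have "\<bar>(\<Sum>os\<in>?O. if P os then (cmod (ct (map2 k is os) \<psi>))\<^sup>2 else 0)
        - (\<Sum>os\<in>?O. if P os then (cmod (ct (map2 k' is os) \<psi>))\<^sup>2 else 0)\<bar>
      \<le> L2_set (\<lambda>os. cmod (ct (map2 k is os) \<psi> - ct (map2 k' is os) \<psi>)) ?O * (sqrt (sq ?n \<psi>) + sqrt (sq ?n \<psi>))"
      using L2_square_diff[OF fin, of P "\<lambda>os. ct (map2 k is os) \<psi>" "\<lambda>os. ct (map2 k' is os) \<psi>"]
      by (simp only: n[OF k(1)] n[OF k(2)])
    also have "\<dots> \<le> (?n * \<epsilon> * sqrt (sq ?n \<psi>)) * (sqrt (sq ?n \<psi>) + sqrt (sq ?n \<psi>))"
      by (intro mult_right_mono ct_near k \<open>0 \<le> \<epsilon>\<close>) simp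
    also have "\<dots> = 2 * ?n * \<epsilon> * (sqrt (sq ?n \<psi>) * sqrt (sq ?n \<psi>))" by (simp add: algebra_simps)
    finally show "\<bar>(\<Sum>os\<in>?O. if P os then (cmod (ct (map2 k is os) \<psi>))\<^sup>2 else 0)
        - (\<Sum>os\<in>?O. if P os then (cmod (ct (map2 k' is os) \<psi>))\<^sup>2 else 0)\<bar> \<le> 2 * ?n * \<epsilon> * sq ?n \<psi>" by simp
  qed
  also have "\<dots> = 2 * ?n * \<epsilon> * wt ?n \<Psi>" by (simp add: wt_def sum_list_const_mult)
  finally show ?thesis .
qed

lemma mass_bad:
  fixes \<delta> :: real
  assumes "\<And>i. iso (k i) (A i)"
    "\<And>i u. (\<Sum>x\<in>A i. if \<not> good i x then (cmod (braket (k i x) u))\<^sup>2 else 0) \<le> \<delta> * vsq u"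
  shows "mass k A is \<Psi> (\<lambda>os. \<not> list_all2 good is os) \<le> length is * \<delta> * wt (length is) \<Psi>"
proof -
  have "mass k A is \<Psi> (\<lambda>os. \<not> list_all2 good is os) \<le> (\<Sum>\<psi>\<leftarrow>\<Psi>. length is * \<delta> * sq (length is) \<psi>)"
    unfolding mass_def
  proof (rule sum_list_mono)
    fix \<psi>
    have "(\<Sum>os\<in>listset (map A is). if \<not> list_all2 good is os then (cmod (ct (map2 k is os) \<psi>))\<^sup>2 else 0)
        = (\<Sum>os\<in>listset (map A is). if list_all2 (\<lambda>i x. \<not> \<not> good i x) is os then 0 else (cmod (ct (map2 k is os) \<psi>))\<^sup>2)"
      by (intro sum.cong refl) simp
    also have "\<dots> \<le> length is * \<delta> * sq (length is) \<psi>"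
      by (rule ct_bad_mass) (rule assms)+
    finally show "(\<Sum>os\<in>listset (map A is). if \<not> list_all2 good is os then (cmod (ct (map2 k is os) \<psi>))\<^sup>2 else 0)
        \<le> length is * \<delta> * sq (length is) \<psi>" .
  qed
  then show ?thesis by (simp add: wt_def sum_list_const_mult)
qed

lemma mass_mono: "(\<And>os. P os \<Longrightarrow> P' os) \<Longrightarrow> mass k A is \<Psi> P \<le> mass k A is \<Psi> P'"
  unfolding mass_def by (intro sum_list_mono sum_mono) auto

lemma mass_disj: "mass k A is \<Psi> (\<lambda>os. P os \<or> P' os) \<le> mass k A is \<Psi> P + mass k A is \<Psi> P'"
  unfolding mass_def sum_list_addf[symmetric] sum.distrib[symmetric]
  by (intro sum_list_mono sum_mono) auto

lemma mass_resolves: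
  assumes "\<And>i. resolves (k i) (A i) (f i) (n i)" "\<And>i. orthonormal (n i)"
  shows "mass k A is \<Psi> (\<lambda>os. P (map2 f is os))
    = (\<Sum>\<psi>\<leftarrow>\<Psi>. \<Sum>vs\<in>bitstr (length is). if P vs then (cmod (ct (map2 n is vs) \<psi>))\<^sup>2 else 0)"
  unfolding mass_def
proof (intro arg_cong[of _ _ sum_list] map_cong refl)
  fix \<psi>
  let ?O = "listset (map A is)" and ?B = "bitstr (length is)"
  let ?g = "\<lambda>os. (cmod (ct (map2 k is os) \<psi>))\<^sup>2"
  have "(\<Sum>vs\<in>?B. if P vs then (cmod (ct (map2 n is vs) \<psi>))\<^sup>2 else 0)
      = (\<Sum>vs\<in>?B. \<Sum>os\<in>?O. if map2 f is os = vs then (if P vs then ?g os else 0) else 0)"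
  proof (intro sum.cong refl)
    fix vs assume "vs \<in> ?B"
    then have "(\<Sum>os\<in>?O. if map2 f is os = vs then ?g os else 0) = (cmod (ct (map2 n is vs) \<psi>))\<^sup>2"
      by (intro ct_statistics) (use assms in auto)
    then show "(if P vs then (cmod (ct (map2 n is vs) \<psi>))\<^sup>2 else 0)
        = (\<Sum>os\<in>?O. if map2 f is os = vs then (if P vs then ?g os else 0) else 0)"
      by (cases "P vs") (simp_all cong: if_cong)
  qed
  also have "\<dots> = (\<Sum>os\<in>?O. \<Sum>vs\<in>?B. if map2 f is os = vs then (if P vs then ?g os else 0) else 0)"
    by (rule sum.swap)
  also have "\<dots> = (\<Sum>os\<in>?O. if P (map2 f is os) then ?g os else 0)"
  proof (intro sum.cong refl)
    fix os assume "os \<in> ?O"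
    then have "map2 f is os \<in> ?B" by (auto simp: listset_eq list_all2_conv_all_nth)
    then show "(\<Sum>vs\<in>?B. if map2 f is os = vs then (if P vs then ?g os else 0) else 0)
        = (if P (map2 f is os) then ?g os else 0)"
      by (subst sum.delta'[OF finite_bitstr]) (simp only: if_True)
  qed
  finally show "(\<Sum>os\<in>?O. if P (map2 f is os) then ?g os else 0)
      = (\<Sum>vs\<in>?B. if P vs then (cmod (ct (map2 n is vs) \<psi>))\<^sup>2 else 0)" by (rule sym)
qed

text \<open>The joint outcome distribution on some positions does not depend on the bases in which the
  other positions are measured.\<close>

lemma unread_basis:
  assumes "\<And>i. i \<in> set is \<Longrightarrow> iso (n i) UNIV" "\<And>i. i \<in> set is \<Longrightarrow> iso (n' i) UNIV"
    and "\<And>i. i \<in> set is \<Longrightarrow> i \<in> J \<Longrightarrow> n i = n' i"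
    and "\<And>vs vs'. length vs = length is \<Longrightarrow> length vs' = length is \<Longrightarrow>
       (\<And>p. p < length is \<Longrightarrow> is ! p \<in> J \<Longrightarrow> vs ! p = vs' ! p) \<Longrightarrow> P vs = P vs'"
  shows "(\<Sum>vs\<in>bitstr (length is). if P vs then (cmod (ct (map2 n is vs) \<psi>))\<^sup>2 else 0)
    = (\<Sum>vs\<in>bitstr (length is). if P vs then (cmod (ct (map2 n' is vs) \<psi>))\<^sup>2 else 0)"
  using assms
proof (induction "is" arbitrary: P \<psi>)
  case (Cons i "is")
  let ?B = "bitstr (length is)"
  have IH: "(\<Sum>vs\<in>?B. if P (v # vs) then (cmod (ct (map2 n is vs) \<phi>))\<^sup>2 else 0)
    = (\<Sum>vs\<in>?B. if P (v # vs) then (cmod (ct (map2 n' is vs) \<phi>))\<^sup>2 else 0)" for v \<phi>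
  proof (rule Cons.IH)
    fix vs vs' :: bits
    assume "length vs = length is" "length vs' = length is"
      "\<And>p. p < length is \<Longrightarrow> is ! p \<in> J \<Longrightarrow> vs ! p = vs' ! p"
    then show "P (v # vs) = P (v # vs')"
      by (intro Cons.prems(4)) (auto simp: nth_Cons split: nat.split)
  qed (use Cons.prems in auto)
  have "(\<Sum>vs\<in>bitstr (length (i # is)). if P vs then (cmod (ct (map2 n (i # is) vs) \<psi>))\<^sup>2 else 0)
      = (\<Sum>v\<in>UNIV. \<Sum>vs\<in>?B. if P (v # vs) then (cmod (ct (map2 n' is vs) (\<lambda>a. braket (n i v) (\<lambda>s. \<psi> (s # a)))))\<^sup>2 else 0)"
    by (simp add: sum_bitstr_Suc IH cong: if_cong)
  also have "\<dots> = (\<Sum>v\<in>UNIV. \<Sum>vs\<in>?B. if P (v # vs) then (cmod (ct (map2 n' is vs) (\<lambda>a. braket (n' i v) (\<lambda>s. \<psi> (s # a)))))\<^sup>2 else 0)"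
  proof (cases "i \<in> J")
    case True
    then have "n i = n' i" using Cons.prems(3)[of i] by simp
    then show ?thesis by (simp only:)
  next
    case False
    \<comment> \<open>The event ignores the outcome at an unread position, so summing over that
      outcome gives a norm, the same for every complete measurement.\<close>
    have P: "P (v # vs) = P (True # vs)" if "vs \<in> ?B" for v vs
      using that False by (intro Cons.prems(4)) (auto simp: nth_Cons split: nat.split)
    have *: "(\<Sum>v\<in>UNIV. \<Sum>vs\<in>?B. if P (v # vs) then (cmod (ct (map2 n' is vs) (\<lambda>a. braket (m v) (\<lambda>s. \<psi> (s # a)))))\<^sup>2 else 0)
       = (\<Sum>vs\<in>?B. if P (True # vs) then vsq (\<lambda>s. ct (map2 n' is vs) (\<lambda>a. \<psi> (s # a))) else 0)"
      if m: "iso m UNIV" for m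
    proof -
      have "(\<Sum>v\<in>UNIV. \<Sum>vs\<in>?B. if P (v # vs) then (cmod (ct (map2 n' is vs) (\<lambda>a. braket (m v) (\<lambda>s. \<psi> (s # a)))))\<^sup>2 else 0)
        = (\<Sum>vs\<in>?B. \<Sum>v\<in>UNIV. if P (True # vs) then (cmod (braket (m v) (\<lambda>s. ct (map2 n' is vs) (\<lambda>a. \<psi> (s # a)))))\<^sup>2 else 0)"
      proof (subst sum.swap, intro sum.cong refl)
        fix vs v assume "vs \<in> ?B"
        then show "(if P (v # vs) then (cmod (ct (map2 n' is vs) (\<lambda>a. braket (m v) (\<lambda>s. \<psi> (s # a)))))\<^sup>2 else 0)
            = (if P (True # vs) then (cmod (braket (m v) (\<lambda>s. ct (map2 n' is vs) (\<lambda>a. \<psi> (s # a)))))\<^sup>2 else 0)"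
          by (simp only: P[of vs v] ct_braket)
      qed
      also have "\<dots> = (\<Sum>vs\<in>?B. if P (True # vs) then vsq (\<lambda>s. ct (map2 n' is vs) (\<lambda>a. \<psi> (s # a))) else 0)"
        using m by (intro sum.cong refl) (simp add: iso_def)
      finally show ?thesis .
    qed
    show ?thesis using *[of "n i"] *[of "n' i"] Cons.prems(1,2)[of i] by simp
  qed
  also have "\<dots> = (\<Sum>vs\<in>bitstr (length (i # is)). if P vs then (cmod (ct (map2 n' (i # is) vs) \<psi>))\<^sup>2 else 0)"
    by (simp add: sum_bitstr_Suc cong: if_cong)
  finally show ?case .
qed (simp cong: if_cong)

text \<open>To be comparable with the game, the ideal measurement is written as a product
  measurement of all positions, with the standard basis outside \<open>J\<close>.\<close>

lemma ideal_mk: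
  assumes "valid l \<Psi>" "wt l \<Psi> = 1" "J \<subseteq> {..<l}"
  shows "measure_pmf.prob (ideal (mk l \<Psi>) J bs) S
    = (\<Sum>\<psi>\<leftarrow>\<Psi>. \<Sum>vs\<in>bitstr l. if map ((!) vs) (sorted_list_of_set J) \<in> S
        then (cmod (ct (map2 (\<lambda>j. if j \<in> J \<and> bs ! j then had1 else id1) [0..<l] vs) \<psi>))\<^sup>2 else 0)"
proof -
  let ?js = "sorted_list_of_set J"
  let ?f = "\<lambda>a :: bits. map ((!) a) ?js"
  let ?P = "\<lambda>j. j \<in> J \<and> bs ! j"
  let ?U = "circ_op (map Had (filter ?P [0..<0 + l]))"
  let ?n = "\<lambda>j. if ?P j then had1 else id1"
  \<comment> \<open>As a filter of all positions, the sorted list brings the gates into the form of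
    \<open>circ_op_some_hadamards\<close>.\<close>
  have "?js = filter (\<lambda>j. j \<in> J) [0..<l]"
  proof (rule sorted_distinct_set_unique)
    show "set ?js = set (filter (\<lambda>j. j \<in> J) [0..<l])"
      using assms(3) finite_subset[OF assms(3)] by auto
  qed (simp_all add: sorted_wrt_filter)
  then have flt: "filter ((!) bs) ?js = filter ?P [0..<0 + l]" by (simp add: conj_commute)
  have wf: "wf_gates l (map Had (filter ?P [0..<0 + l]))" by (auto simp: wf_gates_def)
  have n: "supp l (?U \<psi>) \<and> sq l (?U \<psi>) = sq l \<psi>" if "\<psi> \<in> set \<Psi>" for \<psi>
    by (rule circ_op_norm[OF wf]) (use assms(1) that in \<open>simp add: valid_def\<close>)
  have ev: "evolve ?U (mk l \<Psi>) = mk l (map ?U \<Psi>)"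
    by (rule evolve_mk[OF linear_op_circ]) (use n in blast)
  have wt: "wt l (map ?U \<Psi>) = 1"
    unfolding assms(2)[symmetric] wt_def map_map o_def using n
    by (intro arg_cong[of _ _ sum_list] map_cong refl) blast
  have v: "valid l (map ?U \<Psi>)" using n wt by (auto simp: valid_def)
  obtain Q where Q: "measure_with ?f (mk l (map ?U \<Psi>)) = map_pmf (\<lambda>z. (z, mk l (map (keep ?f z) (map ?U \<Psi>)))) Q"
    "\<And>z. pmf Q z = wt l (map (keep ?f z) (map ?U \<Psi>)) / wt l (map ?U \<Psi>)"
    using measure_with_mk[OF v] by blast
  have id: "ideal (mk l \<Psi>) J bs = Q"
    unfolding ideal_def Let_def flt ev Q(1) map_pmf_comp fst_conv by simp
  have U: "?U \<psi> vs = ct (map2 ?n [0..<l] vs) \<psi>" if \<psi>: "\<psi> \<in> set \<Psi>" and vs: "length vs = l" for \<psi> vs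
  proof -
    let ?K = "map (\<lambda>j. if ?P j then had_kern else id_kern) [0..<0 + l]"
    have "?U \<psi> = sap 0 1 ?K \<psi>"
      by (rule circ_op_some_hadamards) (use assms(1) \<psi> in \<open>auto simp: valid_def\<close>)
    moreover have "sap 0 1 ?K \<psi> ([] @ concat (map (\<lambda>v. [v]) vs) @ [])
        = ct (map2 (\<lambda>K b. K b) ?K (map (\<lambda>v. [v]) vs)) (\<lambda>b. \<psi> ([] @ b @ []))"
      by (rule sap_ct) (use vs in auto)
    moreover have "concat (map (\<lambda>v. [v]) vs) = vs" by (induction vs) auto
    moreover have "map2 (\<lambda>K b. K b) ?K (map (\<lambda>v. [v]) vs) = map2 ?n [0..<l] vs"
      using vs by (intro nth_equalityI) (auto simp: had_kern_def id_kern_def fun_eq_iff)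
    ultimately show ?thesis by simp
  qed
  let ?Z = "?f ` bitstr l"
  have pQ: "pmf Q z = (\<Sum>\<psi>\<leftarrow>\<Psi>. \<Sum>vs\<in>bitstr l. if ?f vs = z then (cmod (ct (map2 ?n [0..<l] vs) \<psi>))\<^sup>2 else 0)" for z
  proof -
    have "pmf Q z = wt l (map (keep ?f z) (map ?U \<Psi>))" by (simp only: Q(2) wt div_by_1)
    also have "\<dots> = (\<Sum>\<psi>\<leftarrow>\<Psi>. \<Sum>vs\<in>bitstr l. if ?f vs = z then (cmod (ct (map2 ?n [0..<l] vs) \<psi>))\<^sup>2 else 0)"
      unfolding wt_def map_map o_def sq_def
    proof (intro arg_cong[of _ _ sum_list] map_cong sum.cong refl)
      fix \<psi> vs assume "\<psi> \<in> set \<Psi>" "vs \<in> bitstr l"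
      then have u: "?U \<psi> vs = ct (map2 ?n [0..<l] vs) \<psi>" by (intro U) simp_all
      show "(cmod (keep ?f z (?U \<psi>) vs))\<^sup>2 = (if ?f vs = z then (cmod (ct (map2 ?n [0..<l] vs) \<psi>))\<^sup>2 else 0)"
        unfolding keep_def u by simp
    qed
    finally show ?thesis .
  qed
  have "measure_pmf.prob Q S = (\<Sum>z\<in>?Z. if z \<in> S then pmf Q z else 0)"
  proof (rule prob_finite_support)
    fix z assume "z \<notin> ?Z"
    then show "pmf Q z = 0" unfolding pQ by (intro sum_list_zero sum.neutral) auto
  qed simp
  also have "\<dots> = (\<Sum>z\<in>?Z. \<Sum>\<psi>\<leftarrow>\<Psi>. \<Sum>vs\<in>bitstr l. if ?f vs = z then
      (if ?f vs \<in> S then (cmod (ct (map2 ?n [0..<l] vs) \<psi>))\<^sup>2 else 0) else 0)"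
  proof (intro sum.cong refl)
    fix z
    show "(if z \<in> S then pmf Q z else 0) = (\<Sum>\<psi>\<leftarrow>\<Psi>. \<Sum>vs\<in>bitstr l. if ?f vs = z then
      (if ?f vs \<in> S then (cmod (ct (map2 ?n [0..<l] vs) \<psi>))\<^sup>2 else 0) else 0)"
    proof (cases "z \<in> S")
      case True
      then show ?thesis unfolding pQ if_P[OF True]
        by (intro arg_cong[of _ _ sum_list] map_cong sum.cong refl) auto
    next
      case False
      then show ?thesis by (subst sum_list_zero) (auto intro!: sum.neutral)
    qed
  qed
  also have "\<dots> = (\<Sum>\<psi>\<leftarrow>\<Psi>. \<Sum>vs\<in>bitstr l. \<Sum>z\<in>?Z. if ?f vs = z then
      (if ?f vs \<in> S then (cmod (ct (map2 ?n [0..<l] vs) \<psi>))\<^sup>2 else 0) else 0)"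
    unfolding sum_list_swap[symmetric] by (intro arg_cong[of _ _ sum_list] map_cong refl sum.swap)
  also have "\<dots> = (\<Sum>\<psi>\<leftarrow>\<Psi>. \<Sum>vs\<in>bitstr l. if ?f vs \<in> S then (cmod (ct (map2 ?n [0..<l] vs) \<psi>))\<^sup>2 else 0)"
  proof (intro arg_cong[of _ _ sum_list] map_cong sum.cong refl)
    fix \<psi> vs assume "vs \<in> bitstr l"
    then have "?f vs \<in> ?Z" by (rule imageI)
    then show "(\<Sum>z\<in>?Z. if ?f vs = z then
      (if ?f vs \<in> S then (cmod (ct (map2 ?n [0..<l] vs) \<psi>))\<^sup>2 else 0) else 0)
        = (if ?f vs \<in> S then (cmod (ct (map2 ?n [0..<l] vs) \<psi>))\<^sup>2 else 0)"
      by (subst sum.delta'[OF finite_imageI[OF finite_bitstr]]) (simp only: if_True)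
  qed
  finally show ?thesis by (simp only: id)
qed

section \<open>The semi-succinct game against the ideal measurement\<close>

lemma map2_self_map: "map2 f xs (map g xs) = map (\<lambda>x. f x (g x)) xs"
  by (induction xs) auto

text \<open>What the verifier would compute from the true commitments instead of hash
  openings.\<close>

definition decode ::
  "ntcf \<Rightarrow> nat \<Rightarrow> keys \<Rightarrow> (nat \<times> bool) list \<Rightarrow> bits list \<times> bits list \<Rightarrow> bits option" where
  "decode F lam ks jbs = (\<lambda>(ys, zs). if list_all2 (\<lambda>(j, b) z. ver1 F lam ks (ys ! j) b z) jbs zs
     then Some (map2 (\<lambda>(j, b) z. out1 F lam ks (ys ! j) b z) jbs zs) else None)"

context claw_keys
begin

text \<open>The first term is the exchange of the preparations at \<open>l\<close> positions with
  the factor 2 of \<open>mass_near\<close>; the second is the union bound over rejected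
  outcomes.\<close>

definition "ss_error l = 2 * real l * ((w + 2) * ep) + real l * ((w + 1) * (2 * eg))"

context
  fixes l \<sigma> and jbs :: "(nat \<times> bool) list"
  assumes state: "is_state l \<sigma>" and jbs: "distinct (map fst jbs)" "fst ` set jbs \<subseteq> {..<l}"
begin

lemma position_less: "(j, b) \<in> set jbs \<Longrightarrow> j < l"
  using jbs(2) by force

abbreviation "bases \<equiv> map (\<lambda>j. (j, False) \<in> set jbs) [0..<l]"

abbreviation "all_outcomes \<equiv> listset (map (\<lambda>_. outcomes F lam pks) bases)"

lemma game_mass:
  obtains D \<Psi> where "\<sigma> = mk l \<Psi>" "valid l \<Psi>" "wt l \<Psi> = 1"
    "ss_game F lam pks jbs \<sigma> = map_pmf (visible jbs) D" "set_pmf D \<subseteq> all_outcomes"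
    "\<And>P. measure_pmf.prob D {os. P os} = mass (game_kern F lam pks) (\<lambda>_. outcomes F lam pks) bases \<Psi> P"
proof -
  obtain \<Psi> where \<Psi>: "\<sigma> = mk l \<Psi>" "valid l \<Psi>" "wt l \<Psi> = 1" using is_state_mk[OF state] by blast
  have u: "unit_prep F lam pk" if "pk \<in> set pks" for pk
    using that keys unit_prep_key by auto
  have lp: "length pks = w + 2" using length_keys by simp
  obtain D where D: "ss_game F lam pks jbs (mk l \<Psi>) = map_pmf (visible jbs) D"
    "\<And>os. pmf D os = (if os \<in> all_outcomes
       then (\<Sum>\<psi>\<leftarrow>\<Psi>. (cmod (ct (map2 (game_kern F lam pks) bases os) \<psi>))\<^sup>2) / wt l \<Psi> else 0)"
    by (rule game_distribution[where jbs = jbs and l = l, OF u lp \<Psi>(2) jbs(1) _ iso_game refl], assumption, erule position_less, rule that)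
  have fin: "finite all_outcomes" using iso_game by (intro finite_listset) (auto simp: iso_def)
  have "measure_pmf.prob D {os. P os} = mass (game_kern F lam pks) (\<lambda>_. outcomes F lam pks) bases \<Psi> P" for P
  proof -
    have "measure_pmf.prob D {os. P os} = (\<Sum>os\<in>all_outcomes. if os \<in> {os. P os} then pmf D os else 0)"
      by (rule prob_finite_support[OF fin]) (simp add: D(2))
    also have "\<dots> = (\<Sum>os\<in>all_outcomes. \<Sum>\<psi>\<leftarrow>\<Psi>. if P os then (cmod (ct (map2 (game_kern F lam pks) bases os) \<psi>))\<^sup>2 else 0)"
      by (intro sum.cong refl) (simp add: D(2) \<Psi>(3) sum_list_zero)
    finally show ?thesis unfolding mass_def sum_list_swap .
  qed
  moreover have "set_pmf D \<subseteq> all_outcomes" using D(2) by (auto simp: set_pmf_iff split: if_splits)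
  ultimately show ?thesis using that \<Psi> D(1) by blast
qed

abbreviation "ideal_mass \<equiv> mass ideal_kern (\<lambda>_. outcomes F lam pks) bases"

lemma real_ideal_mass:
  assumes "wt l \<Psi> = 1"
  shows "\<bar>mass (game_kern F lam pks) (\<lambda>_. outcomes F lam pks) bases \<Psi> P - ideal_mass \<Psi> P\<bar>
    \<le> 2 * real l * ((w + 2) * ep)"
  using mass_near[of "game_kern F lam pks" "\<lambda>_. outcomes F lam pks" ideal_kern "(w + 2) * ep" bases \<Psi> P]
    iso_game iso_ideal near_game ep_nonneg assms by simp

lemma ideal_mass_bad:
  assumes "wt l \<Psi> = 1"
  shows "ideal_mass \<Psi> (\<lambda>os. \<not> list_all2 verified bases os) \<le> real l * ((w + 1) * (2 * eg))"
  using mass_bad[of ideal_kern "\<lambda>_. outcomes F lam pks" verified "(w + 1) * (2 * eg)" bases \<Psi>]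
    iso_ideal ideal_bad assms by simp

lemma basis_at: "(j, b) \<in> set jbs \<Longrightarrow> bases ! j = (\<not> b)"
proof -
  assume j: "(j, b) \<in> set jbs"
  have "b = b'" if "(j, b') \<in> set jbs" for b' using j that jbs(1) by (simp add: eq_key_imp_eq_value)
  then show ?thesis using j position_less[OF j] by (cases b) auto
qed

text \<open>Verification is demanded at all positions, opened or not; the complement of this event
  is what the union bound \<open>ideal_mass_bad\<close> controls.\<close>

lemma verified_visible:
  assumes "list_all2 verified bases os"
  shows "decode F lam ks jbs (visible jbs os) = Some (map (\<lambda>(j, b). result (bases ! j) (os ! j)) jbs)"
proof -
  have os: "length os = l" using list_all2_lengthD[OF assms] by simp
  have *: "ver1 F lam ks (map (commit_hash \<circ> fst) os ! j) b (snd (snd (os ! j)))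
     \<and> out1 F lam ks (map (commit_hash \<circ> fst) os ! j) b (snd (snd (os ! j))) = result (bases ! j) (os ! j)"
    if j: "(j, b) \<in> set jbs" for j b
  proof -
    have "verified (bases ! j) (os ! j)"
      using list_all2_nthD[OF assms, of j] position_less[OF j] by simp
    then show ?thesis
      using position_less[OF j] os unfolding basis_at[OF j] by (simp add: verified_def result_def split_def)
  qed
  let ?ys = "map (commit_hash \<circ> fst) os" and ?zs = "map (\<lambda>(j, b). snd (snd (os ! j))) jbs"
  have "list_all2 (\<lambda>(j, b) z. ver1 F lam ks (?ys ! j) b z) jbs ?zs"
    unfolding list_all2_map2 list_all2_same using * by (auto simp: split_def)
  moreover have "map2 (\<lambda>(j, b) z. out1 F lam ks (?ys ! j) b z) jbs ?zs
      = map (\<lambda>(j, b). result (bases ! j) (os ! j)) jbs"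
    unfolding map2_self_map using * by (intro map_cong refl) (auto simp: split_def)
  ultimately show ?thesis unfolding decode_def visible_def case_prod_conv by (simp only: if_True)
qed

lemma game_verified:
  "measure_pmf.prob (ss_game F lam pks jbs \<sigma>) {v. decode F lam ks jbs v = None} \<le> ss_error l"
proof -
  obtain D \<Psi> where D: "\<sigma> = mk l \<Psi>" "valid l \<Psi>" "wt l \<Psi> = 1"
    "ss_game F lam pks jbs \<sigma> = map_pmf (visible jbs) D" "set_pmf D \<subseteq> all_outcomes"
    "\<And>P. measure_pmf.prob D {os. P os} = mass (game_kern F lam pks) (\<lambda>_. outcomes F lam pks) bases \<Psi> P"
    by (rule game_mass, rule that)
  have "measure_pmf.prob (ss_game F lam pks jbs \<sigma>) {v. decode F lam ks jbs v = None}
      = measure_pmf.prob D {os. decode F lam ks jbs (visible jbs os) = None}"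
    unfolding D(4) by (simp add: vimage_def)
  also have "\<dots> \<le> measure_pmf.prob D {os. \<not> list_all2 verified bases os}"
    using verified_visible by (intro measure_pmf.finite_measure_mono) auto
  also have "\<dots> \<le> ss_error l"
    unfolding D(6) ss_error_def
    using real_ideal_mass[OF D(3), of "\<lambda>os. \<not> list_all2 verified bases os"] ideal_mass_bad[OF D(3)] by linarith
  finally show ?thesis .
qed

end

lemma game_close:
  assumes "is_state l \<sigma>" "J \<subseteq> {..<l}"
  shows "\<bar>measure_pmf.prob (map_pmf (decode F lam ks (positions J bs)) (ss_game F lam pks (positions J bs) \<sigma>)) S
     - measure_pmf.prob (map_pmf Some (ideal \<sigma> J bs)) S\<bar> \<le> ss_error l"
proof -
  let ?jbs = "positions J bs" and ?js = "sorted_list_of_set J"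
  have finJ: "finite J" using assms(2) finite_subset by blast
  have jbs: "distinct (map fst ?jbs)" "fst ` set ?jbs \<subseteq> {..<l}"
    using assms(2) finJ by (auto simp: positions_def o_def)
  let ?is = "bases l ?jbs"
  obtain D \<Psi> where D: "\<sigma> = mk l \<Psi>" "valid l \<Psi>" "wt l \<Psi> = 1"
    "ss_game F lam pks ?jbs \<sigma> = map_pmf (visible ?jbs) D" "set_pmf D \<subseteq> all_outcomes l ?jbs"
    "\<And>P. measure_pmf.prob D {os. P os} = mass (game_kern F lam pks) (\<lambda>_. outcomes F lam pks) ?is \<Psi> P"
    by (rule game_mass[OF assms(1) jbs], rule that)
  let ?IM = "ideal_mass l ?jbs \<Psi>"
  let ?P = "\<lambda>os. decode F lam ks ?jbs (visible ?jbs os) \<in> S"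
  let ?R = "\<lambda>os. Some (map ((!) (map2 result ?is os)) ?js) \<in> S"
  have real: "measure_pmf.prob (map_pmf (decode F lam ks ?jbs) (ss_game F lam pks ?jbs \<sigma>)) S
      = mass (game_kern F lam pks) (\<lambda>_. outcomes F lam pks) ?is \<Psi> ?P"
    unfolding D(6)[symmetric] D(4) map_pmf_comp by (simp add: vimage_def)
  have PR: "?P os = ?R os" if v: "list_all2 verified ?is os" for os
  proof -
    have os: "length os = l" using list_all2_lengthD[OF v] by simp
    have "map (\<lambda>(j, b). result (?is ! j) (os ! j)) ?jbs = map ((!) (map2 result ?is os)) ?js"
      using assms(2) finJ os by (auto simp: positions_def)
    then show ?thesis using verified_visible[OF assms(1) jbs v] by simp
  qed
  let ?B = "\<lambda>os. \<not> list_all2 verified ?is os"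
  \<comment> \<open>Decoded outputs and labels agree off the rejected outcomes, so the two masses
    differ by at most the mass of these, in either direction.\<close>
  have "?IM ?P \<le> ?IM ?R + ?IM ?B"
    by (rule order_trans[OF mass_mono mass_disj]) (use PR in blast)
  moreover have "?IM ?R \<le> ?IM ?P + ?IM ?B"
    by (rule order_trans[OF mass_mono mass_disj]) (use PR in blast)
  moreover have "?IM ?R = measure_pmf.prob (map_pmf Some (ideal \<sigma> J bs)) S"
  proof -
    let ?T = "\<lambda>vs. map ((!) vs) ?js \<in> Some -` S"
    let ?n = "\<lambda>j. basis_kern ((j, False) \<in> set ?jbs)"
    let ?n' = "\<lambda>j. if j \<in> J \<and> bs ! j then had1 else id1"
    have on: "orthonormal (basis_kern \<beta>)" "iso (basis_kern \<beta>) UNIV" for \<beta>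
      by (simp_all add: basis_kern_def orthonormal_had1 orthonormal_id1 iso_had1 iso_id1)
    have len: "length ?is = l" by simp
    have "?IM (\<lambda>os. ?T (map2 result ?is os))
        = (\<Sum>\<psi>\<leftarrow>\<Psi>. \<Sum>vs\<in>bitstr (length ?is). if ?T vs then (cmod (ct (map2 basis_kern ?is vs) \<psi>))\<^sup>2 else 0)"
      by (rule mass_resolves[OF resolves_ideal on(1)])
    also have "\<dots> = (\<Sum>\<psi>\<leftarrow>\<Psi>. \<Sum>vs\<in>bitstr (length [0..<l]). if ?T vs then (cmod (ct (map2 ?n [0..<l] vs) \<psi>))\<^sup>2 else 0)"
      by (simp add: zip_map1 split_def o_def cong: if_cong)
    \<comment> \<open>Unopened positions carry the Hadamard basis in the game and the standard basis
      in \<open>ideal\<close>; their labels are not read.\<close>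
    also have "\<dots> = (\<Sum>\<psi>\<leftarrow>\<Psi>. \<Sum>vs\<in>bitstr (length [0..<l]). if ?T vs then (cmod (ct (map2 ?n' [0..<l] vs) \<psi>))\<^sup>2 else 0)"
    proof (intro arg_cong[of _ _ sum_list] map_cong refl unread_basis[where J = J])
      fix j assume "j \<in> J"
      then show "?n j = ?n' j" using finJ by (auto simp: basis_kern_def positions_def)
    next
      fix vs vs' :: bits
      assume "\<And>p. p < length [0..<l] \<Longrightarrow> [0..<l] ! p \<in> J \<Longrightarrow> vs ! p = vs' ! p"
      then have "map ((!) vs) ?js = map ((!) vs') ?js" using assms(2) finJ by (intro map_cong) auto
      then show "?T vs = ?T vs'" by (simp only:)
    qed (simp_all add: on iso_had1 iso_id1)
    also have "\<dots> = measure_pmf.prob (ideal (mk l \<Psi>) J bs) (Some -` S)"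
      unfolding ideal_mk[OF D(2,3) assms(2)] by simp
    finally show ?thesis by (simp add: D(1))
  qed
  ultimately show ?thesis
    using real_ideal_mass[OF assms(1) jbs D(3), of ?P] ideal_mass_bad[OF assms(1) jbs D(3)]
    unfolding real ss_error_def by linarith
qed

end

section \<open>Statistical distance and asymptotics\<close>

text \<open>Total variation distance as a family of inequalities, free of the supremum in
  \<open>tv_dist\<close>.\<close>

definition close :: "real \<Rightarrow> 'a pmf \<Rightarrow> 'a pmf \<Rightarrow> bool" where
  "close \<epsilon> p q \<longleftrightarrow> (\<forall>A. \<bar>measure_pmf.prob p A - measure_pmf.prob q A\<bar> \<le> \<epsilon>)"

lemma tv_dist_le: "close \<epsilon> p q \<Longrightarrow> tv_dist p q \<le> \<epsilon>"
  unfolding tv_dist_def close_def by (intro cSUP_least) auto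

lemma close_refl: "0 \<le> \<epsilon> \<Longrightarrow> close \<epsilon> p p"
  by (simp add: close_def)

lemma close_mono: "close \<epsilon> p q \<Longrightarrow> \<epsilon> \<le> \<epsilon>' \<Longrightarrow> close \<epsilon>' p q"
  unfolding close_def using order_trans by blast

lemma close_trans:
  assumes "close \<epsilon> p q" "close \<epsilon>' q s"
  shows "close (\<epsilon> + \<epsilon>') p s"
  unfolding close_def
proof
  fix A
  have "\<bar>measure_pmf.prob p A - measure_pmf.prob q A\<bar> \<le> \<epsilon>" "\<bar>measure_pmf.prob q A - measure_pmf.prob s A\<bar> \<le> \<epsilon>'"
    using assms by (auto simp: close_def)
  then show "\<bar>measure_pmf.prob p A - measure_pmf.prob s A\<bar> \<le> \<epsilon> + \<epsilon>'" by linarith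
qed

lemma prob_bind_pmf: "measure_pmf.prob (bind_pmf p f) A = measure_pmf.expectation p (\<lambda>x. measure_pmf.prob (f x) A)"
proof -
  have e: "measure_pmf.prob q A = pmf (map_pmf (\<lambda>x. x \<in> A) q) True" for q
    by (simp add: pmf_map vimage_def)
  show ?thesis unfolding e map_bind_pmf by (simp add: pmf_bind)
qed

lemma integrable_bounded_pmf:
  fixes f :: "'a \<Rightarrow> real"
  assumes "\<And>x. \<bar>f x\<bar> \<le> c"
  shows "integrable (measure_pmf p) f"
  by (rule measure_pmf.integrable_const_bound[where B = c]) (use assms in auto)

text \<open>On the bad event two probabilities differ by at most 1, so it costs its own
  probability.\<close>

lemma close_bind:
  assumes "measure_pmf.prob p Bad \<le> \<delta>" "\<And>x. x \<in> set_pmf p \<Longrightarrow> x \<notin> Bad \<Longrightarrow> close \<epsilon> (f x) (g x)" "0 \<le> \<epsilon>"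
  shows "close (\<delta> + \<epsilon>) (bind_pmf p f) (bind_pmf p g)"
  unfolding close_def
proof
  fix A
  let ?F = "\<lambda>x. measure_pmf.prob (f x) A" and ?G = "\<lambda>x. measure_pmf.prob (g x) A"
  have i: "integrable (measure_pmf p) ?F" "integrable (measure_pmf p) ?G"
    by (rule integrable_bounded_pmf[where c = 1]; simp)+
  have ib: "integrable (measure_pmf p) (indicator Bad :: 'a \<Rightarrow> real)"
    by (rule integrable_bounded_pmf[where c = 1]) (simp add: indicator_def)
  have pt: "\<bar>?F x - ?G x\<bar> \<le> indicator Bad x + \<epsilon>" if "x \<in> set_pmf p" for x
  proof (cases "x \<in> Bad")
    case True
    have "0 \<le> ?F x" "?F x \<le> 1" "0 \<le> ?G x" "?G x \<le> 1" by simp_all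
    then have "\<bar>?F x - ?G x\<bar> \<le> 1" by linarith
    then show ?thesis using True assms(3) by simp
  next
    case False
    then show ?thesis using assms(2)[OF that] by (simp add: close_def)
  qed
  have "\<bar>measure_pmf.prob (bind_pmf p f) A - measure_pmf.prob (bind_pmf p g) A\<bar>
      = \<bar>measure_pmf.expectation p (\<lambda>x. ?F x - ?G x)\<bar>"
    unfolding prob_bind_pmf by (simp add: i)
  also have "\<dots> \<le> measure_pmf.expectation p (\<lambda>x. \<bar>?F x - ?G x\<bar>)"
    by (rule integral_abs_bound)
  also have "\<dots> \<le> measure_pmf.expectation p (\<lambda>x. indicator Bad x + \<epsilon>)"
    by (intro integral_mono_AE) (use i ib pt in \<open>auto simp: AE_measure_pmf_iff\<close>)
  also have "\<dots> = measure_pmf.prob p Bad + \<epsilon>"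
    using ib by simp
  finally show "\<bar>measure_pmf.prob (bind_pmf p f) A - measure_pmf.prob (bind_pmf p g) A\<bar> \<le> \<delta> + \<epsilon>"
    using assms(1) by linarith
qed

lemma close_bind_all:
  assumes "\<And>x. x \<in> set_pmf p \<Longrightarrow> close \<epsilon> (f x) (g x)" "0 \<le> \<epsilon>"
  shows "close \<epsilon> (bind_pmf p f) (bind_pmf p g)"
  using close_bind[of p "{}" 0 \<epsilon> f g] assms by simp

lemma close_bind_const:
  assumes "measure_pmf.prob p Bad \<le> \<delta>" "\<And>x. x \<in> set_pmf p \<Longrightarrow> x \<notin> Bad \<Longrightarrow> close \<epsilon> (f x) q" "0 \<le> \<epsilon>"
  shows "close (\<delta> + \<epsilon>) (bind_pmf p f) q"
  using close_bind[OF assms(1), of \<epsilon> f "\<lambda>_. q"] assms(2,3) by (simp add: bind_pmf_const)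

lemma close_bool:
  assumes "pmf p True \<ge> 1 - \<delta>"
  shows "close \<delta> (bind_pmf p (\<lambda>b. if b then q else s)) q"
proof -
  have "measure_pmf.prob p {False} \<le> \<delta>"
    using assms pmf_False_conv_True[of p] by (simp add: measure_pmf_single)
  from close_bind_const[OF this, of 0 "\<lambda>b. if b then q else s" q] show ?thesis
    by (auto simp: close_refl)
qed

section \<open>Polynomial bounds and negligible functions\<close>

lemma add_two_le_square: "2 \<le> n \<Longrightarrow> n + 2 \<le> n ^ 2" for n :: nat
proof -
  assume n: "2 \<le> n"
  then have "2 * n \<le> n * n" by (rule mult_le_mono1)
  then show ?thesis using n unfolding power2_eq_square by linarith
qed

text \<open>Powers of \<open>n + 2\<close> multiply by adding exponents and absorb the factor 2,
  since the base is at least 2 even at \<open>n = 0\<close>; closure under sums and products becomes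
  immediate.\<close>

lemma poly_bounded_iff: "poly_bounded f \<longleftrightarrow> (\<exists>k. \<forall>n. f n \<le> (n + 2) ^ k)"
proof
  assume "poly_bounded f"
  then obtain c where c: "\<And>n. f n \<le> n ^ c + c" by (auto simp: poly_bounded_def)
  have "f n \<le> (n + 2) ^ Suc c" for n
  proof -
    have "n ^ c \<le> (n + 2) ^ c" by (rule power_mono) auto
    moreover have "c \<le> (n + 2) ^ c"
      using less_exp[of c] power_mono[of 2 "n + 2" c] by linarith
    ultimately have "f n \<le> 2 * (n + 2) ^ c" using c[of n] by linarith
    also have "\<dots> \<le> (n + 2) ^ Suc c" by simp
    finally show ?thesis .
  qed
  then show "\<exists>k. \<forall>n. f n \<le> (n + 2) ^ k" by blast
next
  assume "\<exists>k. \<forall>n. f n \<le> (n + 2) ^ k"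
  then obtain k where k: "\<And>n. f n \<le> (n + 2) ^ k" by blast
  \<comment> \<open>For \<open>n\<close> at least 2 the bound \<open>n + 2 \<le> n ^ 2\<close> gives
    the exponent \<open>2 * k\<close>; the summand \<open>3 ^ k\<close> covers the values at 0 and
    1.\<close>
  have "f n \<le> n ^ (2 * k + 3 ^ k) + (2 * k + 3 ^ k)" for n
  proof (cases "n < 2")
    case True
    then have "(n + 2) ^ k \<le> 3 ^ k" by (intro power_mono) auto
    then show ?thesis using k[of n] by linarith
  next
    case False
    then have "n + 2 \<le> n ^ 2" by (intro add_two_le_square) simp
    then have "(n + 2) ^ k \<le> (n ^ 2) ^ k" by (rule power_mono) simp
    also have "\<dots> \<le> n ^ (2 * k + 3 ^ k)"
      unfolding power_mult[symmetric] using False by (intro power_increasing) auto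
    finally show ?thesis using k[of n] by linarith
  qed
  then show "poly_bounded f" unfolding poly_bounded_def by blast
qed

lemma poly_bounded_const [simp]: "poly_bounded (\<lambda>n. c)"
  unfolding poly_bounded_def by (intro exI[of _ c]) simp

lemma poly_bounded_id [simp]: "poly_bounded (\<lambda>n. n)"
  unfolding poly_bounded_def by (intro exI[of _ 1]) simp

lemma poly_bounded_add [intro]:
  assumes "poly_bounded f" "poly_bounded g"
  shows "poly_bounded (\<lambda>n. f n + g n)"
proof -
  obtain a b where ab: "\<And>n. f n \<le> (n + 2) ^ a" "\<And>n. g n \<le> (n + 2) ^ b"
    using assms by (auto simp: poly_bounded_iff)
  have "f n + g n \<le> (n + 2) ^ Suc (a + b)" for n
  proof -
    have "(n + 2) ^ a \<le> (n + 2) ^ (a + b)" "(n + 2) ^ b \<le> (n + 2) ^ (a + b)"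
      by (intro power_increasing; simp)+
    then have "f n + g n \<le> 2 * (n + 2) ^ (a + b)" using ab[of n] by linarith
    also have "\<dots> \<le> (n + 2) ^ Suc (a + b)" by simp
    finally show ?thesis .
  qed
  then show ?thesis unfolding poly_bounded_iff by blast
qed

lemma poly_bounded_mult [intro]:
  assumes "poly_bounded f" "poly_bounded g"
  shows "poly_bounded (\<lambda>n. f n * g n)"
proof -
  obtain a b where ab: "\<And>n. f n \<le> (n + 2) ^ a" "\<And>n. g n \<le> (n + 2) ^ b"
    using assms by (auto simp: poly_bounded_iff)
  have "f n * g n \<le> (n + 2) ^ (a + b)" for n
    unfolding power_add using ab by (intro mult_le_mono)
  then show ?thesis unfolding poly_bounded_iff by blast
qed

lemma poly_bounded_power [intro]:
  assumes "poly_bounded f"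
  shows "poly_bounded (\<lambda>n. f n ^ c)"
proof (induction c)
  case (Suc c)
  then show ?case using poly_bounded_mult[OF assms] by simp
qed simp

lemma negl_abs: "negl \<nu> \<Longrightarrow> negl (\<lambda>n. \<bar>\<nu> n\<bar>)"
  by (simp add: negl_def)

text \<open>Negligibility is used at exponent \<open>2 * k + c\<close>, because the factor is at
  most \<open>n ^ (2 * k)\<close> from \<open>n = 2\<close> on.\<close>

lemma negl_scale:
  assumes "negl \<nu>" "poly_bounded f"
  shows "negl (\<lambda>n. real (f n) * \<nu> n)"
  unfolding negl_def
proof
  fix c :: nat
  obtain k where k: "\<And>n. f n \<le> (n + 2) ^ k" using assms(2) by (auto simp: poly_bounded_iff)
  have "eventually (\<lambda>n. \<bar>\<nu> n\<bar> < 1 / real n ^ (2 * k + c)) sequentially"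
    using assms(1) unfolding negl_def by blast
  then show "eventually (\<lambda>n. \<bar>real (f n) * \<nu> n\<bar> < 1 / real n ^ c) sequentially"
    using eventually_ge_at_top[of 2]
  proof eventually_elim
    case (elim n)
    then have n: "0 < real n" "n + 2 \<le> n ^ 2"
      by (simp, intro add_two_le_square)
    have "f n \<le> (n ^ 2) ^ k" using k[of n] power_mono[OF n(2), of k] by linarith
    then have "real (f n) \<le> real n ^ (2 * k)"
      by (metis of_nat_le_iff of_nat_power power_mult)
    then have "\<bar>real (f n) * \<nu> n\<bar> \<le> real n ^ (2 * k) * \<bar>\<nu> n\<bar>"
      by (simp add: abs_mult mult_right_mono)
    also have "\<dots> < real n ^ (2 * k) * (1 / real n ^ (2 * k + c))"
      using elim(1) n(1) by (intro mult_strict_left_mono) auto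
    also have "\<dots> = 1 / real n ^ c" using n(1) by (simp add: power_add)
    finally show ?case .
  qed
qed

text \<open>One spare power of \<open>n\<close> absorbs the factor 2.\<close>

lemma negl_add:
  assumes "negl \<mu>" "negl \<nu>"
  shows "negl (\<lambda>n. \<mu> n + \<nu> n)"
  unfolding negl_def
proof
  fix c :: nat
  have "eventually (\<lambda>n. \<bar>\<mu> n\<bar> < 1 / real n ^ (c + 1)) sequentially"
    "eventually (\<lambda>n. \<bar>\<nu> n\<bar> < 1 / real n ^ (c + 1)) sequentially"
    using assms unfolding negl_def by blast+
  then show "eventually (\<lambda>n. \<bar>\<mu> n + \<nu> n\<bar> < 1 / real n ^ c) sequentially"
    using eventually_ge_at_top[of 2]
  proof eventually_elim
    case (elim n)
    have "\<bar>\<mu> n + \<nu> n\<bar> < 2 * (1 / real n ^ (c + 1))" using elim by linarith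
    also have "\<dots> = (2 / real n) * (1 / real n ^ c)" by simp
    also have "\<dots> \<le> 1 * (1 / real n ^ c)"
      using elim(3) by (intro mult_right_mono) auto
    finally show ?case by simp
  qed
qed

section \<open>Output lengths\<close>

text \<open>The constant 2 is attained by a left move on an empty tape, which writes a symbol and
  creates a blank in front of it.\<close>

lemma tape_act_length: "length (fst (tape_act tp act)) + length (snd (tape_act tp act)) \<le> length (fst tp) + length (snd tp) + 2"
proof -
  obtain l r z m where e: "tp = (l, r)" "act = (z, m)" by (cases tp; cases act) auto
  show ?thesis unfolding e by (cases m; cases l; cases r) simp_all
qed

text \<open>The bound on the state belongs to the invariant because \<open>wf_tm\<close> controls
  transitions only from states below \<open>states M\<close>.\<close>

definition tapes_within :: "tm \<Rightarrow> nat \<Rightarrow> config \<Rightarrow> bool" where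
  "tapes_within M n cfg \<longleftrightarrow> fst cfg < states M \<and> length (snd cfg) = tapes M \<and>
     (\<forall>tp\<in>set (snd cfg). length (fst tp) + length (snd tp) \<le> n)"

lemma tapes_within_step:
  assumes "wf_tm M" "tapes_within M n cfg"
  shows "tapes_within M (n + 2) (tm_step M c cfg)"
proof -
  obtain s ts where cfg: "cfg = (s, ts)" by (cases cfg)
  show ?thesis
  proof (cases "delta M s c (map tape_read ts)")
    case None
    then show ?thesis using assms(2) by (force simp: cfg tapes_within_def)
  next
    case (Some sw)
    obtain s' ws where sw: "sw = (s', ws)" by (cases sw)
    have ts: "s < states M" "length ts = tapes M" "\<And>tp. tp \<in> set ts \<Longrightarrow> length (fst tp) + length (snd tp) \<le> n"
      using assms(2) by (auto simp: cfg tapes_within_def)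
    have "s' < states M \<and> length ws = tapes M"
      using assms(1) ts(1,2) Some unfolding wf_tm_def sw by (metis length_map)
    moreover have "length (fst tp) + length (snd tp) \<le> n + 2" if "tp \<in> set (map2 tape_act ts ws)" for tp
    proof -
      have "tp \<in> (\<lambda>p. tape_act (fst p) (snd p)) ` set (zip ts ws)" using that by (simp add: split_def)
      then obtain p where p: "p \<in> set (zip ts ws)" "tp = tape_act (fst p) (snd p)" by blast
      have "fst p \<in> set ts" using p(1) by (metis set_zip_leftD prod.collapse)
      then show ?thesis using tape_act_length[of "fst p" "snd p"] ts(3)[of "fst p"] p(2) by simp
    qed
    ultimately show ?thesis using ts(2) by (simp add: cfg Some sw tapes_within_def)
  qed
qed

lemma tm_output_length:
  assumes "wf_tm M"
  shows "length (tm_output (tm_run M coins x)) \<le> length x + 2 * length coins"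
proof -
  have "tapes_within M (n + 2 * length coins) (fold (tm_step M) coins cfg)" if "tapes_within M n cfg" for n cfg
    using that
  proof (induction coins arbitrary: n cfg)
    case (Cons c coins)
    from Cons.IH[OF tapes_within_step[OF assms Cons.prems]] show ?case by (simp add: algebra_simps)
  qed simp
  moreover have "tapes_within M (length x) (0, ([], map Some x) # replicate (tapes M - 1) ([], []))"
    using assms by (auto simp: tapes_within_def wf_tm_def)
  ultimately have tw: "tapes_within M (length x + 2 * length coins) (tm_run M coins x)"
    unfolding tm_run_def by blast
  obtain s ts where run: "tm_run M coins x = (s, ts)" by (cases "tm_run M coins x")
  have "ts \<noteq> []" using tw assms by (auto simp: run tapes_within_def wf_tm_def)
  then have "last ts \<in> set ts" by (rule last_in_set)
  then have "length (fst (last ts)) + length (snd (last ts)) \<le> length x + 2 * length coins"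
    using tw unfolding run tapes_within_def by simp
  then have "length (snd (last ts)) \<le> length x + 2 * length coins" by simp
  moreover have "length (tm_output (s, ts)) \<le> length (snd (last ts))"
    by (simp add: length_takeWhile_le del: not_None_eq)
  ultimately show ?thesis unfolding run by linarith
qed

text \<open>Keys come without an explicit length bound, so one is extracted from the running time of
  the machine that produces them. It is wanted because completeness of arguments is uniform only
  over polynomially long instances and witnesses.\<close>

lemma ppt_length:
  assumes "ppt inp A out"
  obtains c where "\<And>a x. x \<in> set_pmf (A a) \<Longrightarrow> length (out x) \<le> length (inp a) + 2 * (length (inp a) ^ c + c)"
proof -
  obtain c M where M: "wf_tm M" "\<And>a. map_pmf out (A a) = map_pmf (\<lambda>r. tm_output (tm_run M r (inp a)))
      (pmf_of_set (bitstr (length (inp a) ^ c + c)))"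
    using assms unfolding ppt_def in_time_def by blast
  have "length (out x) \<le> length (inp a) + 2 * (length (inp a) ^ c + c)" if x: "x \<in> set_pmf (A a)" for a x
  proof -
    let ?t = "length (inp a) ^ c + c"
    have "zeros ?t \<in> bitstr ?t" by simp
    then have ne: "bitstr ?t \<noteq> {}" by blast
    have "out x \<in> set_pmf (map_pmf out (A a))" using x by simp
    then have "out x \<in> (\<lambda>r. tm_output (tm_run M r (inp a))) ` bitstr ?t"
      by (simp only: M(2) set_map_pmf set_pmf_of_set[OF ne finite_bitstr])
    then obtain r where "r \<in> bitstr ?t" "out x = tm_output (tm_run M r (inp a))" by blast
    then show ?thesis using tm_output_length[OF M(1), of r "inp a"] by simp
  qed
  then show ?thesis using that by blast
qed

lemma length_enc: "length (enc xs) = (\<Sum>x\<leftarrow>xs. 2 * length x + 1)"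
proof -
  have "length (concat (map (\<lambda>b. [True, b]) x)) = 2 * length x" for x :: bits by (induction x) auto
  then show ?thesis unfolding enc_def by (induction xs) auto
qed

lemma length_enc_uniform:
  assumes "\<And>x. x \<in> set xs \<Longrightarrow> length x \<le> n"
  shows "length (enc xs) \<le> length xs * (2 * n + 1)"
  using assms unfolding length_enc
proof (induction xs)
  case (Cons a xs)
  then have "length a \<le> n" "(\<Sum>x\<leftarrow>xs. 2 * length x + 1) \<le> length xs * (2 * n + 1)" by simp_all
  then show ?case by simp
qed simp

text \<open>A crude bound, sufficient because only polynomial growth is at stake.\<close>

lemma floorlog_le_self: "floorlog 2 n \<le> n"
  using floorlog_le_iff[of 2 n n] less_exp[of n] by (cases "n = 0") auto

section \<open>Correctness for fixed keys\<close>

lemma prob_False_le: "pmf p True \<ge> 1 - \<delta> \<Longrightarrow> measure_pmf.prob p {False} \<le> \<delta>"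
  using pmf_False_conv_True[of p] by (simp add: measure_pmf_single)

lemma if_neg: "(if \<not> c then a else b) = (if c then b else a)"
  by simp

lemma union_bound:
  assumes "\<And>i. i < l \<Longrightarrow> measure_pmf.prob p {x. Q i x} \<ge> 1 - \<delta>"
  shows "measure_pmf.prob p {x. \<exists>i<l. \<not> Q i x} \<le> real l * \<delta>"
proof -
  have "measure_pmf.prob p {x. \<exists>i<l. \<not> Q i x} = measure_pmf.prob p (\<Union>i\<in>{..<l}. {x. \<not> Q i x})"
    by (intro arg_cong[where f = "measure_pmf.prob p"]) auto
  also have "\<dots> \<le> (\<Sum>i<l. measure_pmf.prob p {x. \<not> Q i x})"
    by (rule measure_UNION_le) auto
  also have "\<dots> \<le> (\<Sum>i<l. \<delta>)"
  proof (rule sum_mono)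
    fix i assume "i \<in> {..<l}"
    then have "measure_pmf.prob p {x. Q i x} \<ge> 1 - \<delta>" using assms by simp
    moreover have "measure_pmf.prob p {x. \<not> Q i x} = 1 - measure_pmf.prob p {x. Q i x}"
      using measure_pmf.prob_compl[of "{x. Q i x}" p] by (simp add: Compl_eq_Diff_UNIV[symmetric] Collect_neg_eq)
    ultimately show "measure_pmf.prob p {x. \<not> Q i x} \<le> \<delta>" by linarith
  qed
  finally show ?thesis by simp
qed

definition opening_ok :: "hash \<Rightarrow> bits list \<Rightarrow> nat \<Rightarrow> bits \<Rightarrow> bool" where
  "opening_ok H xs i hk \<longleftrightarrow> fst (Open_H H hk xs i) = xs ! i \<and>
     Ver_H H hk (Eval_H H hk xs) i (fst (Open_H H hk xs i)) (snd (Open_H H hk xs i))"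

context claw_keys
begin

definition commitment_shape :: "nat \<Rightarrow> bits list \<Rightarrow> bool" where
  "commitment_shape l ys \<longleftrightarrow> length ys = l \<and> (\<forall>y\<in>set ys. length y = (w + 2) * r)"

definition opening_shape :: "nat \<Rightarrow> bits list \<Rightarrow> bool" where
  "opening_shape l us \<longleftrightarrow> length us = l \<and> (\<forall>z\<in>set us. length z = blk F lam)"

lemma game_shape:
  assumes "is_state l \<sigma>" "distinct (map fst jbs)" "fst ` set jbs \<subseteq> {..<l}"
    and "(ys, us) \<in> set_pmf (ss_game F lam pks jbs \<sigma>)"
  shows "commitment_shape l ys" "opening_shape (length jbs) us"
proof -
  obtain D \<Psi> where D: "\<sigma> = mk l \<Psi>" "valid l \<Psi>" "wt l \<Psi> = 1"
    "ss_game F lam pks jbs \<sigma> = map_pmf (visible jbs) D" "set_pmf D \<subseteq> all_outcomes l jbs"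
    "\<And>P. measure_pmf.prob D {os. P os} = mass (game_kern F lam pks) (\<lambda>_. outcomes F lam pks) (bases l jbs) \<Psi> P"
    by (rule game_mass[OF assms(1-3)], rule that)
  obtain os where os: "os \<in> all_outcomes l jbs" "visible jbs os = (ys, us)"
    using assms(4) D(5) unfolding D(4) by auto
  have len: "length os = l" and mem: "\<And>j. j < l \<Longrightarrow> os ! j \<in> outcomes F lam pks"
    using os(1) by (auto simp: listset_eq list_all2_conv_all_nth)
  have ys: "ys = map (commit_hash \<circ> fst) os" and us: "us = map (\<lambda>(j, b). snd (snd (os ! j))) jbs"
    using os(2) by (simp_all add: visible_def)
  have "length (commit_hash (fst (os ! j))) = (w + 2) * r" "length (snd (snd (os ! j))) = blk F lam" if "j < l" for j
  proof -
    obtain x t b where e: "os ! j = (x, t, b)" by (cases "os ! j") auto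
    have o: "(x, t, b) \<in> outcomes F lam pks" using mem[OF that] e by simp
    show "length (commit_hash (fst (os ! j))) = (w + 2) * r" "length (snd (snd (os ! j))) = blk F lam"
      using commit_length[OF o] outcomesD(7)[OF o] by (simp_all only: e fst_conv snd_conv blk_eq Suc_eq_plus1)
  qed
  then show "commitment_shape l ys" "opening_shape (length jbs) us"
    using assms(3) len by (force simp: commitment_shape_def ys in_set_conv_nth, force simp: opening_shape_def us)
qed

text \<open>A commitment is the first component of the game without opened positions.\<close>

lemma commit_shape:
  assumes "is_state l \<sigma>" "(ys, \<rho>) \<in> set_pmf (commit_ss F lam pks \<sigma>)"
  shows "commitment_shape l ys"
proof -
  have "(ys, []) \<in> set_pmf (ss_game F lam pks [] \<sigma>)"
    using assms(2) by (force simp: ss_game_def)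
  from game_shape(1)[OF assms(1) _ _ this] show ?thesis by simp
qed

context
  fixes H :: hash and \<A>1 \<A>2 :: argument and e1 e2 eh :: real and l :: nat and \<sigma> :: qstate
  assumes state: "is_state l \<sigma>" and nonneg: "0 \<le> e1" "0 \<le> e2" "0 \<le> eh"
    and commit_argued: "\<And>hk ys. hk \<in> set_pmf (Gen_H H lam) \<Longrightarrow> commitment_shape l ys \<Longrightarrow>
       pmf (ver_commit \<A>1 lam hk (Eval_H H hk ys) ys) True \<ge> 1 - e1"
begin

lemma ss_error_nonneg: "0 \<le> ss_error n"
  unfolding ss_error_def using ep_nonneg eg_nonneg by (intro add_nonneg_nonneg mult_nonneg_nonneg) auto

text \<open>The argument of the commit phase is accepted up to \<open>e1\<close> for every
  commitment of the right shape, so it can be removed whatever the continuation \<open>X\<close>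
  is.\<close>

lemma drop_commit_argument:
  "close e1 (bind_pmf (Gen_H H lam) (\<lambda>hk. bind_pmf (commit F H lam (pks, hk) \<sigma>) (\<lambda>(rt, ys, \<rho>).
       bind_pmf (ver_commit \<A>1 lam hk rt ys) (\<lambda>acc. if \<not> acc then return_pmf None else X hk rt ys \<rho>))))
     (bind_pmf (Gen_H H lam) (\<lambda>hk. bind_pmf (commit_ss F lam pks \<sigma>) (\<lambda>(ys, \<rho>). X hk (Eval_H H hk ys) ys \<rho>)))"
proof (rule close_bind_all)
  fix hk assume hk: "hk \<in> set_pmf (Gen_H H lam)"
  have "close e1 (bind_pmf (commit_ss F lam pks \<sigma>) (\<lambda>p. bind_pmf (ver_commit \<A>1 lam hk (Eval_H H hk (fst p)) (fst p))
         (\<lambda>acc. if acc then X hk (Eval_H H hk (fst p)) (fst p) (snd p) else return_pmf None)))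
      (bind_pmf (commit_ss F lam pks \<sigma>) (\<lambda>p. X hk (Eval_H H hk (fst p)) (fst p) (snd p)))"
  proof (intro close_bind_all close_bool commit_argued hk nonneg(1))
    fix p assume "p \<in> set_pmf (commit_ss F lam pks \<sigma>)"
    then show "commitment_shape l (fst p)" by (cases p) (auto intro: commit_shape[OF state])
  qed
  then show "close e1 (bind_pmf (commit F H lam (pks, hk) \<sigma>) (\<lambda>(rt, ys, \<rho>).
       bind_pmf (ver_commit \<A>1 lam hk rt ys) (\<lambda>acc. if \<not> acc then return_pmf None else X hk rt ys \<rho>)))
     (bind_pmf (commit_ss F lam pks \<sigma>) (\<lambda>(ys, \<rho>). X hk (Eval_H H hk ys) ys \<rho>))"
    by (simp add: split_def bind_assoc_pmf bind_return_pmf if_neg cong: if_cong)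
qed (rule nonneg(1))

text \<open>Dropping the argument costs \<open>e1\<close>, replacing hash openings by the true
  commitments costs \<open>real l * eh\<close>, and passing to the ideal measurement costs
  \<open>ss_error l\<close>.\<close>

lemma real0_close:
  assumes J: "J \<subseteq> {..<l}"
    and hash: "\<And>ys i. commitment_shape l ys \<Longrightarrow> i < l \<Longrightarrow>
       measure_pmf.prob (Gen_H H lam) {hk. opening_ok H ys i hk} \<ge> 1 - eh"
  shows "close (e1 + (real l * eh + ss_error l))
    (bind_pmf (Gen_H H lam) (\<lambda>hk. bind_pmf (commit F H lam (pks, hk) \<sigma>) (\<lambda>(rt, ys, \<rho>).
       bind_pmf (ver_commit \<A>1 lam hk rt ys) (\<lambda>acc. if \<not> acc then return_pmf None
         else bind_pmf (open_at F H lam hk ys \<rho> (positions J bs)) (\<lambda>ops.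
           return_pmf (if ver_at F H lam (ks, hk) rt (positions J bs) ops
                                then Some (out_at F lam (ks, hk) (positions J bs) ops) else None))))))
    (map_pmf Some (ideal \<sigma> J bs))"
proof -
  let ?jbs = "positions J bs"
  have finJ: "finite J" using J finite_subset by blast
  have jbs: "distinct (map fst ?jbs)" "fst ` set ?jbs \<subseteq> {..<l}"
    using J finJ by (auto simp: positions_def o_def)
  let ?ops = "\<lambda>hk ys us. map2 (\<lambda>(j, b) z. (fst (Open_H H hk ys j), snd (Open_H H hk ys j), z)) ?jbs us"
  let ?G = "\<lambda>hk v. if ver_at F H lam (ks, hk) (Eval_H H hk (fst v)) ?jbs (?ops hk (fst v) (snd v))
      then Some (out_at F lam (ks, hk) ?jbs (?ops hk (fst v) (snd v))) else None"
  let ?game = "ss_game F lam pks ?jbs \<sigma>"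
  have G: "?G hk (ys, us) = decode F lam ks ?jbs (ys, us)"
    if len: "length us = length ?jbs" and ok: "\<And>i. i < l \<Longrightarrow> opening_ok H ys i hk" for hk ys us
  proof -
    have op: "opening_ok H ys (fst (?jbs ! n)) hk" if "n < length ?jbs" for n
      using that jbs(2) by (intro ok) (meson image_eqI lessThan_iff nth_mem subsetD)
    have ok': "fst (Open_H H hk ys (fst (?jbs ! n))) = ys ! fst (?jbs ! n)"
      "Ver_H H hk (Eval_H H hk ys) (fst (?jbs ! n)) (ys ! fst (?jbs ! n)) (snd (Open_H H hk ys (fst (?jbs ! n))))"
      if "n < length ?jbs" for n
      using op[OF that] by (auto simp: opening_ok_def)
    have "ver_at F H lam (ks, hk) (Eval_H H hk ys) ?jbs (?ops hk ys us)
       \<longleftrightarrow> list_all2 (\<lambda>(j, b) z. ver1 F lam ks (ys ! j) b z) ?jbs us"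
      using ok' len by (auto simp: ver_at_def list_all2_conv_all_nth split_def)
    moreover have "out_at F lam (ks, hk) ?jbs (?ops hk ys us) = map2 (\<lambda>(j, b) z. out1 F lam ks (ys ! j) b z) ?jbs us"
      using ok' len by (intro nth_equalityI) (auto simp: out_at_def split_def)
    ultimately show ?thesis by (simp add: decode_def)
  qed
  have A: "close e1 (bind_pmf (Gen_H H lam) (\<lambda>hk. bind_pmf (commit F H lam (pks, hk) \<sigma>) (\<lambda>(rt, ys, \<rho>).
       bind_pmf (ver_commit \<A>1 lam hk rt ys) (\<lambda>acc. if \<not> acc then return_pmf None
         else bind_pmf (open_at F H lam hk ys \<rho> ?jbs) (\<lambda>ops.
           return_pmf (if ver_at F H lam (ks, hk) rt ?jbs ops then Some (out_at F lam (ks, hk) ?jbs ops) else None))))))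
     (bind_pmf (Gen_H H lam) (\<lambda>hk. bind_pmf ?game (\<lambda>v. return_pmf (?G hk v))))"
    using drop_commit_argument[of "\<lambda>hk rt ys \<rho>. bind_pmf (open_at F H lam hk ys \<rho> ?jbs) (\<lambda>ops.
           return_pmf (if ver_at F H lam (ks, hk) rt ?jbs ops then Some (out_at F lam (ks, hk) ?jbs ops) else None))"]
    by (simp add: ss_game_def open_at_def split_def bind_assoc_pmf bind_return_pmf bind_map_pmf cong: if_cong)
  have B: "close (real l * eh) (bind_pmf (Gen_H H lam) (\<lambda>hk. bind_pmf ?game (\<lambda>v. return_pmf (?G hk v))))
      (bind_pmf ?game (\<lambda>v. return_pmf (decode F lam ks ?jbs v)))"
  \<comment> \<open>Commitments and openings do not depend on the hash key, so it may be drawn after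
    them; correctness of hash openings then applies to a fixed message, with a union bound over
    positions.\<close>
  proof (subst bind_commute_pmf, rule close_bind_all)
    fix v assume v: "v \<in> set_pmf ?game"
    obtain ys us where yz: "v = (ys, us)" by (cases v)
    note sh = game_shape[OF state jbs v[unfolded yz]]
    have "close (real l * eh + 0) (bind_pmf (Gen_H H lam) (\<lambda>hk. return_pmf (?G hk v))) (return_pmf (decode F lam ks ?jbs v))"
    proof (rule close_bind_const)
      show "measure_pmf.prob (Gen_H H lam) {hk. \<exists>i<l. \<not> opening_ok H ys i hk} \<le> real l * eh"
        by (rule union_bound) (rule hash[OF sh(1)])
      fix hk assume "hk \<notin> {hk. \<exists>i<l. \<not> opening_ok H ys i hk}"
      then have "?G hk (ys, us) = decode F lam ks ?jbs (ys, us)"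
        using sh(2) by (intro G) (auto simp: opening_shape_def)
      then show "close 0 (return_pmf (?G hk v)) (return_pmf (decode F lam ks ?jbs v))"
        unfolding yz by (simp only:) (rule close_refl, simp)
    qed simp
    then show "close (real l * eh) (bind_pmf (Gen_H H lam) (\<lambda>hk. return_pmf (?G hk v))) (return_pmf (decode F lam ks ?jbs v))"
      by simp
  qed (use nonneg in simp)
  have C: "close (ss_error l) (bind_pmf ?game (\<lambda>v. return_pmf (decode F lam ks ?jbs v))) (map_pmf Some (ideal \<sigma> J bs))"
    unfolding map_pmf_def[symmetric] close_def using game_close[OF state J] by blast
  show ?thesis by (rule close_trans[OF A close_trans[OF B C]])
qed

text \<open>Verification fails with probability at most \<open>ss_error l\<close>; otherwise the
  honest pair is a witness for the test relation, and the two arguments lose \<open>e1\<close> and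
  \<open>e2\<close>.\<close>

lemma test_close:
  assumes hk: "hk \<in> set_pmf (Gen_H H lam)"
    and open_argued: "\<And>us. opening_shape l us \<Longrightarrow>
       pmf (argue \<A>1 lam (enc [hk, Eval_H H hk us]) (enc us)) True \<ge> 1 - e1"
    and test_argued: "\<And>ys us b. commitment_shape l ys \<Longrightarrow> opening_shape l us \<Longrightarrow>
       ver_ss F lam ks ys (replicate (length ys) b) us \<Longrightarrow>
       pmf (argue \<A>2 lam (enc [enc_keys ks, hk, Eval_H H hk ys, Eval_H H hk us, [b]]) (enc [enc ys, enc us])) True \<ge> 1 - e2"
  shows "close (ss_error l + (e1 + e2))
    (bind_pmf (commit_ss F lam pks \<sigma>) (\<lambda>(ys, \<rho>).
       bind_pmf (test F H \<A>1 \<A>2 lam ks hk (Eval_H H hk ys) ys \<rho>) (\<lambda>acc. return_pmf (if acc then Some True else None))))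
    (return_pmf (Some True))"
proof -
  let ?jbs = "\<lambda>b. map (\<lambda>j. (j, b)) [0..<l]"
  let ?Z = "\<lambda>b ys us. bind_pmf (argue \<A>1 lam (enc [hk, Eval_H H hk us]) (enc us)) (\<lambda>acc1.
      bind_pmf (argue \<A>2 lam (enc [enc_keys ks, hk, Eval_H H hk ys, Eval_H H hk us, [b]]) (enc [enc ys, enc us]))
        (\<lambda>acc2. return_pmf (if acc1 \<and> acc2 then Some True else None)))"
  have jbs: "distinct (map fst (?jbs b))" "fst ` set (?jbs b) \<subseteq> {..<l}" for b by (auto simp: o_def)
  have "bind_pmf (commit_ss F lam pks \<sigma>) (\<lambda>(ys, \<rho>).
       bind_pmf (test F H \<A>1 \<A>2 lam ks hk (Eval_H H hk ys) ys \<rho>) (\<lambda>acc. return_pmf (if acc then Some True else None)))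
     = bind_pmf (commit_ss F lam pks \<sigma>) (\<lambda>p. bind_pmf (pmf_of_set UNIV) (\<lambda>b.
         bind_pmf (open_ss F lam (?jbs b) (snd p)) (\<lambda>us. ?Z b (fst p) us)))"
  proof (rule bind_pmf_cong[OF refl])
    fix p assume p: "p \<in> set_pmf (commit_ss F lam pks \<sigma>)"
    have "length (fst p) = l" using commit_shape[OF state, of "fst p" "snd p"] p by (simp add: commitment_shape_def)
    then show "(case p of (ys, \<rho>) \<Rightarrow> bind_pmf (test F H \<A>1 \<A>2 lam ks hk (Eval_H H hk ys) ys \<rho>)
        (\<lambda>acc. return_pmf (if acc then Some True else None)))
      = bind_pmf (pmf_of_set UNIV) (\<lambda>b. bind_pmf (open_ss F lam (?jbs b) (snd p)) (\<lambda>us. ?Z b (fst p) us))"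
      by (simp add: split_def test_def Let_def bind_assoc_pmf bind_return_pmf)
  qed
  \<comment> \<open>The honest commitment does not depend on the challenge; drawing the challenge
    first fixes the bases of the game.\<close>
  also have "\<dots> = bind_pmf (pmf_of_set UNIV) (\<lambda>b. bind_pmf (ss_game F lam pks (?jbs b) \<sigma>) (\<lambda>v. ?Z b (fst v) (snd v)))"
    by (subst bind_commute_pmf) (simp add: ss_game_def split_def bind_assoc_pmf bind_map_pmf)
  finally have e: "bind_pmf (commit_ss F lam pks \<sigma>) (\<lambda>(ys, \<rho>).
       bind_pmf (test F H \<A>1 \<A>2 lam ks hk (Eval_H H hk ys) ys \<rho>) (\<lambda>acc. return_pmf (if acc then Some True else None)))
     = bind_pmf (pmf_of_set UNIV) (\<lambda>b. bind_pmf (ss_game F lam pks (?jbs b) \<sigma>) (\<lambda>v. ?Z b (fst v) (snd v)))" .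
  have "close (0 + (ss_error l + (e1 + e2))) (bind_pmf (pmf_of_set UNIV)
      (\<lambda>b. bind_pmf (ss_game F lam pks (?jbs b) \<sigma>) (\<lambda>v. ?Z b (fst v) (snd v)))) (return_pmf (Some True))"
  proof (rule close_bind_const[where Bad = "{}"])
    fix b :: bool
    show "close (ss_error l + (e1 + e2)) (bind_pmf (ss_game F lam pks (?jbs b) \<sigma>) (\<lambda>v. ?Z b (fst v) (snd v))) (return_pmf (Some True))"
    proof (rule close_bind_const)
      show "measure_pmf.prob (ss_game F lam pks (?jbs b) \<sigma>) {v. decode F lam ks (?jbs b) v = None} \<le> ss_error l"
        by (rule game_verified[OF state jbs])
      fix v assume v: "v \<in> set_pmf (ss_game F lam pks (?jbs b) \<sigma>)" "v \<notin> {v. decode F lam ks (?jbs b) v = None}"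
      obtain ys us where yz: "v = (ys, us)" by (cases v)
      have sh: "commitment_shape l ys" "opening_shape l us"
        using game_shape[OF state jbs v(1)[unfolded yz]] by simp_all
      have "list_all2 (\<lambda>(j, b) z. ver1 F lam ks (ys ! j) b z) (?jbs b) us"
        using v(2) by (simp add: yz decode_def split: if_splits)
      then have "ver_ss F lam ks ys (replicate (length ys) b) us"
        using sh by (simp add: ver_ss_def list_all2_conv_all_nth commitment_shape_def opening_shape_def)
      note t = test_argued[OF sh this]
      let ?a1 = "argue \<A>1 lam (enc [hk, Eval_H H hk us]) (enc us)"
      let ?a2 = "argue \<A>2 lam (enc [enc_keys ks, hk, Eval_H H hk ys, Eval_H H hk us, [b]]) (enc [enc ys, enc us])"
      have "close (e1 + e2) (?Z b ys us) (return_pmf (Some True))"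
      proof (rule close_bind_const)
        show "measure_pmf.prob ?a1 {False} \<le> e1" by (rule prob_False_le[OF open_argued[OF sh(2)]])
        fix acc1 assume "acc1 \<notin> {False}"
        then have "acc1 = True" by simp
        moreover have "close e2 (bind_pmf ?a2 (\<lambda>acc2. if acc2 then return_pmf (Some True) else return_pmf None)) (return_pmf (Some True))"
          by (rule close_bool[OF t])
        moreover have "(\<lambda>acc2. if acc2 then return_pmf (Some True) else return_pmf None)
            = (\<lambda>acc2. return_pmf (if acc2 then Some True else None))" by (simp add: fun_eq_iff)
        ultimately show "close e2 (bind_pmf ?a2 (\<lambda>acc2. return_pmf (if acc1 \<and> acc2 then Some True else None))) (return_pmf (Some True))"
          by simp
      qed (rule nonneg(2))
      then show "close (e1 + e2) (?Z b (fst v) (snd v)) (return_pmf (Some True))" by (simp only: yz fst_conv snd_conv)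
    qed (use nonneg in simp)
  qed (use nonneg ss_error_nonneg in simp_all)
  then show ?thesis unfolding e by simp
qed

lemma real1_close:
  assumes open_argued: "\<And>hk us. hk \<in> set_pmf (Gen_H H lam) \<Longrightarrow> opening_shape l us \<Longrightarrow>
       pmf (argue \<A>1 lam (enc [hk, Eval_H H hk us]) (enc us)) True \<ge> 1 - e1"
    and test_argued: "\<And>hk ys us b. hk \<in> set_pmf (Gen_H H lam) \<Longrightarrow> commitment_shape l ys \<Longrightarrow> opening_shape l us \<Longrightarrow>
       ver_ss F lam ks ys (replicate (length ys) b) us \<Longrightarrow>
       pmf (argue \<A>2 lam (enc [enc_keys ks, hk, Eval_H H hk ys, Eval_H H hk us, [b]]) (enc [enc ys, enc us])) True \<ge> 1 - e2"
  shows "close (e1 + (ss_error l + (e1 + e2)))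
    (bind_pmf (Gen_H H lam) (\<lambda>hk. bind_pmf (commit F H lam (pks, hk) \<sigma>) (\<lambda>(rt, ys, \<rho>).
       bind_pmf (ver_commit \<A>1 lam hk rt ys) (\<lambda>acc. if \<not> acc then return_pmf None
         else bind_pmf (test F H \<A>1 \<A>2 lam ks hk rt ys \<rho>) (\<lambda>acc'. return_pmf (if acc' then Some True else None))))))
    (return_pmf (Some True))"
proof -
  have "close (0 + (ss_error l + (e1 + e2))) (bind_pmf (Gen_H H lam) (\<lambda>hk. bind_pmf (commit_ss F lam pks \<sigma>) (\<lambda>(ys, \<rho>).
       bind_pmf (test F H \<A>1 \<A>2 lam ks hk (Eval_H H hk ys) ys \<rho>) (\<lambda>acc. return_pmf (if acc then Some True else None)))))
    (return_pmf (Some True))"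
  proof (rule close_bind_const[where Bad = "{}"])
    fix hk assume hk: "hk \<in> set_pmf (Gen_H H lam)"
    show "close (ss_error l + (e1 + e2)) (bind_pmf (commit_ss F lam pks \<sigma>) (\<lambda>(ys, \<rho>).
       bind_pmf (test F H \<A>1 \<A>2 lam ks hk (Eval_H H hk ys) ys \<rho>) (\<lambda>acc. return_pmf (if acc then Some True else None))))
      (return_pmf (Some True))"
      by (rule test_close[OF hk]; (rule open_argued[OF hk] | rule test_argued[OF hk]); assumption)
  qed (use nonneg ss_error_nonneg in simp_all)
  then have B: "close (ss_error l + (e1 + e2)) (bind_pmf (Gen_H H lam) (\<lambda>hk. bind_pmf (commit_ss F lam pks \<sigma>) (\<lambda>(ys, \<rho>).
       bind_pmf (test F H \<A>1 \<A>2 lam ks hk (Eval_H H hk ys) ys \<rho>) (\<lambda>acc. return_pmf (if acc then Some True else None)))))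
    (return_pmf (Some True))" unfolding add_0_left .
  show ?thesis by (rule close_trans[OF _ B]) (rule drop_commit_argument)
qed

end

end

section \<open>Keys, lengths and the completeness of the arguments\<close>

text \<open>Absolute values make the errors nonnegative, and each of the two negligible functions is
  uniform over the support of key generation.\<close>

lemma claw_keys_gen1:
  assumes "is_ntcf F"
  obtains \<nu>p \<nu>g where "negl \<nu>p" "negl \<nu>g" "\<And>lam. 0 \<le> \<nu>p lam" "\<And>lam. 0 \<le> \<nu>g lam"
    "\<And>lam ks. ks \<in> set_pmf (gen1 F lam) \<Longrightarrow> claw_keys F lam ks (\<nu>p lam) (\<nu>g lam)"
proof -
  have dom: "ntcf_domains F" and comp: "ntcf_complete F" and prep: "ntcf_preparable F"
    using assms by (simp_all add: is_ntcf_def)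
  obtain \<nu>p where p: "negl \<nu>p" "\<forall>lam. \<forall>(pk, sk)\<in>set_pmf (Gen_F F lam). \<forall>b.
           wf_gates (prep_size F lam pk) (prep_F F pk b) \<and>
           L2_set (\<lambda>a. cmod (prep_vec F lam pk b a - range_superposition F lam pk b a))
             (bitstr (prep_size F lam pk)) \<le> \<nu>p lam"
    using prep unfolding ntcf_preparable_def by (elim conjE exE)
  obtain \<nu>g where g: "negl \<nu>g" "\<forall>lam. \<forall>(pk, sk)\<in>set_pmf (Gen_F F lam). \<forall>x0\<in>Dom_F F pk. \<forall>x1\<in>Dom_F F pk. x0 \<noteq> x1 \<longrightarrow>
           real (card (good_set F lam x0 x1)) / 2 ^ (width F lam + 1) \<ge> 1 - \<nu>g lam"
    using comp unfolding ntcf_complete_def by (elim conjE exE)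
  have "claw_keys F lam ks \<bar>\<nu>p lam\<bar> \<bar>\<nu>g lam\<bar>" if ks: "ks \<in> set_pmf (gen1 F lam)" for lam ks
  proof
    show "ntcf_domains F" "ntcf_complete F" by fact+
    show "set ks \<subseteq> set_pmf (Gen_F F lam)" "length ks = width F lam + 2"
      using ks by (auto simp: gen1_def set_replicate_pmf)
  next
    fix pk sk s assume k: "(pk, sk) \<in> set_pmf (Gen_F F lam)"
    note P = p(2)[rule_format, OF k, unfolded case_prod_conv, rule_format, of s]
    show "wf_gates (prep_size F lam pk) (prep_F F pk s)" using P by (rule conjunct1)
    show "L2_set (\<lambda>a. cmod (prep_vec F lam pk s a - range_superposition F lam pk s a)) (bitstr (prep_size F lam pk)) \<le> \<bar>\<nu>p lam\<bar>"
      by (rule order_trans[OF conjunct2[OF P] abs_ge_self])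
  next
    fix pk sk x0 x1
    assume k: "(pk, sk) \<in> set_pmf (Gen_F F lam)" and x: "x0 \<in> Dom_F F pk" "x1 \<in> Dom_F F pk" "x0 \<noteq> x1"
    have "1 - \<nu>g lam \<le> real (card (good_set F lam x0 x1)) / 2 ^ (width F lam + 1)"
      using g(2)[rule_format, OF k, unfolded case_prod_conv] x by blast
    then show "1 - \<bar>\<nu>g lam\<bar> \<le> real (card (good_set F lam x0 x1)) / 2 ^ (width F lam + 1)"
      using abs_ge_self[of "\<nu>g lam"] by linarith
  qed
  from that[OF negl_abs[OF p(1)] negl_abs[OF g(1)] abs_ge_zero abs_ge_zero this] show thesis .
qed

text \<open>The bound on the witness length in the completeness statement is instantiated with the
  exact length, as \<open>argue\<close> does.\<close>

lemma argue_complete: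
  assumes "arg_complete \<A> R" "poly_bounded p"
  obtains \<nu> where "negl \<nu>" "\<And>lam. 0 \<le> \<nu> lam"
    "\<And>lam x u. R lam x u \<Longrightarrow> length x \<le> p lam \<Longrightarrow> length u \<le> p lam \<Longrightarrow> pmf (argue \<A> lam x u) True \<ge> 1 - \<nu> lam"
proof -
  obtain \<nu> where \<nu>: "negl \<nu>" "\<forall>lam m x u. R lam x u \<longrightarrow> length x \<le> p lam \<longrightarrow> length u \<le> m \<longrightarrow> m \<le> p lam \<longrightarrow>
      measure_pmf.prob (honest_transcript \<A> lam m x u) {t. verdict \<A> lam m x t} \<ge> 1 - \<nu> lam"
    using assms(1)[unfolded arg_complete_def, THEN spec, THEN mp, OF assms(2)] by (elim exE conjE)
  have "pmf (argue \<A> lam x u) True \<ge> 1 - \<bar>\<nu> lam\<bar>" if "R lam x u" "length x \<le> p lam" "length u \<le> p lam" for lam x u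
  proof -
    have "pmf (argue \<A> lam x u) True
        = measure_pmf.prob (honest_transcript \<A> lam (length u) x u) {t. verdict \<A> lam (length u) x t}"
      by (simp add: argue_def pmf_map vimage_def)
    then show ?thesis using \<nu>(2)[rule_format, OF that(1,2) le_refl that(3)] abs_ge_self[of "\<nu> lam"] by linarith
  qed
  from that[OF negl_abs[OF \<nu>(1)] abs_ge_zero this] show thesis .
qed

lemma hash_opening:
  assumes "hash_opening_correct H" "poly_bounded p"
  obtains \<nu> where "negl \<nu>" "\<And>lam. 0 \<le> \<nu> lam"
    "\<And>lam xs i. uniform_blocks xs \<Longrightarrow> i < length xs \<Longrightarrow> length (enc xs) \<le> p lam \<Longrightarrow>
       measure_pmf.prob (Gen_H H lam) {hk. opening_ok H xs i hk} \<ge> 1 - \<nu> lam"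
proof -
  obtain \<nu> where \<nu>: "negl \<nu>" "\<forall>lam xs i. uniform_blocks xs \<longrightarrow> i < length xs \<longrightarrow> length (enc xs) \<le> p lam \<longrightarrow>
       measure_pmf.prob (Gen_H H lam) {hk. opening_ok H xs i hk} \<ge> 1 - \<nu> lam"
    using assms(1)[unfolded hash_opening_correct_def, THEN spec, THEN mp, OF assms(2)]
    unfolding opening_ok_def by (elim exE conjE)
  have "measure_pmf.prob (Gen_H H lam) {hk. opening_ok H xs i hk} \<ge> 1 - \<bar>\<nu> lam\<bar>"
    if "uniform_blocks xs" "i < length xs" "length (enc xs) \<le> p lam" for lam xs i
    using \<nu>(2)[rule_format, OF that] abs_ge_self[of "\<nu> lam"] by linarith
  from that[OF negl_abs[OF \<nu>(1)] abs_ge_zero this] show thesis .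
qed

text \<open>A common shape for committed symbols and opened blocks, so that one length estimate
  serves both.\<close>

definition block_list :: "ntcf \<Rightarrow> nat \<Rightarrow> nat \<Rightarrow> bits list \<Rightarrow> bool" where
  "block_list F lam l xs \<longleftrightarrow> length xs = l \<and> uniform_blocks xs \<and>
     (\<forall>x\<in>set xs. length x \<le> (width F lam + 2) * rlen F lam + blk F lam)"

lemma block_list_uniform:
  assumes "length xs = l" "\<forall>x\<in>set xs. length x = n" "n \<le> (width F lam + 2) * rlen F lam + blk F lam"
  shows "block_list F lam l xs"
proof -
  have "set xs \<subseteq> bitstr n" using assms(2) by (auto simp: bitstr_def)
  then have "uniform_blocks xs" unfolding uniform_blocks_def by (rule exI)
  then show ?thesis using assms by (simp add: block_list_def)
qed

lemma block_list_shapes: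
  assumes "claw_keys F lam ks ep eg"
  shows "claw_keys.commitment_shape F lam l xs \<Longrightarrow> block_list F lam l xs"
    and "claw_keys.opening_shape F lam l xs \<Longrightarrow> block_list F lam l xs"
  unfolding claw_keys.commitment_shape_def[OF assms] claw_keys.opening_shape_def[OF assms]
  by (erule conjE, erule block_list_uniform, assumption, simp)+

text \<open>One polynomial for all instances and witnesses, because completeness fixes the
  polynomial before it yields the negligible error.\<close>

lemma message_lengths:
  assumes F: "is_ntcf F" and H: "is_hash_family H" and ell: "poly_bounded ell"
  obtains p where "poly_bounded p"
    "\<And>lam xs. block_list F lam (ell lam) xs \<Longrightarrow> length (enc xs) \<le> p lam"
    "\<And>lam hk xs. hk \<in> set_pmf (Gen_H H lam) \<Longrightarrow> block_list F lam (ell lam) xs \<Longrightarrow>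
       length (enc [hk, Eval_H H hk xs]) \<le> p lam"
    "\<And>lam xs us. block_list F lam (ell lam) xs \<Longrightarrow> block_list F lam (ell lam) us \<Longrightarrow>
       length (enc [enc xs, enc us]) \<le> p lam"
    "\<And>lam ks hk xs us b. ks \<in> set_pmf (gen1 F lam) \<Longrightarrow> hk \<in> set_pmf (Gen_H H lam) \<Longrightarrow>
       block_list F lam (ell lam) xs \<Longrightarrow> block_list F lam (ell lam) us \<Longrightarrow>
       length (enc [enc_keys ks, hk, Eval_H H hk xs, Eval_H H hk us, [b]]) \<le> p lam"
proof -
  have ppt_F: "ppt unary (Gen_F F) (\<lambda>(pk, sk). enc [pk, sk])" and bounded: "poly_bounded (width F)" "poly_bounded (rlen F)"
    using F by (simp_all add: is_ntcf_def ntcf_efficient_def ntcf_domains_def)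
  have he: "hash_efficient H" using H by (simp add: is_hash_family_def)
  then have ppt_H: "ppt unary (Gen_H H) id" by (simp add: hash_efficient_def)
  obtain c1 where c1: "\<And>a x. x \<in> set_pmf (Gen_H H a) \<Longrightarrow>
      length (id x) \<le> length (unary a) + 2 * (length (unary a) ^ c1 + c1)"
    by (rule ppt_length[OF ppt_H], rule that)
  obtain c3 where c3: "\<And>a x. x \<in> set_pmf (Gen_F F a) \<Longrightarrow>
      length (case x of (pk, sk) \<Rightarrow> enc [pk, sk]) \<le> length (unary a) + 2 * (length (unary a) ^ c3 + c3)"
    by (rule ppt_length[OF ppt_F], rule that)
  obtain c2 where c2: "\<forall>lam. \<forall>hk\<in>set_pmf (Gen_H H lam). \<forall>xs. uniform_blocks xs \<longrightarrow>
        length (Eval_H H hk xs) \<le> (lam + floorlog 2 (length (enc xs))) ^ c2 + c2 \<and>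
        (\<forall>i<length xs.
           length (snd (Open_H H hk xs i)) \<le> (lam + floorlog 2 (length (enc xs))) ^ c2 + c2)"
    using he unfolding hash_efficient_def by (elim conjE exE)
  define E where "E lam = ell lam * (2 * ((width F lam + 2) * rlen F lam + (width F lam + 1) ^ 2) + 1)" for lam
  define Lh where "Lh lam = lam + 2 * (lam ^ c1 + c1)" for lam :: nat
  define Lk where "Lk lam = lam + 2 * (lam ^ c3 + c3)" for lam :: nat
  define Ek where "Ek lam = (2 * (width F lam + 2)) * (2 * Lk lam + 1)" for lam
  define Lr where "Lr lam = (lam + E lam) ^ c2 + c2" for lam
  \<comment> \<open>Each component of an encoding costs twice its length plus 1. The instance of the
    test has five components, among them two hash values and a single bit; the term in
    \<open>E\<close> covers a pair of encoded lists.\<close>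
  define p where "p lam = 2 * Ek lam + 2 * Lh lam + 4 * Lr lam + 4 * E lam + 10" for lam
  have pE: "poly_bounded E" unfolding E_def[abs_def]
    by (intro poly_bounded_add poly_bounded_mult poly_bounded_power poly_bounded_const poly_bounded_id bounded ell)
  have pk: "poly_bounded Ek" "poly_bounded Lh" unfolding Ek_def[abs_def] Lk_def Lh_def[abs_def]
    by (intro poly_bounded_add poly_bounded_mult poly_bounded_power poly_bounded_const poly_bounded_id bounded)+
  have pr: "poly_bounded Lr" unfolding Lr_def[abs_def]
    by (intro poly_bounded_add poly_bounded_power poly_bounded_const poly_bounded_id pE)
  have pp: "poly_bounded p" unfolding p_def[abs_def]
    by (intro poly_bounded_add poly_bounded_mult poly_bounded_const pE pk pr)
  have hk: "length hk \<le> Lh lam" if "hk \<in> set_pmf (Gen_H H lam)" for hk lam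
    using c1[OF that] by (simp add: Lh_def)
  have xs: "length (enc xs) \<le> E lam" if b: "block_list F lam (ell lam) xs" for xs lam
  proof -
    have "length (enc xs) \<le> length xs * (2 * ((width F lam + 2) * rlen F lam + (width F lam + 1) ^ 2) + 1)"
      by (rule length_enc_uniform) (use b in \<open>simp add: block_list_def blk_def\<close>)
    moreover have "length xs = ell lam" using b by (simp add: block_list_def)
    ultimately show ?thesis by (simp only: E_def)
  qed
  have rt: "length (Eval_H H hk xs) \<le> Lr lam"
    if h: "hk \<in> set_pmf (Gen_H H lam)" and b: "block_list F lam (ell lam) xs" for hk xs lam
  proof -
    have "floorlog 2 (length (enc xs)) \<le> E lam"
      using floorlog_le_self[of "length (enc xs)"] xs[OF b] by linarith
    then have "(lam + floorlog 2 (length (enc xs))) ^ c2 \<le> (lam + E lam) ^ c2" by (intro power_mono) auto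
    moreover have "uniform_blocks xs" using b by (simp add: block_list_def)
    note bspec[OF spec[OF c2] h, THEN spec, THEN mp, OF this, THEN conjunct1]
    ultimately show ?thesis unfolding Lr_def by linarith
  qed
  have ks: "length (enc_keys ks) \<le> Ek lam" if k: "ks \<in> set_pmf (gen1 F lam)" for ks lam
  proof -
    have sub: "set ks \<subseteq> set_pmf (Gen_F F lam)" and len: "length ks = width F lam + 2"
      using k by (auto simp: gen1_def set_replicate_pmf)
    let ?ss = "concat (map (\<lambda>(pk, sk). [pk, sk]) ks)"
    have "length s \<le> Lk lam" if s: "s \<in> set ?ss" for s
    proof -
      obtain a b where ab: "(a, b) \<in> set ks" "s = a \<or> s = b" using s by auto
      have "length (enc [a, b]) \<le> Lk lam"
        using c3[OF subsetD[OF sub ab(1)]] by (simp add: Lk_def)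
      then show ?thesis using ab(2) by (auto simp: length_enc)
    qed
    from length_enc_uniform[OF this] have "length (enc_keys ks) \<le> length ?ss * (2 * Lk lam + 1)"
      unfolding enc_keys_def .
    moreover have "length (concat (map (\<lambda>(pk, sk). [pk, sk]) kl)) = 2 * length kl" for kl :: keys
      by (induction kl) auto
    ultimately show ?thesis by (simp only: Ek_def len)
  qed
  show thesis
  proof (rule that[OF pp])
    fix lam xs assume a: "block_list F lam (ell lam) xs"
    show "length (enc xs) \<le> p lam" using xs[OF a] by (simp add: p_def)
  next
    fix lam g xs assume a: "g \<in> set_pmf (Gen_H H lam)" "block_list F lam (ell lam) xs"
    show "length (enc [g, Eval_H H g xs]) \<le> p lam"
      using hk[OF a(1)] rt[OF a] by (simp add: p_def length_enc[of "[g, Eval_H H g xs]"])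
  next
    fix lam xs us assume a: "block_list F lam (ell lam) xs" "block_list F lam (ell lam) us"
    show "length (enc [enc xs, enc us]) \<le> p lam"
      using xs[OF a(1)] xs[OF a(2)] by (simp add: p_def length_enc[of "[enc xs, enc us]"])
  next
    fix lam kl g xs us b
    assume a: "kl \<in> set_pmf (gen1 F lam)" "g \<in> set_pmf (Gen_H H lam)" "block_list F lam (ell lam) xs"
      "block_list F lam (ell lam) us"
    show "length (enc [enc_keys kl, g, Eval_H H g xs, Eval_H H g us, [b]]) \<le> p lam"
      using ks[OF a(1)] hk[OF a(2)] rt[OF a(2,3)] rt[OF a(2,4)]
      by (simp add: p_def length_enc[of "[enc_keys kl, g, Eval_H H g xs, Eval_H H g us, [b]]"])
  qed
qed

section \<open>Correctness of the succinct scheme\<close>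

theorem theoremB6:
  fixes F :: ntcf and H :: hash and \<A>1 \<A>2 :: argument and ell :: "nat \<Rightarrow> nat"
  assumes "is_ntcf F"
    and "is_hash_family H"
    and "is_sp_argument \<A>1 (hash_rel H)"
    and "is_sp_argument \<A>2 (test_rel F H)"
    and "poly_bounded ell"
  shows "\<exists>\<nu>. negl \<nu> \<and>
    (\<forall>lam \<sigma> bs J. is_state (ell lam) \<sigma> \<longrightarrow> bs \<in> bitstr (ell lam) \<longrightarrow> J \<subseteq> {..<ell lam} \<longrightarrow>
       tv_dist (real0 F H \<A>1 lam \<sigma> J bs) (map_pmf Some (ideal \<sigma> J bs)) \<le> \<nu> lam \<and>
       tv_dist (real1 F H \<A>1 \<A>2 lam \<sigma>) (return_pmf (Some True)) \<le> \<nu> lam)"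
proof -
  obtain \<nu>p \<nu>g where nu: "negl \<nu>p" "negl \<nu>g" "\<And>lam. 0 \<le> \<nu>p lam" "\<And>lam. 0 \<le> \<nu>g lam"
    "\<And>lam ks. ks \<in> set_pmf (gen1 F lam) \<Longrightarrow> claw_keys F lam ks (\<nu>p lam) (\<nu>g lam)"
    by (rule claw_keys_gen1[OF assms(1)], rule that)
  obtain p where p: "poly_bounded p"
    "\<And>lam xs. block_list F lam (ell lam) xs \<Longrightarrow> length (enc xs) \<le> p lam"
    "\<And>lam hk xs. hk \<in> set_pmf (Gen_H H lam) \<Longrightarrow> block_list F lam (ell lam) xs \<Longrightarrow>
       length (enc [hk, Eval_H H hk xs]) \<le> p lam"
    "\<And>lam xs us. block_list F lam (ell lam) xs \<Longrightarrow> block_list F lam (ell lam) us \<Longrightarrow>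
       length (enc [enc xs, enc us]) \<le> p lam"
    "\<And>lam ks hk xs us b. ks \<in> set_pmf (gen1 F lam) \<Longrightarrow> hk \<in> set_pmf (Gen_H H lam) \<Longrightarrow>
       block_list F lam (ell lam) xs \<Longrightarrow> block_list F lam (ell lam) us \<Longrightarrow>
       length (enc [enc_keys ks, hk, Eval_H H hk xs, Eval_H H hk us, [b]]) \<le> p lam"
    by (rule message_lengths[OF assms(1,2,5)], rule that)
  have comp1: "arg_complete \<A>1 (hash_rel H)" and comp2: "arg_complete \<A>2 (test_rel F H)"
    using assms(3,4) by (simp_all add: is_sp_argument_def)
  have hcorr: "hash_opening_correct H" using assms(2) by (simp add: is_hash_family_def)
  obtain e1 where e1: "negl e1" "\<And>lam. 0 \<le> e1 lam" "\<And>lam x u. hash_rel H lam x u \<Longrightarrow> length x \<le> p lam \<Longrightarrow>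
      length u \<le> p lam \<Longrightarrow> pmf (argue \<A>1 lam x u) True \<ge> 1 - e1 lam"
    by (rule argue_complete[OF comp1 p(1)], rule that)
  obtain e2 where e2: "negl e2" "\<And>lam. 0 \<le> e2 lam" "\<And>lam x u. test_rel F H lam x u \<Longrightarrow> length x \<le> p lam \<Longrightarrow>
      length u \<le> p lam \<Longrightarrow> pmf (argue \<A>2 lam x u) True \<ge> 1 - e2 lam"
    by (rule argue_complete[OF comp2 p(1)], rule that)
  obtain eh where eh: "negl eh" "\<And>lam. 0 \<le> eh lam" "\<And>lam xs i. uniform_blocks xs \<Longrightarrow> i < length xs \<Longrightarrow>
      length (enc xs) \<le> p lam \<Longrightarrow> measure_pmf.prob (Gen_H H lam) {hk. opening_ok H xs i hk} \<ge> 1 - eh lam"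
    by (rule hash_opening[OF hcorr p(1)], rule that)
  \<comment> \<open>\<open>ss_error\<close> at the negligible errors, rearranged into natural number
    factors so that \<open>negl_scale\<close> applies to each term.\<close>
  define ss where "ss lam = real (2 * (ell lam * (width F lam + 2))) * \<nu>p lam
      + real (2 * (ell lam * (width F lam + 1))) * \<nu>g lam" for lam
  \<comment> \<open>\<open>e1\<close> counts twice because the test runs the first argument again,
    on the hash of the opening. The sum dominates the errors of both experiments.\<close>
  define \<nu> where "\<nu> lam = (e1 lam + e1 lam) + (e2 lam + (real (ell lam) * eh lam + ss lam))" for lam
  have wb: "poly_bounded (width F)" using assms(1) by (simp add: is_ntcf_def ntcf_domains_def)
  have N: "negl \<nu>" unfolding \<nu>_def[abs_def] ss_def
    by (intro negl_add negl_scale e1(1) e2(1) eh(1) nu(1,2) assms(5) poly_bounded_mult poly_bounded_add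
        poly_bounded_const wb)
  have M: "tv_dist (real0 F H \<A>1 lam \<sigma> J bs) (map_pmf Some (ideal \<sigma> J bs)) \<le> \<nu> lam \<and>
       tv_dist (real1 F H \<A>1 \<A>2 lam \<sigma>) (return_pmf (Some True)) \<le> \<nu> lam"
    if st: "is_state (ell lam) \<sigma>" and J: "J \<subseteq> {..<ell lam}" for lam \<sigma> bs J
  proof -
    let ?l = "ell lam"
    have ss: "0 \<le> ss lam" unfolding ss_def using nu(3,4) by simp
    have eh0: "0 \<le> real ?l * eh lam" using eh(2) by simp
    have b0: "0 + (e1 lam + (real ?l * eh lam + ss lam)) \<le> \<nu> lam"
      using e1(2)[of lam] e2(2)[of lam] unfolding \<nu>_def by linarith
    have b1: "0 + (e1 lam + (ss lam + (e1 lam + e2 lam))) \<le> \<nu> lam"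
      using eh0 unfolding \<nu>_def by linarith
    have argued: "pmf (argue \<A>1 lam (enc [hk, Eval_H H hk xs]) (enc xs)) True \<ge> 1 - e1 lam"
      if "hk \<in> set_pmf (Gen_H H lam)" "block_list F lam ?l xs" for hk xs
    proof (rule e1(3))
      show "hash_rel H lam (enc [hk, Eval_H H hk xs]) (enc xs)" unfolding hash_rel_def
        by (rule exI[of _ hk], rule exI[of _ "Eval_H H hk xs"], rule exI[of _ xs]) simp
      show "length (enc [hk, Eval_H H hk xs]) \<le> p lam" by (rule p(3)[OF that])
      show "length (enc xs) \<le> p lam" by (rule p(2)[OF that(2)])
    qed
    have tested: "pmf (argue \<A>2 lam (enc [enc_keys ks, hk, Eval_H H hk ys, Eval_H H hk us, [b]]) (enc [enc ys, enc us])) True \<ge> 1 - e2 lam"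
      if "ks \<in> set_pmf (gen1 F lam)" "hk \<in> set_pmf (Gen_H H lam)" "block_list F lam ?l ys" "block_list F lam ?l us"
        "ver_ss F lam ks ys (replicate (length ys) b) us" for ks hk ys us b
    proof (rule e2(3))
      show "test_rel F H lam (enc [enc_keys ks, hk, Eval_H H hk ys, Eval_H H hk us, [b]]) (enc [enc ys, enc us])"
        unfolding test_rel_def
        by (rule exI[of _ ks], rule exI[of _ hk], rule exI[of _ "Eval_H H hk ys"], rule exI[of _ "Eval_H H hk us"],
            rule exI[of _ b], rule exI[of _ ys], rule exI[of _ us]) (intro conjI refl that(5))
      show "length (enc [enc_keys ks, hk, Eval_H H hk ys, Eval_H H hk us, [b]]) \<le> p lam" by (rule p(5)[OF that(1-4)])
      show "length (enc [enc ys, enc us]) \<le> p lam" by (rule p(4)[OF that(3,4)])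
    qed
    have hashed: "measure_pmf.prob (Gen_H H lam) {hk. opening_ok H xs i hk} \<ge> 1 - eh lam"
      if b: "block_list F lam ?l xs" and i: "i < ?l" for xs i
      by (rule eh(3)) (use b i p(2)[OF b] in \<open>simp_all add: block_list_def\<close>)
    have sse: "claw_keys.ss_error F lam (\<nu>p lam) (\<nu>g lam) ?l = ss lam" if "ks \<in> set_pmf (gen1 F lam)" for ks
      unfolding claw_keys.ss_error_def[OF nu(5)[OF that]] ss_def by (simp add: algebra_simps)
    have r0: "real0 F H \<A>1 lam \<sigma> J bs = bind_pmf (gen1 F lam) (\<lambda>ks. bind_pmf (Gen_H H lam)
        (\<lambda>hk. bind_pmf (commit F H lam (map fst ks, hk) \<sigma>) (\<lambda>(rt, ys, \<rho>).
       bind_pmf (ver_commit \<A>1 lam hk rt ys) (\<lambda>acc. if \<not> acc then return_pmf None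
         else bind_pmf (open_at F H lam hk ys \<rho> (positions J bs)) (\<lambda>ops.
           return_pmf (if ver_at F H lam (ks, hk) rt (positions J bs) ops
                                then Some (out_at F lam (ks, hk) (positions J bs) ops) else None))))))"
      unfolding real0_def gen_def bind_assoc_pmf bind_return_pmf case_prod_conv fst_conv snd_conv
      by (rule refl)
    have r1: "real1 F H \<A>1 \<A>2 lam \<sigma> = bind_pmf (gen1 F lam) (\<lambda>ks. bind_pmf (Gen_H H lam)
        (\<lambda>hk. bind_pmf (commit F H lam (map fst ks, hk) \<sigma>) (\<lambda>(rt, ys, \<rho>).
       bind_pmf (ver_commit \<A>1 lam hk rt ys) (\<lambda>acc. if \<not> acc then return_pmf None
         else bind_pmf (test F H \<A>1 \<A>2 lam ks hk rt ys \<rho>) (\<lambda>acc'. return_pmf (if acc' then Some True else None))))))"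
      unfolding real1_def gen_def bind_assoc_pmf bind_return_pmf case_prod_conv fst_conv snd_conv
      by (rule refl)
    have "close (0 + (e1 lam + (real ?l * eh lam + ss lam))) (real0 F H \<A>1 lam \<sigma> J bs) (map_pmf Some (ideal \<sigma> J bs))"
      unfolding r0
    \<comment> \<open>The estimate holds for every key list in the support, so the bad event is
      empty.\<close>
    proof (rule close_bind_const[where Bad = "{}"])
      fix ks assume ks: "ks \<in> set_pmf (gen1 F lam)"
      note ck = nu(5)[OF ks]
      show "close (e1 lam + (real ?l * eh lam + ss lam)) (bind_pmf (Gen_H H lam)
        (\<lambda>hk. bind_pmf (commit F H lam (map fst ks, hk) \<sigma>) (\<lambda>(rt, ys, \<rho>).
       bind_pmf (ver_commit \<A>1 lam hk rt ys) (\<lambda>acc. if \<not> acc then return_pmf None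
         else bind_pmf (open_at F H lam hk ys \<rho> (positions J bs)) (\<lambda>ops.
           return_pmf (if ver_at F H lam (ks, hk) rt (positions J bs) ops
                                then Some (out_at F lam (ks, hk) (positions J bs) ops) else None))))))
         (map_pmf Some (ideal \<sigma> J bs))"
        unfolding sse[OF ks, symmetric]
      proof (rule claw_keys.real0_close[OF ck st])
        show "0 \<le> e1 lam" "0 \<le> e2 lam" "0 \<le> eh lam" by (rule e1(2) e2(2) eh(2))+
        show "J \<subseteq> {..<?l}" by fact
        show "1 - e1 lam \<le> pmf (ver_commit \<A>1 lam hk (Eval_H H hk ys) ys) True"
          if "hk \<in> set_pmf (Gen_H H lam)" "claw_keys.commitment_shape F lam ?l ys" for hk ys
          unfolding ver_commit_def by (rule argued[OF that(1) block_list_shapes(1)[OF ck that(2)]])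
        show "1 - eh lam \<le> measure_pmf.prob (Gen_H H lam) {hk. opening_ok H ys i hk}"
          if "claw_keys.commitment_shape F lam ?l ys" "i < ?l" for ys i
          by (rule hashed[OF block_list_shapes(1)[OF ck that(1)] that(2)])
      qed
    qed (use e1(2)[of lam] eh0 ss in simp_all)
    then have c0: "tv_dist (real0 F H \<A>1 lam \<sigma> J bs) (map_pmf Some (ideal \<sigma> J bs)) \<le> \<nu> lam"
      by (rule tv_dist_le[OF close_mono[OF _ b0]])
    have "close (0 + (e1 lam + (ss lam + (e1 lam + e2 lam)))) (real1 F H \<A>1 \<A>2 lam \<sigma>) (return_pmf (Some True))"
      unfolding r1
    proof (rule close_bind_const[where Bad = "{}"])
      fix ks assume ks: "ks \<in> set_pmf (gen1 F lam)"
      note ck = nu(5)[OF ks]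
      show "close (e1 lam + (ss lam + (e1 lam + e2 lam))) (bind_pmf (Gen_H H lam)
        (\<lambda>hk. bind_pmf (commit F H lam (map fst ks, hk) \<sigma>) (\<lambda>(rt, ys, \<rho>).
       bind_pmf (ver_commit \<A>1 lam hk rt ys) (\<lambda>acc. if \<not> acc then return_pmf None
         else bind_pmf (test F H \<A>1 \<A>2 lam ks hk rt ys \<rho>) (\<lambda>acc'. return_pmf (if acc' then Some True else None))))))
         (return_pmf (Some True))"
        unfolding sse[OF ks, symmetric]
      proof (rule claw_keys.real1_close[OF ck st])
        show "0 \<le> e1 lam" "0 \<le> e2 lam" "0 \<le> eh lam" by (rule e1(2) e2(2) eh(2))+
        show "1 - e1 lam \<le> pmf (ver_commit \<A>1 lam hk (Eval_H H hk ys) ys) True"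
          if "hk \<in> set_pmf (Gen_H H lam)" "claw_keys.commitment_shape F lam ?l ys" for hk ys
          unfolding ver_commit_def by (rule argued[OF that(1) block_list_shapes(1)[OF ck that(2)]])
        show "1 - e1 lam \<le> pmf (argue \<A>1 lam (enc [hk, Eval_H H hk us]) (enc us)) True"
          if "hk \<in> set_pmf (Gen_H H lam)" "claw_keys.opening_shape F lam ?l us" for hk us
          by (rule argued[OF that(1) block_list_shapes(2)[OF ck that(2)]])
        show "1 - e2 lam \<le> pmf (argue \<A>2 lam (enc [enc_keys ks, hk, Eval_H H hk ys, Eval_H H hk us, [b]]) (enc [enc ys, enc us])) True"
          if "hk \<in> set_pmf (Gen_H H lam)" "claw_keys.commitment_shape F lam ?l ys" "claw_keys.opening_shape F lam ?l us"
            "ver_ss F lam ks ys (replicate (length ys) b) us" for hk ys us b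
          by (rule tested[OF ks that(1) block_list_shapes(1)[OF ck that(2)] block_list_shapes(2)[OF ck that(3)] that(4)])
      qed
    qed (use e1(2)[of lam] e2(2)[of lam] ss in simp_all)
    then have "tv_dist (real1 F H \<A>1 \<A>2 lam \<sigma>) (return_pmf (Some True)) \<le> \<nu> lam"
      by (rule tv_dist_le[OF close_mono[OF _ b1]])
    with c0 show ?thesis by (rule conjI)
  qed
  show ?thesis
  proof (rule exI[of _ \<nu>], rule conjI[OF N], intro allI impI)
    fix lam \<sigma> bs J
    assume A: "is_state (ell lam) \<sigma>" "J \<subseteq> {..<ell lam}"
    show "tv_dist (real0 F H \<A>1 lam \<sigma> J bs) (map_pmf Some (ideal \<sigma> J bs)) \<le> \<nu> lam \<and>
       tv_dist (real1 F H \<A>1 \<A>2 lam \<sigma>) (return_pmf (Some True)) \<le> \<nu> lam"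
      by (rule M[OF A])
  qed
qed

end
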